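(* Let $X,Y$ be complex Banach spaces, $0<p\le1$, $\alpha>-1$ and $\gamma=(n+1+\alpha)\left(\frac1p-1\right)$. Let $b\in\mathcal{H}(\mathbb{B}_n,\mathcal{L}(\overline{X},Y))$ satisfy $$\int_{\mathbb{B}_n}\frac{\|b(w)\|_{\mathcal{L}(\overline{X},Y)}}{|1-\langle z,w\rangle|^{n+1+\alpha}}\mathrm{d}\nu_\alpha(w)<\infty\ \text{ for every } z\in\mathbb{B}_n,\qquad \int_{\mathbb{B}_n}\|b(z)\|_{\mathcal{L}(\overline{X},Y)}\log\left(\frac1{1-|z|^2}\right)\mathrm{d}\nu_\alpha(z)<\infty.$$ If the little Hankel operator $h_b$ extends to a bounded operator from $A^p_\alpha(\mathbb{B}_n,X)$ into $A^q_\alpha(\mathbb{B}_n,Y)$ for some positive $q<1$, then $b\in\Gamma_\gamma(\mathbb{B}_n,\mathcal{L}(\overline{X},Y))$. Conversely, if $b\in\Gamma_\gamma(\mathbb{B}_n,\mathcal{L}(\overline{X},Y))$, then $h_b:A^p_\alpha(\mathbb{B}_n,X)\to A^{1,\infty}_\alpha(\mathbb{B}_n,Y)$ is a bounded operator.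
   Context: $n\ge1$; $\mathbb{B}_n$ is the open unit ball of $\mathbb{C}^n$, $\langle z,w\rangle=\sum_j z_j\overline{w_j}$. $\mathrm{d}\nu_\alpha(z)=c_\alpha(1-|z|^2)^\alpha\mathrm{d}\nu(z)$, $c_\alpha=\frac{\Gamma(n+\alpha+1)}{n!\Gamma(\alpha+1)}$, where $\nu$ is Lebesgue measure normalized so that $\nu_\alpha$ is a probability measure on $\mathbb{B}_n$. For a complex Banach space $X$: $\mathcal{H}(\mathbb{B}_n,X)$ is the space of $X$-valued holomorphic functions on $\mathbb{B}_n$; $H^\infty(\mathbb{B}_n,X)$ the bounded ones; $A^p_\alpha(\mathbb{B}_n,X)$ those with $\|f\|^p_{p,\alpha,X}=\int_{\mathbb{B}_n}\|f(z)\|_X^p\mathrm{d}\nu_\alpha(z)<\infty$; $A^{p,\infty}_\alpha(\mathbb{B}_n,X)$ those with $\left(\sup_{\lambda>0}\lambda^p\nu_\alpha(\{z\in\mathbb{B}_n:\|f(z)\|_X>\lambda\})\right)^{1/p}<\infty$. $H^\infty(\mathbb{B}_n,X)$ is dense in $A^p_\alpha(\mathbb{B}_n,X)$. $X^{\star}$ is the dual of $X$ with scalar multiplication $(\lambda x^{\star})(x)=\overline\lambda x^{\star}(x)$. The complex conjugate of $x\in X$ is the functional $\overline{x}(x^{\star})=\overline{x^{\star}(x)}$ on $X^{\star}$, and $\overline{X}=\{\overline{x}:x\in X\}$ with norm $\|\overline{x}\|=\sup_{\|x^{\star}\|=1}|\overline{x}(x^{\star})|=\|x\|_X$; $\overline{X}$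 is a Banach space and $x\mapsto\overline{x}$ is an isometric conjugate-linear bijection. $\mathcal{L}(\overline{X},Y)$ is the Banach space of bounded linear operators $\overline X\to Y$. The little Hankel operator is $h_bf(z)=\int_{\mathbb{B}_n}\frac{b(w)\overline{f(w)}}{(1-\langle z,w\rangle)^{n+1+\alpha}}\mathrm{d}\nu_\alpha(w)$ for $f\in H^\infty(\mathbb{B}_n,X)$, $z\in\mathbb{B}_n$ (a conjugate-linear map). It is bounded (extends to a bounded operator) between two of the spaces above if the (quasi-)norm of $h_bf$ in the target is at most a constant times the norm of $f$ in the source for all $f\in H^\infty(\mathbb{B}_n,X)$; it is then extended by density. Radial derivative: $Nf(z)=\sum_j z_j\frac{\partial f}{\partial z_j}(z)$; $N^k$ is its $k$-fold iterate. For $\gamma\ge0$, $\Gamma_\gamma(\mathbb{B}_n,X)$ is the space of $f\in\mathcal{H}(\mathbb{B}_n,X)$ for which there is an integer $k>\gamma$ with $\|f(0)\|_X+\sup_{z\in\mathbb{B}_n}(1-|z|^2)^{k-\gamma}\|N^kf(z)\|_X<\infty$ (independent of $k$). *)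

theory Defs
  imports "HOL-Analysis.Analysis"
begin

section \<open>Complex Banach spaces\<close>

class complex_normed_vector = real_normed_vector +
  fixes scaleC :: "complex \<Rightarrow> 'a \<Rightarrow> 'a" (infixr \<open>*\<^sub>C\<close> 75)
  assumes scaleC_add_right: "c *\<^sub>C (x + y) = c *\<^sub>C x + c *\<^sub>C y"
    and scaleC_add_left: "(c + d) *\<^sub>C x = c *\<^sub>C x + d *\<^sub>C x"
    and scaleC_scaleC: "c *\<^sub>C d *\<^sub>C x = (c * d) *\<^sub>C x"
    and scaleC_of_real: "complex_of_real r *\<^sub>C x = r *\<^sub>R x"
    and norm_scaleC: "norm (c *\<^sub>C x) = cmod c * norm x"
begin

lemma scaleC_zero_right: "c *\<^sub>C 0 = 0"
  using norm_scaleC[of c 0] by simp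

lemma scaleC_minus_right: "c *\<^sub>C (- x) = - (c *\<^sub>C x)"
proof -
  have "c *\<^sub>C x + c *\<^sub>C (- x) = 0"
    by (simp add: scaleC_add_right[symmetric] scaleC_zero_right)
  then show ?thesis by (simp add: eq_neg_iff_add_eq_0 add.commute)
qed

lemma scaleC_diff_right: "c *\<^sub>C (x - y) = c *\<^sub>C x - c *\<^sub>C y"
  using scaleC_add_right[of c x "- y"] by (simp add: scaleC_minus_right)

end

lemma scaleC_scaleR_commute: "c *\<^sub>C r *\<^sub>R x = r *\<^sub>R c *\<^sub>C x"
  by (metis mult.commute scaleC_of_real scaleC_scaleC)

lemma bounded_linear_scaleC: "bounded_linear (\<lambda>x. c *\<^sub>C x)"
  by (rule bounded_linear_intro[where K = "cmod c"])
    (simp_all add: scaleC_add_right scaleC_scaleR_commute norm_scaleC mult.commute)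

class cbanach = complex_normed_vector + banach

instantiation complex :: cbanach
begin
definition "scaleC_complex (c::complex) (x::complex) = c * x"
instance
  by standard (simp_all add: scaleC_complex_def algebra_simps norm_mult scaleR_conv_of_real)
end


section \<open>Bounded complex-linear operators\<close>

typedef (overloaded) ('a, 'b) cblinfun =
  "{f :: 'a::complex_normed_vector \<Rightarrow>\<^sub>L 'b::complex_normed_vector.
      \<forall>c x. blinfun_apply f (c *\<^sub>C x) = c *\<^sub>C blinfun_apply f x}"
  morphisms blinfun_of_cblinfun CBlinfun
  by (rule exI[of _ 0]) (simp add: scaleC_zero_right)

setup_lifting type_definition_cblinfun

definition cblinfun_apply :: "('a::complex_normed_vector, 'b::complex_normed_vector) cblinfun \<Rightarrow> 'a \<Rightarrow> 'b"
  where "cblinfun_apply f = blinfun_apply (blinfun_of_cblinfun f)"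

lemma cblinfun_eqI: "(\<And>x. cblinfun_apply f x = cblinfun_apply g x) \<Longrightarrow> f = g"
  by (simp add: cblinfun_apply_def blinfun_eqI blinfun_of_cblinfun_inject[symmetric])

lemma cblinfun_apply_scaleC: "cblinfun_apply f (c *\<^sub>C x) = c *\<^sub>C cblinfun_apply f x"
  using blinfun_of_cblinfun[of f] by (simp add: cblinfun_apply_def)

instantiation cblinfun :: (complex_normed_vector, complex_normed_vector) complex_normed_vector
begin

lift_definition zero_cblinfun :: "('a, 'b) cblinfun" is 0
  by (simp add: scaleC_zero_right)

lift_definition plus_cblinfun :: "('a, 'b) cblinfun \<Rightarrow> ('a, 'b) cblinfun \<Rightarrow> ('a, 'b) cblinfun" is "(+)"
  by (simp add: blinfun.add_left scaleC_add_right)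

lift_definition minus_cblinfun :: "('a, 'b) cblinfun \<Rightarrow> ('a, 'b) cblinfun \<Rightarrow> ('a, 'b) cblinfun" is "(-)"
  by (simp add: blinfun.diff_left scaleC_diff_right)

lift_definition uminus_cblinfun :: "('a, 'b) cblinfun \<Rightarrow> ('a, 'b) cblinfun" is uminus
  by (simp add: blinfun.minus_left scaleC_minus_right)

lift_definition scaleR_cblinfun :: "real \<Rightarrow> ('a, 'b) cblinfun \<Rightarrow> ('a, 'b) cblinfun" is scaleR
  by (simp add: blinfun.scaleR_left scaleC_scaleR_commute)

lift_definition scaleC_cblinfun :: "complex \<Rightarrow> ('a, 'b) cblinfun \<Rightarrow> ('a, 'b) cblinfun"
  is "\<lambda>c f. Blinfun (\<lambda>x. c *\<^sub>C blinfun_apply f x)"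
  by (simp add: bounded_linear_Blinfun_apply bounded_linear_compose[OF bounded_linear_scaleC]
      blinfun.bounded_linear_right scaleC_scaleC mult.commute)

lift_definition norm_cblinfun :: "('a, 'b) cblinfun \<Rightarrow> real" is norm .

definition "dist_cblinfun (f :: ('a, 'b) cblinfun) g = norm (f - g)"
definition "sgn_cblinfun (f :: ('a, 'b) cblinfun) = inverse (norm f) *\<^sub>R f"
definition [code del]:
  "(uniformity :: (('a, 'b) cblinfun \<times> ('a, 'b) cblinfun) filter) =
    (INF e\<in>{0 <..}. principal {(x, y). dist x y < e})"
definition [code del]:
  "open (S :: ('a, 'b) cblinfun set) = (\<forall>x\<in>S. \<forall>\<^sub>F (x', y) in uniformity. x' = x \<longrightarrow> y \<in> S)"

lemma apply_scaleC_cblinfun: "cblinfun_apply (c *\<^sub>C f) x = c *\<^sub>C cblinfun_apply f x"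
  by (simp add: cblinfun_apply_def scaleC_cblinfun.rep_eq bounded_linear_Blinfun_apply
      bounded_linear_compose[OF bounded_linear_scaleC] blinfun.bounded_linear_right)

lemma apply_plus_cblinfun: "cblinfun_apply (f + g) x = cblinfun_apply f x + cblinfun_apply g x"
  by (simp add: cblinfun_apply_def plus_cblinfun.rep_eq blinfun.add_left)

lemma apply_scaleR_cblinfun: "cblinfun_apply (r *\<^sub>R f) x = r *\<^sub>R cblinfun_apply f x"
  by (simp add: cblinfun_apply_def scaleR_cblinfun.rep_eq blinfun.scaleR_left)

lemma norm_cblinfun_onorm: "norm f = onorm (cblinfun_apply f)"
  by (simp add: cblinfun_apply_def norm_cblinfun.rep_eq norm_blinfun.rep_eq)

instance
proof
  fix f g h :: "('a, 'b) cblinfun" and r s :: real and c d :: complex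
  show "norm (c *\<^sub>C f) = cmod c * norm f"
  proof (cases "c = 0")
    case True
    have "c *\<^sub>C f = 0 *\<^sub>R f"
      unfolding True
      by (rule cblinfun_eqI)
        (simp only: apply_scaleC_cblinfun apply_scaleR_cblinfun scaleC_of_real[of 0, unfolded of_real_0])
    then show ?thesis
      using True by (simp add: norm_cblinfun.rep_eq scaleR_cblinfun.rep_eq)
  next
    case False
    have le: "norm (e *\<^sub>C k) \<le> cmod e * norm k" for e and k :: "('a, 'b) cblinfun"
      unfolding norm_cblinfun_onorm
    proof (rule onorm_bound)
      show "0 \<le> cmod e * onorm (cblinfun_apply k)"
        by (simp add: norm_cblinfun_onorm[symmetric] norm_cblinfun.rep_eq)
      show "norm (cblinfun_apply (e *\<^sub>C k) x) \<le> cmod e * onorm (cblinfun_apply k) * norm x"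
        for x
      proof -
        have "norm (cblinfun_apply k x) \<le> onorm (cblinfun_apply k) * norm x"
          using norm_blinfun[of "blinfun_of_cblinfun k" x]
          by (simp add: cblinfun_apply_def norm_blinfun.rep_eq)
        then show ?thesis
          by (simp only: apply_scaleC_cblinfun norm_scaleC mult.assoc mult_left_mono norm_ge_zero)
      qed
    qed
    have "inverse c *\<^sub>C c *\<^sub>C f = f"
      using False
      by (intro cblinfun_eqI)
        (simp add: apply_scaleC_cblinfun scaleC_scaleC scaleC_of_real[of 1, unfolded of_real_1])
    with le[of "inverse c" "c *\<^sub>C f"] have "norm f \<le> cmod (inverse c) * norm (c *\<^sub>C f)"
      by simp
    then have "cmod c * norm f \<le> norm (c *\<^sub>C f)"
      using False by (simp add: norm_divide field_simps)
    with le[of c f] show ?thesis by simp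
  qed
  show "c *\<^sub>C (f + g) = c *\<^sub>C f + c *\<^sub>C g"
    by (rule cblinfun_eqI) (simp add: apply_scaleC_cblinfun apply_plus_cblinfun scaleC_add_right)
  show "(c + d) *\<^sub>C f = c *\<^sub>C f + d *\<^sub>C f"
    by (rule cblinfun_eqI) (simp add: apply_scaleC_cblinfun apply_plus_cblinfun scaleC_add_left)
  show "c *\<^sub>C d *\<^sub>C f = (c * d) *\<^sub>C f"
    by (rule cblinfun_eqI) (simp add: apply_scaleC_cblinfun scaleC_scaleC)
  show "complex_of_real r *\<^sub>C f = r *\<^sub>R f"
    by (rule cblinfun_eqI) (simp add: apply_scaleC_cblinfun apply_scaleR_cblinfun scaleC_of_real)
qed (simp_all add: dist_cblinfun_def sgn_cblinfun_def uniformity_cblinfun_def open_cblinfun_def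
    blinfun_of_cblinfun_inject[symmetric] zero_cblinfun.rep_eq plus_cblinfun.rep_eq
    minus_cblinfun.rep_eq uminus_cblinfun.rep_eq scaleR_cblinfun.rep_eq norm_cblinfun.rep_eq
    algebra_simps norm_triangle_ineq)

end


section \<open>The dual with conjugated scalars and the conjugate space\<close>

text \<open>
  The type \<open>'a cdual\<close> is $X^\star$: the bounded complex-linear functionals on $X$ with their usual
  norm and addition, but with $(\lambda x^\star)(x) = \overline{\lambda}\, x^\star(x)$.
\<close>

typedef (overloaded) 'a cdual = "UNIV :: ('a::complex_normed_vector, complex) cblinfun set"
  morphisms cblinfun_of_cdual CDual ..

setup_lifting type_definition_cdual

definition cdual_apply :: "'a::complex_normed_vector cdual \<Rightarrow> 'a \<Rightarrow> complex"
  where "cdual_apply xs = cblinfun_apply (cblinfun_of_cdual xs)"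

instantiation cdual :: (complex_normed_vector) complex_normed_vector
begin

lift_definition zero_cdual :: "'a cdual" is 0 .
lift_definition plus_cdual :: "'a cdual \<Rightarrow> 'a cdual \<Rightarrow> 'a cdual" is "(+)" .
lift_definition minus_cdual :: "'a cdual \<Rightarrow> 'a cdual \<Rightarrow> 'a cdual" is "(-)" .
lift_definition uminus_cdual :: "'a cdual \<Rightarrow> 'a cdual" is uminus .
lift_definition scaleR_cdual :: "real \<Rightarrow> 'a cdual \<Rightarrow> 'a cdual" is scaleR .
lift_definition scaleC_cdual :: "complex \<Rightarrow> 'a cdual \<Rightarrow> 'a cdual" is "\<lambda>c xs. cnj c *\<^sub>C xs" .
lift_definition norm_cdual :: "'a cdual \<Rightarrow> real" is norm .

definition "dist_cdual (f :: 'a cdual) g = norm (f - g)"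
definition "sgn_cdual (f :: 'a cdual) = inverse (norm f) *\<^sub>R f"
definition [code del]:
  "(uniformity :: ('a cdual \<times> 'a cdual) filter) =
    (INF e\<in>{0 <..}. principal {(x, y). dist x y < e})"
definition [code del]:
  "open (S :: 'a cdual set) = (\<forall>x\<in>S. \<forall>\<^sub>F (x', y) in uniformity. x' = x \<longrightarrow> y \<in> S)"

instance
  by standard (simp_all add: dist_cdual_def sgn_cdual_def uniformity_cdual_def open_cdual_def
    cblinfun_of_cdual_inject[symmetric] zero_cdual.rep_eq plus_cdual.rep_eq
    minus_cdual.rep_eq uminus_cdual.rep_eq scaleR_cdual.rep_eq scaleC_cdual.rep_eq norm_cdual.rep_eq
    scaleC_add_right scaleC_add_left scaleC_scaleC scaleC_of_real norm_scaleC
    algebra_simps norm_triangle_ineq)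

end

lemma cdual_apply_plus: "cdual_apply (xs + ys) x = cdual_apply xs x + cdual_apply ys x"
  by (simp add: cdual_apply_def plus_cdual.rep_eq apply_plus_cblinfun)

lemma cdual_apply_scaleR: "cdual_apply (r *\<^sub>R xs) x = r *\<^sub>R cdual_apply xs x"
  by (simp add: cdual_apply_def scaleR_cdual.rep_eq apply_scaleR_cblinfun)

lemma cdual_apply_scaleC: "cdual_apply (c *\<^sub>C xs) x = cnj c * cdual_apply xs x"
  by (simp add: cdual_apply_def scaleC_cdual.rep_eq apply_scaleC_cblinfun scaleC_complex_def)

lemma norm_cdual_apply: "cmod (cdual_apply xs x) \<le> norm xs * norm x"
  by (simp add: cdual_apply_def norm_cdual.rep_eq norm_cblinfun.rep_eq cblinfun_apply_def norm_blinfun)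

lemma bounded_linear_conj_functional: "bounded_linear (\<lambda>xs. cnj (cdual_apply xs x))"
  by (rule bounded_linear_intro[where K = "norm x"])
    (simp_all add: cdual_apply_plus cdual_apply_scaleR norm_cdual_apply)

definition conj_functional :: "'a::complex_normed_vector \<Rightarrow> ('a cdual, complex) cblinfun"
  where "conj_functional x = CBlinfun (Blinfun (\<lambda>xs. cnj (cdual_apply xs x)))"

lemma conj_functional_apply: "cblinfun_apply (conj_functional x) xs = cnj (cdual_apply xs x)"
  by (simp add: cblinfun_apply_def conj_functional_def CBlinfun_inverse cdual_apply_scaleC
      bounded_linear_Blinfun_apply[OF bounded_linear_conj_functional] scaleC_complex_def)

lemma conj_functional_add: "conj_functional (x + y) = conj_functional x + conj_functional y"
  by (rule cblinfun_eqI)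
    (simp only: conj_functional_apply apply_plus_cblinfun,
      simp add: cdual_apply_def cblinfun_apply_def blinfun.add_right)

lemma conj_functional_scaleC: "c *\<^sub>C conj_functional x = conj_functional (cnj c *\<^sub>C x)"
  by (rule cblinfun_eqI)
    (simp add: conj_functional_apply apply_scaleC_cblinfun cdual_apply_def cblinfun_apply_scaleC
      scaleC_complex_def)

lemma conj_functional_scaleR: "r *\<^sub>R conj_functional x = conj_functional (r *\<^sub>R x)"
  using conj_functional_scaleC[of "complex_of_real r" x] by (simp add: scaleC_of_real)

lemma conj_functional_uminus: "- conj_functional x = conj_functional (- x)"
  using conj_functional_scaleR[of "- 1" x] by simp

lemma conj_functional_zero: "0 = conj_functional 0"
  using conj_functional_scaleR[of 0 0] by simp

lemma conj_functional_diff: "conj_functional x - conj_functional y = conj_functional (x - y)"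
  using conj_functional_add[of x "- y"] by (simp add: conj_functional_uminus[symmetric])

text \<open>
  The type \<open>'a cconj\<close> is $\overline{X} = \{\overline{x} : x \in X\}$, a complex subspace of the bounded
  functionals on $X^\star$, with the inherited vector space operations and (operator) norm.
\<close>

typedef (overloaded) 'a cconj = "range (conj_functional :: 'a::complex_normed_vector \<Rightarrow> _)"
  morphisms functional_of_cconj CConj
  by blast

setup_lifting type_definition_cconj

lift_definition conjugate :: "'a::complex_normed_vector \<Rightarrow> 'a cconj" is conj_functional
  by simp

instantiation cconj :: (complex_normed_vector) complex_normed_vector
begin

lift_definition zero_cconj :: "'a cconj" is 0
  using conj_functional_zero by blast
lift_definition plus_cconj :: "'a cconj \<Rightarrow> 'a cconj \<Rightarrow> 'a cconj" is "(+)"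
  by (auto simp: conj_functional_add[symmetric])
lift_definition minus_cconj :: "'a cconj \<Rightarrow> 'a cconj \<Rightarrow> 'a cconj" is "(-)"
  by (auto simp: conj_functional_diff)
lift_definition uminus_cconj :: "'a cconj \<Rightarrow> 'a cconj" is uminus
  by (auto simp: conj_functional_uminus)
lift_definition scaleR_cconj :: "real \<Rightarrow> 'a cconj \<Rightarrow> 'a cconj" is scaleR
  by (auto simp: conj_functional_scaleR)
lift_definition scaleC_cconj :: "complex \<Rightarrow> 'a cconj \<Rightarrow> 'a cconj" is scaleC
  by (auto simp: conj_functional_scaleC)
lift_definition norm_cconj :: "'a cconj \<Rightarrow> real" is norm .

definition "dist_cconj (f :: 'a cconj) g = norm (f - g)"
definition "sgn_cconj (f :: 'a cconj) = inverse (norm f) *\<^sub>R f"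
definition [code del]:
  "(uniformity :: ('a cconj \<times> 'a cconj) filter) =
    (INF e\<in>{0 <..}. principal {(x, y). dist x y < e})"
definition [code del]:
  "open (S :: 'a cconj set) = (\<forall>x\<in>S. \<forall>\<^sub>F (x', y) in uniformity. x' = x \<longrightarrow> y \<in> S)"

instance
  by standard (simp_all add: dist_cconj_def sgn_cconj_def uniformity_cconj_def open_cconj_def
    functional_of_cconj_inject[symmetric] zero_cconj.rep_eq plus_cconj.rep_eq
    minus_cconj.rep_eq uminus_cconj.rep_eq scaleR_cconj.rep_eq scaleC_cconj.rep_eq norm_cconj.rep_eq
    scaleC_add_right scaleC_add_left scaleC_scaleC scaleC_of_real norm_scaleC
    algebra_simps norm_triangle_ineq)

end


section \<open>Bochner integral\<close>

text \<open>
  The library's \<^const>\<open>has_bochner_integral\<close> and \<^const>\<open>lebesgue_integral\<close> are restricted to second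
  countable (that is, separable) target spaces. This is the same definition for arbitrary Banach
  spaces; existence of the approximating simple functions makes the integrand essentially
  separably valued.
\<close>

definition has_banach_integral :: "'z measure \<Rightarrow> ('z \<Rightarrow> 'b::banach) \<Rightarrow> 'b \<Rightarrow> bool" where
  "has_banach_integral M f y \<longleftrightarrow>
    f \<in> borel_measurable M \<and>
    (\<exists>s. (\<forall>i::nat. Bochner_Integration.simple_bochner_integrable M (s i)) \<and>
         (\<lambda>i. \<integral>\<^sup>+w. ennreal (norm (f w - s i w)) \<partial>M) \<longlonglongrightarrow> 0 \<and>
         (\<lambda>i. Bochner_Integration.simple_bochner_integral M (s i)) \<longlonglongrightarrow> y)"

definition banach_integral :: "'z measure \<Rightarrow> ('z \<Rightarrow> 'b::banach) \<Rightarrow> 'b" where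
  "banach_integral M f =
    (if \<exists>y. has_banach_integral M f y then THE y. has_banach_integral M f y else 0)"


section \<open>Function spaces on the unit ball\<close>

text \<open>
  The unit ball of $\mathbb{C}^n$ is \<open>ball 0 1\<close> in \<open>complex ^ 'n\<close>, with $n$ = \<open>CARD('n)\<close>. Functions on
  it are total functions whose values outside the ball are irrelevant.
\<close>

definition herm :: "complex ^ 'n \<Rightarrow> complex ^ 'n \<Rightarrow> complex" where
  "herm z w = (\<Sum>j\<in>UNIV. z $ j * cnj (w $ j))"

definition weight_const :: "nat \<Rightarrow> real \<Rightarrow> real" where
  "weight_const n \<alpha> = Gamma (real n + \<alpha> + 1) / (fact n * Gamma (\<alpha> + 1))"

text \<open>
  The measure $\nu_\alpha$ has the ball as its space. The factor $c_\alpha$ makes it a probability measure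
  when $\nu$ itself has total mass $1$, so $\nu$ is the uniform distribution on the ball.
\<close>

definition ball_measure :: "real \<Rightarrow> (complex ^ 'n) measure" where
  "ball_measure \<alpha> =
    density (restrict_space (uniform_measure lborel (ball 0 1)) (ball 0 1))
      (\<lambda>z. ennreal (weight_const CARD('n) \<alpha> * (1 - (norm z)\<^sup>2) powr \<alpha>))"

definition ball_holomorphic :: "(complex ^ 'n \<Rightarrow> 'e::complex_normed_vector) set" where
  "ball_holomorphic =
    {f. \<forall>z\<in>ball 0 1. \<exists>D. (f has_derivative D) (at z) \<and> (\<forall>c v. D (c *s v) = c *\<^sub>C D v)}"

definition Hinf :: "(complex ^ 'n \<Rightarrow> 'e::complex_normed_vector) set" where
  "Hinf = {f \<in> ball_holomorphic. bounded (f ` ball 0 1)}"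

definition bergman_integral :: "real \<Rightarrow> real \<Rightarrow> (complex ^ 'n \<Rightarrow> 'e::complex_normed_vector) \<Rightarrow> ennreal" where
  "bergman_integral p \<alpha> f = (\<integral>\<^sup>+z. ennreal (norm (f z) powr p) \<partial>ball_measure \<alpha>)"

definition bergman :: "real \<Rightarrow> real \<Rightarrow> (complex ^ 'n \<Rightarrow> 'e::complex_normed_vector) set" where
  "bergman p \<alpha> = {f \<in> ball_holomorphic. bergman_integral p \<alpha> f < \<infinity>}"

definition bergman_norm :: "real \<Rightarrow> real \<Rightarrow> (complex ^ 'n \<Rightarrow> 'e::complex_normed_vector) \<Rightarrow> real" where
  "bergman_norm p \<alpha> f = enn2real (bergman_integral p \<alpha> f) powr (1 / p)"

definition weak_bergman_sup :: "real \<Rightarrow> real \<Rightarrow> (complex ^ 'n \<Rightarrow> 'e::complex_normed_vector) \<Rightarrow> ennreal" where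
  "weak_bergman_sup p \<alpha> f =
    (SUP t\<in>{0<..}. ennreal (t powr p) * emeasure (ball_measure \<alpha>) {z \<in> ball 0 1. norm (f z) > t})"

definition weak_bergman :: "real \<Rightarrow> real \<Rightarrow> (complex ^ 'n \<Rightarrow> 'e::complex_normed_vector) set" where
  "weak_bergman p \<alpha> = {f \<in> ball_holomorphic. weak_bergman_sup p \<alpha> f < \<infinity>}"

definition weak_bergman_norm :: "real \<Rightarrow> real \<Rightarrow> (complex ^ 'n \<Rightarrow> 'e::complex_normed_vector) \<Rightarrow> real" where
  "weak_bergman_norm p \<alpha> f = enn2real (weak_bergman_sup p \<alpha> f) powr (1 / p)"

definition partial_deriv ::
  "'n \<Rightarrow> (complex ^ 'n \<Rightarrow> 'e::complex_normed_vector) \<Rightarrow> complex ^ 'n \<Rightarrow> 'e" where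
  "partial_deriv j f z = Lim (at 0) (\<lambda>h. inverse h *\<^sub>C (f (z + axis j h) - f z))"

definition radial_deriv :: "(complex ^ 'n \<Rightarrow> 'e::complex_normed_vector) \<Rightarrow> complex ^ 'n \<Rightarrow> 'e" where
  "radial_deriv f z = (\<Sum>j\<in>UNIV. z $ j *\<^sub>C partial_deriv j f z)"

definition Gamma_space :: "real \<Rightarrow> (complex ^ 'n \<Rightarrow> 'e::complex_normed_vector) set" where
  "Gamma_space \<gamma> = {f \<in> ball_holomorphic. \<exists>k::nat. real k > \<gamma> \<and>
     ennreal (norm (f 0)) +
     (SUP z\<in>ball 0 1. ennreal ((1 - (norm z)\<^sup>2) powr (real k - \<gamma>) * norm ((radial_deriv ^^ k) f z))) < \<infinity>}"


section \<open>Little Hankel operators\<close>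

definition little_hankel ::
  "real \<Rightarrow> (complex ^ 'n \<Rightarrow> ('a::cbanach cconj, 'b::cbanach) cblinfun) \<Rightarrow>
   (complex ^ 'n \<Rightarrow> 'a) \<Rightarrow> complex ^ 'n \<Rightarrow> 'b" where
  "little_hankel \<alpha> b f z = banach_integral (ball_measure \<alpha>)
     (\<lambda>w. inverse ((1 - herm z w) powr of_real (real CARD('n) + 1 + \<alpha>))
            *\<^sub>C cblinfun_apply (b w) (conjugate (f w)))"

text \<open>
  Boundedness of an operator that is defined on $H^\infty$, with respect to the quasi-norm \<open>N\<close> on the
  source, into the space \<open>V\<close> with quasi-norm \<open>N'\<close>. Membership in \<open>V\<close> is stated separately because
  \<open>N'\<close> is real-valued and only meaningful on \<open>V\<close>.
\<close>

definition bounded_on_Hinf ::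
  "((complex ^ 'n \<Rightarrow> 'a::complex_normed_vector) \<Rightarrow> real) \<Rightarrow>
   (complex ^ 'n \<Rightarrow> 'b::complex_normed_vector) set \<Rightarrow> ((complex ^ 'n \<Rightarrow> 'b) \<Rightarrow> real) \<Rightarrow>
   ((complex ^ 'n \<Rightarrow> 'a) \<Rightarrow> (complex ^ 'n \<Rightarrow> 'b)) \<Rightarrow> bool" where
  "bounded_on_Hinf N V N' T \<longleftrightarrow> (\<exists>C. \<forall>f\<in>Hinf. T f \<in> V \<and> N' (T f) \<le> C * N f)"

end

theory Submission
  imports Defs "HOL-Complex_Analysis.Complex_Analysis"
begin

text \<open>
  Put $N = n + 1 + \alpha$. With respect to the weight $(1 - |w|^2)^a$ the kernel
  $(1 - \langle z, w\rangle)^{-s}$ multiplies the homogeneous component of degree $m$ of a holomorphic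
  function by a constant times $(s)_m / (n + 1 + a)_m$. For $a = \alpha$, $s = N + j$ this is a
  polynomial in $m$, so kernels produce radial derivatives; for $a = \alpha + k$, $s = N$ it inverts
  such a polynomial, so $b$ is recovered from $g$, a combination of $b, Nb, \dots, N^k b$.

  Necessity: a combination $f$ of the functions $(1 - \langle w, a\rangle)^{-(N+j)} x$ with $j \le k$
  makes $h_b f(0)$ a multiple of $N^k b(a) \overline{x}$. Evaluation at $0$ is bounded on
  $A^q_\alpha$, and the Forelli--Rudin estimates bound the norm of $f$ in $A^p_\alpha$.

  Sufficiency: by Fubini, $h_b f(z)$ is a multiple of
  $\int (1 - \langle z, u\rangle)^{-N} g(u) \overline{f(u)} (1 - |u|^2)^k d\nu_\alpha(u)$. The growth of
  $g$ and the pointwise bound for $f$ in $A^p_\alpha$ give $g(u) \overline{f(u)} (1 - |u|^2)^k$ an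
  $L^1$ norm of at most a constant times the norm of $f$. It remains to see that the operator with
  kernel $\rho(z,w)^{-N}$, $\rho(z,w) = |1 - \langle z, w\rangle|$, is of weak type $(1,1)$: if $S$ is the set where
  all averages of $\phi$ over $\rho$-balls are at most $\lambda$ and $\delta$ is the distance to $S$,
  the Cauchy--Schwarz inequality with the weights $\delta^{\pm\epsilon}$ bounds the operator on $S$.

  Statements about functions with values in a Banach space are reduced to scalar ones by composing
  with functionals.
\<close>

section \<open>Functionals and integrals in complex Banach spaces\<close>

text \<open>The integer k > \<gamma> is what both directions have in common. It gives p (N + k) > N,
  so Forelli--Rudin applies to the p-th power of a kernel of exponent N + k, and (N - p (N + k)) / p
  = \<gamma> - k is exactly the growth that \<open>Gamma_space\<close> allows for the k-th radial
  derivative. Conversely |g(u)| (1 - |u|^2)^k is at most a constant times (1 - |u|^2)^\<gamma>, and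
  \<gamma> is the exponent at which |f|^(1-p) can be estimated pointwise while |f|^p is integrated.

  The obstacle is that N is the critical exponent: \<rho>-balls of radius r have measure of order at
  most r^N, so all dyadic shells may contribute equally to the integral of \<rho>^(-N). Only the
  size of the kernel is used, no cancellation. The room comes from the boundary: a layer of width s
  \<le> r in a ball of radius r has measure at most of order r^n s^(1+\<alpha>), with 1 + \<alpha> >
  0, so a small power of a distance can be traded between the Cauchy--Schwarz factors. The mass of
  \<phi> near S obeys the same bound, which is the crux.\<close>

lemma hahn_banach_real:
  fixes x0 :: "'a::real_normed_vector"
  obtains u :: "'a \<Rightarrow> real" where "linear u" "\<And>x. u x \<le> norm x" "u x0 = norm x0"
proof -
  \<comment> \<open>Partial functionals are represented by their graphs, subspaces of X x R on which
    the second component is at most the norm of the first. Single-valuedness is not imposed. It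
    comes out at the end: a subspace of this kind that contains (0, t) also contains (0, -t), so t =
    0.\<close>
  define G where "G = {g :: ('a \<times> real) set. subspace g \<and> (x0, norm x0) \<in> g \<and> (\<forall>(x,t)\<in>g. t \<le> norm x)}"
  have "\<exists>M\<in>G. \<forall>X\<in>G. M \<subseteq> X \<longrightarrow> X = M"
  proof (rule subset_Zorn_nonempty)
    have "span {(x0, norm x0)} \<in> G"
      unfolding G_def
    proof (intro CollectI conjI)
      show "(x0, norm x0) \<in> span {(x0, norm x0)}" by (rule span_base) simp
      show "\<forall>(x,t)\<in>span {(x0, norm x0)}. t \<le> norm x"
        by (auto simp: span_singleton intro: mult_right_mono)
    qed (rule subspace_span)
    then show "G \<noteq> {}" by blast
    fix C assume ne: "C \<noteq> {}" and "subset.chain G C"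
    then have CG: "C \<subseteq> G" and ch: "\<And>X Y. X \<in> C \<Longrightarrow> Y \<in> C \<Longrightarrow> X \<subseteq> Y \<or> Y \<subseteq> X"
      by (auto simp: subset_chain_def)
    have sub: "subspace X" if "X \<in> C" for X using that CG by (auto simp: G_def)
    have "subspace (\<Union>C)"
      unfolding subspace_def
    proof (intro conjI ballI allI)
      show "0 \<in> \<Union>C" using ne sub subspace_0 by blast
      fix x assume x: "x \<in> \<Union>C"
      then obtain X where X: "X \<in> C" "x \<in> X" by blast
      show "c *\<^sub>R x \<in> \<Union>C" for c using X sub subspace_scale by blast
      fix y assume "y \<in> \<Union>C"
      then obtain Y where Y: "Y \<in> C" "y \<in> Y" by blast
      then show "x + y \<in> \<Union>C" using ch[OF X(1) Y(1)] X sub subspace_add by blast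
    qed
    then show "\<Union>C \<in> G" using ne CG by (auto simp: G_def)
  qed
  then obtain M where MG: "M \<in> G" and max: "\<And>X. X \<in> G \<Longrightarrow> M \<subseteq> X \<Longrightarrow> X = M" by blast
  have sM: "subspace M" and x0M: "(x0, norm x0) \<in> M" and dom: "\<And>x t. (x,t) \<in> M \<Longrightarrow> t \<le> norm x"
    using MG by (auto simp: G_def)
  have total: "\<exists>t. (x1, t) \<in> M" for x1
  proof -
    \<comment> \<open>The value at x1 has to lie above every s - norm (y - x1) and below every norm
      (y' + x1) - s'. The supremum of the former is such a value.\<close>
    define S where "S = (\<lambda>(y,s). s - norm (y - x1)) ` M"
    have le: "s - norm (y - x1) \<le> norm (y' + x1) - s'" if "(y,s) \<in> M" "(y',s') \<in> M" for y s y' s'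
    proof -
      have "(y + y', s + s') \<in> M" using subspace_add[OF sM that] by simp
      then have "s + s' \<le> norm (y + y')" by (rule dom)
      also have "\<dots> \<le> norm (y - x1) + norm (y' + x1)"
        using norm_triangle_ineq[of "y - x1" "y' + x1"] by (simp add: algebra_simps)
      finally show ?thesis by simp
    qed
    have bdd: "bdd_above S" unfolding S_def using le[OF _ x0M] by (auto intro!: bdd_aboveI)
    have neS: "S \<noteq> {}" using x0M by (auto simp: S_def)
    define a where "a = Sup S"
    have a1: "s - norm (y - x1) \<le> a" if "(y,s) \<in> M" for y s
      unfolding a_def using that by (intro cSup_upper bdd) (force simp: S_def)
    have a2: "a \<le> norm (y + x1) - s" if "(y,s) \<in> M" for y s
      unfolding a_def using le[OF _ that] by (intro cSup_least neS) (auto simp: S_def)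
    define g where "g = {(y + c *\<^sub>R x1, s + c * a) | y s c. (y,s) \<in> M}"
    have "g \<in> G"
      unfolding G_def
    proof (intro CollectI conjI)
      show "subspace g"
        unfolding subspace_def
      proof (intro conjI ballI allI)
        show "0 \<in> g" unfolding g_def using subspace_0[OF sM]
          by (force simp: zero_prod_def intro: exI[of _ 0])
        fix p q assume "p \<in> g"
        then obtain y s c where p: "p = (y + c *\<^sub>R x1, s + c * a)" "(y,s) \<in> M" by (auto simp: g_def)
        show "d *\<^sub>R p \<in> g" for d
        proof -
          have "d *\<^sub>R p = (d *\<^sub>R y + (d * c) *\<^sub>R x1, d * s + (d * c) * a)"
            by (simp add: p(1) algebra_simps)
          then show ?thesis unfolding g_def using subspace_scale[OF sM p(2), of d] by auto
        qed
        assume "q \<in> g"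
        then obtain y' s' c' where q: "q = (y' + c' *\<^sub>R x1, s' + c' * a)" "(y',s') \<in> M" by (auto simp: g_def)
        show "p + q \<in> g"
        proof -
          have "p + q = ((y + y') + (c + c') *\<^sub>R x1, (s + s') + (c + c') * a)"
            by (simp add: p(1) q(1) algebra_simps)
          then show ?thesis unfolding g_def using subspace_add[OF sM p(2) q(2)] by auto
        qed
      qed
      show "(x0, norm x0) \<in> g" unfolding g_def using x0M by (force intro: exI[of _ 0])
      have "s + c * a \<le> norm (y + c *\<^sub>R x1)" if m: "(y,s) \<in> M" for y s c
      proof -
        consider "c = 0" | "c > 0" | "c < 0" by linarith
        then show ?thesis
        proof cases
          case 1 then show ?thesis using dom[OF m] by simp
        next
          case 2
          have "((1/c) *\<^sub>R y, s / c) \<in> M" using subspace_scale[OF sM m, of "1/c"] by simp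
          from a2[OF this] have "c * a \<le> c * (norm ((1/c) *\<^sub>R y + x1) - s / c)" using 2 by simp
          also have "\<dots> = norm (c *\<^sub>R ((1/c) *\<^sub>R y + x1)) - s"
            using 2 by (simp only: norm_scaleR right_diff_distrib) simp
          also have "c *\<^sub>R ((1/c) *\<^sub>R y + x1) = y + c *\<^sub>R x1"
            using 2 by (simp add: algebra_simps)
          finally show ?thesis by simp
        next
          case 3
          have "((1/(-c)) *\<^sub>R y, s / (-c)) \<in> M" using subspace_scale[OF sM m, of "1/(-c)"] by simp
          from a1[OF this] have "(-c) * (s/(-c) - norm ((1/(-c)) *\<^sub>R y - x1)) \<le> (-c) * a"
            using 3 by (intro mult_left_mono) auto
          then have "s - norm ((-c) *\<^sub>R ((1/(-c)) *\<^sub>R y - x1)) \<le> - c * a"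
            using 3 by (simp only: norm_scaleR right_diff_distrib) simp
          also have "(-c) *\<^sub>R ((1/(-c)) *\<^sub>R y - x1) = y + c *\<^sub>R x1"
            using 3 by (simp add: algebra_simps)
          finally show ?thesis by simp
        qed
      qed
      then show "\<forall>(x,t)\<in>g. t \<le> norm x" by (auto simp: g_def)
    qed
    moreover have "M \<subseteq> g"
    proof
      fix q assume "q \<in> M"
      moreover have "q = (fst q + 0 *\<^sub>R x1, snd q + 0 * a)" by simp
      ultimately show "q \<in> g" unfolding g_def by (metis (mono_tags, lifting) mem_Collect_eq prod.collapse)
    qed
    ultimately have "g = M" by (rule max)
    moreover have "(x1, a) \<in> g"
    proof -
      have "(0, 0) \<in> M" "(x1, a) = (0 + 1 *\<^sub>R x1, 0 + 1 * a)"
        using subspace_0[OF sM] by (simp_all add: zero_prod_def)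
      then show ?thesis unfolding g_def by blast
    qed
    ultimately show ?thesis by blast
  qed
  have uniq: "t = t'" if "(x,t) \<in> M" "(x,t') \<in> M" for x t t'
    using subspace_diff[OF sM that] subspace_diff[OF sM that(2) that(1)] dom[of 0 "t - t'"] dom[of 0 "t' - t"]
    by simp
  define u where "u x = (THE t. (x,t) \<in> M)" for x
  have u: "(x, u x) \<in> M" for x
    unfolding u_def using total[of x] uniq by (metis theI)
  show thesis
  proof
    show "linear u"
    proof
      show "u (x + y) = u x + u y" for x y
        using subspace_add[OF sM u[of x] u[of y]] uniq[OF u] by simp
      show "u (c *\<^sub>R x) = c *\<^sub>R u x" for c x
        using subspace_scale[OF sM u[of x]] uniq[OF u] by simp
    qed
    show "u x \<le> norm x" for x using dom u by blast
    show "u x0 = norm x0" using uniq[OF u x0M] .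
  qed
qed

section \<open>Complex functionals and their norms\<close>

lemma cblinfun_apply_CBlinfun:
  assumes "bounded_linear f" "\<And>c x. f (c *\<^sub>C x) = c *\<^sub>C f x"
  shows "cblinfun_apply (CBlinfun (Blinfun f)) = f"
  using assms by (simp add: cblinfun_apply_def CBlinfun_inverse bounded_linear_Blinfun_apply)

lemma norm_cblinfun_apply: "norm (cblinfun_apply f x) \<le> norm f * norm x"
  by (simp add: cblinfun_apply_def norm_cblinfun.rep_eq norm_blinfun)

lemma norm_cblinfun_bound:
  "0 \<le> C \<Longrightarrow> (\<And>x. norm (cblinfun_apply f x) \<le> C * norm x) \<Longrightarrow> norm f \<le> C"
  by (simp add: cblinfun_apply_def norm_cblinfun.rep_eq norm_blinfun_bound)

lemma bounded_linear_cblinfun_apply: "bounded_linear (cblinfun_apply f)"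
  unfolding cblinfun_apply_def by (rule blinfun.bounded_linear_right)

lemma scaleC_one [simp]: "1 *\<^sub>C x = (x::'e::complex_normed_vector)"
  using scaleC_of_real[of 1 x] by simp

text \<open>Complexification of a real Hahn--Banach functional u: x \<mapsto> u x - i u (i x) is
  complex linear. Multiplying x by a unimodular c that makes the value at c x real and nonnegative
  reduces its modulus to the bound for u.\<close>

lemma norming_functional:
  fixes x0 :: "'e::complex_normed_vector"
  obtains \<phi> :: "('e, complex) cblinfun" where "norm \<phi> \<le> 1" "cblinfun_apply \<phi> x0 = norm x0"
proof -
  obtain u :: "'e \<Rightarrow> real" where u: "linear u" "\<And>x. u x \<le> norm x" "u x0 = norm x0"
    using hahn_banach_real[of x0] by blast
  interpret u: linear u by fact
  define f where "f x = Complex (u x) (- u (\<i> *\<^sub>C x))" for x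
  have neg: "(-1) *\<^sub>C x = - x" for x :: 'e
    using scaleC_of_real[of "-1" x] by simp
  have fi: "f (\<i> *\<^sub>C x) = \<i> * f x" for x
    by (simp add: f_def scaleC_scaleC neg complex_eq_iff u.neg)
  have fadd: "f (x + y) = f x + f y" for x y
    by (simp add: f_def scaleC_add_right u.add complex_eq_iff)
  have fR: "f (r *\<^sub>R x) = r *\<^sub>R f x" for r x
    by (simp add: f_def scaleC_scaleR_commute u.scale complex_eq_iff)
  have fC: "f (c *\<^sub>C x) = c *\<^sub>C f x" for c x
  proof -
    have "c *\<^sub>C x = (complex_of_real (Re c) + \<i> * complex_of_real (Im c)) *\<^sub>C x"
      using complex_eq[of c] by simp
    also have "\<dots> = Re c *\<^sub>R x + \<i> *\<^sub>C (Im c *\<^sub>R x)"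
      by (simp only: scaleC_add_left scaleC_scaleC[symmetric] scaleC_of_real)
    finally have "f (c *\<^sub>C x) = Re c *\<^sub>R f x + \<i> * (Im c *\<^sub>R f x)"
      by (simp add: fadd fR fi)
    also have "\<dots> = c * f x"
      by (simp add: scaleR_conv_of_real complex_eq_iff)
    finally show ?thesis by (simp add: scaleC_complex_def)
  qed
  have fle: "cmod (f x) \<le> norm x" for x
  proof (cases "f x = 0")
    case False
    define c where "c = cnj (f x) / cmod (f x)"
    have c: "cmod c = 1" using False by (simp add: c_def norm_divide)
    have "f (c *\<^sub>C x) = cmod (f x)"
      using False complex_norm_square[of "f x"]
      by (simp add: fC scaleC_complex_def c_def mult.commute[of "cnj (f x)"] power2_eq_square
          nonzero_divide_eq_eq)
    then have "cmod (f x) = u (c *\<^sub>C x)" by (simp add: f_def complex_eq_iff)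
    also have "\<dots> \<le> norm (c *\<^sub>C x)" by (rule u)
    finally show ?thesis by (simp add: norm_scaleC c)
  qed simp
  have bl: "bounded_linear f"
    by (rule bounded_linear_intro[where K = 1]) (simp_all add: fadd fR fle)
  have ap: "cblinfun_apply (CBlinfun (Blinfun f)) = f"
    by (rule cblinfun_apply_CBlinfun[OF bl fC])
  have "Re (f x0) = norm x0" by (simp add: f_def u)
  \<comment> \<open>The real part already has modulus norm x0, the bound for the whole number, so
    nothing is left for the imaginary part.\<close>
  moreover have "(Im (f x0))\<^sup>2 \<le> 0"
    using power_mono[OF fle[of x0], of 2] \<open>Re (f x0) = norm x0\<close> by (simp add: cmod_power2)
  ultimately have "f x0 = norm x0" by (simp add: complex_eq_iff)
  then show thesis
    using that[of "CBlinfun (Blinfun f)"] ap norm_cblinfun_bound[of 1 "CBlinfun (Blinfun f)"] fle by simp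
qed

section \<open>The conjugate space and operators on it\<close>

lemma conjugate_add: "conjugate (x + y) = conjugate x + conjugate y"
  by transfer (rule conj_functional_add)

lemma conjugate_scaleC: "conjugate (c *\<^sub>C x) = cnj c *\<^sub>C conjugate x"
  by transfer (simp add: conj_functional_scaleC)

lemma conjugate_scaleR: "conjugate (c *\<^sub>R x) = c *\<^sub>R conjugate x"
  by transfer (simp add: conj_functional_scaleR)

lemma conjugate_cases: obtains x where "y = conjugate x"
  by (metis conjugate.rep_eq functional_of_cconj functional_of_cconj_inject rangeE)

text \<open>The lower bound is Hahn--Banach: a norming functional of x, read as an element of
  \<open>cdual\<close>, is a unit vector on which the conjugate of x attains norm x.\<close>

lemma norm_conjugate: "norm (conjugate x) = norm x"
proof (rule antisym)
  have "norm (conj_functional x) \<le> norm x"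
    using norm_cdual_apply[of _ x]
    by (intro norm_cblinfun_bound) (simp_all add: conj_functional_apply mult.commute)
  then show "norm (conjugate x) \<le> norm x"
    by (simp add: norm_cconj.rep_eq conjugate.rep_eq)
  obtain \<phi> where \<phi>: "norm \<phi> \<le> 1" "cblinfun_apply \<phi> x = norm x" using norming_functional[of x] by blast
  have "norm x = norm (cblinfun_apply (conj_functional x) (CDual \<phi>))"
    by (simp add: conj_functional_apply cdual_apply_def CDual_inverse \<phi>)
  also have "\<dots> \<le> norm (conj_functional x) * norm (CDual \<phi>)" by (rule norm_cblinfun_apply)
  also have "\<dots> \<le> norm (conj_functional x) * 1"
    using \<phi> by (intro mult_left_mono) (simp_all add: norm_cdual.rep_eq CDual_inverse)
  finally show "norm x \<le> norm (conjugate x)"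
    by (simp add: norm_cconj.rep_eq conjugate.rep_eq)
qed

lemma bounded_linear_conjugate: "bounded_linear conjugate"
  by (rule bounded_linear_intro[where K = 1]) (simp_all add: conjugate_add conjugate_scaleR norm_conjugate)

lemma bounded_bilinear_cblinfun_apply: "bounded_bilinear cblinfun_apply"
proof
  show "\<exists>K. \<forall>a b. norm (cblinfun_apply a b) \<le> norm a * norm b * K"
    using norm_cblinfun_apply by (auto intro!: exI[of _ 1])
  fix a :: "('a,'b) cblinfun" and b b' r
  show "cblinfun_apply a (b + b') = cblinfun_apply a b + cblinfun_apply a b'"
    by (rule linear_add[OF bounded_linear.linear[OF bounded_linear_cblinfun_apply]])
  show "cblinfun_apply a (r *\<^sub>R b) = r *\<^sub>R cblinfun_apply a b"
    by (rule linear_scale[OF bounded_linear.linear[OF bounded_linear_cblinfun_apply]])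
qed (simp_all add: apply_plus_cblinfun apply_scaleR_cblinfun)

text \<open>Completeness makes the symbol b an instance of the general theory, in which radial
  derivatives are obtained as limits. A Cauchy sequence converges among the real-linear operators,
  and complex homogeneity passes to the pointwise limit.\<close>

instance cblinfun :: (complex_normed_vector, cbanach) cbanach
proof
  fix X :: "nat \<Rightarrow> ('a, 'b) cblinfun" assume "Cauchy X"
  then have "Cauchy (\<lambda>i. blinfun_of_cblinfun (X i))"
    by (simp add: Cauchy_def dist_norm norm_cblinfun.rep_eq minus_cblinfun.rep_eq)
  then obtain L where L: "(\<lambda>i. blinfun_of_cblinfun (X i)) \<longlonglongrightarrow> L"
    using Cauchy_convergent_iff convergent_def by blast
  have ap: "(\<lambda>i. blinfun_apply (blinfun_of_cblinfun (X i)) x) \<longlonglongrightarrow> blinfun_apply L x" for x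
    by (intro tendsto_intros L)
  have "blinfun_apply L (c *\<^sub>C x) = c *\<^sub>C blinfun_apply L x" for c x
  proof (rule LIMSEQ_unique[OF ap])
    have "(\<lambda>i. c *\<^sub>C blinfun_apply (blinfun_of_cblinfun (X i)) x) \<longlonglongrightarrow> c *\<^sub>C blinfun_apply L x"
      by (intro bounded_linear.tendsto[OF bounded_linear_scaleC] ap)
    then show "(\<lambda>i. blinfun_apply (blinfun_of_cblinfun (X i)) (c *\<^sub>C x)) \<longlonglongrightarrow> c *\<^sub>C blinfun_apply L x"
      using blinfun_of_cblinfun[where ?'a = 'a and ?'b = 'b] by simp
  qed
  then have inv: "blinfun_of_cblinfun (CBlinfun L) = L" by (simp add: CBlinfun_inverse)
  have "X \<longlonglongrightarrow> CBlinfun L"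
    using L by (simp add: LIMSEQ_iff norm_cblinfun.rep_eq minus_cblinfun.rep_eq inv)
  then show "convergent X" by (auto simp: convergent_def)
qed

lemma norm_le_functionals:
  fixes x :: "'e::complex_normed_vector"
  assumes "\<And>\<phi> :: ('e, complex) cblinfun. norm \<phi> \<le> 1 \<Longrightarrow> cmod (cblinfun_apply \<phi> x) \<le> C"
  shows "norm x \<le> C"
  by (metis assms norm_of_real abs_norm_cancel norming_functional)

lemma eq_functionals:
  fixes x :: "'e::complex_normed_vector"
  assumes "\<And>\<phi> :: ('e, complex) cblinfun. cblinfun_apply \<phi> x = cblinfun_apply \<phi> y"
  shows "x = y"
proof -
  have "norm (x - y) \<le> 0"
    by (rule norm_le_functionals)
      (simp add: assms linear_diff[OF bounded_linear.linear[OF bounded_linear_cblinfun_apply]])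
  then show ?thesis by simp
qed

section \<open>Integrals of Banach-space valued functions\<close>

lemma has_banach_integral_functional:
  fixes \<phi> :: "'b::banach \<Rightarrow> 'c::{banach, second_countable_topology}"
  assumes f: "has_banach_integral M f y" and \<phi>: "bounded_linear \<phi>"
  shows "has_bochner_integral M (\<lambda>w. \<phi> (f w)) (\<phi> y)"
proof -
  interpret \<phi>: bounded_linear \<phi> by fact
  obtain s where f1[measurable]: "f \<in> borel_measurable M"
    and s: "\<And>i::nat. Bochner_Integration.simple_bochner_integrable M (s i)"
    and s0: "(\<lambda>i. \<integral>\<^sup>+w. ennreal (norm (f w - s i w)) \<partial>M) \<longlonglongrightarrow> 0"
    and sy: "(\<lambda>i. Bochner_Integration.simple_bochner_integral M (s i)) \<longlonglongrightarrow> y"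
    using f by (auto simp: has_banach_integral_def)
  obtain K where K: "K > 0" "\<And>x. norm (\<phi> x) \<le> norm x * K" using \<phi>.pos_bounded by blast
  show ?thesis
  proof (rule has_bochner_integral.intros)
    have "\<phi> \<in> borel_measurable borel"
      by (intro borel_measurable_continuous_onI linear_continuous_on \<phi>)
    then show "(\<lambda>w. \<phi> (f w)) \<in> borel_measurable M" by measurable
    show "Bochner_Integration.simple_bochner_integrable M (\<lambda>x. \<phi> (s i x))" for i
      by (rule simple_bochner_integrable_compose2[where p="\<lambda>x y. \<phi> x", OF _ s s]) simp
    show "(\<lambda>i. Bochner_Integration.simple_bochner_integral M (\<lambda>x. \<phi> (s i x))) \<longlonglongrightarrow> \<phi> y"
      by (simp add: simple_bochner_integral_linear[OF \<phi>.linear s] \<phi>.tendsto[OF sy])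
    show "(\<lambda>i. \<integral>\<^sup>+ x. norm (\<phi> (f x) - \<phi> (s i x)) \<partial>M) \<longlonglongrightarrow> 0"
    proof (rule tendsto_sandwich[OF _ _ tendsto_const])
      have "(\<lambda>i. ennreal K * (\<integral>\<^sup>+w. ennreal (norm (f w - s i w)) \<partial>M)) \<longlonglongrightarrow> ennreal K * 0"
        by (intro ennreal_tendsto_cmult s0) simp
      then show "(\<lambda>i. ennreal K * (\<integral>\<^sup>+w. ennreal (norm (f w - s i w)) \<partial>M)) \<longlonglongrightarrow> 0" by simp
      \<comment> \<open>In a nonseparable space a difference of Borel functions need not be Borel.
        Here one of them has finitely many values, so the function is a finite sum over these
        values.\<close>
      have ms: "(\<lambda>w. norm (f w - s i w)) \<in> borel_measurable M" for i
      proof -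
        have sf: "simple_function M (s i)" using s[of i] by (auto elim: simple_bochner_integrable.cases)
        have fin: "finite (s i ` space M)" and vim: "s i -` {c} \<inter> space M \<in> sets M" for c
          using sf by (auto simp: simple_functionD)
        have [measurable]: "(\<lambda>w. norm (f w - c)) \<in> borel_measurable M" for c
          by (rule measurable_compose[OF f1]) (intro borel_measurable_continuous_onI continuous_intros)
        have "(\<lambda>w. \<Sum>c\<in>s i ` space M. indicator (s i -` {c} \<inter> space M) w * norm (f w - c)) \<in> borel_measurable M"
          using vim by measurable
        also have "?this \<longleftrightarrow> (\<lambda>w. norm (f w - s i w)) \<in> borel_measurable M"
        proof (rule measurable_cong)
          fix w assume w: "w \<in> space M"
          have "(\<Sum>c\<in>s i ` space M. indicator (s i -` {c} \<inter> space M) w * norm (f w - c))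
            = (\<Sum>c\<in>s i ` space M. if c = s i w then norm (f w - c) else 0)"
            using w by (intro sum.cong) (auto simp: indicator_def)
          also have "\<dots> = norm (f w - s i w)" using w fin by simp
          finally show "(\<Sum>c\<in>s i ` space M. indicator (s i -` {c} \<inter> space M) w * norm (f w - c)) = norm (f w - s i w)" .
        qed
        finally show ?thesis .
      qed
      show "\<forall>\<^sub>F i in sequentially. (\<integral>\<^sup>+ x. norm (\<phi> (f x) - \<phi> (s i x)) \<partial>M)
        \<le> ennreal K * (\<integral>\<^sup>+w. ennreal (norm (f w - s i w)) \<partial>M)"
        by (intro always_eventually allI, subst nn_integral_cmult[symmetric])
          (auto intro!: nn_integral_mono simp: ms \<phi>.diff[symmetric] ennreal_mult''[symmetric] mult.commute[of K] intro: ennreal_leI K)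
    qed simp
  qed
qed

lemma has_banach_integral_unique:
  fixes f :: "'z \<Rightarrow> 'b::cbanach"
  assumes "has_banach_integral M f x" "has_banach_integral M f y"
  shows "x = y"
proof (rule eq_functionals)
  fix \<phi> :: "('b, complex) cblinfun"
  show "cblinfun_apply \<phi> x = cblinfun_apply \<phi> y"
    using assms[THEN has_banach_integral_functional[OF _ bounded_linear_cblinfun_apply[of \<phi>]]]
    by (metis has_bochner_integral_eq)
qed

lemma has_banach_integral_eq:
  fixes f :: "'z \<Rightarrow> 'b::cbanach"
  assumes "has_banach_integral M f y"
  shows "banach_integral M f = y"
  unfolding banach_integral_def using assms has_banach_integral_unique by (auto intro!: the_equality)

text \<open>The approximating simple function takes the point nearest to f w among the first points
  of a countable dense set, with the least index in case of a tie. The errors decrease to 0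
  pointwise, and dominated convergence applies to their norms, which are real functions.\<close>

lemma has_banach_integral_exists:
  fixes f :: "'z \<Rightarrow> 'b::banach"
  assumes f[measurable]: "f \<in> borel_measurable M" and fin: "(\<integral>\<^sup>+w. ennreal (norm (f w)) \<partial>M) < \<infinity>"
    and D: "countable D" "f ` space M \<subseteq> closure D"
  shows "\<exists>y. has_banach_integral M f y"
proof -
  obtain d0 where d0: "D \<union> {0} = range (d0 :: nat \<Rightarrow> 'b)"
    using D(1) by (metis Un_empty countable_Un countable_finite finite.emptyI finite.insertI insert_not_empty range_from_nat_into)
  \<comment> \<open>The point 0 comes first in the list, so no approximation is farther from f w
    than 0 is: norm (f w) dominates all errors.\<close>
  define d where "d i = (case i of 0 \<Rightarrow> 0 | Suc j \<Rightarrow> d0 j)" for i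
  have dD: "D \<subseteq> range d"
  proof
    fix x assume "x \<in> D"
    then obtain j where "x = d0 j" using d0 by blast
    then have "x = d (Suc j)" by (simp add: d_def)
    then show "x \<in> range d" by blast
  qed
  define P where "P i w k \<longleftrightarrow> k \<le> i \<and> (\<forall>j\<le>i. norm (f w - d k) \<le> norm (f w - d j))" for i w and k :: nat
  define idx where "idx i w = (LEAST k. P i w k)" for i w
  have "\<exists>k. P i w k" for i w
  proof -
    have "Min ((\<lambda>j. norm (f w - d j)) ` {..i}) \<in> (\<lambda>j. norm (f w - d j)) ` {..i}"
      by (rule Min_in) auto
    then obtain k where "k \<le> i" "norm (f w - d k) = Min ((\<lambda>j. norm (f w - d j)) ` {..i})"
      by (smt (verit, best) atMost_iff imageE)
    then have "P i w k" by (auto simp: P_def)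
    then show ?thesis ..
  qed
  then have P: "P i w (idx i w)" for i w unfolding idx_def by (rule LeastI_ex)
  have [measurable]: "(\<lambda>w. norm (f w - c)) \<in> borel_measurable M" for c
    by (rule measurable_compose[OF f]) (intro borel_measurable_continuous_onI continuous_intros)
  have im[measurable]: "idx i \<in> measurable M (count_space UNIV)" for i
    unfolding idx_def P_def by measurable
  have sfi: "simple_function M (idx i)" for i
  proof -
    have "idx i ` space M \<subseteq> {..i}" using P by (auto simp: P_def)
    moreover have "idx i -` {k} \<inter> space M \<in> sets M" for k using measurable_sets[OF im, of "{k}"] by simp
    ultimately show ?thesis by (auto simp: simple_function_def intro: finite_subset)
  qed
  define s where "s i w = d (idx i w)" for i w
  have ssf: "simple_function M (s i)" for i
    using simple_function_compose1[OF sfi, of d] by (simp add: s_def[abs_def])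
  have le: "norm (f w - s i w) \<le> norm (f w - d j)" if "j \<le> i" for i j w
    using P[of i w] that by (simp add: P_def s_def)
  have le0: "norm (f w - s i w) \<le> norm (f w)" for i w
    using le[of 0 i w] by (simp add: d_def)
  have ms[measurable]: "(\<lambda>w. norm (f w - s i w)) \<in> borel_measurable M" for i
    unfolding s_def by (rule measurable_compose_countable[OF _ im]) measurable
  have mn[measurable]: "(\<lambda>w. norm (f w)) \<in> borel_measurable M"
    by (rule measurable_compose[OF f]) (intro borel_measurable_continuous_onI continuous_intros)
  have pt: "(\<lambda>i. norm (f w - s i w)) \<longlonglongrightarrow> 0" if "w \<in> space M" for w
  proof (rule LIMSEQ_I)
    fix r :: real assume r: "0 < r"
    have "f w \<in> closure D" using D(2) that by blast
    then obtain x where "x \<in> D" "dist x (f w) < r" using r by (meson closure_approachable)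
    then obtain j where j: "norm (f w - d j) < r" using dD by (metis dist_commute dist_norm imageE subsetD)
    show "\<exists>no. \<forall>n\<ge>no. norm (norm (f w - s n w) - 0) < r"
    proof (intro exI[of _ j] allI impI)
      fix n assume "j \<le> n"
      then show "norm (norm (f w - s n w) - 0) < r" using le[of j n w] j by simp
    qed
  qed
  have s0: "(\<lambda>i. \<integral>\<^sup>+w. ennreal (norm (f w - s i w)) \<partial>M) \<longlonglongrightarrow> (\<integral>\<^sup>+w. 0 \<partial>M)"
  proof (rule nn_integral_dominated_convergence[where w="\<lambda>w. ennreal (norm (f w))"])
    show "AE x in M. (\<lambda>i. ennreal (norm (f x - s i x))) \<longlonglongrightarrow> 0"
      using tendsto_ennrealI[OF pt] by (intro AE_I2) simp
  qed (use le0 fin in \<open>auto intro!: AE_I2 ennreal_leI\<close>)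
  then have s0: "(\<lambda>i. \<integral>\<^sup>+w. ennreal (norm (f w - s i w)) \<partial>M) \<longlonglongrightarrow> 0" by simp
  have "norm (s i w) \<le> 2 * norm (f w)" for i w
    using le0[of w i] norm_triangle_ineq2[of "s i w" "f w"] by (simp add: norm_minus_commute)
  then have "(\<integral>\<^sup>+w. norm (s i w) \<partial>M) \<le> (\<integral>\<^sup>+w. 2 * ennreal (norm (f w)) \<partial>M)" for i
    by (intro nn_integral_mono) (metis ennreal_leI ennreal_mult' ennreal_numeral norm_ge_zero zero_le_numeral)
  also have "\<dots> < \<infinity>" using fin by (simp add: nn_integral_cmult ennreal_mult_less_top)
  finally have sb: "Bochner_Integration.simple_bochner_integrable M (s i)" for i
    by (intro simple_bochner_integrableI_bounded ssf) auto
  let ?I = "\<lambda>i. Bochner_Integration.simple_bochner_integral M (s i)"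
  let ?e = "\<lambda>i. \<integral>\<^sup>+w. ennreal (norm (f w - s i w)) \<partial>M"
  have IJ: "ennreal (norm (?I i - ?I j)) \<le> ?e i + ?e j" for i j
  proof -
    have sd: "Bochner_Integration.simple_bochner_integrable M (\<lambda>w. s i w - s j w)"
      by (rule simple_bochner_integrable_compose2[where p="(-)"]) (simp_all add: sb)
    have sn: "Bochner_Integration.simple_bochner_integrable M (\<lambda>w. norm (s i w - s j w))"
      by (rule simple_bochner_integrable_compose2[where p="\<lambda>x y. norm (x - y)"]) (simp_all add: sb)
    have "ennreal (norm (?I i - ?I j)) = ennreal (norm (Bochner_Integration.simple_bochner_integral M (\<lambda>w. s i w - s j w)))"
      by (simp add: simple_bochner_integral_diff sb)
    also have "\<dots> \<le> ennreal (Bochner_Integration.simple_bochner_integral M (\<lambda>w. norm (s i w - s j w)))"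
      by (intro ennreal_leI simple_bochner_integral_norm_bound sd)
    also have "\<dots> = (\<integral>\<^sup>+w. norm (s i w - s j w) \<partial>M)"
      by (rule simple_bochner_integral_eq_nn_integral[OF sn]) simp
    also have "\<dots> \<le> (\<integral>\<^sup>+w. ennreal (norm (f w - s i w)) + ennreal (norm (f w - s j w)) \<partial>M)"
    proof (intro nn_integral_mono)
      fix w
      have "norm (s i w - s j w) \<le> norm (f w - s i w) + norm (f w - s j w)"
        using norm_triangle_ineq4[of "f w - s j w" "f w - s i w"] by simp
      then show "ennreal (norm (s i w - s j w)) \<le> ennreal (norm (f w - s i w)) + ennreal (norm (f w - s j w))"
        by (simp add: ennreal_plus[symmetric] del: ennreal_plus)
    qed
    also have "\<dots> = ?e i + ?e j" by (rule nn_integral_add) measurable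
    finally show ?thesis .
  qed
  have "Cauchy ?I"
  proof (rule metric_CauchyI)
    fix e :: real assume e: "0 < e"
    then have "\<forall>\<^sub>F i in sequentially. ?e i < ennreal (e/2)"
      by (intro order_tendstoD[OF s0]) simp
    then obtain n where n: "\<And>i. i \<ge> n \<Longrightarrow> ?e i < ennreal (e/2)" by (auto simp: eventually_sequentially)
    show "\<exists>M. \<forall>m\<ge>M. \<forall>n\<ge>M. dist (?I m) (?I n) < e"
    proof (intro exI[of _ n] allI impI)
      fix i j assume "n \<le> i" "n \<le> j"
      then have "?e i + ?e j < ennreal (e/2) + ennreal (e/2)" by (intro add_strict_mono n)
      with IJ[of i j] have "ennreal (norm (?I i - ?I j)) < ennreal e"
        using e by (simp add: ennreal_plus[symmetric] del: ennreal_plus)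
      then show "dist (?I i) (?I j) < e" by (simp add: dist_norm ennreal_less_iff)
    qed
  qed
  then obtain y where "?I \<longlonglongrightarrow> y" using Cauchy_convergent_iff convergent_def by blast
  then show ?thesis unfolding has_banach_integral_def using f sb s0 by blast
qed

lemma has_banach_integral_functional':
  fixes f :: "'z \<Rightarrow> 'b::cbanach" and \<phi> :: "('b, complex) cblinfun"
  assumes "has_banach_integral M f y"
  shows "integrable M (\<lambda>w. cblinfun_apply \<phi> (f w))" "(\<integral>w. cblinfun_apply \<phi> (f w) \<partial>M) = cblinfun_apply \<phi> y"
  using has_banach_integral_functional[OF assms bounded_linear_cblinfun_apply[of \<phi>]]
  by (auto simp: has_bochner_integral_iff)

section \<open>Holomorphic functions on the ball\<close>

text \<open>The condition in \<open>ball_holomorphic\<close> for an arbitrary set of points, since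
  the Cauchy estimates and uniform limits work on small balls around a point.\<close>

definition cholo :: "(complex ^ 'n \<Rightarrow> 'e::complex_normed_vector) \<Rightarrow> (complex ^ 'n) set \<Rightarrow> bool" where
  "cholo f S \<longleftrightarrow> (\<forall>z\<in>S. \<exists>D. (f has_derivative D) (at z) \<and> (\<forall>c v. D (c *s v) = c *\<^sub>C D v))"

lemma ball_holomorphic_iff: "f \<in> ball_holomorphic \<longleftrightarrow> cholo f (ball 0 1)"
  by (simp add: ball_holomorphic_def cholo_def)

abbreviation fderiv where "fderiv f z \<equiv> frechet_derivative f (at z)"

lemma cholo_fderiv:
  assumes "cholo f S" "z \<in> S"
  shows "(f has_derivative fderiv f z) (at z)" "fderiv f z (c *s v) = c *\<^sub>C fderiv f z v"
  using assms frechet_derivative_at unfolding cholo_def by metis+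

lemma cholo_continuous: "cholo f S \<Longrightarrow> continuous_on S f"
  unfolding cholo_def by (meson continuous_at_imp_continuous_on has_derivative_continuous)

lemma cholo_compose_linear:
  fixes \<phi> :: "'e::complex_normed_vector \<Rightarrow> 'f::complex_normed_vector"
  assumes f: "cholo f S" and \<phi>: "bounded_linear \<phi>" "\<And>c x. \<phi> (c *\<^sub>C x) = c *\<^sub>C \<phi> x"
  shows "cholo (\<lambda>z. \<phi> (f z)) S" and "z \<in> S \<Longrightarrow> fderiv (\<lambda>z. \<phi> (f z)) z = (\<lambda>v. \<phi> (fderiv f z v))"
proof -
  have d: "((\<lambda>z. \<phi> (f z)) has_derivative (\<lambda>v. \<phi> (fderiv f z v))) (at z)" if "z \<in> S" for z
    using bounded_linear.has_derivative[OF \<phi>(1) cholo_fderiv(1)[OF f that]] .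
  show "cholo (\<lambda>z. \<phi> (f z)) S"
    unfolding cholo_def using d cholo_fderiv(2)[OF f] by (fastforce simp: \<phi>(2))
  show "fderiv (\<lambda>z. \<phi> (f z)) z = (\<lambda>v. \<phi> (fderiv f z v))" if "z \<in> S"
    using frechet_derivative_at[OF d[OF that]] by simp
qed

lemma cholo_functional:
  assumes "cholo f S"
  shows "cholo (\<lambda>z. cblinfun_apply \<phi> (f z)) S"
    "z \<in> S \<Longrightarrow> fderiv (\<lambda>z. cblinfun_apply \<phi> (f z)) z = (\<lambda>v. cblinfun_apply \<phi> (fderiv f z v))"
  using cholo_compose_linear[OF assms bounded_linear_cblinfun_apply[of \<phi>] cblinfun_apply_scaleC] by auto

lemma cholo_compose_affine:
  assumes f: "cholo f S" and A: "bounded_linear A" "\<And>c v. A (c *s v) = c *s A v"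
    and sub: "\<And>z. z \<in> T \<Longrightarrow> a + A z \<in> S"
  shows "cholo (\<lambda>z. f (a + A z)) T"
    "z \<in> T \<Longrightarrow> fderiv (\<lambda>z. f (a + A z)) z = (\<lambda>v. fderiv f (a + A z) (A v))"
proof -
  have d: "((\<lambda>z. f (a + A z)) has_derivative (\<lambda>v. fderiv f (a + A z) (A v))) (at z)" if "z \<in> T" for z
  proof -
    have "((\<lambda>z. a + A z) has_derivative A) (at z)"
      using bounded_linear_imp_has_derivative[OF A(1)] by (auto intro!: derivative_eq_intros)
    from diff_chain_at[OF this cholo_fderiv(1)[OF f sub[OF that]]] show ?thesis by (simp add: o_def)
  qed
  show "cholo (\<lambda>z. f (a + A z)) T"
    unfolding cholo_def using d cholo_fderiv(2)[OF f sub] by (fastforce simp: A(2))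
  show "fderiv (\<lambda>z. f (a + A z)) z = (\<lambda>v. fderiv f (a + A z) (A v))" if "z \<in> T"
    using frechet_derivative_at[OF d[OF that]] by simp
qed

section \<open>Restriction to complex lines; partial and radial derivatives\<close>

lemma norm_vector_smult: "norm (c *s v) = cmod c * norm (v :: complex ^ 'n)"
proof -
  have "norm (c *s v) = L2_set (\<lambda>i. cmod c * norm (v $ i)) UNIV"
    by (simp add: norm_vec_def norm_mult)
  then show ?thesis by (simp add: L2_set_right_distrib norm_vec_def)
qed

lemma bounded_linear_vector_smult: "bounded_linear (\<lambda>v :: complex ^ 'n. c *s v)"
  by (rule bounded_linear_intro[where K = "cmod c"])
    (simp_all add: norm_vector_smult mult.commute vector_add_ldistrib vec_eq_iff)

lemma bounded_linear_smult_left: "bounded_linear (\<lambda>c. c *s (v :: complex ^ 'n))"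
  by (rule bounded_linear_intro[where K = "norm v"])
    (simp_all add: norm_vector_smult vec_eq_iff algebra_simps)

lemma of_real_smult: "complex_of_real r *s (v :: complex ^ 'n) = r *\<^sub>R v"
  unfolding vec_eq_iff vector_smult_component vector_scaleR_component by (simp add: scaleR_conv_of_real)

lemma cholo_slice:
  fixes g :: "complex ^ 'n \<Rightarrow> complex"
  assumes g: "cholo g S" and S: "z + t *s v \<in> S"
  shows "((\<lambda>t. g (z + t *s v)) has_field_derivative fderiv g (z + t *s v) v) (at t)"
proof -
  have "((\<lambda>t. z + t *s v) has_derivative (\<lambda>t. t *s v)) (at t)"
    using bounded_linear_imp_has_derivative[OF bounded_linear_smult_left[of v]]
    by (auto intro!: derivative_eq_intros)
  from diff_chain_at[OF this cholo_fderiv(1)[OF g S]]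
  have "((\<lambda>t. g (z + t *s v)) has_derivative (\<lambda>h. fderiv g (z + t *s v) (h *s v))) (at t)"
    by (simp add: o_def)
  moreover have "(\<lambda>h. fderiv g (z + t *s v) (h *s v)) = (*) (fderiv g (z + t *s v) v)"
    by (simp add: cholo_fderiv(2)[OF g S] scaleC_complex_def mult.commute fun_eq_iff)
  ultimately show ?thesis by (simp add: has_field_derivative_def)
qed

lemma partial_deriv_cholo:
  assumes "cholo f S" "z \<in> S"
  shows "partial_deriv j f z = fderiv f z (axis j 1)"
  unfolding partial_deriv_def
proof (rule tendsto_Lim)
  let ?D = "fderiv f z"
  have D: "(f has_derivative ?D) (at z)" "\<And>c v. ?D (c *s v) = c *\<^sub>C ?D v"
    using cholo_fderiv[OF assms] by auto
  have ax: "axis j h = h *s axis j (1::complex)" for h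
    by (simp add: vec_eq_iff axis_def)
  have nax: "norm (axis j h :: complex ^ 'a) = cmod h" for h
    by (simp add: norm_axis_1 ax[of h] norm_vector_smult)
  have "filterlim (\<lambda>h. axis j h :: complex ^ 'a) (at 0) (at 0)"
    by (rule filterlim_atI)
      (auto simp: tendsto_norm_zero_iff[symmetric, where f="\<lambda>h. axis j h :: complex ^ 'a"] nax
        eventually_at_filter axis_eq_0_iff intro!: tendsto_norm_zero tendsto_ident_at)
  from filterlim_compose[OF conjunct2[OF iffD1[OF has_derivative_at D(1)]] this]
  have lim: "((\<lambda>h. norm (f (z + axis j h) - f z - ?D (axis j h)) / cmod h) \<longlongrightarrow> 0) (at 0)"
    by (simp add: nax)
  show "((\<lambda>h. inverse h *\<^sub>C (f (z + axis j h) - f z)) \<longlongrightarrow> ?D (axis j 1)) (at 0)"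
  proof (subst tendsto_dist_iff, rule Lim_transform_eventually[OF lim])
    show "\<forall>\<^sub>F h in at 0. norm (f (z + axis j h) - f z - ?D (axis j h)) / cmod h
       = dist (inverse h *\<^sub>C (f (z + axis j h) - f z)) (?D (axis j 1))"
      unfolding eventually_at_filter
    proof (intro always_eventually allI impI)
      fix h :: complex assume h: "h \<noteq> 0" 
      have "?D (axis j 1) = inverse h *\<^sub>C ?D (axis j h)"
        using h by (subst ax) (simp add: D(2) scaleC_scaleC)
      then have "inverse h *\<^sub>C (f (z + axis j h) - f z) - ?D (axis j 1)
         = inverse h *\<^sub>C (f (z + axis j h) - f z - ?D (axis j h))"
        by (simp add: scaleC_diff_right)
      then show "norm (f (z + axis j h) - f z - ?D (axis j h)) / cmod h
       = dist (inverse h *\<^sub>C (f (z + axis j h) - f z)) (?D (axis j 1))"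
        by (simp add: dist_norm norm_scaleC norm_inverse divide_inverse mult.commute)
    qed
  qed
qed simp

text \<open>Removes the coordinates: from here on the radial derivative at z is the derivative in
  the direction z.\<close>

lemma radial_deriv_cholo:
  assumes "cholo f S" "z \<in> S"
  shows "radial_deriv f z = fderiv f z z"
proof -
  have lin: "linear (fderiv f z)"
    using cholo_fderiv(1)[OF assms] has_derivative_linear by blast
  have "radial_deriv f z = (\<Sum>j\<in>UNIV. fderiv f z (z $ j *s axis j 1))"
    unfolding radial_deriv_def using cholo_fderiv(2)[OF assms] partial_deriv_cholo[OF assms] by simp
  also have "\<dots> = fderiv f z (\<Sum>j\<in>UNIV. z $ j *s axis j 1)" by (simp add: linear_sum[OF lin])
  finally show ?thesis by (simp add: basis_expansion)
qed

text \<open>Discs of radius r/3 around the points of the disc of radius r/2 stay in the domain, and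
  Cauchy's inequality on them bounds the second derivative by 2 B / (r/3)^2 = 18 B / r^2.\<close>

lemma Taylor2_bound:
  fixes h :: "complex \<Rightarrow> complex"
  assumes h: "h holomorphic_on ball 0 r" and r: "0 < r" and B: "\<And>t. t \<in> ball 0 r \<Longrightarrow> cmod (h t) \<le> B"
    and t: "cmod t \<le> r / 2" and d: "(h has_field_derivative h') (at 0)"
  shows "cmod (h t - h 0 - t * h') \<le> 18 * B / r\<^sup>2 * (cmod t)\<^sup>2"
proof -
  have B0: "0 \<le> B" using B[of 0] r by (metis centre_in_ball norm_ge_zero order_trans)
  let ?f = "\<lambda>i. (deriv ^^ i) h"
  have bd: "cmod (?f 2 x) \<le> 18 * B / r\<^sup>2" if x: "x \<in> cball 0 (r/2)" for x
  proof -
    have sub: "cball x (r/3) \<subseteq> ball 0 r"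
    proof
      fix y assume "y \<in> cball x (r/3)"
      then have "norm y \<le> norm x + r/3"
        using norm_triangle_ineq2[of y x] by (simp add: dist_norm norm_minus_commute)
      then show "y \<in> ball 0 r" using x r by simp
    qed
    have "cmod (?f 2 x) \<le> fact 2 * B / (r/3)^2"
    proof (rule Cauchy_inequality)
      show "h holomorphic_on ball x (r/3)" using h sub ball_subset_cball holomorphic_on_subset by blast
      show "continuous_on (cball x (r/3)) h"
        using h sub holomorphic_on_imp_continuous_on continuous_on_subset by blast
      show "cmod (h y) \<le> B" if "cmod (x - y) = r/3" for y
        using that sub by (intro B) (auto simp: dist_norm)
    qed (use r in auto)
    then show ?thesis by (simp add: power_divide fact_numeral)
  qed
  have "cmod (?f 0 t - (\<Sum>i\<le>1. ?f i 0 * (t-0) ^ i / (fact i))) \<le> 18 * B / r\<^sup>2 * cmod(t - 0)^(Suc 1) / fact 1"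
  proof (rule complex_Taylor[of "cball 0 (r/2)"])
    fix i :: nat and x :: complex assume x: "x \<in> cball 0 (r/2)" "i \<le> 1"
    have xin: "x \<in> ball 0 r" using x r by simp
    have "?f i holomorphic_on ball 0 r" by (rule holomorphic_higher_deriv[OF h]) simp
    then have "(?f i has_field_derivative deriv (?f i) x) (at x)"
      using holomorphic_derivI[OF _ open_ball xin] by blast
    then show "(?f i has_field_derivative ?f (Suc i) x) (at x within cball 0 (r/2))"
      by (simp add: has_field_derivative_at_within)
  next
    fix x :: complex assume "x \<in> cball 0 (r/2)"
    then show "cmod (?f (Suc 1) x) \<le> 18 * B / r\<^sup>2" using bd[of x] by (simp add: numeral_2_eq_2)
  qed (use r t in auto)
  moreover have "deriv h 0 = h'" using d by (rule DERIV_imp_deriv)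
  ultimately show ?thesis by (simp add: algebra_simps power2_eq_square)
qed

text \<open>Cauchy's inequality for t \<mapsto> f (x + t v) on the disc of radius r / (2 norm v),
  which is mapped into the ball, after composition with functionals of norm at most 1.\<close>

lemma fderiv_bound:
  fixes f :: "complex ^ 'n \<Rightarrow> 'e::complex_normed_vector"
  assumes f: "cholo f (ball x r)" and r: "0 < r" and B: "\<And>y. y \<in> ball x r \<Longrightarrow> norm (f y) \<le> B"
  shows "norm (fderiv f x v) \<le> 2 * B * norm v / r"
proof (rule norm_le_functionals)
  fix \<phi> :: "('e, complex) cblinfun" assume \<phi>: "norm \<phi> \<le> 1"
  have x: "x \<in> ball x r" using r by simp
  show "cmod (cblinfun_apply \<phi> (fderiv f x v)) \<le> 2 * B * norm v / r"
  proof (cases "v = 0")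
    case True
    then have "fderiv f x v = 0"
      using cholo_fderiv(1)[OF f x] has_derivative_linear linear_0 by blast
    then show ?thesis using True by (simp add: linear_0[OF bounded_linear.linear[OF bounded_linear_cblinfun_apply]])
  next
    case False
    let ?g = "\<lambda>z. cblinfun_apply \<phi> (f z)" and ?h = "\<lambda>t. cblinfun_apply \<phi> (f (x + t *s v))"
    define \<rho> where "\<rho> = r / (2 * norm v)"
    have \<rho>: "0 < \<rho>" using False r by (simp add: \<rho>_def)
    have inb: "x + t *s v \<in> ball x r" if "t \<in> cball 0 \<rho>" for t
    proof -
      have "cmod t * norm v \<le> \<rho> * norm v" using that by (intro mult_right_mono) auto
      also have "\<dots> < r" using r False by (simp add: \<rho>_def)
      finally show ?thesis by (simp add: dist_norm norm_vector_smult)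
    qed
    have g: "cholo ?g (ball x r)" by (rule cholo_functional(1)[OF f])
    have der: "(?h has_field_derivative fderiv ?g (x + t *s v) v) (at t)" if "t \<in> cball 0 \<rho>" for t
      using cholo_slice[OF g inb[OF that]] .
    have "cmod ((deriv ^^ 1) ?h 0) \<le> fact 1 * B / \<rho> ^ 1"
    proof (rule Cauchy_inequality)
      show "?h holomorphic_on ball 0 \<rho>"
        unfolding holomorphic_on_open[OF open_ball] using der ball_subset_cball by (meson subsetD)
      show "continuous_on (cball 0 \<rho>) ?h"
        using der DERIV_isCont continuous_at_imp_continuous_on by blast
      fix t assume "cmod (0 - t) = \<rho>"
      then have "norm (f (x + t *s v)) \<le> B" by (intro B inb) simp
      then show "cmod (?h t) \<le> B"
        using norm_cblinfun_apply[of \<phi> "f (x + t *s v)"] mult_right_mono[OF \<phi> norm_ge_zero[of "f (x + t *s v)"]] by simp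
    qed (rule \<rho>)
    moreover have "deriv ?h 0 = fderiv ?g x v"
      using DERIV_imp_deriv[OF der[of 0]] \<rho> by simp
    ultimately show ?thesis
      using False r by (simp add: cholo_functional(2)[OF f x] \<rho>_def mult_ac)
  qed
qed

lemma fderiv_diff_scale:
  assumes "(f has_derivative D) (at x)" "(g has_derivative E) (at x)"
  shows "fderiv (\<lambda>z. c *\<^sub>R (f z - g z)) x = (\<lambda>v. c *\<^sub>R (D v - E v))"
  by (rule frechet_derivative_at[symmetric]) (intro derivative_intros assms)

text \<open>Weierstrass' theorem. By the Cauchy estimate, uniform closeness of the functions gives
  uniform closeness of their derivatives on the ball of half the radius, and the theorem on limits
  of derivatives applies there.\<close>

lemma cholo_uniform_limit:
  fixes f :: "nat \<Rightarrow> complex ^ 'n \<Rightarrow> 'e::cbanach"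
  assumes f: "\<And>k. cholo (f k) (ball z (2 * r))" and r: "0 < r"
    and e0: "e \<longlonglongrightarrow> (0::real)" and fe: "\<And>k x. x \<in> ball z (2 * r) \<Longrightarrow> norm (f k x - g x) \<le> e k"
  shows "\<exists>D. (g has_derivative D) (at z) \<and> (\<forall>c v. D (c *s v) = c *\<^sub>C D v)"
proof -
  let ?S = "ball z r"
  have S2: "ball x r \<subseteq> ball z (2 * r)" if "x \<in> ?S" for x
    using that by (auto simp: subset_iff dist_commute) (metis dist_commute dist_triangle_less_add mult_2)
  have inS: "x \<in> ball z (2*r)" if "x \<in> ?S" for x using that r by simp
  have est: "norm (fderiv (f k) x v - fderiv (f m) x v) \<le> 2 * (e k + e m) / r * norm v" if x: "x \<in> ?S" for x v k m
  proof -
    let ?d = "\<lambda>y. 1 *\<^sub>R (f k y - f m y)"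
    have dk: "(f k has_derivative fderiv (f k) y) (at y)" "(f m has_derivative fderiv (f m) y) (at y)"
      if "y \<in> ball x r" for y
      using cholo_fderiv(1)[OF f] S2[OF x] that by auto
    have fd: "fderiv ?d y = (\<lambda>v. 1 *\<^sub>R (fderiv (f k) y v - fderiv (f m) y v))" if "y \<in> ball x r" for y
      by (rule fderiv_diff_scale[OF dk[OF that]])
    have ch: "cholo ?d (ball x r)"
      unfolding cholo_def
    proof
      fix y assume y: "y \<in> ball x r"
      have "(?d has_derivative (\<lambda>v. 1 *\<^sub>R (fderiv (f k) y v - fderiv (f m) y v))) (at y)"
        by (intro derivative_intros dk[OF y])
      moreover have "1 *\<^sub>R (fderiv (f k) y (c *s v) - fderiv (f m) y (c *s v)) = c *\<^sub>C 1 *\<^sub>R (fderiv (f k) y v - fderiv (f m) y v)" for c v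
        using cholo_fderiv(2)[OF f] S2[OF x] y by (auto simp: scaleC_diff_right)
      ultimately show "\<exists>D. (?d has_derivative D) (at y) \<and> (\<forall>c v. D (c *s v) = c *\<^sub>C D v)" by blast
    qed
    have "norm (fderiv ?d x v) \<le> 2 * (e k + e m) * norm v / r"
    proof (rule fderiv_bound[OF ch r])
      fix y assume "y \<in> ball x r"
      then have "y \<in> ball z (2 * r)" using S2[OF x] by blast
      then show "norm (?d y) \<le> e k + e m"
        using fe[of y k] fe[of y m] norm_triangle_ineq4[of "f k y - g y" "f m y - g y"] by simp
    qed
    then show ?thesis using fd[of x] r by simp
  qed
  have "\<exists>l. (\<lambda>k. fderiv (f k) x v) \<longlonglongrightarrow> l" if x: "x \<in> ?S" for x v
  proof -
    have "Cauchy (\<lambda>k. fderiv (f k) x v)"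
    proof (rule metric_CauchyI)
      fix d :: real assume d: "0 < d"
      define K where "K = 4 * norm v / r + 1"
      have K: "0 < K" using r by (simp add: K_def add_nonneg_pos)
      have "\<forall>\<^sub>F k in sequentially. e k < d / K"
        using K d by (intro order_tendstoD[OF e0]) simp
      then obtain N where N: "\<And>k. k \<ge> N \<Longrightarrow> e k < d / K" by (auto simp: eventually_sequentially)
      show "\<exists>M. \<forall>k\<ge>M. \<forall>m\<ge>M. dist (fderiv (f k) x v) (fderiv (f m) x v) < d"
      proof (intro exI[of _ N] allI impI)
        fix k m assume km: "N \<le> k" "N \<le> m"
        have "norm (fderiv (f k) x v - fderiv (f m) x v) \<le> 2 * (e k + e m) / r * norm v" by (rule est[OF x])
        also have "\<dots> \<le> 2 * (d / K + d / K) / r * norm v"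
          using N[OF km(1)] N[OF km(2)] r by (intro mult_right_mono divide_right_mono) auto
        also have "\<dots> = (4 * norm v / r) * (d / K)" by (simp add: mult_ac)
        also have "\<dots> = d * ((K - 1) / K)" by (simp add: K_def)
        also have "\<dots> < d" using K d by (simp add: field_simps)
        finally show "dist (fderiv (f k) x v) (fderiv (f m) x v) < d" by (simp add: dist_norm)
      qed
    qed
    then show ?thesis using Cauchy_convergent_iff convergent_def by blast
  qed
  then obtain g' where g': "\<And>x v. x \<in> ?S \<Longrightarrow> (\<lambda>k. fderiv (f k) x v) \<longlonglongrightarrow> g' x v" by metis
  have close: "norm (fderiv (f k) x v - g' x v) \<le> 2 * e k / r * norm v" if x: "x \<in> ?S" for x v k
  proof (rule tendsto_le[OF trivial_limit_sequentially])
    show "(\<lambda>m. norm (fderiv (f k) x v - fderiv (f m) x v)) \<longlonglongrightarrow> norm (fderiv (f k) x v - g' x v)"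
      by (intro tendsto_intros g'[OF x])
    have "(\<lambda>m. 2 * (e k + e m) / r * norm v) \<longlonglongrightarrow> 2 * (e k + 0) / r * norm v"
      by (intro tendsto_intros e0) (use r in auto)
    then show "(\<lambda>m. 2 * (e k + e m) / r * norm v) \<longlonglongrightarrow> 2 * e k / r * norm v" by simp
  qed (use est[OF x] in simp)
  have zS: "z \<in> ?S" using r by simp
  have gl: "(\<lambda>k. f k x) \<longlonglongrightarrow> g x" if "x \<in> ?S" for x
  proof (rule Lim_null[THEN iffD2], rule tendsto_norm_zero_cancel, rule tendsto_sandwich[OF _ _ tendsto_const e0])
    show "\<forall>\<^sub>F k in sequentially. norm (f k x - g x) \<le> e k" using fe inS[OF that] by simp
  qed simp
  have "\<exists>h. \<forall>x\<in>?S. (\<lambda>n. f n x) \<longlonglongrightarrow> h x \<and> (h has_derivative g' x) (at x within ?S)"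
  proof (rule has_derivative_sequence)
    fix n x assume x: "x \<in> ?S"
    show "(f n has_derivative fderiv (f n) x) (at x within ?S)"
      using cholo_fderiv(1)[OF f inS[OF x]] has_derivative_at_withinI by blast
  next
    fix d :: real assume d: "0 < d"
    have "\<forall>\<^sub>F k in sequentially. e k < d * r / 2"
      using r d by (intro order_tendstoD[OF e0]) simp
    then show "\<forall>\<^sub>F n in sequentially. \<forall>x\<in>?S. \<forall>h. norm (fderiv (f n) x h - g' x h) \<le> d * norm h"
    proof (rule eventually_mono, intro ballI allI)
      fix n x and h :: "complex ^ 'n" assume e: "e n < d * r / 2" and x: "x \<in> ?S"
      have "2 * e n / r * norm h \<le> d * norm h"
        using e r by (intro mult_right_mono) (auto simp: field_simps)
      with close[OF x, of n h] show "norm (fderiv (f n) x h - g' x h) \<le> d * norm h" by linarith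
    qed
  qed (use gl[OF zS] zS in auto)
  then obtain h where h: "\<And>x. x \<in> ?S \<Longrightarrow> (\<lambda>n. f n x) \<longlonglongrightarrow> h x" "\<And>x. x \<in> ?S \<Longrightarrow> (h has_derivative g' x) (at x within ?S)" by blast
  have hg: "h x = g x" if "x \<in> ?S" for x using LIMSEQ_unique[OF h(1)[OF that] gl[OF that]] .
  have "(h has_derivative g' z) (at z)" using h(2)[OF zS] at_within_open[OF zS open_ball] by simp
  then have "(g has_derivative g' z) (at z)"
    by (rule has_derivative_transform_within_open[OF _ open_ball zS]) (use hg in auto)
  moreover have "g' z (c *s v) = c *\<^sub>C g' z v" for c v
  proof (rule LIMSEQ_unique[OF g'[OF zS]])
    have "(\<lambda>k. c *\<^sub>C fderiv (f k) z v) \<longlonglongrightarrow> c *\<^sub>C g' z v"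
      by (intro bounded_linear.tendsto[OF bounded_linear_scaleC] g'[OF zS])
    then show "(\<lambda>k. fderiv (f k) z (c *s v)) \<longlonglongrightarrow> c *\<^sub>C g' z v"
      using cholo_fderiv(2)[OF f inS[OF zS]] by simp
  qed
  ultimately show ?thesis by blast
qed

text \<open>\<open>ball_holomorphic\<close> asks for one derivative only, so holomorphy of a
  derivative is a theorem. Radial difference quotients (f ((1 + t) x) - f x) / t are holomorphic in
  x, and the second-order Taylor bound on the line through x makes their convergence locally
  uniform.\<close>

lemma cholo_radial_deriv:
  fixes f :: "complex ^ 'n \<Rightarrow> 'e::cbanach"
  assumes f: "cholo f (ball 0 1)"
  shows "cholo (radial_deriv f) (ball 0 1)"
  unfolding cholo_def
proof
  fix z :: "complex ^ 'n" assume z: "z \<in> ball 0 1"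
  \<comment> \<open>The closed ball of radius 4 r around z lies in the unit ball. It contains x + s
    x whenever x is within 2 r of z and |s| < 2 r, which is the disc used in the Taylor
    bound.\<close>
  define r where "r = (1 - norm z) / 5"
  have r: "0 < r" using z by (simp add: r_def)
  have sub: "cball z (4 * r) \<subseteq> ball 0 1"
  proof
    fix y assume "y \<in> cball z (4 * r)"
    then have "norm y \<le> norm z + 4 * r"
      using norm_triangle_ineq2[of y z] by (simp add: dist_norm norm_minus_commute)
    then show "y \<in> ball 0 1" using r by (simp add: r_def field_simps)
  qed
  have "compact (f ` cball z (4*r))"
    by (intro compact_continuous_image continuous_on_subset[OF cholo_continuous[OF f] sub]) simp
  then obtain B where B: "\<And>y. y \<in> cball z (4*r) \<Longrightarrow> norm (f y) \<le> B"
    using compact_imp_bounded bounded_iff by (metis imageI)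
  define t where "t k = r * inverse (real (Suc k))" for k
  have t: "0 < t k" "t k \<le> r" for k using r by (simp_all add: t_def field_simps)
  have t0: "t \<longlonglongrightarrow> 0" unfolding t_def using tendsto_mult_right_zero[OF LIMSEQ_inverse_real_of_nat] by blast
  define F where "F k x = (1 / t k) *\<^sub>R (f (0 + (1 + t k) *\<^sub>R x) - f x)" for k x
  have n1: "norm x < 1" if "x \<in> ball z (2*r)" for x using that sub r by (auto simp: subset_iff)
  have in4: "x + c *s x \<in> ball z (4*r)" if x: "x \<in> ball z (2*r)" and c: "cmod c < 2 * r" for x c
  proof -
    have "norm (c *s x) \<le> cmod c * 1" unfolding norm_vector_smult using n1[OF x] by (intro mult_left_mono) auto
    then have "norm (c *s x) < 2 * r" using c by simp
    then show ?thesis using x norm_triangle_ineq[of "x - z" "c *s x"] by (simp add: dist_norm norm_minus_commute algebra_simps)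
  qed
  have eq: "0 + (1 + s) *\<^sub>R x = x + complex_of_real s *s x" for s x
    by (simp add: of_real_smult algebra_simps)
  have in4': "0 + (1 + t k) *\<^sub>R x \<in> ball 0 1" if "x \<in> ball z (2*r)" for k x
    unfolding eq using in4[OF that, of "of_real (t k)"] t[of k] r sub by (auto simp: subset_iff)
  show "\<exists>D. (radial_deriv f has_derivative D) (at z) \<and> (\<forall>c v. D (c *s v) = c *\<^sub>C D v)"
  proof (rule cholo_uniform_limit[OF _ r])
    show "cholo (F k) (ball z (2*r))" for k
      unfolding cholo_def
    proof
      fix x assume x: "x \<in> ball z (2*r)"
      have x1: "x \<in> ball 0 1" using n1[OF x] by simp
      define G where "G x = f (0 + (1 + t k) *\<^sub>R x)" for x
      have d1: "cholo G (ball z (2*r))"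
        unfolding G_def[abs_def]
        by (rule cholo_compose_affine(1)[OF f bounded_linear_scaleR_right _ in4']) (auto simp: vec_eq_iff)
      have "(F k has_derivative (\<lambda>v. (1/t k) *\<^sub>R (fderiv G x v - fderiv f x v))) (at x)"
        unfolding F_def[abs_def] G_def[symmetric]
        by (intro derivative_intros cholo_fderiv(1)[OF d1 x] cholo_fderiv(1)[OF f x1])
      moreover have "(1/t k) *\<^sub>R (fderiv G x (c *s v) - fderiv f x (c *s v))
         = c *\<^sub>C (1/t k) *\<^sub>R (fderiv G x v - fderiv f x v)" for c v
        by (simp add: cholo_fderiv(2)[OF d1 x] cholo_fderiv(2)[OF f x1] scaleC_scaleR_commute scaleC_diff_right)
      ultimately show "\<exists>D. (F k has_derivative D) (at x) \<and> (\<forall>c v. D (c *s v) = c *\<^sub>C D v)" by blast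
    qed
    show "norm (F k x - radial_deriv f x) \<le> 18 * B / (2 * r)\<^sup>2 * t k" if x: "x \<in> ball z (2*r)" for k x
    proof (rule norm_le_functionals)
      fix \<phi> :: "('e, complex) cblinfun" assume \<phi>: "norm \<phi> \<le> 1"
      interpret l: bounded_linear "cblinfun_apply \<phi>" by (rule bounded_linear_cblinfun_apply)
      let ?g = "\<lambda>z. cblinfun_apply \<phi> (f z)" and ?h = "\<lambda>s. cblinfun_apply \<phi> (f (x + s *s x))"
      have x1: "x \<in> ball 0 1" using n1[OF x] by simp
      have g: "cholo ?g (ball 0 1)" by (rule cholo_functional(1)[OF f])
      have in1: "x + s *s x \<in> ball 0 1" if "s \<in> ball 0 (2*r)" for s
        using in4[OF x, of s] that sub by (auto simp: subset_iff)
      have der: "(?h has_field_derivative fderiv ?g (x + s *s x) x) (at s)" if "s \<in> ball 0 (2*r)" for s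
        by (rule cholo_slice[OF g in1[OF that]])
      have "cmod (?h (t k) - ?h 0 - of_real (t k) * fderiv ?g x x) \<le> 18 * B / (2 * r)\<^sup>2 * (cmod (of_real (t k)))\<^sup>2"
      proof (rule Taylor2_bound)
        show "?h holomorphic_on ball 0 (2*r)"
          unfolding holomorphic_on_open[OF open_ball] using der by blast
        show "(?h has_field_derivative fderiv ?g x x) (at 0)" using der[of 0] r by simp
        fix s :: complex assume "s \<in> ball 0 (2*r)"
        then have "norm (f (x + s *s x)) \<le> B" using in4[OF x, of s] by (intro B) simp
        then show "cmod (?h s) \<le> B"
          using norm_cblinfun_apply[of \<phi> "f (x + s *s x)"] mult_right_mono[OF \<phi> norm_ge_zero[of "f (x + s *s x)"]] by simp
      qed (use r t[of k] in auto)
      also have "?h (t k) - ?h 0 - of_real (t k) * fderiv ?g x x = t k *\<^sub>R cblinfun_apply \<phi> (F k x - radial_deriv f x)"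
      proof -
        have "cblinfun_apply \<phi> (F k x - radial_deriv f x) = (1 / t k) *\<^sub>R (?h (t k) - ?h 0) - fderiv ?g x x"
          unfolding F_def eq by (simp add: l.diff l.scaleR cholo_functional(2)[OF f x1] radial_deriv_cholo[OF f x1] del: scaleR_right_diff_distrib)
        then show ?thesis using t(1)[of k] by (simp add: scaleR_conv_of_real field_simps)
      qed
      finally have "t k * cmod (cblinfun_apply \<phi> (F k x - radial_deriv f x)) \<le> t k * (18 * B / (2 * r)\<^sup>2 * t k)"
        unfolding norm_scaleR norm_of_real abs_of_pos[OF t(1)] power2_eq_square[of "t k"] by (simp only: mult_ac)
      then show "cmod (cblinfun_apply \<phi> (F k x - radial_deriv f x)) \<le> 18 * B / (2 * r)\<^sup>2 * t k"
        by (rule mult_left_le_imp_le[OF _ t(1)])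
    qed
    have "(\<lambda>k. 18 * B / (2 * r)\<^sup>2 * t k) \<longlonglongrightarrow> 18 * B / (2 * r)\<^sup>2 * 0" by (intro tendsto_intros t0)
    then show "(\<lambda>k. 18 * B / (2 * r)\<^sup>2 * t k) \<longlonglongrightarrow> 0" by simp
  qed
qed

lemma cholo_radial_deriv_iterate:
  fixes f :: "complex ^ 'n \<Rightarrow> 'e::cbanach"
  assumes f: "cholo f (ball 0 1)"
  shows "cholo ((radial_deriv ^^ k) f) (ball 0 1)"
  by (induction k) (simp_all add: f cholo_radial_deriv)

text \<open>The value at w of the homogeneous component of degree m of g. Taking it from the slice t
  \<mapsto> g (t w) avoids power series in several variables; w may be any vector, since only t near
  0 matters.\<close>

definition coef :: "(complex ^ 'n \<Rightarrow> complex) \<Rightarrow> complex ^ 'n \<Rightarrow> nat \<Rightarrow> complex" where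
  "coef g w m = (deriv ^^ m) (\<lambda>t. g (t *s w)) 0 / fact m"

lemma slice_holomorphic:
  assumes g: "cholo g (ball 0 1)" and r: "r * norm w \<le> 1"
  shows "(\<lambda>t. g (t *s w)) holomorphic_on ball 0 r"
    "t \<in> ball 0 r \<Longrightarrow> ((\<lambda>t. g (t *s w)) has_field_derivative fderiv g (t *s w) w) (at t)"
proof -
  have inb: "0 + t *s w \<in> ball 0 1" if "t \<in> ball 0 r" for t
  proof (cases "w = 0")
    case False
    then have "cmod t * norm w < r * norm w" using that by (intro mult_strict_right_mono) auto
    then show ?thesis using r by (simp add: norm_vector_smult)
  qed simp
  have d: "((\<lambda>t. g (t *s w)) has_field_derivative fderiv g (t *s w) w) (at t)" if "t \<in> ball 0 r" for t
    using cholo_slice[OF g inb[OF that]] by simp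
  show "t \<in> ball 0 r \<Longrightarrow> ((\<lambda>t. g (t *s w)) has_field_derivative fderiv g (t *s w) w) (at t)" using d .
  show "(\<lambda>t. g (t *s w)) holomorphic_on ball 0 r"
    unfolding holomorphic_on_open[OF open_ball] using d by blast
qed

lemma coef_sums:
  assumes g: "cholo g (ball 0 1)" and t: "cmod t * norm w < 1"
  shows "(\<lambda>m. coef g w m * t ^ m) sums g (t *s w)"
proof -
  obtain r where r: "r * norm w \<le> 1" "cmod t < r"
  proof (cases "w = 0")
    case True then show ?thesis using that[of "cmod t + 1"] by simp
  next
    case False then show ?thesis using that[of "1 / norm w"] t by (simp add: field_simps)
  qed
  from holomorphic_power_series[OF slice_holomorphic(1)[OF g r(1)], of t] r(2)
  show ?thesis by (simp add: coef_def)
qed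

lemma coef_sums1:
  assumes "cholo g (ball 0 1)" "w \<in> ball 0 1"
  shows "coef g w sums g w"
  using coef_sums[OF assms(1), of 1 w] assms(2) by simp

lemma coef_unique:
  assumes r: "0 < r" and s: "\<And>t. cmod t < r \<Longrightarrow> (\<lambda>m. a m * t ^ m) sums g (t *s w)"
  shows "coef g w m = a m"
proof -
  have "(\<lambda>t. g (t *s w)) has_fps_expansion Abs_fps a"
    unfolding has_fps_expansion_def
  proof
    have "summable (\<lambda>m. a m * (of_real (r/2)) ^ m)" using s[of "of_real (r/2)"] r by (auto simp: sums_iff)
    then have "conv_radius a \<ge> norm (complex_of_real (r/2))" by (rule conv_radius_geI)
    then show "0 < fps_conv_radius (Abs_fps a)"
      using r by (simp add: fps_conv_radius_def) (smt (verit) ereal_less_eq(3) ereal_less(2) half_gt_zero less_le_trans)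
    have "\<forall>\<^sub>F z in nhds 0. z \<in> ball (0::complex) r" using r by (intro eventually_nhds_in_open) auto
    then show "\<forall>\<^sub>F z in nhds 0. eval_fps (Abs_fps a) z = g (z *s w)"
      by eventually_elim (use s in \<open>auto simp: eval_fps_def sums_iff\<close>)
  qed
  then show ?thesis by (simp add: coef_def fps_nth_fps_expansion[symmetric])
qed

text \<open>On the slice t \<mapsto> g (t w) the radial derivative acts as t d/dt.\<close>

lemma coef_radial_deriv:
  assumes g: "cholo g (ball 0 1)"
  shows "coef (radial_deriv g) w m = of_nat m * coef g w m"
proof -
  define r where "r = 1 / (norm w + 1)"
  have "0 < norm w + 1" by (simp add: add_nonneg_pos)
  then have r: "0 < r" "r * norm w \<le> 1" by (simp_all add: r_def divide_simps)
  show ?thesis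
  proof (rule coef_unique[OF r(1)])
    fix t assume t: "cmod t < r"
    have lt: "cmod s * norm w < 1" if "cmod s < r" for s
    proof (cases "w = 0")
      case False
      then have "cmod s * norm w < r * norm w" using that by (intro mult_strict_right_mono) auto
      then show ?thesis using r by simp
    qed simp
    have "(\<lambda>n. diffs (coef g w) n * t ^ n) sums fderiv g (t *s w) w"
      by (rule termdiffs_sums_strong[where K=r, OF _ slice_holomorphic(2)[OF g r(2)]])
        (use t coef_sums[OF g lt] in auto)
    then have "(\<lambda>n. t * (diffs (coef g w) n * t ^ n)) sums (t * fderiv g (t *s w) w)"
      by (rule sums_mult)
    also have "(\<lambda>n. t * (diffs (coef g w) n * t ^ n)) = (\<lambda>n. of_nat (Suc n) * coef g w (Suc n) * t ^ Suc n)"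
      by (simp add: diffs_def fun_eq_iff)
    finally have "(\<lambda>n. of_nat n * coef g w n * t ^ n) sums (t * fderiv g (t *s w) w + of_nat 0 * coef g w 0 * t ^ 0)"
      by (rule sums_Suc)
    moreover have "t *s w \<in> ball 0 1" using lt[OF t] by (simp add: norm_vector_smult)
    ultimately show "(\<lambda>m. of_nat m * coef g w m * t ^ m) sums radial_deriv g (t *s w)"
      by (simp add: radial_deriv_cholo[OF g] cholo_fderiv(2)[OF g] scaleC_complex_def)
  qed
qed

lemma coef_radial_deriv_iterate:
  assumes g: "cholo g (ball 0 1)"
  shows "coef ((radial_deriv ^^ k) g) w m = of_nat m ^ k * coef g w m"
  by (induction k) (simp_all add: coef_radial_deriv cholo_radial_deriv_iterate[OF g])

lemma coef_smult: "cholo g (ball 0 1) \<Longrightarrow> coef g (c *s w) m = c ^ m * coef g w m"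
proof (rule coef_unique[of "1 / (cmod c * norm w + 1)"])
  assume g: "cholo g (ball 0 1)"
  show "0 < 1 / (cmod c * norm w + 1)" by (simp add: add_nonneg_pos)
  fix t assume "cmod t < 1 / (cmod c * norm w + 1)"
  then have "cmod t * (cmod c * norm w + 1) < 1"
    by (simp add: pos_less_divide_eq add_nonneg_pos)
  then have "cmod (t * c) * norm w < 1"
    by (simp add: norm_mult algebra_simps) (smt (verit) norm_ge_zero)
  from coef_sums[OF g this] show "(\<lambda>m. c ^ m * coef g w m * t ^ m) sums g (t *s (c *s w))"
    by (simp add: power_mult_distrib mult_ac)
qed

lemma radial_deriv_functional:
  assumes "cholo f (ball 0 1)" "z \<in> ball 0 1"
    "bounded_linear \<phi>" "\<And>c x. \<phi> (c *\<^sub>C x) = c *\<^sub>C \<phi> x"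
  shows "radial_deriv (\<lambda>z. \<phi> (f z)) z = \<phi> (radial_deriv f z)"
  using cholo_compose_linear[OF assms(1,3,4)] assms(2) by (simp add: radial_deriv_cholo[OF assms(1)] radial_deriv_cholo)

text \<open>Functions are meaningful on the ball only, so iterates can be compared only there;
  openness of the ball is enough to transfer derivatives.\<close>

lemma radial_deriv_cong:
  assumes "\<And>z. z \<in> ball 0 1 \<Longrightarrow> f z = g z" "z \<in> ball 0 1" "cholo f (ball 0 1)"
  shows "radial_deriv f z = radial_deriv g z" "cholo g (ball 0 1)"
proof -
  have d: "(g has_derivative fderiv f z) (at z)" if "z \<in> ball 0 1" for z
    by (rule has_derivative_transform_within_open[OF cholo_fderiv(1)[OF assms(3) that] open_ball that]) (use assms(1) in auto)
  show g: "cholo g (ball 0 1)" unfolding cholo_def using d cholo_fderiv(2)[OF assms(3)] by blast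
  show "radial_deriv f z = radial_deriv g z"
    using frechet_derivative_at[OF d[OF assms(2)]] by (simp add: radial_deriv_cholo[OF g assms(2)] radial_deriv_cholo[OF assms(3,2)])
qed

lemma radial_deriv_iterate_functional:
  fixes f :: "complex ^ 'n \<Rightarrow> 'e::cbanach" and \<phi> :: "'e \<Rightarrow> 'f::cbanach"
  assumes f: "cholo f (ball 0 1)" and \<phi>: "bounded_linear \<phi>" "\<And>c x. \<phi> (c *\<^sub>C x) = c *\<^sub>C \<phi> x"
    and z: "z \<in> ball 0 1"
  shows "(radial_deriv ^^ k) (\<lambda>z. \<phi> (f z)) z = \<phi> ((radial_deriv ^^ k) f z)"
  using z
proof (induction k arbitrary: z)
  case (Suc k)
  have fk: "cholo (\<lambda>z. \<phi> ((radial_deriv ^^ k) f z)) (ball 0 1)"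
    by (rule cholo_compose_linear(1)[OF cholo_radial_deriv_iterate[OF f] \<phi>])
  have "radial_deriv (\<lambda>z. \<phi> ((radial_deriv ^^ k) f z)) z = radial_deriv ((radial_deriv ^^ k) (\<lambda>z. \<phi> (f z))) z"
    by (rule radial_deriv_cong(1)[OF _ Suc.prems fk]) (simp add: Suc.IH)
  then show ?case
    using radial_deriv_functional[OF cholo_radial_deriv_iterate[OF f] Suc.prems \<phi>] by simp
qed simp

section \<open>Weighted integrals over the ball\<close>

text \<open>Lebesgue measure and its image under U are both translation invariant. Fubini applied to
  the indicator of x in A and x + U y in B shows that they are proportional, and the unit ball,
  which U preserves and whose measure is positive and finite, fixes the factor.\<close>

lemma lborel_linear_isometry:
  fixes U :: "'a::euclidean_space \<Rightarrow> 'a"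
  assumes lin: "linear U" and iso: "\<And>x. norm (U x) = norm x"
  shows "distr lborel borel U = lborel"
proof -
  have cont: "continuous_on UNIV U"
    using lin linear_continuous_on linear_conv_bounded_linear by blast
  then have mU[measurable]: "U \<in> borel_measurable borel" by (rule borel_measurable_continuous_onI)
  have "inj U" using lin iso by (simp add: linear_inj_iff_eq_0) (metis norm_eq_zero)
  then have "surj U" using lin linear_injective_imp_surjective by blast
  have trans: "(\<integral>\<^sup>+y. f (c + y) \<partial>lborel) = (\<integral>\<^sup>+y. f y \<partial>lborel)"
    if [measurable]: "f \<in> borel_measurable borel" for f :: "'a \<Rightarrow> ennreal" and c
    by (subst (2) lborel_distr_plus[of c, symmetric]) (simp add: nn_integral_distr)
  have refl: "(\<integral>\<^sup>+y. f (- y) \<partial>lborel) = (\<integral>\<^sup>+y. f y \<partial>lborel)"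
    if [measurable]: "f \<in> borel_measurable borel" for f :: "'a \<Rightarrow> ennreal"
  proof -
    have "lborel = density (distr lborel borel (\<lambda>x::'a. 0 + (-1) *\<^sub>R x)) (\<lambda>_. ennreal (\<bar>-1\<bar> ^ DIM('a)))"
      using lborel_affine[of "-1" "0::'a"] by simp
    then have "(\<integral>\<^sup>+y. f y \<partial>lborel) = (\<integral>\<^sup>+y. f y \<partial>density (distr lborel borel (\<lambda>x::'a. 0 + (-1) *\<^sub>R x)) (\<lambda>_. ennreal (\<bar>-1\<bar> ^ DIM('a))))"
      by (rule arg_cong)
    also have "\<dots> = (\<integral>\<^sup>+y. f (- y) \<partial>lborel)"
      by (subst nn_integral_density) (simp_all add: nn_integral_distr)
    finally show ?thesis by simp
  qed
  have transU: "(\<integral>\<^sup>+y. f (c + U y) \<partial>lborel) = (\<integral>\<^sup>+y. f (U y) \<partial>lborel)"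
    if [measurable]: "f \<in> borel_measurable borel" for f :: "'a \<Rightarrow> ennreal" and c
  proof -
    obtain d where "c = U d" using \<open>surj U\<close> by (metis surjD)
    then have "(\<integral>\<^sup>+y. f (c + U y) \<partial>lborel) = (\<integral>\<^sup>+y. f (U (d + y)) \<partial>lborel)"
      by (simp add: linear_add[OF lin])
    also have "\<dots> = (\<integral>\<^sup>+y. f (U y) \<partial>lborel)" by (rule trans) measurable
    finally show ?thesis .
  qed
  have reflU: "(\<integral>\<^sup>+y. f (c - U y) \<partial>lborel) = (\<integral>\<^sup>+y. f (U y) \<partial>lborel)"
    if [measurable]: "f \<in> borel_measurable borel" for f :: "'a \<Rightarrow> ennreal" and c
  proof -
    have "(\<integral>\<^sup>+y. f (c - U y) \<partial>lborel) = (\<integral>\<^sup>+y. f (c - U (- y)) \<partial>lborel)"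
      by (rule refl[symmetric]) measurable
    also have "\<dots> = (\<integral>\<^sup>+y. f (c + U y) \<partial>lborel)" by (simp add: linear_neg[OF lin])
    finally show ?thesis by (simp add: transU)
  qed
  let ?\<mu> = "distr lborel borel U"
  have emU: "emeasure ?\<mu> B = (\<integral>\<^sup>+y. indicator B (U y) \<partial>lborel)" if [measurable]: "B \<in> sets borel" for B
    by (subst nn_integral_indicator[symmetric]) (simp_all add: nn_integral_distr del: nn_integral_indicator)
  have key: "emeasure lborel A * emeasure ?\<mu> B = emeasure lborel B * emeasure ?\<mu> A"
    if [measurable]: "A \<in> sets borel" "B \<in> sets borel" for A B
  proof -
    have "emeasure lborel A * emeasure ?\<mu> B = (\<integral>\<^sup>+x. indicator A x * emeasure ?\<mu> B \<partial>lborel)"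
      by (simp add: nn_integral_multc)
    also have "\<dots> = (\<integral>\<^sup>+x. (\<integral>\<^sup>+y. indicator A x * indicator B (x + U y) \<partial>lborel) \<partial>lborel)"
      by (intro nn_integral_cong) (simp add: emU nn_integral_cmult transU[of "indicator B"])
    also have "\<dots> = (\<integral>\<^sup>+y. (\<integral>\<^sup>+x. indicator A x * indicator B (x + U y) \<partial>lborel) \<partial>lborel)"
      by (rule lborel_pair.Fubini') measurable
    also have "\<dots> = (\<integral>\<^sup>+y. (\<integral>\<^sup>+x. indicator A (x - U y) * indicator B x \<partial>lborel) \<partial>lborel)"
    proof (rule nn_integral_cong)
      fix y
      show "(\<integral>\<^sup>+x. indicator A x * indicator B (x + U y) \<partial>lborel) = (\<integral>\<^sup>+x. indicator A (x - U y) * indicator B x \<partial>lborel)"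
        using trans[of "\<lambda>x. indicator A (x - U y) * indicator B x" "U y"] by (simp add: add.commute)
    qed
    also have "\<dots> = (\<integral>\<^sup>+x. (\<integral>\<^sup>+y. indicator A (x - U y) * indicator B x \<partial>lborel) \<partial>lborel)"
      by (rule lborel_pair.Fubini') measurable
    also have "\<dots> = (\<integral>\<^sup>+x. emeasure ?\<mu> A * indicator B x \<partial>lborel)"
      by (intro nn_integral_cong) (simp add: emU nn_integral_multc reflU[of "indicator A"])
    finally show ?thesis by (simp add: nn_integral_multc mult.commute)
  qed
  have ball: "emeasure ?\<mu> (ball 0 1) = emeasure lborel (ball (0::'a) 1)"
  proof -
    have "indicator (ball 0 1) (U y) = (indicator (ball 0 1) y :: ennreal)" for y by (simp add: indicator_def iso)
    then show ?thesis by (simp add: emU)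
  qed
  have pos: "emeasure lborel (ball (0::'a) 1) \<noteq> 0" "emeasure lborel (ball (0::'a) 1) \<noteq> \<infinity>"
    using emeasure_lborel_ball_finite[of "0::'a" 1] content_ball_pos[of 1 "0::'a"]
    by (auto simp: measure_def enn2real_positive_iff)
  show ?thesis
  proof (rule measure_eqI)
    fix B assume "B \<in> sets ?\<mu>"
    then have [measurable]: "B \<in> sets borel" by simp
    have "emeasure lborel (ball (0::'a) 1) * emeasure ?\<mu> B = emeasure lborel (ball (0::'a) 1) * emeasure lborel B"
      using key[of "ball 0 1" B] ball by (simp add: mult.commute)
    then show "emeasure ?\<mu> B = emeasure lborel B"
      using pos by (metis ennreal_mult_cancel_left infinity_ennreal_def)
  qed simp
qed

section \<open>The Hermitian form and unitary maps\<close>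

lemma herm_add_left: "herm (x + y) z = herm x z + herm y z"
  by (simp add: herm_def distrib_right sum.distrib)

lemma herm_diff_left: "herm (x - y) z = herm x z - herm y z"
  by (simp add: herm_def left_diff_distrib sum_subtractf)

lemma herm_smult_left: "herm (c *s x) z = c * herm x z"
  by (simp add: herm_def sum_distrib_left mult.assoc)

lemma herm_scaleR_left: "herm (r *\<^sub>R x) z = r * herm x z"
  by (simp add: of_real_smult[symmetric] herm_smult_left)

lemma cnj_herm: "cnj (herm x y) = herm y x"
  by (simp add: herm_def mult.commute)

lemma herm_diff_right: "herm z (x - y) = herm z x - herm z y"
  by (metis cnj_herm complex_cnj_diff herm_diff_left)

lemma herm_smult_right: "herm z (c *s x) = cnj c * herm z x"
  by (metis cnj_herm complex_cnj_mult herm_smult_left)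

lemma herm_axis_left: "herm (axis i 1) x = cnj (x $ i)"
  by (simp add: herm_def axis_def if_distrib[where f="\<lambda>x. x * _"] cong: if_cong)

lemma Re_herm: "Re (herm x y) = x \<bullet> y"
  by (simp add: herm_def inner_vec_def inner_complex_def)

lemma herm_self: "herm x x = of_real ((norm x)\<^sup>2)"
proof (rule complex_eqI)
  show "Im (herm x x) = Im (of_real ((norm x)\<^sup>2))"
    using cnj_herm[of x x] by (metis Im_complex_of_real Reals_cnj_iff complex_is_Real_iff)
qed (simp add: Re_herm power2_norm_eq_inner)

lemma cmod_herm_le: "cmod (herm x y) \<le> norm x * norm y"
proof (cases "herm x y = 0")
  case False
  define c where "c = cnj (herm x y) / cmod (herm x y)"
  have c: "cmod c = 1" using False by (simp add: c_def norm_divide)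
  have "herm (c *s x) y = cmod (herm x y)"
    using False complex_norm_square[of "herm x y"]
    by (simp add: herm_smult_left c_def mult.commute[of "cnj (herm x y)"] power2_eq_square nonzero_divide_eq_eq)
  then have "cmod (herm x y) = (c *s x) \<bullet> y" by (metis Re_complex_of_real Re_herm)
  also have "\<dots> \<le> norm (c *s x) * norm y" by (rule norm_cauchy_schwarz)
  finally show ?thesis by (simp add: norm_vector_smult c)
qed simp

lemma isCont_herm_right [continuous_intros]:
  "continuous_on S f \<Longrightarrow> continuous_on S g \<Longrightarrow> continuous_on S (\<lambda>x. herm (f x) (g x))"
  unfolding herm_def by (intro continuous_intros)

definition unitary :: "(complex ^ 'n \<Rightarrow> complex ^ 'n) \<Rightarrow> bool" where
  "unitary U \<longleftrightarrow> linear U \<and> (\<forall>c x. U (c *s x) = c *s U x) \<and> (\<forall>x y. herm (U x) (U y) = herm x y)"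

lemma unitary_norm: "unitary U \<Longrightarrow> norm (U x) = norm x"
  unfolding unitary_def by (metis herm_self norm_ge_zero of_real_eq_iff power2_eq_iff_nonneg)

lemma unitary_bounded_linear: "unitary U \<Longrightarrow> bounded_linear U"
  unfolding unitary_def using linear_conv_bounded_linear by blast

text \<open>A Householder reflection. Let \<zeta> be w divided by its norm and e the basis vector. A
  phase c makes <e, c \<zeta>> real and nonnegative, and then the reflection along v = e - c \<zeta>
  maps e to c \<zeta>. The phase and the norm of w are collected in k.\<close>

lemma unitary_transitive:
  fixes w :: "complex ^ 'n"
  obtains U k where "unitary U" "w = k *s U (axis i 1)" "cmod k = norm w"
proof -
  let ?e = "axis i 1 :: complex ^ 'n"
  define \<zeta> where "\<zeta> = (if w = 0 then ?e else (1 / norm w) *\<^sub>R w)"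
  have n\<zeta>: "norm \<zeta> = 1" by (simp add: \<zeta>_def norm_axis_1)
  have w: "w = of_real (norm w) *s \<zeta>" by (simp add: \<zeta>_def of_real_smult)
  define h where "h = herm ?e \<zeta>"
  define c where "c = (if h = 0 then 1 else h / cmod h)"
  have c: "cmod c = 1" by (simp add: c_def norm_divide)
  have cc: "cnj c * c = 1" using complex_norm_square[of c] c by (simp add: mult.commute)
  have hc: "herm ?e (c *s \<zeta>) = cmod h"
    using complex_norm_square[of h]
    by (auto simp: herm_smult_right h_def[symmetric] c_def power2_eq_square mult.commute[of "cnj h"] nonzero_divide_eq_eq)
  define v where "v = ?e - c *s \<zeta>"
  have ee: "herm ?e ?e = 1" by (simp add: herm_self norm_axis_1)
  have vv: "herm v v = 2 * (1 - of_real (cmod h))"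
  proof -
    have "herm (c *s \<zeta>) ?e = cmod h" using hc by (metis cnj_herm complex_cnj_complex_of_real)
    moreover have "herm (c *s \<zeta>) (c *s \<zeta>) = 1" by (simp add: herm_self norm_vector_smult c n\<zeta>)
    ultimately show ?thesis by (simp add: v_def herm_diff_left herm_diff_right ee hc)
  qed
  have ev: "herm ?e v = 1 - of_real (cmod h)" by (simp add: v_def herm_diff_right ee hc)
  have wU: "w = (of_real (norm w) * cnj c) *s (c *s \<zeta>)"
    using w cc by (metis mult.assoc mult.right_neutral vector_smult_assoc)
  have nk: "cmod (of_real (norm w) * cnj c) = norm w" by (simp add: norm_mult c)
  show thesis
  proof (cases "v = 0")
    case True
    then have "c *s \<zeta> = ?e" by (simp add: v_def)
    moreover have "unitary (\<lambda>x. x :: complex ^ 'n)" by (simp add: unitary_def linear_ident)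
    ultimately show ?thesis using that[of "\<lambda>x. x"] wU nk by simp
  next
    case False
    define s where "s = 2 / herm v v"
    have s: "s * herm v v = 2" "cnj s = s" using False by (auto simp: s_def herm_self)
    define U where "U x = x - (s * herm x v) *s v" for x
    have "unitary U"
      unfolding unitary_def
    proof (intro conjI allI)
      show hom: "U (c *s x) = c *s U x" for c x
        by (simp add: U_def herm_smult_left vec_eq_iff algebra_simps)
      show "linear U"
      proof (rule linearI)
        show "U (x + y) = U x + U y" for x y
          by (simp add: U_def herm_add_left vec_eq_iff algebra_simps)
        show "U (r *\<^sub>R x) = r *\<^sub>R U x" for r x
          using hom[of "of_real r" x] by (simp add: of_real_smult)
      qed
      show "herm (U x) (U y) = herm x y" for x y
      proof -
        have "herm (U x) (U y) = herm x y - 2 * (s * herm x v * herm v y) + s * herm x v * herm v y * (s * herm v v)"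
          by (simp add: U_def herm_diff_left herm_diff_right herm_smult_left herm_smult_right s(2) cnj_herm algebra_simps)
        then show ?thesis unfolding s(1) by simp
      qed
    qed
    moreover have "U ?e = c *s \<zeta>"
    proof -
      have "herm v v \<noteq> 0" using False by (simp add: herm_self)
      then have "s * herm ?e v = 1" using vv ev by (simp add: s_def)
      then show ?thesis by (simp add: U_def v_def)
    qed
    ultimately show ?thesis using that[of U] wU nk by simp
  qed
qed

text \<open>Unnormalized, so that multiplication by a power of 1 - |z|^2 merely shifts the exponent.
  Besides \<alpha>, the exponents \<alpha> + k and \<alpha> - \<epsilon> occur.\<close>

definition bmeas :: "real \<Rightarrow> (complex ^ 'n) measure" where
  "bmeas a = density (restrict_space lborel (ball 0 1)) (\<lambda>z. ennreal ((1 - (norm z)\<^sup>2) powr a))"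

lemma space_bmeas [simp]: "space (bmeas a) = ball 0 1"
  by (simp add: bmeas_def space_restrict_space)

lemma sets_bmeas [measurable_cong]: "sets (bmeas a) = sets (restrict_space borel (ball 0 1))"
  by (simp add: bmeas_def sets_restrict_space)

lemma borel_measurable_bmeas: "continuous_on (ball 0 1) f \<Longrightarrow> f \<in> borel_measurable (bmeas a)"
  using borel_measurable_continuous_on_restrict by (simp add: measurable_cong_sets[OF sets_bmeas refl])

lemma borel_measurable_bmeas_borel: "f \<in> borel_measurable borel \<Longrightarrow> f \<in> measurable (bmeas a) borel"
  by (simp add: measurable_cong_sets[OF sets_bmeas refl] measurable_restrict_space1)

lemma nn_integral_bmeas:
  assumes f: "f \<in> borel_measurable (bmeas a)"
  shows "(\<integral>\<^sup>+z. f z \<partial>bmeas a) = (\<integral>\<^sup>+z. indicator (ball 0 1) z * (ennreal ((1 - (norm z)\<^sup>2) powr a) * f z) \<partial>lborel)"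
proof -
  have "(\<lambda>z :: complex ^ 'a. ennreal ((1 - (norm z)\<^sup>2) powr a)) \<in> borel_measurable (restrict_space lborel (ball 0 1))"
    by (intro measurable_restrict_space1) measurable
  moreover have "f \<in> borel_measurable (restrict_space lborel (ball 0 1))"
    using f by (simp add: bmeas_def)
  ultimately show ?thesis
    unfolding bmeas_def by (subst nn_integral_density) (auto simp: nn_integral_restrict_space mult_ac)
qed

lemma distr_bmeas_isometry:
  fixes U :: "complex ^ 'n \<Rightarrow> complex ^ 'n"
  assumes U: "linear U" "\<And>x. norm (U x) = norm x"
  shows "distr (bmeas a) (bmeas a) U = (bmeas a :: (complex ^ 'n) measure)"
proof (rule measure_eqI)
  have "continuous_on UNIV U"
    using U(1) linear_continuous_on linear_conv_bounded_linear by blast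
  then have mU[measurable]: "U \<in> borel_measurable borel" by (rule borel_measurable_continuous_onI)
  have U1: "U \<in> measurable (bmeas a) (bmeas a)"
    unfolding measurable_cong_sets[OF sets_bmeas sets_bmeas]
    by (rule measurable_restrict_space3) (use U(2) in auto)
  fix X :: "(complex ^ 'n) set" assume "X \<in> sets (distr (bmeas a) (bmeas a) U)"
  then have Xs: "X \<in> sets (bmeas a)" by simp
  then have X[measurable]: "X \<in> sets borel" by (simp add: sets_bmeas sets_restrict_space_iff)
  let ?g = "\<lambda>z. indicator (ball 0 1) z * (ennreal ((1 - (norm z)\<^sup>2) powr a) * indicator X z)"
  have "emeasure (distr (bmeas a) (bmeas a) U) X = (\<integral>\<^sup>+z. indicator X z \<partial>distr (bmeas a) (bmeas a) U)"
    using Xs by simp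
  also have "\<dots> = (\<integral>\<^sup>+z. indicator X (U z) \<partial>bmeas a)"
    using Xs by (intro nn_integral_distr U1) simp
  also have "\<dots> = (\<integral>\<^sup>+z. ?g (U z) \<partial>lborel)"
    by (subst nn_integral_bmeas) (auto intro!: borel_measurable_bmeas_borel nn_integral_cong simp: U(2) indicator_def)
  also have "\<dots> = (\<integral>\<^sup>+z. ?g z \<partial>distr lborel borel U)"
  proof -
    have [measurable]: "ball (0 :: complex ^ 'n) 1 \<in> sets borel" by simp
    have "?g \<in> borel_measurable borel" by measurable
    then show ?thesis by (simp add: nn_integral_distr)
  qed
  also have "\<dots> = (\<integral>\<^sup>+z. ?g z \<partial>lborel)" by (simp only: lborel_linear_isometry[OF U])
  also have "\<dots> = (\<integral>\<^sup>+z. indicator X z \<partial>bmeas a)"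
    by (rule nn_integral_bmeas[symmetric]) (use Xs in simp)
  finally show "emeasure (distr (bmeas a) (bmeas a) U) X = emeasure (bmeas a) X" using Xs by simp
qed simp

text \<open>Replaces polar coordinates: the image under u of the measure with density h is
  determined by its values on the half-lines below s, and the power law there identifies its density
  as the derivative of V s^(k+1).\<close>

lemma nn_integral_pushforward_power:
  fixes u :: "'a::euclidean_space \<Rightarrow> real" and h :: "'a \<Rightarrow> ennreal"
  assumes u[measurable]: "u \<in> borel_measurable borel" and u0: "\<And>z. 0 \<le> u z"
    and h[measurable]: "h \<in> borel_measurable borel" and V: "0 \<le> V"
    and s: "\<And>s. 0 < s \<Longrightarrow> (\<integral>\<^sup>+z. h z * indicator {z. u z < s} z \<partial>lborel) = ennreal (V * s ^ Suc k)"
    and F[measurable]: "F \<in> borel_measurable borel"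
  shows "(\<integral>\<^sup>+z. F (u z) * h z \<partial>lborel)
    = (\<integral>\<^sup>+s. F s * (ennreal (V * (real (Suc k) * s ^ k)) * indicator {0..} s) \<partial>lborel)"
proof -
  define d where "d s = ennreal (V * (real (Suc k) * s ^ k)) * indicator {0..} s" for s :: real
  have [measurable]: "d \<in> borel_measurable borel" unfolding d_def by measurable
  let ?N = "distr (density lborel h) borel u" and ?N' = "density lborel d"
  have N: "emeasure ?N {..<s} = (\<integral>\<^sup>+z. h z * indicator {z. u z < s} z \<partial>lborel)" for s
  proof -
    have "u -` {..<s} = {z. u z < s}" by auto
    then show ?thesis by (simp add: emeasure_distr emeasure_density)
  qed
  have eq: "emeasure ?N {..<s} = emeasure ?N' {..<s}" for s
  proof (cases "0 < s")
    case False
    then have "\<not> u z < s" for z using u0[of z] by simp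
    moreover have "(\<integral>\<^sup>+t. d t * indicator {..<s} t \<partial>lborel) = (\<integral>\<^sup>+t. 0 \<partial>(lborel :: real measure))"
      by (rule nn_integral_cong) (use False in \<open>auto simp: d_def indicator_def\<close>)
    ultimately show ?thesis by (simp add: N emeasure_density)
  next
    case True
    have "emeasure ?N' {..<s} = (\<integral>\<^sup>+t. ennreal (V * (real (Suc k) * t ^ k)) * indicator {0..s} t \<partial>lborel)"
    proof -
      have "AE t in lborel. t \<noteq> s" by (rule AE_lborel_singleton)
      then have "AE t in lborel. d t * indicator {..<s} t = ennreal (V * (real (Suc k) * t ^ k)) * indicator {0..s} t"
        by eventually_elim (auto simp: d_def indicator_def)
      then show ?thesis by (simp add: emeasure_density del: of_nat_Suc cong: nn_integral_cong_AE)
    qed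
    also have "\<dots> = V * s ^ Suc k - V * 0 ^ Suc k"
    proof (rule nn_integral_FTC_Icc)
      show "((\<lambda>t. V * t ^ Suc k) has_real_derivative V * (real (Suc k) * t ^ k)) (at t)" for t
        using DERIV_cmult[OF DERIV_pow[of "Suc k" t UNIV], of V] by simp
    qed (use True V in auto)
    finally show ?thesis using N s[OF True] by simp
  qed
  have "?N = ?N'"
  proof (rule measure_eqI_generator_eq[where E="range lessThan" and \<Omega>=UNIV and A="\<lambda>i. {..<real i}"])
    show "Int_stable (range lessThan :: real set set)"
      unfolding Int_stable_def
    proof (intro ballI)
      fix A B :: "real set" assume "A \<in> range lessThan" "B \<in> range lessThan"
      then obtain a b where "A = {..<a}" "B = {..<b}" by blast
      then have "A \<inter> B = {..<min a b}" by auto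
      then show "A \<inter> B \<in> range lessThan" by blast
    qed
    show "sets ?N = sigma_sets UNIV (range lessThan)" "sets ?N' = sigma_sets UNIV (range lessThan)"
      by (simp_all add: borel_Iio)
    show "(\<Union>i. {..<real i}) = UNIV" using reals_Archimedean2 by auto
    show "emeasure ?N {..<real i} \<noteq> \<infinity>" for i
      using N[of "real i"] s[of "real i"] u0 by (cases "i = 0") (auto simp: not_less[symmetric])
  qed (use eq in auto)
  then have "(\<integral>\<^sup>+t. F t \<partial>?N) = (\<integral>\<^sup>+t. F t \<partial>?N')" by simp
  then show ?thesis
    unfolding d_def[symmetric] by (simp add: nn_integral_distr nn_integral_density mult.commute[of "F _"])
qed

lemma prod_Basis_axis:
  "(\<Prod>j\<in>(Basis :: (complex ^ 'n) set). if j \<in> {axis i 1, axis i \<i>} then c else 1) = (c::real)\<^sup>2"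
proof -
  have "{axis i 1, axis i \<i>} \<subseteq> (Basis :: (complex ^ 'n) set)"
    by (auto simp: Basis_vec_def Basis_complex_def)
  then have "(\<Prod>j\<in>(Basis :: (complex ^ 'n) set). if j \<in> {axis i 1, axis i \<i>} then c else 1)
    = (\<Prod>j\<in>{axis i 1, axis i \<i> :: complex ^ 'n}. c)"
    by (intro prod.mono_neutral_cong_right) auto
  also have "\<dots> = c\<^sup>2"
    by (simp add: axis_eq_axis power2_eq_square)
  finally show ?thesis .
qed

lemma nn_integral_scale_coordinate:
  fixes f :: "complex ^ 'n \<Rightarrow> ennreal"
  assumes f[measurable]: "f \<in> borel_measurable borel" and c: "0 < c"
  shows "(\<integral>\<^sup>+z. f z \<partial>lborel) = ennreal (c\<^sup>2) * (\<integral>\<^sup>+z. f (\<chi> j. if j = i then c *\<^sub>R z $ j else z $ j) \<partial>lborel)"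
proof -
  let ?B = "{axis i 1, axis i \<i>} :: (complex ^ 'n) set"
  let ?c = "\<lambda>j. if j \<in> ?B then c else 1"
  let ?T = "\<lambda>x :: complex ^ 'n. 0 + (\<Sum>j\<in>Basis. (?c j * (x \<bullet> j)) *\<^sub>R j)"
  have T: "?T x = (\<chi> j. if j = i then c *\<^sub>R x $ j else x $ j)" for x
  proof (rule euclidean_eqI)
    fix b :: "complex ^ 'n" assume b: "b \<in> Basis"
    then obtain k u where bk: "b = axis k u" "u \<in> Basis" by (auto simp: Basis_vec_def)
    have "?T x \<bullet> b = ?c b * (x \<bullet> b)" using b by simp
    also have "\<dots> = (if k = i then c else 1) * (x $ k \<bullet> u)"
      using bk(2) by (auto simp: bk(1) axis_eq_axis inner_axis Basis_complex_def)
    also have "\<dots> = (\<chi> j. if j = i then c *\<^sub>R x $ j else x $ j) \<bullet> b"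
      by (simp add: bk(1) inner_axis)
    finally show "?T x \<bullet> b = (\<chi> j. if j = i then c *\<^sub>R x $ j else x $ j) \<bullet> b" .
  qed
  have mT[measurable]: "?T \<in> borel_measurable borel"
    by (intro borel_measurable_continuous_onI continuous_intros)
  have "(\<Prod>j\<in>(Basis :: (complex ^ 'n) set). \<bar>?c j\<bar>) = (\<Prod>j\<in>Basis. ?c j)"
    using c by (intro prod.cong) auto
  then have pr: "(\<Prod>j\<in>(Basis :: (complex ^ 'n) set). \<bar>?c j\<bar>) = c\<^sup>2" by (simp only: prod_Basis_axis)
  have "lborel = density (distr lborel borel ?T) (\<lambda>_. (\<Prod>j\<in>Basis. \<bar>?c j\<bar>))"
    by (rule lborel_affine_euclidean) (use c in auto)
  then have "lborel = density (distr lborel borel ?T) (\<lambda>_. ennreal (c\<^sup>2))"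
    by (simp only: pr)
  then have "(\<integral>\<^sup>+z. f z \<partial>lborel) = (\<integral>\<^sup>+z. f z \<partial>density (distr lborel borel ?T) (\<lambda>_. ennreal (c\<^sup>2)))" by simp
  also have "\<dots> = ennreal (c\<^sup>2) * (\<integral>\<^sup>+z. f (?T z) \<partial>lborel)"
    by (subst nn_integral_density) (simp_all add: nn_integral_cmult nn_integral_distr del: add_0)
  finally show ?thesis by (simp only: T)
qed

lemma nn_integral_affine:
  fixes f :: "'a::euclidean_space \<Rightarrow> ennreal"
  assumes f[measurable]: "f \<in> borel_measurable borel" and c: "0 < c"
  shows "(\<integral>\<^sup>+z. f z \<partial>lborel) = ennreal (c ^ DIM('a)) * (\<integral>\<^sup>+z. f (t + c *\<^sub>R z) \<partial>lborel)"
proof -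
  have "lborel = density (distr lborel borel (\<lambda>x::'a. t + c *\<^sub>R x)) (\<lambda>_. \<bar>c\<bar> ^ DIM('a))"
    by (rule lborel_affine) (use c in auto)
  then have "(\<integral>\<^sup>+z. f z \<partial>lborel) = (\<integral>\<^sup>+z. f z \<partial>density (distr lborel borel (\<lambda>x::'a. t + c *\<^sub>R x)) (\<lambda>_. \<bar>c\<bar> ^ DIM('a)))"
    by simp
  also have "\<dots> = ennreal (c ^ DIM('a)) * (\<integral>\<^sup>+z. f (t + c *\<^sub>R z) \<partial>lborel)"
    using c by (subst nn_integral_density) (simp_all add: nn_integral_cmult nn_integral_distr ennreal_power)
  finally show ?thesis .
qed

lemma nn_integral_Gamma:
  "(\<integral>\<^sup>+s. ennreal (exp (- s)) * (ennreal (V * (real (Suc k) * s ^ k)) * indicator {0..} s) \<partial>lborel) = ennreal (V * fact (Suc k))"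
  if "0 \<le> V" for V :: real
proof -
  have "ennreal (exp (- s)) * (ennreal (V * (real (Suc k) * s ^ k)) * indicator {0..} s)
    = ennreal (V * real (Suc k)) * ennreal (indicator {0..} s * s powr (real (Suc k) - 1) / exp s)" if "s \<noteq> 0" for s
    using that \<open>0 \<le> V\<close>
    by (auto simp: indicator_def ennreal_mult[symmetric] powr_realpow exp_minus field_simps)
  moreover have "AE s in lborel. s \<noteq> (0::real)" by (rule AE_lborel_singleton)
  ultimately have "(\<integral>\<^sup>+s. ennreal (exp (- s)) * (ennreal (V * (real (Suc k) * s ^ k)) * indicator {0..} s) \<partial>lborel)
    = (\<integral>\<^sup>+s. ennreal (V * real (Suc k)) * ennreal (indicator {0..} s * s powr (real (Suc k) - 1) / exp s) \<partial>lborel)"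
    by (intro nn_integral_cong_AE) auto
  also have "\<dots> = ennreal (V * real (Suc k)) * ennreal (Gamma (real (Suc k)))"
    by (subst nn_integral_cmult) (simp_all add: Gamma_conv_nn_integral_real)
  also have "\<dots> = ennreal (V * fact (Suc k))"
    using that Gamma_fact[of k, where ?'a = real] by (simp add: ennreal_mult[symmetric] mult_ac add.commute)
  finally show ?thesis .
qed

lemma nn_integral_Beta_power:
  assumes V: "0 \<le> V" and a: "a > -1"
  shows "(\<integral>\<^sup>+s. ennreal (indicator {..<1} s * (1 - s) powr a) * (ennreal (V * (real (Suc k) * s ^ k)) * indicator {0..} s) \<partial>lborel)
    = ennreal (V * (fact (Suc k) * Gamma (a + 1) / Gamma (real k + 2 + a)))"
proof -
  have "ennreal (indicator {..<1} s * (1 - s) powr a) * (ennreal (V * (real (Suc k) * s ^ k)) * indicator {0..} s)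
    = ennreal (V * real (Suc k)) * ennreal (indicator {0..1} s * (s powr (real (Suc k) - 1) * (1 - s) powr (a + 1 - 1)))"
    if "s \<noteq> 0" "s \<noteq> 1" for s
    using that V by (auto simp: indicator_def ennreal_mult[symmetric] powr_realpow field_simps)
  moreover have "AE s in lborel. s \<noteq> (0::real)" "AE s in lborel. s \<noteq> (1::real)" by (rule AE_lborel_singleton)+
  ultimately have "(\<integral>\<^sup>+s. ennreal (indicator {..<1} s * (1 - s) powr a) * (ennreal (V * (real (Suc k) * s ^ k)) * indicator {0..} s) \<partial>lborel)
    = (\<integral>\<^sup>+s. ennreal (V * real (Suc k)) * ennreal (indicator {0..1} s * (s powr (real (Suc k) - 1) * (1 - s) powr (a + 1 - 1))) \<partial>lborel)"
    by (intro nn_integral_cong_AE) auto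
  also have "\<dots> = ennreal (V * real (Suc k)) * (\<integral>\<^sup>+s. ennreal (indicator {0..1} s * (s powr (real (Suc k) - 1) * (1 - s) powr (a + 1 - 1))) \<partial>lborel)"
    by (rule nn_integral_cmult) measurable
  also have "(\<integral>\<^sup>+s. ennreal (indicator {0..1} s * (s powr (real (Suc k) - 1) * (1 - s) powr (a + 1 - 1))) \<partial>lborel) = ennreal (Beta (real (Suc k)) (a + 1))"
    using nn_integral_has_integral_lebesgue[OF _ has_integral_Beta_real[of "real (Suc k)" "a + 1"]] a by simp
  also have "Beta (real (Suc k)) (a + 1) = fact k * Gamma (a + 1) / Gamma (real k + 2 + a)"
    using Gamma_fact[of k, where ?'a = real] by (simp add: Beta_def add_ac)
  finally show ?thesis using V a by (simp add: ennreal_mult[symmetric] mult_ac Gamma_real_pos)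
qed

lemma borel_measurable_component [measurable]:
  "(\<lambda>z :: complex ^ 'n. z $ i) \<in> borel_measurable borel"
  by (intro borel_measurable_continuous_onI continuous_intros)

lemma sets_norm_less [measurable]:
  "{z :: complex ^ 'n. (norm z)\<^sup>2 < s} \<in> sets borel" "{z :: complex ^ 'n. (cmod (z $ i))\<^sup>2 < s} \<in> sets borel"
  by (intro borel_open open_Collect_less continuous_intros)+

text \<open>One Gaussian moment is computed twice. Integrating along (norm z)^2 gives b m (n + m)!,
  where b m is the moment over the unit ball. Integrating along |z_i|^2, with the other coordinates
  kept in the density, gives V m! with V independent of m. Comparison determines b m.\<close>

lemma nn_integral_moments:
  fixes i :: "'n::finite"
  obtains V :: real where "0 < V"
    "\<And>m (F :: real \<Rightarrow> ennreal). F \<in> borel_measurable borel \<Longrightarrow>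
      (\<integral>\<^sup>+z. F ((norm z)\<^sup>2) * ennreal (cmod ((z :: complex ^ 'n) $ i) ^ (2 * m)) \<partial>lborel)
      = (\<integral>\<^sup>+s. F s * (ennreal (V * fact m / fact (CARD('n) + m) * (real (CARD('n) + m) * s ^ (CARD('n) + m - 1))) * indicator {0..} s) \<partial>lborel)"
proof -
  let ?n = "CARD('n)"
  have n: "?n \<ge> 1" by (simp add: Suc_leI)
  let ?h = "\<lambda>m (z :: complex ^ 'n). ennreal (cmod (z $ i) ^ (2 * m))"
  define B where "B m = (\<integral>\<^sup>+z. ?h m z * indicator {z. (norm z)\<^sup>2 < 1} z \<partial>lborel)" for m
  have ball: "{z :: complex ^ 'n. (norm z)\<^sup>2 < 1} = ball 0 1"
    by (auto simp: abs_square_less_1)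
  have Bfin: "B m < \<infinity>" for m
  proof -
    have "B m \<le> (\<integral>\<^sup>+z. indicator (ball (0 :: complex ^ 'n) 1) z \<partial>lborel)"
      unfolding B_def ball
    proof (rule nn_integral_mono)
      fix z :: "complex ^ 'n"
      have "cmod (z $ i) ^ (2 * m) \<le> 1" if "z \<in> ball 0 1"
        using that Finite_Cartesian_Product.norm_nth_le[of z i] by (intro power_le_one) (auto intro: order_trans)
      then show "?h m z * indicator (ball 0 1) z \<le> indicator (ball 0 1) z"
        by (auto simp: indicator_def)
    qed
    also have "\<dots> < \<infinity>" using emeasure_lborel_ball_finite[of "0 :: complex ^ 'n" 1] by simp
    finally show ?thesis .
  qed
  define b where "b m = enn2real (B m)" for m
  have Bb: "B m = ennreal (b m)" "0 \<le> b m" for m using Bfin[of m] by (simp_all add: b_def)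
  have iso: "(\<integral>\<^sup>+z. F ((norm z)\<^sup>2) * ?h m z \<partial>lborel)
      = (\<integral>\<^sup>+s. F s * (ennreal (b m * (real (Suc (?n + m - 1)) * s ^ (?n + m - 1))) * indicator {0..} s) \<partial>lborel)"
    if "F \<in> borel_measurable borel" for m and F :: "real \<Rightarrow> ennreal"
  proof (rule nn_integral_pushforward_power[OF _ _ _ Bb(2) _ that])
    fix s :: real assume s: "0 < s"
    have "(\<integral>\<^sup>+z. ?h m z * indicator {z. (norm z)\<^sup>2 < s} z \<partial>lborel)
      = ennreal (sqrt s ^ DIM(complex ^ 'n)) * (\<integral>\<^sup>+z. ?h m (sqrt s *\<^sub>R z) * indicator {z. (norm z)\<^sup>2 < s} (sqrt s *\<^sub>R z) \<partial>lborel)"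
      by (rule nn_integral_affine[where t = 0, unfolded add_0_left], measurable) (use s in simp)
    also have "(\<integral>\<^sup>+z. ?h m (sqrt s *\<^sub>R z) * indicator {z. (norm z)\<^sup>2 < s} (sqrt s *\<^sub>R z) \<partial>lborel)
      = (\<integral>\<^sup>+z. ennreal (s ^ m) * (?h m z * indicator {z. (norm z)\<^sup>2 < 1} z) \<partial>lborel)"
      using s by (intro nn_integral_cong)
        (auto simp: indicator_def power_mult_distrib power_mult[of "sqrt s"] ennreal_mult[symmetric])
    also have "\<dots> = ennreal (s ^ m) * B m" unfolding B_def by (rule nn_integral_cmult) measurable
    also have "sqrt s ^ DIM(complex ^ 'n) = s ^ ?n" using s by (simp add: mult.commute[of _ 2] power_mult)
    also have "ennreal (s ^ ?n) * (ennreal (s ^ m) * B m) = ennreal (b m * s ^ Suc (?n + m - 1))"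
      using s n Bb(2) by (simp add: Bb(1) ennreal_mult[symmetric] power_add mult_ac)
    finally show "(\<integral>\<^sup>+z. ?h m z * indicator {z. (norm z)\<^sup>2 < s} z \<partial>lborel) = ennreal (b m * s ^ Suc (?n + m - 1))" .
  qed (auto intro!: borel_measurable_continuous_onI continuous_intros)
  \<comment> \<open>The Gaussian in all coordinates but the i-th. It is unchanged by dilations of
    the i-th coordinate, so the power law for |z_i|^2 has exponent 1.\<close>
  define g where "g z = ennreal (exp (- ((norm z)\<^sup>2 - (cmod (z $ i))\<^sup>2)))" for z :: "complex ^ 'n"
  have gm[measurable]: "g \<in> borel_measurable borel" unfolding g_def by measurable
  have G: "(\<integral>\<^sup>+z. ennreal (exp (- (norm z)\<^sup>2)) * ?h m z \<partial>lborel) = ennreal (b m * fact (?n + m))" for m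
    using iso[of "\<lambda>s. ennreal (exp (- s))" m] nn_integral_Gamma[OF Bb(2)[of m], of "?n + m - 1"] n
    by (simp del: of_nat_Suc of_nat_add fact_Suc)
  define W where "W = (\<integral>\<^sup>+z. g z * indicator {z. (cmod (z $ i))\<^sup>2 < 1} z \<partial>lborel)"
  \<comment> \<open>Where |z_i| < 1, restoring the missing factor exp (- |z_i|^2) costs at most exp
    1.\<close>
  have "W \<le> (\<integral>\<^sup>+z. ennreal (exp 1) * (ennreal (exp (- (norm z)\<^sup>2)) * ?h 0 z) \<partial>lborel)"
    unfolding W_def g_def
    by (intro nn_integral_mono) (auto simp: indicator_def ennreal_mult[symmetric] exp_add[symmetric] intro!: ennreal_leI)
  also have "\<dots> = ennreal (exp 1) * ennreal (b 0 * fact (?n + 0))"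
    by (subst nn_integral_cmult) (use G[of 0] in auto)
  also have "\<dots> < \<infinity>" by (simp add: ennreal_mult_less_top)
  finally have Wfin: "W < \<infinity>" .
  define V where "V = enn2real W"
  have WV: "W = ennreal V" "0 \<le> V" using Wfin by (simp_all add: V_def)
  have aniso: "(\<integral>\<^sup>+z. F ((cmod (z $ i))\<^sup>2) * g z \<partial>lborel)
      = (\<integral>\<^sup>+s. F s * (ennreal (V * (real (Suc 0) * s ^ 0)) * indicator {0..} s) \<partial>lborel)"
    if "F \<in> borel_measurable borel" for F :: "real \<Rightarrow> ennreal"
  proof (rule nn_integral_pushforward_power[OF _ _ _ WV(2) _ that])
    fix s :: real assume s: "0 < s"
    let ?T = "\<lambda>z :: complex ^ 'n. \<chi> j. if j = i then sqrt s *\<^sub>R z $ j else z $ j"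
    have nT: "(norm z)\<^sup>2 - (cmod (z $ i))\<^sup>2 = (\<Sum>j\<in>UNIV - {i}. (cmod (z $ j))\<^sup>2)" for z :: "complex ^ 'n"
      by (simp add: norm_vec_def L2_set_def sum_nonneg sum.remove[of UNIV i])
    have gT: "g (?T z) = g z" for z
      unfolding g_def nT by (auto intro!: sum.cong)
    have "(\<integral>\<^sup>+z. g z * indicator {z. (cmod (z $ i))\<^sup>2 < s} z \<partial>lborel)
      = ennreal ((sqrt s)\<^sup>2) * (\<integral>\<^sup>+z. g (?T z) * indicator {z. (cmod (z $ i))\<^sup>2 < s} (?T z) \<partial>lborel)"
      by (rule nn_integral_scale_coordinate, measurable) (use s in simp)
    also have "(\<integral>\<^sup>+z. g (?T z) * indicator {z. (cmod (z $ i))\<^sup>2 < s} (?T z) \<partial>lborel) = W"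
      unfolding W_def gT using s by (intro nn_integral_cong) (auto simp: indicator_def power_mult_distrib)
    finally show "(\<integral>\<^sup>+z. g z * indicator {z. (cmod (z $ i))\<^sup>2 < s} z \<partial>lborel) = ennreal (V * s ^ Suc 0)"
      using s WV by (simp add: ennreal_mult[symmetric] mult.commute)
  qed (auto intro!: borel_measurable_continuous_onI continuous_intros)
  have bV: "b m = V * fact m / fact (?n + m)" for m
  proof -
    have "ennreal (b m * fact (?n + m)) = (\<integral>\<^sup>+z. (\<lambda>s. ennreal (exp (- s)) * ennreal (s ^ m)) ((cmod (z $ i))\<^sup>2) * g z \<partial>lborel)"
      unfolding G[symmetric] g_def
      by (intro nn_integral_cong) (auto simp: ennreal_mult[symmetric] power_mult[symmetric] exp_add[symmetric] exp_minus exp_diff field_simps)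
    also have "\<dots> = (\<integral>\<^sup>+s. (ennreal (exp (- s)) * ennreal (s ^ m)) * (ennreal (V * (real (Suc 0) * s ^ 0)) * indicator {0..} s) \<partial>lborel)"
      by (rule aniso) measurable
    also have "\<dots> = (\<integral>\<^sup>+s. ennreal (exp (- s)) * (ennreal (V / real (Suc m) * (real (Suc m) * s ^ m)) * indicator {0..} s) \<partial>lborel)"
      using WV(2) by (intro nn_integral_cong) (auto simp: indicator_def ennreal_mult[symmetric] mult_ac)
    also have "\<dots> = ennreal (V / real (Suc m) * fact (Suc m))"
      by (rule nn_integral_Gamma) (use WV in auto)
    also have "V / real (Suc m) * fact (Suc m) = V * fact m" by (simp add: field_simps)
    finally show ?thesis using Bb(2)[of m] WV(2) by (simp add: field_simps)
  qed
  have "B 0 = emeasure lborel (ball (0 :: complex ^ 'n) 1)"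
    unfolding B_def ball by simp
  then have "b 0 = measure lborel (ball (0 :: complex ^ 'n) 1)" by (simp add: b_def measure_def)
  then have "0 < b 0" using content_ball_pos[of 1 "0 :: complex ^ 'n"] by simp
  then have "0 < V" using bV[of 0] WV(2) by (auto simp: order.strict_iff_order)
  moreover have "(\<integral>\<^sup>+z. F ((norm z)\<^sup>2) * ?h m z \<partial>lborel)
      = (\<integral>\<^sup>+s. F s * (ennreal (V * fact m / fact (?n + m) * (real (?n + m) * s ^ (?n + m - 1))) * indicator {0..} s) \<partial>lborel)"
    if "F \<in> borel_measurable borel" for m and F :: "real \<Rightarrow> ennreal"
    using iso[OF that, of m] n unfolding bV by (simp del: of_nat_Suc of_nat_add fact_Suc)
  ultimately show thesis by (rule that)
qed

lemma bounded_bilinear_smult: "bounded_bilinear (\<lambda>c (v :: complex ^ 'n). c *s v)"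
proof
  show "\<exists>K. \<forall>a b. norm (a *s (b :: complex ^ 'n)) \<le> norm a * norm b * K"
    by (intro exI[of _ 1]) (simp add: norm_vector_smult)
qed (simp_all add: vec_eq_iff algebra_simps)

lemmas continuous_on_smult [continuous_intros] = bounded_bilinear.continuous_on[OF bounded_bilinear_smult]

text \<open>The weight (1 - s)^a turns the power law of the unweighted moments into a Beta
  integral.\<close>

lemma bmeas_moment:
  fixes i :: "'n::finite"
  obtains V :: real where "0 < V"
    "\<And>a m. a > -1 \<Longrightarrow> (\<integral>\<^sup>+z. ennreal (cmod ((z :: complex ^ 'n) $ i) ^ (2 * m)) \<partial>bmeas a)
      = ennreal (V * fact m * Gamma (a + 1) / Gamma (real CARD('n) + 1 + a + real m))"
proof -
  obtain V where V: "0 < V" and mom: "\<And>m (F :: real \<Rightarrow> ennreal). F \<in> borel_measurable borel \<Longrightarrow>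
      (\<integral>\<^sup>+z. F ((norm z)\<^sup>2) * ennreal (cmod ((z :: complex ^ 'n) $ i) ^ (2 * m)) \<partial>lborel)
      = (\<integral>\<^sup>+s. F s * (ennreal (V * fact m / fact (CARD('n) + m) * (real (CARD('n) + m) * s ^ (CARD('n) + m - 1))) * indicator {0..} s) \<partial>lborel)"
    using nn_integral_moments[of i] by blast
  show thesis
  proof (rule that[OF V])
    fix a :: real and m assume a: "a > -1"
    let ?n = "CARD('n)"
    have n: "?n \<ge> 1" by (simp add: Suc_leI)
    let ?F = "\<lambda>s. ennreal (indicator {..<1} s * (1 - s) powr a)"
    have "(\<integral>\<^sup>+z. ennreal (cmod ((z :: complex ^ 'n) $ i) ^ (2 * m)) \<partial>bmeas a)
      = (\<integral>\<^sup>+z. ?F ((norm z)\<^sup>2) * ennreal (cmod ((z :: complex ^ 'n) $ i) ^ (2 * m)) \<partial>lborel)"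
      by (subst nn_integral_bmeas) (auto intro!: borel_measurable_bmeas_borel nn_integral_cong simp: indicator_def abs_square_less_1)
    also have "\<dots> = (\<integral>\<^sup>+s. ?F s * (ennreal (V * fact m / fact (?n + m) * (real (?n + m) * s ^ (?n + m - 1))) * indicator {0..} s) \<partial>lborel)"
      by (rule mom) measurable
    also have "\<dots> = ennreal (V * fact m / fact (?n + m) * (fact (?n + m) * Gamma (a + 1) / Gamma (real ?n + 1 + a + real m)))"
    proof -
      obtain k where k: "?n + m = Suc k" using n by (metis Suc_le_D add.commute add_Suc_right One_nat_def)
      have "real ?n + 1 + a + real m = real (?n + m) + 1 + a" by simp
      also have "\<dots> = real k + 2 + a" unfolding k by simp
      finally have e: "real ?n + 1 + a + real m = real k + 2 + a" .
      show ?thesis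
        unfolding e k diff_Suc_1 by (rule nn_integral_Beta_power) (use V a in auto)
    qed
    finally show "(\<integral>\<^sup>+z. ennreal (cmod ((z :: complex ^ 'n) $ i) ^ (2 * m)) \<partial>bmeas a)
      = ennreal (V * fact m * Gamma (a + 1) / Gamma (real ?n + 1 + a + real m))"
      by (simp add: mult.assoc)
  qed
qed

lemma finite_measure_bmeas: "a > -1 \<Longrightarrow> finite_measure (bmeas a :: (complex ^ 'n) measure)"
proof (rule finite_measureI)
  fix i :: 'n assume a: "a > -1"
  obtain V :: real where "(\<integral>\<^sup>+z. ennreal (cmod ((z :: complex ^ 'n) $ i) ^ (2 * 0)) \<partial>bmeas a)
      = ennreal (V * fact 0 * Gamma (a + 1) / Gamma (real CARD('n) + 1 + a + real 0))"
    using bmeas_moment[of i] a by metis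
  then show "emeasure (bmeas a :: (complex ^ 'n) measure) (space (bmeas a)) \<noteq> \<infinity>" by simp
qed

lemma unitary_measurable:
  fixes U :: "complex ^ 'n \<Rightarrow> complex ^ 'n"
  assumes U: "linear U" "\<And>x. norm (U x) = norm x"
  shows "U \<in> measurable (bmeas a) (bmeas a)"
proof -
  have "continuous_on UNIV U"
    using U(1) linear_continuous_on linear_conv_bounded_linear by blast
  then have "U \<in> borel_measurable borel" by (rule borel_measurable_continuous_onI)
  then show ?thesis
    unfolding measurable_cong_sets[OF sets_bmeas sets_bmeas]
    by (intro measurable_restrict_space3) (use U(2) in auto)
qed

lemma bmeas_isometry_integral:
  fixes U :: "complex ^ 'n \<Rightarrow> complex ^ 'n" and f :: "complex ^ 'n \<Rightarrow> 'c::{banach,second_countable_topology}"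
  assumes U: "linear U" "\<And>x. norm (U x) = norm x" and f: "f \<in> borel_measurable (bmeas a)"
  shows "(\<integral>u. f (U u) \<partial>bmeas a) = (\<integral>u. f u \<partial>bmeas a)"
    "integrable (bmeas a) (\<lambda>u. f (U u)) \<longleftrightarrow> integrable (bmeas a) f"
  using integral_distr[OF unitary_measurable[OF U, of a] f] integrable_distr_eq[OF unitary_measurable[OF U, of a] f]
  by (simp_all add: distr_bmeas_isometry[OF U])

section \<open>Averages over rotations and the action of kernels on homogeneous components\<close>

abbreviation "unit_interval \<equiv> restrict_space lborel {0..1::real}"

lemma prob_unit_interval: "finite_measure unit_interval" "measure unit_interval (space unit_interval) = 1"
proof -
  show "finite_measure unit_interval"
    by (rule finite_measureI) (simp add: space_restrict_space emeasure_restrict_space)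
  show "measure unit_interval (space unit_interval) = 1"
    by (simp add: space_restrict_space measure_restrict_space)
qed

text \<open>Each isometry leaves the integral unchanged, hence so does averaging over a family of
  them, by Fubini. This is used for rotations of all coordinates but one and for rotations of the
  whole vector.\<close>

lemma integral_bmeas_average:
  fixes \<psi> :: "complex ^ 'n \<Rightarrow> complex" and V :: "real \<Rightarrow> complex ^ 'n \<Rightarrow> complex ^ 'n"
  assumes a: "a > -1" and c: "continuous_on (ball 0 1) \<psi>" and i: "integrable (bmeas a) \<psi>"
    and Vc: "continuous_on UNIV (\<lambda>x. V (fst x) (snd x))"
    and V: "\<And>\<theta>. linear (V \<theta>)" "\<And>\<theta> x. norm (V \<theta> x) = norm x"
    and H: "\<And>u. u \<in> ball 0 1 \<Longrightarrow> (\<integral>\<theta>. \<psi> (V \<theta> u) \<partial>unit_interval) = H u"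
  shows "integrable (bmeas a) H" "(\<integral>u. H u \<partial>bmeas a) = (\<integral>u. \<psi> u \<partial>bmeas a)"
proof -
  interpret M: finite_measure "bmeas a :: (complex ^ 'n) measure" by (rule finite_measure_bmeas[OF a])
  interpret L: finite_measure unit_interval by (rule prob_unit_interval)
  interpret P: pair_sigma_finite unit_interval "bmeas a :: (complex ^ 'n) measure" ..
  \<comment> \<open>The extension by zero is Borel on the whole space, so joint measurability of its
    composition with V reduces to continuity of V.\<close>
  define \<psi>' where "\<psi>' z = (if z \<in> ball 0 1 then \<psi> z else 0)" for z
  have m\<psi>: "\<psi>' \<in> borel_measurable borel"
    unfolding \<psi>'_def by (rule borel_measurable_continuous_on_if) (use c in auto)
  have mV: "(\<lambda>x. V (fst x) (snd x)) \<in> borel_measurable borel" by (rule borel_measurable_continuous_onI[OF Vc])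
  have id: "(\<lambda>x. x) \<in> measurable (unit_interval \<Otimes>\<^sub>M bmeas a) (borel \<Otimes>\<^sub>M borel :: (real \<times> (complex ^ 'n)) measure)"
  proof -
    have 1: "fst \<in> measurable (unit_interval \<Otimes>\<^sub>M (bmeas a :: (complex ^ 'n) measure)) borel"
      by (rule measurable_compose[OF measurable_fst]) (simp add: measurable_restrict_space1)
    have 2: "snd \<in> measurable (unit_interval \<Otimes>\<^sub>M (bmeas a :: (complex ^ 'n) measure)) borel"
      by (rule measurable_compose[OF measurable_snd]) (simp add: borel_measurable_bmeas_borel)
    show ?thesis using measurable_Pair[OF 1 2] by simp
  qed
  have mf: "(\<lambda>x. \<psi>' (V (fst x) (snd x))) \<in> borel_measurable (unit_interval \<Otimes>\<^sub>M (bmeas a :: (complex ^ 'n) measure))"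
    using measurable_compose[OF id measurable_compose[OF mV[folded borel_prod] m\<psi>]] by (simp add: comp_def)
  have i': "integrable (bmeas a) \<psi>'"
    using i by (rule Bochner_Integration.integrable_cong[THEN iffD1, rotated -1]) (auto simp: \<psi>'_def)
  have e': "(\<integral>u. \<psi>' u \<partial>bmeas a) = (\<integral>u. \<psi> u \<partial>bmeas a)"
    by (intro Bochner_Integration.integral_cong) (auto simp: \<psi>'_def)
  have m': "\<psi>' \<in> borel_measurable (bmeas a)" "(\<lambda>z. norm (\<psi>' z)) \<in> borel_measurable (bmeas a)"
    using i' by auto
  have int: "integrable (unit_interval \<Otimes>\<^sub>M (bmeas a :: (complex ^ 'n) measure)) (\<lambda>(\<theta>,u). \<psi>' (V \<theta> u))"
  proof (rule P.Fubini_integrable)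
    show "(\<lambda>(\<theta>,u). \<psi>' (V \<theta> u)) \<in> borel_measurable (unit_interval \<Otimes>\<^sub>M (bmeas a :: (complex ^ 'n) measure))"
      using mf by (simp add: case_prod_beta')
    show "integrable unit_interval (\<lambda>x. \<integral>y. norm (case (x, y) of (\<theta>, u) \<Rightarrow> \<psi>' (V \<theta> u)) \<partial>bmeas a)"
      using bmeas_isometry_integral(1)[OF V m'(2)] by simp
    show "AE x in unit_interval. integrable (bmeas a) (\<lambda>y. case (x, y) of (\<theta>, u) \<Rightarrow> \<psi>' (V \<theta> u))"
      using bmeas_isometry_integral(2)[OF V m'(1)] i' by simp
  qed
  have HH: "(\<integral>\<theta>. \<psi>' (V \<theta> u) \<partial>unit_interval) = H u" if "u \<in> space (bmeas a)" for u
    using H[of u] that V(2) by (simp add: \<psi>'_def)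
  show "integrable (bmeas a) H"
    using P.integrable_snd[OF int] by (rule Bochner_Integration.integrable_cong[THEN iffD1, rotated -1]) (use HH in auto)
  have "(\<integral>u. H u \<partial>bmeas a) = (\<integral>u. (\<integral>\<theta>. \<psi>' (V \<theta> u) \<partial>unit_interval) \<partial>bmeas a)"
    by (intro Bochner_Integration.integral_cong) (use HH in auto)
  also have "\<dots> = (\<integral>\<theta>. (\<integral>u. \<psi>' (V \<theta> u) \<partial>bmeas a) \<partial>unit_interval)" by (rule P.Fubini_integral[OF int])
  also have "\<dots> = (\<integral>u. \<psi> u \<partial>bmeas a)"
    using prob_unit_interval(2) by (simp add: bmeas_isometry_integral(1)[OF V m'(1)] e')
  finally show "(\<integral>u. H u \<partial>bmeas a) = (\<integral>u. \<psi> u \<partial>bmeas a)" .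
qed

text \<open>Cauchy's formula for the m-th derivative on the unit circle, where the conjugate of a
  point is its inverse. The case m = 0 is the mean value property.\<close>

lemma circle_mean:
  assumes h: "h holomorphic_on ball 0 r" and r: "1 < r"
  shows "(\<integral>\<theta>. h (cis (2 * pi * \<theta>)) * cnj (cis (2 * pi * \<theta>)) ^ m \<partial>unit_interval) = (deriv ^^ m) h 0 / fact m"
proof -
  have sub: "cball 0 1 \<subseteq> ball (0::complex) r" using r by auto
  let ?f = "\<lambda>\<theta>. h (cis (2 * pi * \<theta>)) * cnj (cis (2 * pi * \<theta>)) ^ m"
  have "((\<lambda>u. h u / (u - 0) ^ Suc m) has_contour_integral ((2 * pi * \<i>) / fact m * (deriv ^^ m) h 0)) (circlepath 0 1)"
    using holomorphic_on_subset[OF h sub] ball_subset_cball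
    by (intro Cauchy_has_contour_integral_higher_derivative_circlepath)
      (auto intro: holomorphic_on_subset holomorphic_on_imp_continuous_on)
  then have "((\<lambda>x. h (circlepath 0 1 x) / (circlepath 0 1 x - 0) ^ Suc m * vector_derivative (circlepath 0 1) (at x within {0..1}))
     has_integral ((2 * pi * \<i>) / fact m * (deriv ^^ m) h 0)) {0..1}"
    by (simp add: has_contour_integral_def)
  then have "((\<lambda>x. (2 * pi * \<i>) * ?f x) has_integral ((2 * pi * \<i>) / fact m * (deriv ^^ m) h 0)) {0..1}"
  proof (rule has_integral_eq[rotated])
    fix x :: real assume x: "x \<in> {0..1}"
    have e: "circlepath 0 1 x = cis (2 * pi * x)"
      by (simp add: circlepath cis_conv_exp mult_ac)
    have v: "vector_derivative (circlepath 0 1) (at x within {0..1}) = 2 * pi * \<i> * cis (2 * pi * x)"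
      using x by (simp add: vector_derivative_circlepath01 cis_conv_exp mult_ac)
    define c where "c = cis (2 * pi * x)"
    have c: "cnj c = inverse c" "c \<noteq> 0" by (simp_all add: c_def cis_cnj)
    show "h (circlepath 0 1 x) / (circlepath 0 1 x - 0) ^ Suc m * vector_derivative (circlepath 0 1) (at x within {0..1})
      = (2 * pi * \<i>) * ?f x"
      unfolding e v c_def[symmetric] c(1) using c(2) by (simp add: power_inverse field_simps)
  qed
  then have hi: "(?f has_integral ((deriv ^^ m) h 0 / fact m)) {0..1}"
    by (drule_tac c="1 / (2 * pi * \<i>)" in has_integral_mult_right) simp
  have "continuous_on {0..1} ?f"
  proof (intro continuous_intros)
    show "continuous_on {0..1} (\<lambda>\<theta>. h (cis (2 * pi * \<theta>)))"
      by (rule continuous_on_compose2[OF holomorphic_on_imp_continuous_on[OF h]])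
        (use r in \<open>auto intro!: continuous_intros simp: cis_conv_exp\<close>)
  qed
  then have "set_integrable lborel {0..1} ?f" by (rule borel_integrable_atLeastAtMost')
  then have "(LINT \<theta>:{0..1}|lborel. ?f \<theta>) = (deriv ^^ m) h 0 / fact m"
    using set_borel_integral_eq_integral(2) integral_unique[OF hi] by metis
  then show ?thesis by (simp add: integral_restrict_space set_lebesgue_integral_def)
qed

lemma norm_coordinate_rotation:
  fixes u :: "complex ^ 'n"
  shows "cmod t = 1 \<Longrightarrow> norm ((u $ i) *s axis i 1 + t *s (u - (u $ i) *s axis i 1)) = norm u"
    "cmod t \<le> R \<Longrightarrow> 1 \<le> R \<Longrightarrow> norm ((u $ i) *s axis i 1 + t *s (u - (u $ i) *s axis i 1)) \<le> R * norm u"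
proof -
  let ?v = "(u $ i) *s axis i 1 + t *s (u - (u $ i) *s axis i 1)"
  have comp: "?v $ j = (if j = i then u $ i else t * u $ j)" for j
    by (simp add: axis_def)
  show "norm ?v = norm u" if "cmod t = 1"
    unfolding norm_vec_def by (rule L2_set_cong) (use that comp in \<open>auto simp: norm_mult\<close>)
  show "norm ?v \<le> R * norm u" if "cmod t \<le> R" "1 \<le> R"
  proof -
    have "norm ?v \<le> norm (R *\<^sub>R u)"
    proof (rule norm_le_componentwise_cart)
      fix j
      have "norm (?v $ j) \<le> R * norm (u $ j)"
        unfolding comp using that mult_right_mono[of 1 R "norm (u $ j)"] by (auto simp: norm_mult intro: mult_right_mono)
      then show "norm (?v $ j) \<le> norm ((R *\<^sub>R u) $ j)" using that by simp
    qed
    then show ?thesis using that by simp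
  qed
qed

lemma linear_compose_smult:
  "linear (\<lambda>u :: complex ^ 'n. (u $ i) *s axis i 1 + t *s (u - (u $ i) *s axis i 1))"
  by (rule linearI) (simp_all add: vec_eq_iff algebra_simps)

text \<open>Two averages leave a single number of g. Rotating all coordinates but the i-th replaces
  g u by its value at the projection of u to the i-th axis. Rotating the whole vector then selects
  the component of degree m, which on that axis is u_i^m times its value at the basis
  vector.\<close>

lemma integral_axis_power:
  fixes g :: "complex ^ 'n \<Rightarrow> complex"
  assumes a: "a > -1" and g: "cholo g (ball 0 1)" and ig: "integrable (bmeas a) g"
  shows "(\<integral>u. g u * cnj (u $ i) ^ m \<partial>bmeas a) = (\<integral>u. of_real (cmod (u $ i) ^ (2 * m)) * coef g (axis i 1) m \<partial>bmeas a)"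
proof -
  let ?e = "axis i 1 :: complex ^ 'n"
  let ?p = "\<lambda>u :: complex ^ 'n. (u $ i) *s ?e"
  have ui: "cmod (u $ i) < 1" if "u \<in> ball 0 1" for u :: "complex ^ 'n"
    using that Finite_Cartesian_Product.norm_nth_le[of u i] by simp
  have pin: "?p u \<in> ball 0 1" if "u \<in> ball 0 1" for u :: "complex ^ 'n"
    using ui[OF that] by (simp add: norm_vector_smult norm_axis_1)
  have cg: "continuous_on (ball 0 1) g" by (rule cholo_continuous[OF g])
  have i1: "integrable (bmeas a) (\<lambda>u. g u * cnj (u $ i) ^ m)"
  proof (rule Bochner_Integration.integrable_bound[OF ig])
    show "(\<lambda>u. g u * cnj (u $ i) ^ m) \<in> borel_measurable (bmeas a)"
      by (intro borel_measurable_bmeas continuous_intros cg)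
    show "AE u in bmeas a. norm (g u * cnj (u $ i) ^ m) \<le> norm (g u)"
    proof (rule AE_I2)
      fix u :: "complex ^ 'n" assume "u \<in> space (bmeas a)"
      then have "cmod (u $ i) ^ m \<le> 1" using ui[of u] by (intro power_le_one) auto
      then show "norm (g u * cnj (u $ i) ^ m) \<le> norm (g u)"
        by (simp add: norm_mult norm_power mult_left_le)
    qed
  qed
  let ?V = "\<lambda>\<theta> u. ?p u + cis (2 * pi * \<theta>) *s (u - ?p u)"
  note avg = integral_bmeas_average[OF a _ i1, where V="?V" and H="\<lambda>u. g (?p u) * cnj (u $ i) ^ m"]
  have mean: "(\<integral>\<theta>. g (?V \<theta> u) * cnj (?V \<theta> u $ i) ^ m \<partial>unit_interval) = g (?p u) * cnj (u $ i) ^ m"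
    if u: "u \<in> ball 0 1" for u :: "complex ^ 'n"
  proof -
    \<comment> \<open>The slice has to be holomorphic on a disc larger than the unit disc. A radius
      r > 1 with r norm u \<le> 1 serves; for u = 0 any r > 1 does.\<close>
    define r where "r = (if u = 0 then 2 else 1 / norm u)"
    have r: "1 < r" using u by (auto simp: r_def)
    have inb: "?p u + t *s (u - ?p u) \<in> ball 0 1" if "t \<in> ball 0 r" for t
    proof -
      have "norm (?p u + t *s (u - ?p u)) \<le> max 1 (cmod t) * norm u"
        by (rule norm_coordinate_rotation) auto
      also have "\<dots> < 1" using that u by (auto simp: max_def r_def field_simps split: if_splits)
      finally show ?thesis by simp
    qed
    have hol: "(\<lambda>t. g (?p u + t *s (u - ?p u))) holomorphic_on ball 0 r"
      unfolding holomorphic_on_open[OF open_ball] using cholo_slice[OF g inb] by blast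
    have ci: "?V \<theta> u $ i = u $ i" for \<theta> by (simp add: axis_def)
    have "(\<integral>\<theta>. g (?V \<theta> u) * cnj (?V \<theta> u $ i) ^ m \<partial>unit_interval)
      = (\<integral>\<theta>. cnj (u $ i) ^ m * (g (?V \<theta> u) * cnj (cis (2 * pi * \<theta>)) ^ 0) \<partial>unit_interval)"
      unfolding ci by (simp add: mult.commute)
    also have "\<dots> = cnj (u $ i) ^ m * (\<integral>\<theta>. g (?V \<theta> u) * cnj (cis (2 * pi * \<theta>)) ^ 0 \<partial>unit_interval)"
      by simp
    also have "\<dots> = g (?p u) * cnj (u $ i) ^ m"
      using circle_mean[OF hol r, of 0] by simp
    finally show ?thesis .
  qed
  have Vc: "continuous_on UNIV (\<lambda>x. ?V (fst x) (snd x))"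
    unfolding cis_conv_exp by (intro continuous_intros)
  have Vn: "norm (?V \<theta> u) = norm u" for \<theta> u by (rule norm_coordinate_rotation(1)) simp
  have cm: "continuous_on (ball 0 1) (\<lambda>u. g u * cnj (u $ i) ^ m)" by (intro continuous_intros cg)
  note A = avg[OF cm Vc linear_compose_smult Vn mean]
  have B: "(\<integral>u. of_real (cmod (u $ i) ^ (2 * m)) * coef g ?e m \<partial>bmeas a) = (\<integral>u. g (?p u) * cnj (u $ i) ^ m \<partial>bmeas a)"
  proof (rule integral_bmeas_average(2)[OF a _ A(1), where V="\<lambda>\<theta> u. cis (2 * pi * \<theta>) *s u"])
    fix u :: "complex ^ 'n" assume u: "u \<in> ball 0 1"
    define r where "r = (if u $ i = 0 then 2 else 1 / cmod (u $ i))"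
    have r: "1 < r" "r * norm (?p u) \<le> 1" using ui[OF u] by (auto simp: r_def norm_vector_smult norm_axis_1)
    have "(\<integral>\<theta>. g (?p (cis (2 * pi * \<theta>) *s u)) * cnj ((cis (2 * pi * \<theta>) *s u) $ i) ^ m \<partial>unit_interval)
      = (\<integral>\<theta>. cnj (u $ i) ^ m * (g (cis (2 * pi * \<theta>) *s ?p u) * cnj (cis (2 * pi * \<theta>)) ^ m) \<partial>unit_interval)"
      by (simp add: power_mult_distrib mult_ac)
    also have "\<dots> = cnj (u $ i) ^ m * (\<integral>\<theta>. g (cis (2 * pi * \<theta>) *s ?p u) * cnj (cis (2 * pi * \<theta>)) ^ m \<partial>unit_interval)"
      by simp
    also have "\<dots> = cnj (u $ i) ^ m * coef g (?p u) m"
      using circle_mean[OF slice_holomorphic(1)[OF g r(2)] r(1), of m] by (simp add: coef_def)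
    also have "\<dots> = (u $ i * cnj (u $ i)) ^ m * coef g ?e m"
      by (simp add: coef_smult[OF g] power_mult_distrib)
    also have "u $ i * cnj (u $ i) = of_real ((cmod (u $ i))\<^sup>2)" by (simp only: complex_norm_square)
    finally show "(\<integral>\<theta>. g (?p (cis (2 * pi * \<theta>) *s u)) * cnj ((cis (2 * pi * \<theta>) *s u) $ i) ^ m \<partial>unit_interval)
      = of_real (cmod (u $ i) ^ (2 * m)) * coef g ?e m"
      by (simp add: power_mult)
  next
    show "continuous_on (ball 0 1) (\<lambda>u. g (?p u) * cnj (u $ i) ^ m)"
      by (intro continuous_intros continuous_on_compose2[OF cg]) (use pin in auto)
    show "linear (\<lambda>u. cis (2 * pi * \<theta>) *s (u :: complex ^ 'n))" for \<theta>
      using bounded_linear.linear[OF bounded_linear_vector_smult] .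
  qed (auto intro!: continuous_intros simp: norm_vector_smult cis_conv_exp)
  show ?thesis using A(2) B by simp
qed

text \<open>A unitary change of variables moves w to a multiple of the i-th basis vector, where <w,
  u> involves only the i-th coordinate of u.\<close>

lemma integral_herm_power:
  fixes g :: "complex ^ 'n \<Rightarrow> complex" and i :: 'n
  assumes a: "a > -1" and g: "cholo g (ball 0 1)" and ig: "integrable (bmeas a) g"
  shows "(\<integral>u. herm w u ^ m * g u \<partial>bmeas a) = coef g w m * (\<integral>u. of_real (cmod (u $ i) ^ (2 * m)) \<partial>bmeas a)"
proof -
  obtain U k where U: "unitary U" "w = k *s U (axis i 1)" by (rule unitary_transitive[of w i])
  have lin: "linear U" and hom: "U (c *s x) = c *s U x" and hU: "herm (U x) (U y) = herm x y" for c x y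
    using U(1) by (auto simp: unitary_def)
  note nU = unitary_norm[OF U(1)]
  have cg: "continuous_on (ball 0 1) g" by (rule cholo_continuous[OF g])
  have gU: "cholo (\<lambda>u. g (U u)) (ball 0 1)"
    using cholo_compose_affine(1)[OF g unitary_bounded_linear[OF U(1)] hom, of "ball 0 1" 0] nU by simp
  have igU: "integrable (bmeas a) (\<lambda>u. g (U u))"
    using ig by (simp add: bmeas_isometry_integral(2)[OF lin nU borel_measurable_bmeas[OF cg]])
  have "(\<integral>u. herm w u ^ m * g u \<partial>bmeas a) = (\<integral>u. herm w (U u) ^ m * g (U u) \<partial>bmeas a)"
    by (rule bmeas_isometry_integral(1)[symmetric, OF lin nU])
      (intro borel_measurable_bmeas continuous_intros cg)
  also have "\<dots> = (\<integral>u. k ^ m * (g (U u) * cnj (u $ i) ^ m) \<partial>bmeas a)"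
    by (simp add: U(2) herm_smult_left hU herm_axis_left power_mult_distrib mult_ac)
  also have "\<dots> = k ^ m * (\<integral>u. of_real (cmod (u $ i) ^ (2 * m)) * coef (\<lambda>u. g (U u)) (axis i 1) m \<partial>bmeas a)"
    by (simp add: integral_axis_power[OF a gU igU])
  also have "coef (\<lambda>u. g (U u)) (axis i 1) m = coef g (U (axis i 1)) m"
    by (simp add: coef_def hom)
  finally show ?thesis by (simp add: U(2) coef_smult[OF g] mult_ac)
qed

lemma kernel_sums:
  assumes "cmod x < 1"
  shows "(\<lambda>m. (pochhammer s m / fact m) * x ^ m) sums (1 - x) powr (- s)"
proof -
  have "(\<lambda>m. (- s gchoose m) * (- x) ^ m) sums (1 + (- x)) powr (- s)"
    by (rule gen_binomial_complex) (use assms in simp)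
  also have "(\<lambda>m. (- s gchoose m) * (- x) ^ m) = (\<lambda>m. (pochhammer s m / fact m) * x ^ m)"
  proof
    fix m
    have "(- s gchoose m) * (- x) ^ m = (pochhammer s m / fact m) * ((- 1) ^ m * (- x) ^ m)"
      by (simp only: gbinomial_pochhammer minus_minus divide_inverse mult_ac)
    also have "(- 1) ^ m * (- x) ^ m = x ^ m" by (simp only: power_mult_distrib[symmetric]) simp
    finally show "(- s gchoose m) * (- x) ^ m = (pochhammer s m / fact m) * x ^ m" .
  qed
  finally show ?thesis by simp
qed

lemma pochhammer_ratio_Gamma:
  fixes N :: real assumes "N > 0"
  shows "Gamma (N + real m) = pochhammer N m * Gamma N"
proof -
  have "N \<notin> \<int>\<^sub>\<le>\<^sub>0" using assms by (auto simp: nonpos_Ints_def)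
  then show ?thesis using pochhammer_Gamma[of N m] Gamma_real_pos[OF assms] by (simp add: field_simps)
qed

text \<open>The ratio of Pochhammer symbols is \<open>1\<close> for the reproducing kernel, and a polynomial in
  \<open>m\<close> or its reciprocal when one of the exponents is shifted by an integer.\<close>

lemma kernel_integral:
  assumes a: "a > -1"
  obtains C :: real where "0 < C"
    "\<And>s (g :: complex ^ 'n \<Rightarrow> complex) w. s > 0 \<Longrightarrow> cholo g (ball 0 1) \<Longrightarrow> integrable (bmeas a) g \<Longrightarrow> w \<in> ball 0 1 \<Longrightarrow>
      (\<lambda>m. of_real (C * (pochhammer s m / pochhammer (real CARD('n) + 1 + a) m)) * coef g w m) sums
        (\<integral>u. (1 - herm w u) powr (- of_real s) * g u \<partial>bmeas a)"
proof -
  fix i :: 'n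
  let ?N = "real CARD('n) + 1 + a"
  have N: "?N > 0" using a by linarith
  obtain V where V: "0 < V" and mom: "\<And>m. (\<integral>\<^sup>+z. ennreal (cmod ((z :: complex ^ 'n) $ i) ^ (2 * m)) \<partial>bmeas a)
      = ennreal (V * fact m * Gamma (a + 1) / Gamma (?N + real m))"
    using bmeas_moment[of i] a by metis
  \<comment> \<open>With this C the m-th moment equals C m! / (N)_m. The m! cancels the denominator
    of the m-th binomial coefficient of the kernel.\<close>
  define C where "C = V * Gamma (a + 1) / Gamma ?N"
  have C: "0 < C" using V a N by (simp add: C_def Gamma_real_pos)
  have mom': "(\<integral>u. complex_of_real (cmod ((u :: complex ^ 'n) $ i) ^ (2 * m)) \<partial>bmeas a) = of_real (C * fact m / pochhammer ?N m)" for m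
  proof -
    have "(\<integral>u. cmod ((u :: complex ^ 'n) $ i) ^ (2 * m) \<partial>bmeas a) = V * fact m * Gamma (a + 1) / Gamma (?N + real m)"
      using V a N by (subst integral_eq_nn_integral)
        (auto intro!: borel_measurable_bmeas continuous_intros simp: mom Gamma_real_pos add_pos_nonneg)
    also have "\<dots> = C * fact m / pochhammer ?N m"
      unfolding pochhammer_ratio_Gamma[OF N] C_def by (simp add: mult_ac)
    finally show ?thesis by (simp only: integral_complex_of_real)
  qed
  show thesis
  proof (rule that[OF C])
    fix s :: real and g :: "complex ^ 'n \<Rightarrow> complex" and w :: "complex ^ 'n"
    assume s: "s > 0" and g: "cholo g (ball 0 1)" and ig: "integrable (bmeas a) g" and w: "w \<in> ball 0 1"
    let ?c = "\<lambda>m. pochhammer s m / fact m"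
    have c0: "?c m \<ge> 0" for m using s by (simp add: pochhammer_nonneg)
    have cc: "pochhammer (of_real s) m / fact m = complex_of_real (?c m)" for m
      by (simp add: pochhammer_of_real)
    have cg: "continuous_on (ball 0 1) g" by (rule cholo_continuous[OF g])
    have hw: "cmod (herm w u) \<le> norm w" if "u \<in> ball 0 1" for u
      using cmod_herm_le[of w u] that mult_left_le[of "norm u" "norm w"] by simp
    let ?f = "\<lambda>m u. complex_of_real (?c m) * herm w u ^ m * g u"
    have mf: "?f m \<in> borel_measurable (bmeas a)" for m
      by (intro borel_measurable_bmeas continuous_intros cg)
    have bd: "norm (?f m u) \<le> ?c m * norm w ^ m * norm (g u)" if "u \<in> ball 0 1" for m u
      unfolding norm_mult norm_power norm_of_real abs_of_nonneg[OF c0]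
      using c0[of m] hw[OF that] by (intro mult_right_mono mult_left_mono power_mono) auto
    have sw: "summable (\<lambda>m. ?c m * norm w ^ m)"
    proof -
      have "summable (\<lambda>m. complex_of_real (?c m) * of_real (norm w) ^ m)"
        using kernel_sums[of "of_real (norm w)" "of_real s"] w unfolding cc by (auto simp: sums_iff)
      then have "summable (\<lambda>m. complex_of_real (?c m * norm w ^ m))" by simp
      then show ?thesis by (simp only: summable_of_real_iff)
    qed
    have if': "integrable (bmeas a) (?f m)" for m
    proof (rule Bochner_Integration.integrable_bound[OF _ mf])
      show "integrable (bmeas a) (\<lambda>u. ?c m * norm w ^ m * norm (g u))" using ig by simp
      show "AE u in bmeas a. norm (?f m u) \<le> norm (?c m * norm w ^ m * norm (g u))"
      proof (rule AE_I2)
        fix u :: "complex ^ 'n" assume "u \<in> space (bmeas a)"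
        then have "norm (?f m u) \<le> ?c m * norm w ^ m * norm (g u)" using bd[of u m] by simp
        also have "\<dots> \<le> norm (?c m * norm w ^ m * norm (g u))" by (simp only: real_norm_def abs_ge_self)
        finally show "norm (?f m u) \<le> norm (?c m * norm w ^ m * norm (g u))" .
      qed
    qed
    \<comment> \<open>The series converges absolutely and uniformly in u, since |<w, u>| \<le> norm
      w < 1, so it may be integrated term by term.\<close>
    have "(\<lambda>m. integral\<^sup>L (bmeas a) (?f m)) sums (\<integral>u. (\<Sum>m. ?f m u) \<partial>bmeas a)"
    proof (rule sums_integral[OF if'])
      show "AE u in bmeas a. summable (\<lambda>m. norm (?f m u))"
      proof (rule AE_I2)
        fix u :: "complex ^ 'n" assume "u \<in> space (bmeas a)"
        then have "u \<in> ball 0 1" by simp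
        from bd[OF this] show "summable (\<lambda>m. norm (?f m u))"
          by (intro summable_comparison_test[OF _ summable_mult2[OF sw, of "norm (g u)"]]) auto
      qed
      show "summable (\<lambda>m. \<integral>u. norm (?f m u) \<partial>bmeas a)"
      proof (rule summable_comparison_test[OF _ summable_mult2[OF sw, of "\<integral>u. norm (g u) \<partial>bmeas a"]], intro exI allI impI)
        fix m :: nat
        have "(\<integral>u. norm (?f m u) \<partial>bmeas a) \<le> (\<integral>u. ?c m * norm w ^ m * norm (g u) \<partial>bmeas a)"
          using ig if' bd by (intro integral_mono) auto
        then show "norm (\<integral>u. norm (?f m u) \<partial>bmeas a) \<le> ?c m * norm w ^ m * (\<integral>u. norm (g u) \<partial>bmeas a)"
          by (simp add: integral_nonneg_AE)
      qed
    qed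
    also have "(\<integral>u. (\<Sum>m. ?f m u) \<partial>bmeas a) = (\<integral>u. (1 - herm w u) powr (- of_real s) * g u \<partial>bmeas a)"
    proof (rule Bochner_Integration.integral_cong)
      fix u :: "complex ^ 'n" assume "u \<in> space (bmeas a)"
      then have "cmod (herm w u) < 1" using hw[of u] w by simp
      from sums_mult2[OF kernel_sums[OF this, of "of_real s"], of "g u"]
      show "(\<Sum>m. ?f m u) = (1 - herm w u) powr (- of_real s) * g u" unfolding cc by (simp add: sums_iff)
    qed simp
    also have "(\<lambda>m. integral\<^sup>L (bmeas a) (?f m)) = (\<lambda>m. of_real (C * (pochhammer s m / pochhammer ?N m)) * coef g w m)"
    proof
      fix m
      have "integral\<^sup>L (bmeas a) (?f m) = of_real (?c m) * (\<integral>u. herm w u ^ m * g u \<partial>bmeas a)"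
        by (simp add: mult.assoc)
      also have "\<dots> = of_real (?c m) * (coef g w m * of_real (C * fact m / pochhammer ?N m))"
        by (simp only: integral_herm_power[OF a g ig, where i=i] mom')
      finally show "integral\<^sup>L (bmeas a) (?f m) = of_real (C * (pochhammer s m / pochhammer ?N m)) * coef g w m"
        by simp
    qed
    finally show "(\<lambda>m. of_real (C * (pochhammer s m / pochhammer ?N m)) * coef g w m) sums
        (\<integral>u. (1 - herm w u) powr (- of_real s) * g u \<partial>bmeas a)" .
  qed
qed

section \<open>The nonisotropic quasi-metric\<close>

text \<open>Not a metric even up to a power: \<open>kor z z\<close> is 1 - |z|^2 rather than 0. The
  triangle inequality for its square root nevertheless holds.\<close>

definition kor :: "complex ^ 'n \<Rightarrow> complex ^ 'n \<Rightarrow> real" where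
  "kor z w = cmod (1 - herm z w)"

lemma kor_sym: "kor z w = kor w z"
  unfolding kor_def by (metis cnj_herm complex_cnj_diff complex_cnj_one complex_mod_cnj)

lemma kor_ge: "norm z \<le> 1 \<Longrightarrow> norm w \<le> 1 \<Longrightarrow> 1 - norm z \<le> kor z w"
proof -
  assume *: "norm z \<le> 1" "norm w \<le> 1"
  have "cmod (herm z w) \<le> norm z" using cmod_herm_le[of z w] mult_left_le[OF *(2), of "norm z"] by simp
  then show ?thesis unfolding kor_def using norm_triangle_ineq2[of 1 "herm z w"] by simp
qed

lemma kor_pos: "z \<in> ball 0 1 \<Longrightarrow> w \<in> ball 0 1 \<Longrightarrow> 0 < kor z w"
  using kor_ge[of z w] by simp

lemma kor_less_2: "z \<in> ball 0 1 \<Longrightarrow> w \<in> ball 0 1 \<Longrightarrow> kor z w < 2"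
proof -
  assume *: "z \<in> ball 0 1" "w \<in> ball 0 1"
  have "cmod (herm z w) \<le> norm z" using cmod_herm_le[of z w] mult_left_le[of "norm w" "norm z"] * by simp
  then show ?thesis unfolding kor_def using norm_triangle_ineq4[of 1 "herm z w"] * by simp
qed

lemma kor_lipschitz: "norm z \<le> 1 \<Longrightarrow> kor z w \<le> kor z w' + norm (w - w')"
proof -
  assume z: "norm z \<le> 1"
  have "kor z w \<le> kor z w' + cmod (herm z (w' - w))"
    unfolding kor_def using norm_triangle_ineq[of "1 - herm z w'" "herm z (w' - w)"] by (simp add: herm_diff_right)
  moreover have "cmod (herm z (w' - w)) \<le> norm (w' - w)"
    using cmod_herm_le[of z "w' - w"] mult_right_mono[OF z, of "norm (w' - w)"] by simp
  ultimately show ?thesis by (simp add: norm_minus_commute)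
qed

lemma continuous_on_kor [continuous_intros]:
  "continuous_on S f \<Longrightarrow> continuous_on S g \<Longrightarrow> continuous_on S (\<lambda>x. kor (f x) (g x))"
  unfolding kor_def by (intro continuous_intros)

lemma Cauchy_Schwarz_2:
  fixes a b c d :: real
  shows "a * b + c * d \<le> sqrt (a\<^sup>2 + c\<^sup>2) * sqrt (b\<^sup>2 + d\<^sup>2)"
proof -
  have "(a * b + c * d)\<^sup>2 + (a * d - c * b)\<^sup>2 = (a\<^sup>2 + c\<^sup>2) * (b\<^sup>2 + d\<^sup>2)"
    by (simp add: power2_eq_square algebra_simps)
  then have "(a * b + c * d)\<^sup>2 \<le> (a\<^sup>2 + c\<^sup>2) * (b\<^sup>2 + d\<^sup>2)"
    using zero_le_power2[of "a * d - c * b"] by linarith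
  then show ?thesis by (simp add: real_le_rsqrt real_sqrt_mult[symmetric])
qed

text \<open>The left-hand side equals |z|^2 - |<z,u>|^2, the diagonal value of the form used in the
  triangle inequality below. Writing it as a sum of two squares prepares the Cauchy--Schwarz
  inequality for that form.\<close>

lemma herm_gram:
  assumes z: "norm z \<le> 1" and u: "norm u \<le> 1"
  shows "(norm (z - herm z u *s u))\<^sup>2 + (cmod (herm z u) * sqrt (1 - (norm u)\<^sup>2))\<^sup>2 \<le> 1 - (cmod (herm z u))\<^sup>2"
proof -
  let ?a = "herm z u"
  have u1: "(norm u)\<^sup>2 \<le> 1" using u by (simp add: power_le_one)
  have "complex_of_real ((norm (z - ?a *s u))\<^sup>2) = herm (z - ?a *s u) (z - ?a *s u)" by (simp only: herm_self)
  also have "\<dots> = of_real ((norm z)\<^sup>2) - 2 * (?a * cnj ?a) + ?a * cnj ?a * of_real ((norm u)\<^sup>2)"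
    unfolding herm_diff_left herm_diff_right herm_smult_left herm_smult_right
    by (simp add: herm_self cnj_herm algebra_simps)
  also have "?a * cnj ?a = of_real ((cmod ?a)\<^sup>2)" by (simp only: complex_norm_square)
  finally have "complex_of_real ((norm (z - ?a *s u))\<^sup>2)
    = of_real ((norm z)\<^sup>2 - 2 * (cmod ?a)\<^sup>2 + (cmod ?a)\<^sup>2 * (norm u)\<^sup>2)" by simp
  then have "(norm (z - ?a *s u))\<^sup>2 = (norm z)\<^sup>2 - 2 * (cmod ?a)\<^sup>2 + (cmod ?a)\<^sup>2 * (norm u)\<^sup>2"
    by (simp only: of_real_eq_iff)
  moreover have "(cmod ?a * sqrt (1 - (norm u)\<^sup>2))\<^sup>2 = (cmod ?a)\<^sup>2 - (cmod ?a)\<^sup>2 * (norm u)\<^sup>2"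
    using u1 by (simp add: power_mult_distrib algebra_simps)
  moreover have "(norm z)\<^sup>2 \<le> 1" using z by (simp add: power_le_one)
  ultimately show ?thesis by linarith
qed

text \<open>The Hermitian form \<open>\<langle>z,w\<rangle> - \<langle>z,u\<rangle>\<langle>u,w\<rangle>\<close> is positive semidefinite for \<open>norm u \<le> 1\<close>, so it obeys
  the Cauchy--Schwarz inequality.\<close>

lemma sqrt_kor_triangle:
  assumes z: "norm z \<le> 1" and u: "norm u \<le> 1" and w: "norm w \<le> 1"
  shows "sqrt (kor z w) \<le> sqrt (kor z u) + sqrt (kor u w)"
proof -
  let ?a = "herm z u" and ?b = "herm u w"
  have a1: "cmod ?a \<le> 1" using cmod_herm_le[of z u] z u by (meson mult_le_one norm_ge_zero order_trans)
  have b1: "cmod ?b \<le> 1" using cmod_herm_le[of u w] u w by (meson mult_le_one norm_ge_zero order_trans)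
  have u1: "(norm u)\<^sup>2 \<le> 1" using u by (simp add: power_le_one)
  define t where "t = sqrt (1 - (norm u)\<^sup>2)"
  have t2: "complex_of_real t * of_real t = 1 - of_real ((norm u)\<^sup>2)"
    using u1 unfolding t_def by (simp only: of_real_mult[symmetric]) simp
  let ?p = "z - ?a *s u" and ?q = "w - herm w u *s u"
  have bb: "cnj ?b = herm w u" "cnj (herm w u) = ?b" by (simp_all add: cnj_herm)
  have "herm z w - ?a * ?b = herm ?p ?q + ?a * ?b * (of_real t * of_real t)"
    unfolding t2 by (simp add: herm_diff_left herm_diff_right herm_smult_left herm_smult_right herm_self bb algebra_simps)
  then have "cmod (herm z w - ?a * ?b) \<le> cmod (herm ?p ?q) + cmod (?a * ?b * (of_real t * of_real t))"
    by (metis norm_triangle_ineq)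
  also have "\<dots> \<le> norm ?p * norm ?q + (cmod ?a * t) * (cmod (herm w u) * t)"
  proof -
    have "0 \<le> t" using u1 by (simp add: t_def)
    moreover have "cmod ?b = cmod (herm w u)" by (metis bb(1) complex_mod_cnj)
    ultimately show ?thesis using cmod_herm_le[of ?p ?q] by (simp add: norm_mult)
  qed
  also have "\<dots> \<le> sqrt ((norm ?p)\<^sup>2 + (cmod ?a * t)\<^sup>2) * sqrt ((norm ?q)\<^sup>2 + (cmod (herm w u) * t)\<^sup>2)"
    by (rule Cauchy_Schwarz_2)
  also have "\<dots> \<le> sqrt (1 - (cmod ?a)\<^sup>2) * sqrt (1 - (cmod (herm w u))\<^sup>2)"
    unfolding t_def using power_le_one[OF norm_ge_zero a1, of 2]
    by (intro mult_mono real_sqrt_le_mono herm_gram z w u) auto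
  \<comment> \<open>Both diagonal values are converted to distances by 1 - x^2 \<le> 2 (1 - x) and 1
    - |<z,u>| \<le> kor z u.\<close>
  also have "\<dots> \<le> sqrt (2 * kor z u) * sqrt (2 * kor u w)"
  proof -
    have le: "1 - x\<^sup>2 \<le> 2 * (1 - x)" for x :: real using zero_le_power2[of "x - 1"] by (simp add: power2_eq_square algebra_simps)
    have "1 - cmod ?a \<le> kor z u" unfolding kor_def using norm_triangle_ineq2[of 1 ?a] by simp
    moreover have "1 - cmod (herm w u) \<le> kor u w" 
      using norm_triangle_ineq2[of 1 "herm w u"] kor_sym[of u w] unfolding kor_def by simp
    ultimately have "sqrt (1 - (cmod ?a)\<^sup>2) \<le> sqrt (2 * kor z u)" "sqrt (1 - (cmod (herm w u))\<^sup>2) \<le> sqrt (2 * kor u w)"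
      using le[of "cmod ?a"] le[of "cmod (herm w u)"] by (auto intro!: real_sqrt_le_mono)
    moreover have "cmod (herm w u) \<le> 1" using b1 by (metis bb(1) complex_mod_cnj)
    then have "0 \<le> sqrt (1 - (cmod (herm w u))\<^sup>2)"
      using power_le_one[OF norm_ge_zero, of "herm w u" 2] by simp
    ultimately show ?thesis by (intro mult_mono) (simp_all add: kor_def)
  qed
  also have "\<dots> = 2 * (sqrt (kor z u) * sqrt (kor u w))" by (simp add: real_sqrt_mult)
  finally have G: "cmod (herm z w - ?a * ?b) \<le> 2 * (sqrt (kor z u) * sqrt (kor u w))" .
  have "cmod (1 - ?a * ?b) \<le> kor z u + kor u w"
  proof -
    have "1 - ?a * ?b = (1 - ?a) + ?a * (1 - ?b)" by (simp add: algebra_simps)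
    then have "cmod (1 - ?a * ?b) \<le> cmod (1 - ?a) + cmod (?a * (1 - ?b))" by (metis norm_triangle_ineq)
    also have "cmod (?a * (1 - ?b)) \<le> cmod (1 - ?b)" using a1 by (simp add: norm_mult mult_left_le_one_le)
    finally show ?thesis by (simp add: kor_def)
  qed
  \<comment> \<open>1 - <z,w> is the difference of 1 - <z,u><u,w> and <z,w> - <z,u><u,w>. The two
    bounds add up to a perfect square.\<close>
  then have "kor z w \<le> kor z u + kor u w + 2 * (sqrt (kor z u) * sqrt (kor u w))"
    using G norm_triangle_ineq4[of "1 - ?a * ?b" "herm z w - ?a * ?b"] by (simp add: kor_def)
  also have "\<dots> = (sqrt (kor z u) + sqrt (kor u w))\<^sup>2"
    by (simp add: power2_sum kor_def)
  finally show ?thesis by (rule real_le_lsqrt[rotated]) (simp add: kor_def)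
qed

lemma kor_triangle:
  assumes "norm z \<le> 1" "norm u \<le> 1" "norm w \<le> 1" "kor z u \<le> a\<^sup>2" "kor u w \<le> b\<^sup>2" "0 \<le> a" "0 \<le> b"
  shows "kor z w \<le> (a + b)\<^sup>2"
proof -
  have "sqrt (kor z u) \<le> a" "sqrt (kor u w) \<le> b" using assms by (auto intro: real_le_lsqrt simp: kor_def)
  then have "sqrt (kor z w) \<le> a + b" using sqrt_kor_triangle[OF assms(1-3)] by linarith
  then have "(sqrt (kor z w))\<^sup>2 \<le> (a + b)\<^sup>2" by (intro power_mono) (simp_all add: kor_def)
  then show ?thesis by (simp add: kor_def)
qed

section \<open>Dyadic summation over shells\<close>

lemma dyadic_exists:
  fixes y :: real assumes "1 \<le> y"
  obtains i :: nat where "2 ^ i \<le> y" "y < 2 ^ Suc i"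
proof -
  obtain k where k: "y < 2 ^ k" using real_arch_pow[of 2 y] by auto
  define j where "j = (LEAST k. y < 2 ^ k)"
  have j: "y < 2 ^ j" unfolding j_def by (rule LeastI[of "\<lambda>k. y < 2 ^ k", OF k])
  then have "j \<noteq> 0" using assms by (cases j) auto
  then obtain i where i: "j = Suc i" by (cases j) auto
  have "\<not> y < 2 ^ i" unfolding j_def[symmetric] using not_less_Least[of i "\<lambda>k. y < 2 ^ k"] i j_def by simp
  then show thesis using that[of i] j i by simp
qed

text \<open>The template for shell estimates. The sets X i may overlap; one index for each point is
  enough.\<close>

lemma nn_integral_le_suminf:
  assumes X: "\<And>i::nat. X i \<in> sets M" and b: "\<And>i. emeasure M (X i) \<le> ennreal (b i)" "\<And>i. 0 \<le> b i" "\<And>i. 0 \<le> a i"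
    and F: "\<And>x. x \<in> space M \<Longrightarrow> \<exists>i. x \<in> X i \<and> F x \<le> ennreal (a i)"
    and s: "(\<lambda>i. a i * b i) sums S"
  shows "(\<integral>\<^sup>+x. F x \<partial>M) \<le> ennreal S"
proof -
  have "(\<integral>\<^sup>+x. F x \<partial>M) \<le> (\<integral>\<^sup>+x. (\<Sum>i. ennreal (a i) * indicator (X i) x) \<partial>M)"
  proof (rule nn_integral_mono)
    fix x assume "x \<in> space M"
    then obtain i where i: "x \<in> X i" "F x \<le> ennreal (a i)" using F by blast
    then have "F x \<le> (\<Sum>i\<in>{i}. ennreal (a i) * indicator (X i) x)" by simp
    also have "\<dots> \<le> (\<Sum>i. ennreal (a i) * indicator (X i) x)" by (rule sum_le_suminf) auto
    finally show "F x \<le> (\<Sum>i. ennreal (a i) * indicator (X i) x)" .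
  qed
  also have "\<dots> = (\<Sum>i. \<integral>\<^sup>+x. ennreal (a i) * indicator (X i) x \<partial>M)"
    using X by (intro nn_integral_suminf) auto
  also have "\<dots> = (\<Sum>i. ennreal (a i) * emeasure M (X i))"
    using X by (simp add: nn_integral_cmult_indicator)
  also have "\<dots> \<le> (\<Sum>i. ennreal (a i * b i))"
  proof (rule suminf_le)
    show "ennreal (a i) * emeasure M (X i) \<le> ennreal (a i * b i)" for i
      using b by (simp add: ennreal_mult mult_left_mono)
  qed auto
  also have "\<dots> = ennreal S"
    using s b by (subst suminf_ennreal2) (auto simp: sums_iff)
  finally show ?thesis .
qed

lemma geometric_powr_sums:
  fixes e :: real assumes "e > 0"
  shows "(\<lambda>i. (2 powr (- e)) ^ i) sums (1 / (1 - 2 powr (- e)))" "2 powr (- e) < 1"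
proof -
  show 1: "2 powr (- e) < 1" using assms by (simp add: powr_less_one)
  show "(\<lambda>i. (2 powr (- e)) ^ i) sums (1 / (1 - 2 powr (- e)))"
    using geometric_sums[of "2 powr (- e)"] 1 by simp
qed

text \<open>The shell 2^i \<delta> \<le> v < 2^(i+1) \<delta> contributes at most K 2^N (2^i
  \<delta>)^(N-t), a geometric series because t > N. The measure is arbitrary, since the lemma
  serves for weighted volumes and for masses of \<phi>.\<close>

lemma nn_integral_powr_large:
  assumes v: "v \<in> borel_measurable M" and \<delta>: "0 < \<delta>" "\<And>x. x \<in> space M \<Longrightarrow> \<delta> \<le> v x"
    and K: "0 \<le> K" "\<And>r. 0 < r \<Longrightarrow> emeasure M {x \<in> space M. v x < r} \<le> ennreal (K * r powr N)"
    and t: "N < t" "0 \<le> t"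
  shows "(\<integral>\<^sup>+x. ennreal (v x powr (- t)) \<partial>M) \<le> ennreal (K * (2 powr N / (1 - 2 powr (N - t))) * \<delta> powr (N - t))"
proof (rule nn_integral_le_suminf)
  let ?a = "\<lambda>i::nat. (2 ^ i * \<delta>) powr (- t)" and ?b = "\<lambda>i::nat. K * (2 ^ Suc i * \<delta>) powr N"
  show "{x \<in> space M. v x < 2 ^ Suc i * \<delta>} \<in> sets M" for i using v by measurable
  show "emeasure M {x \<in> space M. v x < 2 ^ Suc i * \<delta>} \<le> ennreal (?b i)" for i
    using \<delta> by (intro K) simp
  show "0 \<le> ?b i" "0 \<le> ?a i" for i using K by auto
  fix x assume x: "x \<in> space M"
  then have "1 \<le> v x / \<delta>" using \<delta> by simp
  then obtain i where i: "2 ^ i \<le> v x / \<delta>" "v x / \<delta> < 2 ^ Suc i" by (rule dyadic_exists)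
  then have "2 ^ i * \<delta> \<le> v x" "v x < 2 ^ Suc i * \<delta>" using \<delta>(1) by (auto simp: field_simps)
  then show "\<exists>i. x \<in> {x \<in> space M. v x < 2 ^ Suc i * \<delta>} \<and> ennreal (v x powr (- t)) \<le> ennreal (?a i)"
    using x \<delta>(1) t by (intro exI[of _ i]) (auto intro!: ennreal_leI powr_mono2')
next
  let ?a = "\<lambda>i::nat. (2 ^ i * \<delta>) powr (- t)" and ?b = "\<lambda>i::nat. K * (2 ^ Suc i * \<delta>) powr N"
  have p: "(2 ^ i :: real) powr s = (2 powr s) ^ i" for i :: nat and s
    by (simp add: powr_powr powr_realpow[symmetric] mult.commute)
  have eq: "?a i * ?b i = K * 2 powr N * \<delta> powr (N - t) * (2 powr (- (t - N))) ^ i" for i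
  proof -
    have "?a i * ?b i = K * 2 powr N * (\<delta> powr (- t) * \<delta> powr N) * ((2 powr (- t)) ^ i * (2 powr N) ^ i)"
      using \<delta>(1) by (simp add: powr_mult p)
    also have "(2 powr (- t)) ^ i * (2 powr N) ^ i = (2 powr (- (t - N))) ^ i"
      by (simp add: power_mult_distrib[symmetric] powr_add[symmetric])
    also have "\<delta> powr (- t) * \<delta> powr N = \<delta> powr (N - t)"
      by (simp add: powr_add[symmetric])
    finally show ?thesis .
  qed
  show "(\<lambda>i. ?a i * ?b i) sums (K * (2 powr N / (1 - 2 powr (N - t))) * \<delta> powr (N - t))"
    unfolding eq using sums_mult[OF geometric_powr_sums(1)[of "t - N"], of "K * 2 powr N * \<delta> powr (N - t)"] t by (simp add: mult_ac)
qed

text \<open>The counterpart for t < N: the shells between r0 / 2^(i+1) and r0 / 2^i shrink towards v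
  = 0, and their contributions decay like 2^(i (t - N)).\<close>

lemma nn_integral_powr_small:
  assumes v: "v \<in> borel_measurable M" "\<And>x. x \<in> space M \<Longrightarrow> 0 < v x" "\<And>x. x \<in> space M \<Longrightarrow> v x \<le> r0" and r0: "0 < r0"
    and K: "0 \<le> K" "\<And>r. 0 < r \<Longrightarrow> r \<le> r0 \<Longrightarrow> emeasure M {x \<in> space M. v x \<le> r} \<le> ennreal (K * r powr N)"
    and t: "t < N" "0 \<le> t"
  shows "(\<integral>\<^sup>+x. ennreal (v x powr (- t)) \<partial>M) \<le> ennreal (K * (2 powr t / (1 - 2 powr (t - N))) * r0 powr (N - t))"
proof (rule nn_integral_le_suminf)
  let ?a = "\<lambda>i::nat. (r0 / 2 ^ Suc i) powr (- t)" and ?b = "\<lambda>i::nat. K * (r0 / 2 ^ i) powr N"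
  show "{x \<in> space M. v x \<le> r0 / 2 ^ i} \<in> sets M" for i using v(1) by measurable
  show "emeasure M {x \<in> space M. v x \<le> r0 / 2 ^ i} \<le> ennreal (?b i)" for i
    using r0 by (intro K) (auto simp: field_simps)
  show "0 \<le> ?b i" "0 \<le> ?a i" for i using K by auto
  fix x assume x: "x \<in> space M"
  then have "1 \<le> r0 / v x" using v by simp
  then obtain i where i: "2 ^ i \<le> r0 / v x" "r0 / v x < 2 ^ Suc i" by (rule dyadic_exists)
  then have "v x \<le> r0 / 2 ^ i" "r0 / 2 ^ Suc i \<le> v x" using v(2)[OF x] by (auto simp: field_simps)
  then show "\<exists>i. x \<in> {x \<in> space M. v x \<le> r0 / 2 ^ i} \<and> ennreal (v x powr (- t)) \<le> ennreal (?a i)"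
    using x r0 t by (intro exI[of _ i]) (auto intro!: ennreal_leI powr_mono2')
next
  let ?a = "\<lambda>i::nat. (r0 / 2 ^ Suc i) powr (- t)" and ?b = "\<lambda>i::nat. K * (r0 / 2 ^ i) powr N"
  have p: "(2 ^ i :: real) powr s = (2 powr s) ^ i" for i :: nat and s
    by (simp add: powr_powr powr_realpow[symmetric] mult.commute)
  have eq: "?a i * ?b i = K * 2 powr t * r0 powr (N - t) * (2 powr (- (N - t))) ^ i" for i
  proof -
    have "?a i * ?b i = K * 2 powr t * (r0 powr (- t) * r0 powr N) * ((2 powr t) ^ i / (2 powr N) ^ i)"
      using r0 by (simp add: powr_mult powr_divide p powr_minus divide_simps)
    also have "(2 powr t) ^ i / (2 powr N) ^ i = (2 powr (- (N - t))) ^ i"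
      by (simp add: power_divide[symmetric] powr_diff[symmetric])
    also have "r0 powr (- t) * r0 powr N = r0 powr (N - t)"
      by (simp add: powr_add[symmetric])
    finally show ?thesis .
  qed
  show "(\<lambda>i. ?a i * ?b i) sums (K * (2 powr t / (1 - 2 powr (t - N))) * r0 powr (N - t))"
    unfolding eq using sums_mult[OF geometric_powr_sums(1)[of "N - t"], of "K * 2 powr t * r0 powr (N - t)"] t by (simp add: mult_ac)
qed

text \<open>The shape of a nonisotropic ball of radius r near the i-th basis vector: with A of order
  r and B of order sqrt r, it is thin in the complex normal direction and wide in the tangential
  ones.\<close>

definition polydisc :: "'n \<Rightarrow> complex \<Rightarrow> real \<Rightarrow> real \<Rightarrow> (complex ^ 'n) set" where
  "polydisc i c A B = {w. cmod (w $ i - c) < A \<and> (\<forall>j. j \<noteq> i \<longrightarrow> cmod (w $ j) < B)}"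

lemma open_polydisc: "open (polydisc i c A B)"
proof -
  have "polydisc i c A B = {w. cmod (w $ i - c) < A} \<inter> (\<Inter>j\<in>-{i}. {w. cmod (w $ j) < B})"
    by (auto simp: polydisc_def)
  also have "open \<dots>"
    by (intro open_Int open_INT ballI open_Collect_less continuous_intros) auto
  finally show ?thesis .
qed

lemma sets_polydisc [measurable]: "polydisc i c A B \<in> sets borel"
  using open_polydisc by (rule borel_open)

text \<open>A dilation by sqrt r in all 2 n real dimensions gives r^n, and one more dilation by sqrt
  r of the i-th complex coordinate gives the remaining factor r.\<close>

lemma emeasure_polydisc:
  fixes i :: "'n::finite"
  assumes r: "0 < r"
  shows "emeasure lborel (polydisc i c (A * r) (B * sqrt r)) = ennreal (r ^ (CARD('n) + 1)) * emeasure lborel (polydisc i 0 A B)"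
proof -
  let ?P = "polydisc i c (A * r) (B * sqrt r)"
  let ?t = "axis i c :: complex ^ 'n"
  have sr: "0 < sqrt r" using r by simp
  have "emeasure lborel ?P = (\<integral>\<^sup>+z. indicator ?P z \<partial>lborel)" by simp
  also have "\<dots> = ennreal (sqrt r ^ DIM(complex ^ 'n)) * (\<integral>\<^sup>+z. indicator ?P (?t + sqrt r *\<^sub>R z) \<partial>lborel)"
    by (rule nn_integral_affine[OF _ sr]) measurable
  also have "(\<integral>\<^sup>+z. indicator ?P (?t + sqrt r *\<^sub>R z) \<partial>lborel) = (\<integral>\<^sup>+z. indicator (polydisc i 0 (A * sqrt r) B) z \<partial>lborel)"
  proof (rule nn_integral_cong)
    fix z :: "complex ^ 'n"
    have rr: "A * r = sqrt r * (A * sqrt r)" using r by simp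
    have "?t + sqrt r *\<^sub>R z \<in> ?P \<longleftrightarrow> z \<in> polydisc i 0 (A * sqrt r) B"
      unfolding polydisc_def mem_Collect_eq rr using sr by (auto simp: axis_def mult.commute[of B])
    then show "(indicator ?P (?t + sqrt r *\<^sub>R z) :: ennreal) = indicator (polydisc i 0 (A * sqrt r) B) z"
      by (simp add: indicator_def)
  qed
  also have "\<dots> = ennreal ((sqrt r)\<^sup>2) * (\<integral>\<^sup>+z. indicator (polydisc i 0 (A * sqrt r) B) (\<chi> j. if j = i then sqrt r *\<^sub>R z $ j else z $ j) \<partial>lborel)"
    by (rule nn_integral_scale_coordinate[OF _ sr]) measurable
  also have "(\<integral>\<^sup>+z. indicator (polydisc i 0 (A * sqrt r) B) (\<chi> j. if j = i then sqrt r *\<^sub>R z $ j else z $ j) \<partial>lborel)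
    = (\<integral>\<^sup>+z. indicator (polydisc i 0 A B) z \<partial>lborel)"
    by (rule nn_integral_cong) (use sr in \<open>auto simp: polydisc_def indicator_def mult.commute[of _ "sqrt r"]\<close>)
  also have "\<dots> = emeasure lborel (polydisc i 0 A B)" by simp
  also have "sqrt r ^ DIM(complex ^ 'n) = r ^ CARD('n)" using r by (simp add: mult.commute[of _ 2] power_mult)
  finally show ?thesis
    using r by (simp add: mult.assoc[symmetric] ennreal_mult[symmetric] mult.commute)
qed

lemma emeasure_polydisc_finite: "emeasure lborel (polydisc (i::'n::finite) 0 A B) < \<infinity>"
proof -
  have "polydisc i 0 A B \<subseteq> cball 0 (CARD('n) * (\<bar>A\<bar> + \<bar>B\<bar>))"
  proof
    fix w assume w: "w \<in> polydisc i 0 A B"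
    have "norm w \<le> (\<Sum>j\<in>UNIV. cmod (w $ j))" unfolding norm_vec_def by (rule L2_set_le_sum) simp
    also have "\<dots> \<le> (\<Sum>j\<in>(UNIV::'n set). \<bar>A\<bar> + \<bar>B\<bar>)"
    proof (rule sum_mono)
      fix j show "cmod (w $ j) \<le> \<bar>A\<bar> + \<bar>B\<bar>" using w by (cases "j = i") (auto simp: polydisc_def intro: less_imp_le order_trans[OF less_imp_le])
    qed
    finally show "w \<in> cball 0 (CARD('n) * (\<bar>A\<bar> + \<bar>B\<bar>))" by simp
  qed
  then have "emeasure lborel (polydisc i 0 A B) \<le> emeasure lborel (cball (0 :: complex ^ 'n) (CARD('n) * (\<bar>A\<bar> + \<bar>B\<bar>)))"
    by (intro emeasure_mono) auto
  also have "\<dots> < \<infinity>" by (rule emeasure_lborel_cball_finite)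
  finally show ?thesis .
qed

lemma emeasure_polydisc_pos: "0 < A \<Longrightarrow> 0 < B \<Longrightarrow> 0 < emeasure lborel (polydisc (i::'n::finite) 0 A B)"
proof -
  assume "0 < A" "0 < B"
  then have "0 \<in> polydisc i 0 A B" by (simp add: polydisc_def)
  then have "\<exists>e>0. ball 0 e \<subseteq> polydisc i 0 A B" using open_polydisc open_contains_ball by blast
  then obtain e where e: "0 < e" "ball 0 e \<subseteq> polydisc i 0 A B" by blast
  have "0 < measure lborel (ball (0 :: complex ^ 'n) e)" using content_ball_pos[OF e(1)] by simp
  then have "0 < emeasure lborel (ball (0 :: complex ^ 'n) e)"
    by (metis measure_def enn2real_0 not_gr_zero order_less_irrefl)
  also have "\<dots> \<le> emeasure lborel (polydisc i 0 A B)" using e(2) by (intro emeasure_mono) auto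
  finally show ?thesis .
qed

definition cap :: "complex ^ 'n \<Rightarrow> real \<Rightarrow> (complex ^ 'n) set" where
  "cap \<zeta> R = {w. norm w < 1 \<and> kor \<zeta> w < R}"

lemma sets_cap [measurable]: "cap \<zeta> R \<in> sets borel"
proof -
  have "cap \<zeta> R = {w. norm w < 1} \<inter> {w. kor \<zeta> w < R}" by (auto simp: cap_def)
  also have "open \<dots>" by (intro open_Int open_Collect_less continuous_intros)
  finally show ?thesis by (rule borel_open)
qed

text \<open>The tangential coordinates are controlled by the normal one: |w_j|^2 < 1 - |w_i|^2 \<le>
  2 (1 - |w_i|) \<le> 2 |1 - w_i| < 2 R.\<close>

lemma cap_subset_polydisc: "cap (axis i 1) R \<subseteq> polydisc i 1 (1 * R) (sqrt 2 * sqrt R)"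
proof
  fix w assume "w \<in> cap (axis i 1) R"
  then have w: "norm w < 1" "cmod (1 - cnj (w $ i)) < R" by (auto simp: cap_def kor_def herm_axis_left)
  have "cmod (1 - cnj (w $ i)) = cmod (w $ i - 1)"
    by (metis complex_cnj_cnj complex_cnj_diff complex_cnj_one complex_mod_cnj norm_minus_commute)
  with w have R: "cmod (w $ i - 1) < R" by simp
  moreover have "cmod (w $ j) < sqrt 2 * sqrt R" if "j \<noteq> i" for j
  proof -
    have "(norm w)\<^sup>2 = (cmod (w $ i))\<^sup>2 + (\<Sum>k\<in>UNIV - {i}. (cmod (w $ k))\<^sup>2)"
      by (simp add: norm_vec_def L2_set_def sum_nonneg sum.remove[of UNIV i])
    moreover have "(cmod (w $ j))\<^sup>2 \<le> (\<Sum>k\<in>UNIV - {i}. (cmod (w $ k))\<^sup>2)"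
      using that by (intro member_le_sum) auto
    moreover have "(norm w)\<^sup>2 < 1" using w(1) by (simp add: abs_square_less_1)
    ultimately have "(cmod (w $ j))\<^sup>2 < 1 - (cmod (w $ i))\<^sup>2" by linarith
    also have "\<dots> \<le> 2 * (1 - cmod (w $ i))" using zero_le_power2[of "1 - cmod (w $ i)"] by (simp add: power2_eq_square algebra_simps)
    also have "\<dots> \<le> 2 * cmod (w $ i - 1)" using norm_triangle_ineq2[of 1 "w $ i"] by (simp add: norm_minus_commute)
    also have "\<dots> < 2 * R" using R by simp
    finally have "sqrt ((cmod (w $ j))\<^sup>2) < sqrt (2 * R)" by (rule real_sqrt_less_mono)
    then show ?thesis by (simp add: real_sqrt_mult)
  qed
  ultimately show "w \<in> polydisc i 1 (1 * R) (sqrt 2 * sqrt R)" by (simp add: polydisc_def)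
qed

lemma emeasure_cap:
  obtains C :: real where "0 < C"
    "\<And>(\<zeta> :: complex ^ 'n) R. norm \<zeta> = 1 \<Longrightarrow> 0 < R \<Longrightarrow> emeasure lborel (cap \<zeta> R) \<le> ennreal (C * R ^ (CARD('n) + 1))"
proof -
  fix i :: 'n
  define C where "C = enn2real (emeasure lborel (polydisc i 0 1 (sqrt 2)))"
  have C: "emeasure lborel (polydisc i 0 1 (sqrt 2)) = ennreal C"
    using emeasure_polydisc_finite[of i 1 "sqrt 2"] by (simp add: C_def)
  have "0 < C" using emeasure_polydisc_pos[of 1 "sqrt 2" i] unfolding C by simp
  moreover have "emeasure lborel (cap \<zeta> R) \<le> ennreal (C * R ^ (CARD('n) + 1))"
    if \<zeta>: "norm \<zeta> = 1" and R: "0 < R" for \<zeta> :: "complex ^ 'n" and R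
  proof -
    obtain U k where U: "unitary U" "\<zeta> = k *s U (axis i 1)" "cmod k = 1"
      using unitary_transitive[of \<zeta> i] \<zeta> by metis
    have lin: "linear U" and hU: "herm (U x) (U y) = herm x y" for x y using U(1) by (auto simp: unitary_def)
    note nU = unitary_norm[OF U(1)]
    define V where "V x = k *s U x" for x
    have V: "linear V" "norm (V x) = norm x" for x
      using linear_compose[OF lin bounded_linear.linear[OF bounded_linear_vector_smult[of k]]]
      by (simp_all add: V_def[abs_def] o_def norm_vector_smult nU U(3))
    have kk: "k * cnj k = 1" using complex_norm_square[of k] U(3) by simp
    have hV: "herm (V x) (V y) = herm x y" for x y
      by (simp add: V_def herm_smult_left herm_smult_right hU mult.assoc[symmetric] kk mult.commute[of "cnj k"])
    have \<zeta>V: "\<zeta> = V (axis i 1)" by (simp add: V_def U(2))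
    have cV: "V -` cap \<zeta> R = cap (axis i 1) R" by (auto simp: cap_def kor_def \<zeta>V hV V)
    have mV: "V \<in> borel_measurable borel"
      using V(1) linear_continuous_on linear_conv_bounded_linear borel_measurable_continuous_onI by blast
    have "emeasure lborel (cap \<zeta> R) = emeasure (distr lborel borel V) (cap \<zeta> R)"
      by (simp only: lborel_linear_isometry[OF V])
    also have "\<dots> = emeasure lborel (cap (axis i 1) R)"
      by (subst emeasure_distr) (use mV cV in auto)
    also have "\<dots> \<le> emeasure lborel (polydisc i 1 (1 * R) (sqrt 2 * sqrt R))"
      by (intro emeasure_mono cap_subset_polydisc) auto
    also have "\<dots> = ennreal (C * R ^ (CARD('n) + 1))"
      unfolding emeasure_polydisc[OF R] C using R \<open>0 < C\<close> by (simp add: ennreal_mult[symmetric] mult.commute)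
    finally show ?thesis .
  qed
  ultimately show thesis by (rule that)
qed

text \<open>The disjoint dilates \<open>(1 - s)\<^sup>j A\<close> of the thin piece \<open>A\<close> of the cap all lie in a cap of twice
  the size.\<close>

lemma emeasure_cap_layer:
  obtains C :: real where "0 < C"
    "\<And>(\<zeta> :: complex ^ 'n) R s. norm \<zeta> = 1 \<Longrightarrow> 0 < s \<Longrightarrow> s \<le> R \<Longrightarrow> R \<le> 4 \<Longrightarrow>
       emeasure lborel {w \<in> cap \<zeta> R. 1 - norm w \<le> s} \<le> ennreal (C * R ^ CARD('n) * s)"
proof -
  let ?n = "CARD('n)"
  obtain C0 where C0: "0 < C0"
    "\<And>(\<zeta> :: complex ^ 'n) R. norm \<zeta> = 1 \<Longrightarrow> 0 < R \<Longrightarrow> emeasure lborel (cap \<zeta> R) \<le> ennreal (C0 * R ^ (?n + 1))"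
    by (rule emeasure_cap[where ?'n = 'n]) blast
  define C where "C = C0 * 2 ^ (?n + 1) * 4 ^ ?n * 8"
  have C: "0 < C" using C0 by (simp add: C_def)
  have "emeasure lborel {w \<in> cap \<zeta> R. 1 - norm w \<le> s} \<le> ennreal (C * R ^ ?n * s)"
    if \<zeta>: "norm \<zeta> = 1" and s: "0 < s" and sR: "s \<le> R" and R4: "R \<le> 4" for \<zeta> :: "complex ^ 'n" and R s
  proof -
    have R: "0 < R" using s sR by simp
    define A where "A = {w \<in> cap \<zeta> R. 1 - norm w \<le> s}"
    have mA[measurable]: "A \<in> sets borel" unfolding A_def by measurable
    have AC: "A \<subseteq> cap \<zeta> R" by (auto simp: A_def)
    show ?thesis
    proof (cases "s < 1")
      case False
      have "emeasure lborel A \<le> emeasure lborel (cap \<zeta> R)" using AC by (intro emeasure_mono) auto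
      also have "\<dots> \<le> ennreal (C0 * R ^ (?n + 1))" by (rule C0(2)[OF \<zeta> R])
      also have "\<dots> \<le> ennreal (C * R ^ ?n * s)"
      proof (rule ennreal_leI)
        have "C0 * R ^ (?n + 1) = C0 * R * R ^ ?n" by simp
        also have "C0 * R * R ^ ?n \<le> (C0 * 4 * s) * R ^ ?n"
          using False R4 C0(1) R by (intro mult_right_mono) (auto intro: order_trans[of R 4 "4 * s"])
        also have "(C0 * 4 * s) \<le> C * s"
        proof -
          have "(4::real) = 2 * 1 * 2" by simp
          also have "\<dots> \<le> 2 ^ (?n + 1) * 4 ^ ?n * 8" by (intro mult_mono) auto
          finally show ?thesis unfolding C_def using C0(1) s by (simp add: mult.assoc)
        qed
        finally show "C0 * R ^ (?n + 1) \<le> C * R ^ ?n * s" using R by (simp add: mult_ac mult_right_mono)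
      qed
      finally show ?thesis by (simp add: A_def)
    next
      case True
      \<comment> \<open>About m / s dilates are used. Since j s < m \<le> R, they stay in the cap of
        size 2 R; since m \<le> 1/2, the factors (1 - s)^j are at least 1/2 and volumes shrink by at
        most 4^n.\<close>
      define m where "m = min R (1/2)"
      have m: "0 < m" "m \<le> R" "m \<le> 1/2" using R by (auto simp: m_def)
      define J where "J = nat \<lceil>m / s\<rceil>"
      have J: "m / s \<le> real J" "real j * s < m" if "j < J" for j
      proof -
        show "m / s \<le> real J" unfolding J_def by linarith
        have "real j < m / s" using that unfolding J_def by linarith
        then show "real j * s < m" using s by (simp add: field_simps)
      qed
      have J': "m / s \<le> real J" unfolding J_def by linarith
      define q where "q j = (1 - s) ^ j" for j :: nat
      have q: "0 < q j" "q j \<le> 1" for j using s True by (auto simp: q_def power_le_one)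
      have q1: "1 - q j \<le> real j * s" for j
        using Bernoulli_inequality[of "- s" j] s True by (simp add: q_def)
      define D where "D j = (\<lambda>w. (1 / q j) *\<^sub>R w) -` A" for j
      have mD[measurable]: "D j \<in> sets borel" for j
      proof -
        have "(\<lambda>w :: complex ^ 'n. (1 / q j) *\<^sub>R w) \<in> borel_measurable borel" by measurable
        from measurable_sets[OF this mA] show ?thesis by (simp add: D_def)
      qed
      have eD: "ennreal ((1/2) ^ (2 * ?n)) * emeasure lborel A \<le> emeasure lborel (D j)" if "j < J" for j
      proof -
        have "emeasure lborel (D j) = (\<integral>\<^sup>+w. indicator (D j) w \<partial>lborel)" by simp
        also have "\<dots> = ennreal (q j ^ DIM(complex ^ 'n)) * (\<integral>\<^sup>+w. indicator (D j) (0 + q j *\<^sub>R w) \<partial>lborel)"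
          by (rule nn_integral_affine[OF _ q(1)]) measurable
        also have "(\<integral>\<^sup>+w. indicator (D j) (0 + q j *\<^sub>R w) \<partial>lborel) = (\<integral>\<^sup>+w. indicator A w \<partial>lborel)"
          by (rule nn_integral_cong) (use q(1)[of j] in \<open>auto simp: D_def indicator_def\<close>)
        finally have e: "emeasure lborel (D j) = ennreal (q j ^ (2 * ?n)) * emeasure lborel A" by (simp add: mult.commute)
        have "1/2 \<le> q j" using q1[of j] J(2)[OF that] m by linarith
        then have "(1/2) ^ (2 * ?n) \<le> q j ^ (2 * ?n)" by (intro power_mono) auto
        then show ?thesis unfolding e by (intro mult_right_mono ennreal_leI) auto
      qed
      have disj: "disjoint_family_on D {..<J}"
        unfolding disjoint_family_on_def
      proof (intro ballI impI)
        \<comment> \<open>Points of the j-th dilate have norm at least q j (1 - s) = q (j + 1),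
          points of the k-th one norm less than q k \<le> q (j + 1).\<close>
        have aux: "D j \<inter> D k = {}" if "j < k" for j k :: nat
        proof (rule ccontr)
          assume "D j \<inter> D k \<noteq> {}"
          then obtain w where w: "(1 / q j) *\<^sub>R w \<in> A" "(1 / q k) *\<^sub>R w \<in> A" by (auto simp: D_def)
          have 1: "q j * (1 - s) \<le> norm w" using w(1) q(1)[of j] by (simp add: A_def field_simps)
          have 2: "norm w < q k" using w(2) q(1)[of k] by (simp add: A_def cap_def field_simps)
          have "q k \<le> q (Suc j)" unfolding q_def using that s True by (intro power_decreasing) auto
          then show False using 1 2 by (simp add: q_def mult.commute)
        qed
        fix j k :: nat assume "j \<noteq> k"
        then show "D j \<inter> D k = {}" using aux[of j k] aux[of k j] by (cases "j < k") auto
      qed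
      have sub: "D j \<subseteq> cap \<zeta> (2 * R)" if "j < J" for j
      proof
        fix w assume "w \<in> D j"
        then have w: "(1 / q j) *\<^sub>R w \<in> cap \<zeta> R" using AC by (auto simp: D_def)
        let ?w = "(1 / q j) *\<^sub>R w"
        have wq: "w = q j *\<^sub>R ?w" using q(1)[of j] by simp
        have nw: "norm ?w < 1" "kor \<zeta> ?w < R" using w by (auto simp: cap_def)
        have "norm w = q j * norm ?w" using q(1)[of j] by simp
        also have "\<dots> \<le> 1 * norm ?w" using q(2)[of j] by (intro mult_right_mono) auto
        finally have "norm w < 1" using nw by simp
        moreover have "kor \<zeta> w \<le> kor \<zeta> ?w + norm (w - ?w)" by (rule kor_lipschitz) (simp add: \<zeta>)
        moreover have "norm (w - ?w) \<le> 1 - q j"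
        proof -
          define v where "v = ?w"
          have "w = q j *\<^sub>R v" using wq by (simp only: v_def)
          then have "w - v = (q j - 1) *\<^sub>R v" by (simp add: algebra_simps)
          then have "w - ?w = (q j - 1) *\<^sub>R ?w" by (simp only: v_def)
          then have "norm (w - ?w) = (1 - q j) * norm ?w" using q(2)[of j] by (simp only: norm_scaleR) simp
          also have "\<dots> \<le> (1 - q j) * 1" using q(2)[of j] nw by (intro mult_left_mono) auto
          finally show ?thesis by simp
        qed
        moreover have "1 - q j \<le> R" using q1[of j] J(2)[OF that] m by linarith
        ultimately show "w \<in> cap \<zeta> (2 * R)" using nw by (simp add: cap_def)
      qed
      have "ennreal (real J) * (ennreal ((1/2) ^ (2 * ?n)) * emeasure lborel A)
        = (\<Sum>j<J. ennreal ((1/2) ^ (2 * ?n)) * emeasure lborel A)" by (simp add: ennreal_of_nat_eq_real_of_nat)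
      also have "\<dots> \<le> (\<Sum>j<J. emeasure lborel (D j))" by (intro sum_mono eD) auto
      also have "\<dots> = emeasure lborel (\<Union>j<J. D j)"
        using disj by (intro sum_emeasure) auto
      also have "\<dots> \<le> emeasure lborel (cap \<zeta> (2 * R))" using sub by (intro emeasure_mono) auto
      also have "\<dots> \<le> ennreal (C0 * (2 * R) ^ (?n + 1))" by (rule C0(2)[OF \<zeta>]) (use R in simp)
      finally have main: "ennreal (real J) * (ennreal ((1/2) ^ (2 * ?n)) * emeasure lborel A) \<le> ennreal (C0 * (2 * R) ^ (?n + 1))" .
      have Afin: "emeasure lborel A < \<infinity>"
      proof -
        have "emeasure lborel A \<le> emeasure lborel (cap \<zeta> R)" using AC by (intro emeasure_mono) auto
        also have "\<dots> \<le> ennreal (C0 * R ^ (?n + 1))" by (rule C0(2)[OF \<zeta> R])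
        finally show ?thesis by (rule le_less_trans) simp
      qed
      define x where "x = enn2real (emeasure lborel A)"
      have x: "emeasure lborel A = ennreal x" "0 \<le> x" using Afin by (simp_all add: x_def)
      have "real J * ((1/2) ^ (2 * ?n) * x) \<le> C0 * (2 * R) ^ (?n + 1)"
        using main x(2) C0(1) R unfolding x(1) by (simp add: ennreal_mult[symmetric])
      moreover have "m / s * ((1/2) ^ (2 * ?n) * x) \<le> real J * ((1/2) ^ (2 * ?n) * x)"
        using J' x(2) by (intro mult_right_mono) auto
      ultimately have "m / s * ((1/2) ^ (2 * ?n) * x) \<le> C0 * (2 * R) ^ (?n + 1)" by linarith
      moreover have "(1/2 :: real) ^ (2 * ?n) = 1 / 4 ^ ?n" by (simp add: power_mult power_divide)
      ultimately have "m * x \<le> C0 * (2 * R) ^ (?n + 1) * 4 ^ ?n * s" using s by (simp add: field_simps)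
      \<comment> \<open>Here R \<le> 4 enters: it makes 1/2 at least R / 8.\<close>
      moreover have "R / 8 * x \<le> m * x" using x(2) R4 R by (intro mult_right_mono) (auto simp: m_def)
      ultimately have "R * x \<le> R * (C * R ^ ?n * s)"
        unfolding C_def by (simp add: power_mult_distrib mult_ac)
      then have "x \<le> C * R ^ ?n * s" using R by simp
      then show ?thesis unfolding A_def[symmetric] x(1) by (rule ennreal_leI)
    qed
  qed
  with C show thesis by (rule that)
qed

section \<open>Weighted volumes of nonisotropic balls\<close>

lemma sets_bmeas_ball: "X \<in> sets borel \<Longrightarrow> X \<subseteq> ball 0 1 \<Longrightarrow> X \<in> sets (bmeas a)"
  by (simp add: sets_bmeas sets_restrict_space_iff)

lemma emeasure_bmeas:
  assumes X: "X \<in> sets borel" "X \<subseteq> ball 0 1"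
  shows "emeasure (bmeas a) X = (\<integral>\<^sup>+z. ennreal ((1 - (norm z)\<^sup>2) powr a) * indicator X z \<partial>lborel)"
proof -
  have "emeasure (bmeas a) X = (\<integral>\<^sup>+z. indicator X z \<partial>bmeas a)"
    using sets_bmeas_ball[OF X] by simp
  also have "\<dots> = (\<integral>\<^sup>+z. indicator (ball 0 1) z * (ennreal ((1 - (norm z)\<^sup>2) powr a) * indicator X z) \<partial>lborel)"
    by (rule nn_integral_bmeas) (use sets_bmeas_ball[OF X] in simp)
  also have "\<dots> = (\<integral>\<^sup>+z. ennreal ((1 - (norm z)\<^sup>2) powr a) * indicator X z \<partial>lborel)"
    by (rule nn_integral_cong) (use X(2) in \<open>auto simp: indicator_def\<close>)
  finally show ?thesis .
qed

text \<open>If some w is closer to z than r, then 1 - norm z < r, so moving the centre radially to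
  the sphere changes distances by less than r.\<close>

lemma kor_boundary_point:
  fixes z :: "complex ^ 'n"
  assumes z: "z \<in> ball 0 1" and r: "0 < r"
  obtains \<zeta> where "norm \<zeta> = 1" "\<And>w. w \<in> ball 0 1 \<Longrightarrow> kor z w < r \<Longrightarrow> w \<in> cap \<zeta> (2 * r)"
proof -
  fix i :: 'n
  define \<zeta> where "\<zeta> = (if z = 0 then axis i 1 else (1 / norm z) *\<^sub>R z)"
  have n\<zeta>: "norm \<zeta> = 1" by (simp add: \<zeta>_def norm_axis_1)
  have "w \<in> cap \<zeta> (2 * r)" if w: "w \<in> ball 0 1" and kr: "kor z w < r" for w
  proof -
    have w1: "norm w \<le> 1" using w by simp
    have "z = norm z *\<^sub>R \<zeta>" by (simp add: \<zeta>_def)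
    then have "norm (\<zeta> - z) = norm ((1 - norm z) *\<^sub>R \<zeta>)" by (simp add: algebra_simps)
    also have "\<dots> = 1 - norm z" using z n\<zeta> by simp
    finally have "norm (\<zeta> - z) = 1 - norm z" .
    moreover have "1 - norm z < r" using kor_ge[of z w] z w1 kr by simp
    moreover have "kor \<zeta> w \<le> kor z w + norm (\<zeta> - z)"
      using kor_lipschitz[OF w1, of \<zeta> z] by (simp add: kor_sym)
    ultimately show ?thesis using w kr by (simp add: cap_def)
  qed
  with n\<zeta> show thesis by (rule that)
qed

lemma one_minus_norm_square:
  fixes w :: "'a::real_normed_vector"
  assumes "norm w \<le> 1"
  shows "1 - norm w \<le> 1 - (norm w)\<^sup>2" "1 - (norm w)\<^sup>2 \<le> 2 * (1 - norm w)"
proof -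
  have "norm w * norm w \<le> norm w" using assms by (simp add: mult_left_le)
  then show "1 - norm w \<le> 1 - (norm w)\<^sup>2" by (simp add: power2_eq_square)
  show "1 - (norm w)\<^sup>2 \<le> 2 * (1 - norm w)" using zero_le_power2[of "1 - norm w"] by (simp add: power2_eq_square algebra_simps)
qed

lemma sets_kor_less [measurable]: "{w. kor z w < r} \<in> sets borel" "{w. 1 - norm w \<le> s} \<in> sets borel"
proof -
  show "{w. kor z w < r} \<in> sets borel" by (intro borel_open open_Collect_less continuous_intros)
  show "{w. 1 - norm w \<le> s} \<in> sets borel" by (intro borel_closed closed_Collect_le continuous_intros)
qed

text \<open>For a \<ge> 0 the weight is at most (2 s)^a on the layer. For a < 0 it is singular at
  the sphere; the Lebesgue measure of thinner layers is linear in their width, and the shell sum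
  converges because - a < 1.\<close>

lemma emeasure_bmeas_layer:
  assumes a: "a > -1"
  obtains C :: real where "0 < C"
    "\<And>(z :: complex ^ 'n) r s. z \<in> ball 0 1 \<Longrightarrow> 0 < s \<Longrightarrow> s \<le> r \<Longrightarrow>
       emeasure (bmeas a) {w \<in> ball 0 1. kor z w < r \<and> 1 - norm w \<le> s} \<le> ennreal (C * r ^ CARD('n) * s powr (1 + a))"
proof -
  let ?n = "CARD('n)"
  obtain C0 where C0: "0 < C0"
    "\<And>(\<zeta> :: complex ^ 'n) R s. norm \<zeta> = 1 \<Longrightarrow> 0 < s \<Longrightarrow> s \<le> R \<Longrightarrow> R \<le> 4 \<Longrightarrow>
       emeasure lborel {w \<in> cap \<zeta> R. 1 - norm w \<le> s} \<le> ennreal (C0 * R ^ ?n * s)"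
    by (rule emeasure_cap_layer[where ?'n = 'n]) blast
  define c where "c = (if a \<ge> 0 then 2 powr a else 2 powr (- a) / (1 - 2 powr (- a - 1)))"
  have c: "0 < c"
    using a powr_less_one[of 2 "- a - 1"] by (auto simp: c_def)
  have layer: "(\<integral>\<^sup>+w. ennreal ((1 - (norm w)\<^sup>2) powr a) * indicator {w \<in> cap \<zeta> R. 1 - norm w \<le> s} w \<partial>lborel)
      \<le> ennreal (C0 * R ^ ?n * c * s powr (1 + a))"
    if \<zeta>: "norm \<zeta> = 1" and s: "0 < s" and sR: "s \<le> R" and R4: "R \<le> 4" for \<zeta> :: "complex ^ 'n" and R s
  proof -
    let ?A = "{w \<in> cap \<zeta> R. 1 - norm w \<le> s}"
    have R: "0 < R" using s sR by simp
    have mA[measurable]: "?A \<in> sets borel" by measurable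
    have A1: "norm w < 1" if "w \<in> ?A" for w using that by (auto simp: cap_def)
    show ?thesis
    proof (cases "a \<ge> 0")
      case True
      have "(\<integral>\<^sup>+w. ennreal ((1 - (norm w)\<^sup>2) powr a) * indicator ?A w \<partial>lborel)
        \<le> (\<integral>\<^sup>+w. ennreal ((2 * s) powr a) * indicator ?A w \<partial>lborel)"
      proof (rule nn_integral_mono)
        fix w
        have "(1 - (norm w)\<^sup>2) powr a \<le> (2 * s) powr a" if "w \<in> ?A"
          using one_minus_norm_square[of w] A1[OF that] that True by (intro powr_mono2) auto
        then show "ennreal ((1 - (norm w)\<^sup>2) powr a) * indicator ?A w \<le> ennreal ((2 * s) powr a) * indicator ?A w"
          by (auto simp: indicator_def intro: ennreal_leI)
      qed
      also have "\<dots> = ennreal ((2 * s) powr a) * emeasure lborel ?A" by (rule nn_integral_cmult_indicator) simp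
      also have "\<dots> \<le> ennreal ((2 * s) powr a) * ennreal (C0 * R ^ ?n * s)"
        by (intro mult_left_mono C0(2) \<zeta> s sR R4) simp
      also have "\<dots> = ennreal (C0 * R ^ ?n * c * s powr (1 + a))"
        using s R C0(1) True by (simp add: ennreal_mult[symmetric] c_def powr_mult powr_add mult_ac)
      finally show ?thesis .
    next
      case False
      let ?M = "restrict_space lborel ?A"
      have spM: "space ?M = ?A" by (simp add: space_restrict_space)
      have "(\<integral>\<^sup>+w. ennreal ((1 - (norm w)\<^sup>2) powr a) * indicator ?A w \<partial>lborel)
        \<le> (\<integral>\<^sup>+w. ennreal ((1 - norm w) powr (- (- a))) * indicator ?A w \<partial>lborel)"
      proof (rule nn_integral_mono)
        fix w
        have "(1 - (norm w)\<^sup>2) powr a \<le> (1 - norm w) powr a" if "w \<in> ?A"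
          using one_minus_norm_square[of w] A1[OF that] False by (intro powr_mono2') auto
        then show "ennreal ((1 - (norm w)\<^sup>2) powr a) * indicator ?A w \<le> ennreal ((1 - norm w) powr (- (- a))) * indicator ?A w"
          by (auto simp: indicator_def intro: ennreal_leI)
      qed
      also have "\<dots> = (\<integral>\<^sup>+w. ennreal ((1 - norm w) powr (- (- a))) \<partial>?M)"
        by (simp add: nn_integral_restrict_space)
      also have "\<dots> \<le> ennreal (C0 * R ^ ?n * (2 powr (- a) / (1 - 2 powr (- a - 1))) * s powr (1 - (- a)))"
      proof (rule nn_integral_powr_small[OF _ _ _ s])
        show "(\<lambda>w. 1 - norm w) \<in> borel_measurable ?M" by (intro measurable_restrict_space1) simp
        show "0 < 1 - norm w" "1 - norm w \<le> s" if "w \<in> space ?M" for w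
          using that A1[of w] unfolding spM by auto
        show "0 \<le> C0 * R ^ ?n" using C0(1) R by simp
        show "- a < 1" "0 \<le> - a" using a False by auto
        fix r :: real assume r: "0 < r" "r \<le> s"
        have "emeasure ?M {w \<in> space ?M. 1 - norm w \<le> r} = emeasure lborel {w \<in> cap \<zeta> R. 1 - norm w \<le> r}"
          unfolding spM using r by (subst emeasure_restrict_space) (auto intro!: arg_cong[where f="emeasure lborel"])
        also have "\<dots> \<le> ennreal (C0 * R ^ ?n * r)" using r sR by (intro C0(2) \<zeta> R4) auto
        finally show "emeasure ?M {w \<in> space ?M. 1 - norm w \<le> r} \<le> ennreal (C0 * R ^ ?n * r powr 1)" using r by simp
      qed
      finally show ?thesis using False by (simp add: c_def)
    qed
  qed
  define C where "C = C0 * 2 ^ ?n * c"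
  have "0 < C" using C0(1) c by (simp add: C_def)
  moreover have "emeasure (bmeas a) {w \<in> ball 0 1. kor z w < r \<and> 1 - norm w \<le> s} \<le> ennreal (C * r ^ ?n * s powr (1 + a))"
    if z: "z \<in> ball 0 1" and s: "0 < s" and sr: "s \<le> r" for z :: "complex ^ 'n" and r s
  proof -
    \<comment> \<open>On the ball both \<open>kor\<close> and 1 - norm w are at most 2, so cutting
      both parameters at 2 loses nothing, and the cap of size 2 r' meets the bound 4 of the
      unweighted estimate.\<close>
    define r' s' where "r' = min r 2" and "s' = min s 2"
    have rs: "0 < s'" "s' \<le> r'" "r' \<le> 2" "r' \<le> r" "s' \<le> s" using s sr by (auto simp: r'_def s'_def)
    obtain \<zeta> where \<zeta>: "norm \<zeta> = 1" "\<And>w. w \<in> ball 0 1 \<Longrightarrow> kor z w < r' \<Longrightarrow> w \<in> cap \<zeta> (2 * r')"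
      by (rule kor_boundary_point[OF z, of r']) (use rs in auto)
    let ?A = "{w \<in> cap \<zeta> (2 * r'). 1 - norm w \<le> s'}"
    have sub: "{w \<in> ball 0 1. kor z w < r \<and> 1 - norm w \<le> s} \<subseteq> ?A"
    proof
      fix w assume w: "w \<in> {w \<in> ball 0 1. kor z w < r \<and> 1 - norm w \<le> s}"
      then have "kor z w < r'" using kor_less_2[OF z, of w] by (simp add: r'_def)
      moreover have "1 - norm w \<le> 2" using norm_ge_zero[of w] by linarith
      then have "1 - norm w \<le> s'" using w by (simp add: s'_def)
      ultimately show "w \<in> ?A" using \<zeta>(2)[of w] w by simp
    qed
    have Ab: "?A \<in> sets borel" by measurable
    have A1: "?A \<subseteq> ball 0 1" by (auto simp: cap_def)
    have "emeasure (bmeas a) {w \<in> ball 0 1. kor z w < r \<and> 1 - norm w \<le> s} \<le> emeasure (bmeas a) ?A"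
      using sub sets_bmeas_ball[OF Ab A1] by (rule emeasure_mono)
    also have "\<dots> \<le> ennreal (C0 * (2 * r') ^ ?n * c * s' powr (1 + a))"
      unfolding emeasure_bmeas[OF Ab A1] by (rule layer[OF \<zeta>(1)]) (use rs in auto)
    also have "\<dots> \<le> ennreal (C0 * (2 * r) ^ ?n * c * s powr (1 + a))"
      using rs C0(1) c a by (intro ennreal_leI mult_mono power_mono powr_mono2) auto
    finally show ?thesis by (simp add: C_def power_mult_distrib mult_ac)
  qed
  ultimately show thesis by (rule that)
qed

text \<open>Because 1 - norm w \<le> kor z w, a ball of radius r is its own boundary layer of width
  r.\<close>

lemma emeasure_bmeas_kor:
  assumes a: "a > -1"
  obtains C :: real where "0 < C"
    "\<And>(z :: complex ^ 'n) r. z \<in> ball 0 1 \<Longrightarrow> 0 < r \<Longrightarrow>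
       emeasure (bmeas a) {w \<in> ball 0 1. kor z w < r} \<le> ennreal (C * r powr (real CARD('n) + 1 + a))"
proof -
  obtain C where C: "0 < C"
    "\<And>(z :: complex ^ 'n) r s. z \<in> ball 0 1 \<Longrightarrow> 0 < s \<Longrightarrow> s \<le> r \<Longrightarrow>
       emeasure (bmeas a) {w \<in> ball 0 1. kor z w < r \<and> 1 - norm w \<le> s} \<le> ennreal (C * r ^ CARD('n) * s powr (1 + a))"
    by (rule emeasure_bmeas_layer[OF a, where ?'n = 'n]) blast
  show thesis
  proof (rule that[OF C(1)])
    fix z :: "complex ^ 'n" and r :: real assume z: "z \<in> ball 0 1" and r: "0 < r"
    have "{w \<in> ball 0 1. kor z w < r} = {w \<in> ball 0 1. kor z w < r \<and> 1 - norm w \<le> r}"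
    proof (intro Collect_cong conj_cong refl iffI conjI)
      fix w :: "complex ^ 'n" assume "w \<in> ball 0 1" "kor z w < r"
      then show "1 - norm w \<le> r" using kor_ge[of w z] z by (simp add: kor_sym)
    qed auto
    then have "emeasure (bmeas a) {w \<in> ball 0 1. kor z w < r} \<le> ennreal (C * r ^ CARD('n) * r powr (1 + a))"
      using C(2)[OF z r order_refl] by simp
    also have "C * r ^ CARD('n) * r powr (1 + a) = C * r powr (real CARD('n) + 1 + a)"
      using r by (simp add: powr_add powr_realpow)
    finally show "emeasure (bmeas a) {w \<in> ball 0 1. kor z w < r} \<le> ennreal (C * r powr (real CARD('n) + 1 + a))" .
  qed
qed

lemma measurable_kor_bmeas [measurable]: "(\<lambda>w. kor z w) \<in> borel_measurable (bmeas a)"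
  by (intro borel_measurable_bmeas continuous_intros)

text \<open>The distance of z to any point of the ball is at least 1 - norm z, so the shells start
  at this radius.\<close>

lemma forelli_rudin:
  assumes a: "a > -1" and t: "t > real CARD('n) + 1 + a"
  obtains C :: real where "0 < C"
    "\<And>z :: complex ^ 'n. z \<in> ball 0 1 \<Longrightarrow>
       (\<integral>\<^sup>+w. ennreal (kor z w powr (- t)) \<partial>bmeas a) \<le> ennreal (C * (1 - norm z) powr (real CARD('n) + 1 + a - t))"
proof -
  let ?N = "real CARD('n) + 1 + a"
  obtain C where C: "0 < C"
    "\<And>(z :: complex ^ 'n) r. z \<in> ball 0 1 \<Longrightarrow> 0 < r \<Longrightarrow>
       emeasure (bmeas a) {w \<in> ball 0 1. kor z w < r} \<le> ennreal (C * r powr ?N)"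
    by (rule emeasure_bmeas_kor[OF a, where ?'n = 'n]) blast
  have "0 < C * (2 powr ?N / (1 - 2 powr (?N - t)))" using C(1) t powr_less_one[of 2 "?N - t"] by simp
  then show thesis
  proof (rule that)
    fix z :: "complex ^ 'n" assume z: "z \<in> ball 0 1"
    show "(\<integral>\<^sup>+w. ennreal (kor z w powr (- t)) \<partial>bmeas a) \<le> ennreal (C * (2 powr ?N / (1 - 2 powr (?N - t))) * (1 - norm z) powr (?N - t))"
    proof (rule nn_integral_powr_large)
      show "emeasure (bmeas a) {w \<in> space (bmeas a). kor z w < r} \<le> ennreal (C * r powr ?N)" if "0 < r" for r
        using C(2)[OF z that] by simp
    qed (use z C(1) t a in \<open>auto intro!: kor_ge\<close>)
  qed
qed

lemma unitary_transitive_norm: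
  fixes z :: "complex ^ 'n"
  obtains V where "unitary V" "z = of_real (norm z) *s V (axis i 1)"
proof -
  obtain U k where U: "unitary U" "z = k *s U (axis i 1)" "cmod k = norm z"
    by (rule unitary_transitive)
  show thesis
  proof (cases "k = 0")
    case True
    then show ?thesis using that[OF U(1)] U(2,3) by simp
  next
    case False
    define c where "c = k / cmod k"
    have c: "of_real (norm z) * c = k" "c * cnj c = 1"
      using False complex_norm_square[of k] by (simp_all add: c_def U(3)[symmetric] power2_eq_square)
    have lin: "linear U" and hom: "U (d *s x) = d *s U x" and hU: "herm (U x) (U y) = herm x y" for d x y
      using U(1) by (auto simp: unitary_def)
    have "unitary (\<lambda>x. c *s U x)"
      unfolding unitary_def
    proof (intro conjI allI)
      show "linear (\<lambda>x. c *s U x)"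
        using linear_compose[OF lin bounded_linear.linear[OF bounded_linear_vector_smult[of c]]] by (simp add: o_def)
      show "herm (c *s U x) (c *s U y) = herm x y" for x y
        by (simp add: herm_smult_left herm_smult_right hU mult.assoc[symmetric] c(2) mult.commute[of "cnj c"])
    qed (simp add: hom mult.commute)
    then show ?thesis using that[of "\<lambda>x. c *s U x"] U(2) c(1) by simp
  qed
qed

text \<open>After a unitary map the ball contains a polydisc around (1 - h) times the i-th basis
  vector, h = s / 32. On it 1 - |w|^2 lies between s / 64 and s, so the weight is at least a
  constant times s^a whatever the sign of a.\<close>

lemma emeasure_bmeas_kor_ge:
  assumes a: "a > -1"
  obtains c :: real where "0 < c"
    "\<And>(z :: complex ^ 'n) s. z \<in> ball 0 1 \<Longrightarrow> 2 * (1 - norm z) \<le> s \<Longrightarrow> s \<le> 8 \<Longrightarrow>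
       ennreal (c * s powr (real CARD('n) + 1 + a)) \<le> emeasure (bmeas a) {w \<in> ball 0 1. kor z w < s}"
proof -
  fix i :: 'n
  let ?n = "CARD('n)"
  have n: "real ?n > 0" by simp
  \<comment> \<open>With this B the tangential coordinates add at most n B^2 s = h / 4 to
    |w|^2.\<close>
  define B where "B = sqrt (1 / (128 * real ?n))"
  have B: "0 < B" "B\<^sup>2 = 1 / (128 * real ?n)" using n by (simp_all add: B_def)
  define d where "d = enn2real (emeasure lborel (polydisc i 0 (1/128) B))"
  have d: "emeasure lborel (polydisc i 0 (1/128) B) = ennreal d"
    using emeasure_polydisc_finite[of i "1/128" B] by (simp add: d_def)
  have d0: "0 < d" using emeasure_polydisc_pos[of "1/128" B i] B unfolding d by simp
  define c1 :: real where "c1 = (if a \<ge> 0 then (1/64) powr a else 1)"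
  have c1: "0 < c1" by (simp add: c1_def)
  have "0 < c1 * d" using c1 d0 by simp
  then show thesis
  proof (rule that)
    fix z :: "complex ^ 'n" and s :: real
    assume z: "z \<in> ball 0 1" and zs: "2 * (1 - norm z) \<le> s" and s8: "s \<le> 8"
    have s: "0 < s" using z zs by simp
    define h where "h = s / 32"
    have h: "0 < h" "h \<le> 1/4" "s = 32 * h" using s s8 by (simp_all add: h_def)
    define P where "P = polydisc i (of_real (1 - h)) (1/128 * s) (B * sqrt s)"
    have P: "norm w < 1 \<and> s / 64 \<le> 1 - (norm w)\<^sup>2 \<and> 1 - (norm w)\<^sup>2 \<le> s \<and> cmod (1 - w $ i) \<le> 5 / 4 * h" if "w \<in> P" for w
    proof -
      have wi: "cmod (w $ i - of_real (1 - h)) < h / 4" using that by (simp add: P_def polydisc_def h_def)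
      have wj: "cmod (w $ j) < B * sqrt s" if "j \<noteq> i" for j using \<open>w \<in> P\<close> that by (simp add: P_def polydisc_def)
      have e: "w $ i = of_real (1 - h) + (w $ i - of_real (1 - h))" by simp
      have "cmod (w $ i) \<le> cmod (of_real (1 - h)) + cmod (w $ i - of_real (1 - h))"
        by (subst e) (rule norm_triangle_ineq)
      also have "cmod (of_real (1 - h)) = 1 - h" using h unfolding norm_of_real by simp
      finally have w1: "cmod (w $ i) \<le> 1 - 3 / 4 * h" using wi by simp
      have "1 - w $ i = of_real h - (w $ i - of_real (1 - h))" by simp
      then have "cmod (1 - w $ i) \<le> cmod (of_real h) + cmod (w $ i - of_real (1 - h))"
        by (metis norm_triangle_ineq4)
      then have w2: "cmod (1 - w $ i) \<le> 5 / 4 * h" using wi h by simp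
      have nw: "(norm w)\<^sup>2 = (cmod (w $ i))\<^sup>2 + (\<Sum>k\<in>UNIV - {i}. (cmod (w $ k))\<^sup>2)"
        by (simp add: norm_vec_def L2_set_def sum_nonneg sum.remove[of UNIV i])
      have "(\<Sum>k\<in>UNIV - {i}. (cmod (w $ k))\<^sup>2) \<le> (\<Sum>k\<in>UNIV - {i}. B\<^sup>2 * s)"
      proof (rule sum_mono)
        fix k assume "k \<in> UNIV - {i}"
        then have "(cmod (w $ k))\<^sup>2 \<le> (B * sqrt s)\<^sup>2" using wj[of k] by (intro power_mono) auto
        then show "(cmod (w $ k))\<^sup>2 \<le> B\<^sup>2 * s" using s by (simp add: power_mult_distrib)
      qed
      also have "\<dots> \<le> (\<Sum>k\<in>(UNIV :: 'n set). B\<^sup>2 * s)" using s by (intro sum_mono2) auto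
      also have "\<dots> = h / 4" using n by (simp add: B(2) h_def)
      finally have S: "(\<Sum>k\<in>UNIV - {i}. (cmod (w $ k))\<^sup>2) \<le> h / 4" .
      have "(cmod (w $ i))\<^sup>2 \<le> cmod (w $ i)" using w1 h by (simp add: power2_eq_square mult_left_le)
      then have n1: "(norm w)\<^sup>2 \<le> 1 - h / 2" using nw S w1 by linarith
      then have "(norm w)\<^sup>2 < 1" using h by linarith
      then have "norm w < 1" by (simp add: abs_square_less_1)
      moreover have "1 - (norm w)\<^sup>2 \<le> s"
      proof -
        have "1 - (norm w)\<^sup>2 \<le> 1 - (cmod (w $ i))\<^sup>2" unfolding nw by (simp add: sum_nonneg)
        also have "\<dots> \<le> 2 * (1 - cmod (w $ i))"
          using zero_le_power2[of "1 - cmod (w $ i)"] by (simp add: power2_eq_square algebra_simps)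
        also have "1 - cmod (w $ i) \<le> cmod (1 - w $ i)" using norm_triangle_ineq2[of 1 "w $ i"] by simp
        also have "2 * cmod (1 - w $ i) \<le> 2 * (5 / 4 * h)" using w2 by simp
        also have "\<dots> \<le> s" using h by simp
        finally show ?thesis by simp
      qed
      ultimately show ?thesis using n1 w2 h by simp
    qed
    obtain V where V: "unitary V" "z = of_real (norm z) *s V (axis i 1)" by (rule unitary_transitive_norm)
    have lin: "linear V" and hV: "herm (V x) (V y) = herm x y" for x y using V(1) by (auto simp: unitary_def)
    note nV = unitary_norm[OF V(1)]
    let ?X = "{w \<in> ball 0 1. kor z w < s}"
    have Xs: "?X \<in> sets (bmeas a)"
    proof (rule sets_bmeas_ball)
      have "?X = cap z s" by (auto simp: cap_def)
      then show "?X \<in> sets borel" by simp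
    qed auto
    have PX: "P \<subseteq> V -` ?X \<inter> space (bmeas a)"
    proof
      fix w assume w: "w \<in> P"
      have "kor z (V w) = cmod (1 - of_real (norm z) * cnj (w $ i))"
        unfolding kor_def by (subst V(2)) (simp add: herm_smult_left hV herm_axis_left)
      also have "1 - of_real (norm z) * cnj (w $ i) = of_real (1 - norm z) + of_real (norm z) * cnj (1 - w $ i)"
        by (simp add: algebra_simps)
      also have "cmod \<dots> \<le> cmod (of_real (1 - norm z)) + cmod (of_real (norm z) * cnj (1 - w $ i))"
        by (rule norm_triangle_ineq)
      also have "\<dots> = (1 - norm z) + norm z * cmod (1 - w $ i)"
        using z unfolding norm_mult norm_of_real complex_mod_cnj by simp
      finally have "kor z (V w) \<le> (1 - norm z) + norm z * cmod (1 - w $ i)" .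
      \<comment> \<open>The assumption 2 (1 - norm z) \<le> s provides the first half of s; the
        other term is 5 s / 128.\<close>
      also have "\<dots> \<le> s / 2 + 5 / 4 * h"
      proof (rule add_mono)
        have "norm z * cmod (1 - w $ i) \<le> 1 * cmod (1 - w $ i)" using z by (intro mult_right_mono) auto
        also have "\<dots> \<le> 5 / 4 * h" using P[OF w] by simp
        finally show "norm z * cmod (1 - w $ i) \<le> 5 / 4 * h" .
      qed (use zs in simp)
      also have "\<dots> < s" using h(1) unfolding h(3) by simp
      finally have "kor z (V w) < s" .
      then show "w \<in> V -` ?X \<inter> space (bmeas a)" using P[OF w] nV by simp
    qed
    have Pb: "P \<in> sets borel" "P \<subseteq> ball 0 1" using P by (auto simp: P_def)
    have "c1 * d * s powr (real ?n + 1 + a) = c1 * s powr a * (d * s ^ (?n + 1))"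
      using s by (simp add: powr_add powr_realpow)
    then have "ennreal (c1 * d * s powr (real ?n + 1 + a)) = ennreal (c1 * s powr a) * ennreal (d * s ^ (?n + 1))"
      using c1 d0 s by (simp only: ennreal_mult[symmetric] mult_nonneg_nonneg less_imp_le powr_ge_zero zero_le_power)
    also have "ennreal (d * s ^ (?n + 1)) = emeasure lborel P"
      unfolding P_def emeasure_polydisc[OF s] d using d0 s by (subst ennreal_mult[symmetric]) (auto simp: mult.commute)
    also have "ennreal (c1 * s powr a) * emeasure lborel P = (\<integral>\<^sup>+w. ennreal (c1 * s powr a) * indicator P w \<partial>lborel)"
      using Pb by (simp add: nn_integral_cmult_indicator)
    also have "\<dots> \<le> (\<integral>\<^sup>+w. ennreal ((1 - (norm w)\<^sup>2) powr a) * indicator P w \<partial>lborel)"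
    proof (rule nn_integral_mono)
      fix w
      have "c1 * s powr a \<le> (1 - (norm w)\<^sup>2) powr a" if "w \<in> P"
      proof (cases "a \<ge> 0")
        case True
        then have "c1 * s powr a = (s / 64) powr a" using s by (simp add: c1_def powr_mult powr_divide)
        also have "\<dots> \<le> (1 - (norm w)\<^sup>2) powr a" using P[OF that] s True by (intro powr_mono2) auto
        finally show ?thesis .
      next
        case False
        then show ?thesis using P[OF that] s by (auto simp: c1_def intro!: powr_mono2')
      qed
      then show "ennreal (c1 * s powr a) * indicator P w \<le> ennreal ((1 - (norm w)\<^sup>2) powr a) * indicator P w"
        by (auto simp: indicator_def intro: ennreal_leI)
    qed
    also have "\<dots> = emeasure (bmeas a) P" by (rule emeasure_bmeas[OF Pb, symmetric])
    also have "\<dots> \<le> emeasure (bmeas a) (V -` ?X \<inter> space (bmeas a))"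
      using PX measurable_sets[OF unitary_measurable[OF lin nV] Xs] by (rule emeasure_mono)
    also have "\<dots> = emeasure (distr (bmeas a) (bmeas a) V) ?X"
      by (rule emeasure_distr[symmetric, OF unitary_measurable[OF lin nV] Xs])
    also have "\<dots> = emeasure (bmeas a) ?X" by (simp only: distr_bmeas_isometry[OF lin nV])
    finally show "ennreal (c1 * d * s powr (real ?n + 1 + a)) \<le> emeasure (bmeas a) ?X" .
  qed
qed

section \<open>The weak-type estimate\<close>

lemma borel_measurable_kor [measurable (raw)]:
  "f \<in> borel_measurable M \<Longrightarrow> g \<in> borel_measurable M \<Longrightarrow> (\<lambda>x. kor (f x) (g x :: complex ^ 'n)) \<in> borel_measurable M"
  by (rule borel_measurable_continuous_Pair[where H=kor]) (auto intro!: continuous_intros)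

lemma measurable_bmeas_coordinates [measurable]:
  "(\<lambda>x. x) \<in> borel_measurable (bmeas a)"
  "fst \<in> borel_measurable (bmeas a \<Otimes>\<^sub>M M)" "snd \<in> borel_measurable (M \<Otimes>\<^sub>M bmeas a)"
proof -
  show id: "(\<lambda>x. x) \<in> borel_measurable (bmeas a)" for a by (rule borel_measurable_bmeas_borel) simp
  show "fst \<in> borel_measurable (bmeas a \<Otimes>\<^sub>M M)" by (rule measurable_compose[OF measurable_fst id])
  show "snd \<in> borel_measurable (M \<Otimes>\<^sub>M bmeas a)" by (rule measurable_compose[OF measurable_snd id])
qed

definition kball :: "complex ^ 'n \<Rightarrow> real \<Rightarrow> (complex ^ 'n) set" where
  "kball z r = {w \<in> ball 0 1. kor z w < r}"

lemma sets_kball [measurable, simp]: "kball z r \<in> sets (bmeas a)"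
proof -
  have "kball z r = {w \<in> space (bmeas a). kor z w < r}" by (simp add: kball_def)
  also have "\<dots> \<in> sets (bmeas a)" by measurable
  finally show ?thesis .
qed

text \<open>The radii are written as squares times s because it is their square roots that add
  up.\<close>

lemma kball_chain:
  assumes "z \<in> ball 0 1" "u \<in> ball 0 1" "w \<in> ball 0 1"
    and "kor z u \<le> a\<^sup>2 * s" "kor u w \<le> b\<^sup>2 * s" "0 \<le> a" "0 \<le> b" "0 \<le> s"
  shows "kor z w \<le> (a + b)\<^sup>2 * s"
proof -
  have "kor z w \<le> (a * sqrt s + b * sqrt s)\<^sup>2"
    by (rule kor_triangle[of z u w]) (use assms in \<open>auto simp: power_mult_distrib\<close>)
  also have "\<dots> = (a + b)\<^sup>2 * s" using assms by (simp add: distrib_right[symmetric] power_mult_distrib)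
  finally show ?thesis .
qed

text \<open>Greedy selection: take a set with largest r, discard all sets that meet it, and continue
  with the rest.\<close>

lemma finite_vitali:
  fixes r :: "'i \<Rightarrow> real" and B :: "'i \<Rightarrow> 'b set"
  assumes "finite I" "\<And>i. i \<in> I \<Longrightarrow> B i \<noteq> {}"
  shows "\<exists>J\<subseteq>I. disjoint_family_on B J \<and> (\<forall>i\<in>I. \<exists>j\<in>J. B i \<inter> B j \<noteq> {} \<and> r i \<le> r j)"
  using assms
proof (induction I rule: finite_psubset_induct)
  case (psubset I)
  show ?case
  proof (cases "I = {}")
    case False
    have "Max (r ` I) \<in> r ` I" using psubset False by (intro Max_in) auto
    then obtain i0 where i0: "i0 \<in> I" "r i0 = Max (r ` I)" by auto
    have max: "r i \<le> r i0" if "i \<in> I" for i unfolding i0(2) using psubset that by (intro Max_ge) auto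
    define I' where "I' = {i \<in> I. B i \<inter> B i0 = {}}"
    have "I' \<subset> I" using i0(1) psubset.prems[OF i0(1)] by (auto simp: I'_def)
    moreover have "B i \<noteq> {}" if "i \<in> I'" for i using psubset.prems that by (auto simp: I'_def)
    ultimately obtain J' where J': "J' \<subseteq> I'" "disjoint_family_on B J'"
      "\<And>i. i \<in> I' \<Longrightarrow> \<exists>j\<in>J'. B i \<inter> B j \<noteq> {} \<and> r i \<le> r j"
      using psubset.IH[of I'] by blast
    show ?thesis
    proof (intro exI[of _ "insert i0 J'"] conjI ballI)
      show "insert i0 J' \<subseteq> I" using i0 J' by (auto simp: I'_def)
      show "disjoint_family_on B (insert i0 J')"
        using J'(1,2) unfolding disjoint_family_on_def I'_def by (auto simp: Int_commute)
      fix i assume "i \<in> I"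
      then show "\<exists>j\<in>insert i0 J'. B i \<inter> B j \<noteq> {} \<and> r i \<le> r j"
        using J'(3)[of i] max[of i] by (cases "i \<in> I'") (auto simp: I'_def)
    qed
  qed (auto simp: disjoint_family_on_def)
qed

text \<open>The weak-type bound for the maximal function of \<phi>, by a covering argument. Using
  only centres from a countable dense set and rational radii makes the exceptional set a countable
  union of balls, hence measurable.\<close>

lemma maximal_exceptional_set:
  assumes a: "a > -1"
  obtains C :: real where "0 < C"
    "\<And>(\<phi> :: complex ^ 'n \<Rightarrow> ennreal) (\<tau>::real). \<phi> \<in> borel_measurable (bmeas a) \<Longrightarrow> 0 < \<tau> \<Longrightarrow>
      \<exists>\<Omega>\<in>sets (bmeas a). ennreal \<tau> * emeasure (bmeas a) \<Omega> \<le> ennreal C * (\<integral>\<^sup>+w. \<phi> w \<partial>bmeas a) \<and>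
        (\<forall>z\<in>ball 0 1 - \<Omega>. \<forall>r>0. emeasure (density (bmeas a) \<phi>) (kball z r)
           \<le> ennreal (4 powr (real CARD('n) + 1 + a) * \<tau> * r powr (real CARD('n) + 1 + a)))"
proof -
  let ?N = "real CARD('n) + 1 + a"
  let ?\<mu> = "bmeas a :: (complex ^ 'n) measure"
  obtain C0 where C0: "0 < C0"
    "\<And>(z :: complex ^ 'n) r. z \<in> ball 0 1 \<Longrightarrow> 0 < r \<Longrightarrow>
       emeasure (bmeas a) {w \<in> ball 0 1. kor z w < r} \<le> ennreal (C0 * r powr ?N)"
    by (rule emeasure_bmeas_kor[OF a, where ?'n = 'n]) blast
  have N: "0 < ?N" using a by linarith
  define C where "C = C0 * 17 powr ?N"
  have "0 < C" using C0 by (simp add: C_def)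
  moreover have "\<exists>\<Omega>\<in>sets ?\<mu>. ennreal \<tau> * emeasure ?\<mu> \<Omega> \<le> ennreal C * (\<integral>\<^sup>+w. \<phi> w \<partial>?\<mu>) \<and>
        (\<forall>z\<in>ball 0 1 - \<Omega>. \<forall>r>0. emeasure (density ?\<mu> \<phi>) (kball z r) \<le> ennreal (4 powr ?N * \<tau> * r powr ?N))"
    if \<phi>[measurable]: "\<phi> \<in> borel_measurable ?\<mu>" and \<tau>: "0 < \<tau>" for \<phi> :: "complex ^ 'n \<Rightarrow> ennreal" and \<tau> :: real
  proof -
    let ?\<Phi> = "density ?\<mu> \<phi>"
    obtain D :: "(complex ^ 'n) set" where D: "countable D" "\<And>X. open X \<Longrightarrow> X \<noteq> {} \<Longrightarrow> \<exists>d\<in>D. d \<in> X"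
      using countable_dense_exists by blast
    define P where "P = {(z, r). z \<in> D \<inter> ball 0 1 \<and> r \<in> \<rat> \<and> 0 < r \<and> ennreal (\<tau> * r powr ?N) < emeasure ?\<Phi> (kball z r)}"
    have "P \<subseteq> D \<times> \<rat>" by (auto simp: P_def)
    then have cP: "countable P" using D(1) countable_rat by (meson countable_SIGMA countable_subset)
    \<comment> \<open>The balls are doubled because a point z close to a centre d need not be close
      to it in the sense of \<open>kor\<close>: \<open>kor d z\<close> is then near 1 -
      |z|^2.\<close>
    define \<Omega> where "\<Omega> = (\<Union>(z, r)\<in>P. kball z (2 * r))"
    have \<Omega>s: "\<Omega> \<in> sets ?\<mu>" unfolding \<Omega>_def using cP by (intro sets.countable_UN') auto
    have fin: "ennreal \<tau> * emeasure ?\<mu> (\<Union>(z, r)\<in>F. kball z (2 * r)) \<le> ennreal C * (\<integral>\<^sup>+w. \<phi> w \<partial>?\<mu>)"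
      if F: "finite F" "F \<subseteq> P" for F
    proof -
      have ne: "kball (fst i) (snd i) \<noteq> {}" if "i \<in> F" for i
      proof
        assume "kball (fst i) (snd i) = {}"
        then show False using F(2) that by (auto simp: P_def)
      qed
      obtain J where J: "J \<subseteq> F" "disjoint_family_on (\<lambda>i. kball (fst i) (snd i)) J"
        "\<And>i. i \<in> F \<Longrightarrow> \<exists>j\<in>J. kball (fst i) (snd i) \<inter> kball (fst j) (snd j) \<noteq> {} \<and> snd i \<le> snd j"
        using finite_vitali[OF F(1) ne, of "\<lambda>i. i" snd] by blast
      have fJ: "finite J" using J(1) F(1) finite_subset by blast
      \<comment> \<open>In units of the square root of the radius of ball j, centres of intersecting
        balls are at most 1 + 1 apart, and a point of the doubled smaller ball is at most 2 further
        away: (1 + 1 + 2)^2 = 16 < 17.\<close>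
      have "(\<Union>(z, r)\<in>F. kball z (2 * r)) \<subseteq> (\<Union>j\<in>J. kball (fst j) (17 * snd j))"
      proof
        fix w assume "w \<in> (\<Union>(z, r)\<in>F. kball z (2 * r))"
        then obtain i where i: "i \<in> F" "w \<in> kball (fst i) (2 * snd i)" by auto
        obtain j x where j: "j \<in> J" "x \<in> kball (fst i) (snd i)" "x \<in> kball (fst j) (snd j)" "snd i \<le> snd j"
          using J(3)[OF i(1)] by blast
        have P: "fst i \<in> ball 0 1" "fst j \<in> ball 0 1" "0 < snd i" "0 < snd j"
          using i(1) j(1) J(1) F(2) by (auto simp: P_def)
        have x: "x \<in> ball 0 1" "w \<in> ball 0 1" using j i by (auto simp: kball_def)
        have "kor (fst j) (fst i) \<le> (1 + 1)\<^sup>2 * snd j"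
          by (rule kball_chain[of _ x]) (use j P x in \<open>auto simp: kball_def kor_sym[of x]\<close>)
        then have "kor (fst j) (fst i) \<le> 2\<^sup>2 * snd j" by simp
        then have "kor (fst j) w \<le> (2 + 2)\<^sup>2 * snd j"
          by (rule kball_chain[rotated 3]) (use i j P x in \<open>auto simp: kball_def\<close>)
        also have "\<dots> < 17 * snd j" using P by simp
        finally show "w \<in> (\<Union>j\<in>J. kball (fst j) (17 * snd j))" using j(1) x by (auto simp: kball_def)
      qed
      then have "emeasure ?\<mu> (\<Union>(z, r)\<in>F. kball z (2 * r)) \<le> emeasure ?\<mu> (\<Union>j\<in>J. kball (fst j) (17 * snd j))"
        using fJ by (intro emeasure_mono sets.finite_UN) auto
      also have "\<dots> \<le> (\<Sum>j\<in>J. emeasure ?\<mu> (kball (fst j) (17 * snd j)))"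
        using fJ by (intro emeasure_subadditive_finite) auto
      finally have "ennreal \<tau> * emeasure ?\<mu> (\<Union>(z, r)\<in>F. kball z (2 * r)) \<le> ennreal \<tau> * (\<Sum>j\<in>J. emeasure ?\<mu> (kball (fst j) (17 * snd j)))"
        by (rule mult_left_mono) simp
      also have "\<dots> = (\<Sum>j\<in>J. ennreal \<tau> * emeasure ?\<mu> (kball (fst j) (17 * snd j)))" by (rule sum_distrib_left)
      also have "\<dots> \<le> (\<Sum>j\<in>J. ennreal C * emeasure ?\<Phi> (kball (fst j) (snd j)))"
      proof (rule sum_mono)
        fix j assume "j \<in> J"
        then have j: "fst j \<in> ball 0 1" "0 < snd j" "ennreal (\<tau> * snd j powr ?N) < emeasure ?\<Phi> (kball (fst j) (snd j))"
          using J(1) F(2) by (auto simp: P_def)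
        have "ennreal \<tau> * emeasure ?\<mu> (kball (fst j) (17 * snd j)) \<le> ennreal \<tau> * ennreal (C0 * (17 * snd j) powr ?N)"
          unfolding kball_def by (intro mult_left_mono C0(2)) (use j in auto)
        also have "\<dots> = ennreal (C * (\<tau> * snd j powr ?N))"
          using \<tau> C0(1) j by (simp add: ennreal_mult[symmetric] C_def powr_mult mult_ac)
        also have "\<dots> = ennreal C * ennreal (\<tau> * snd j powr ?N)"
          using \<tau> \<open>0 < C\<close> by (intro ennreal_mult) auto
        also have "\<dots> \<le> ennreal C * emeasure ?\<Phi> (kball (fst j) (snd j))"
          using j(3) by (intro mult_left_mono) auto
        finally show "ennreal \<tau> * emeasure ?\<mu> (kball (fst j) (17 * snd j)) \<le> ennreal C * emeasure ?\<Phi> (kball (fst j) (snd j))" .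
      qed
      also have "\<dots> = ennreal C * (\<Sum>j\<in>J. emeasure ?\<Phi> (kball (fst j) (snd j)))" by (rule sum_distrib_left[symmetric])
      also have "(\<Sum>j\<in>J. emeasure ?\<Phi> (kball (fst j) (snd j))) = emeasure ?\<Phi> (\<Union>j\<in>J. kball (fst j) (snd j))"
        using J(2) fJ by (intro sum_emeasure) (auto simp: sets_density)
      also have "\<dots> \<le> emeasure ?\<Phi> (space ?\<Phi>)" by (rule emeasure_space)
      also have "\<dots> = (\<integral>\<^sup>+w. \<phi> w * indicator (space ?\<mu>) w \<partial>?\<mu>)" by (simp add: emeasure_density del: space_bmeas)
      also have "\<dots> = (\<integral>\<^sup>+w. \<phi> w \<partial>?\<mu>)" by (rule nn_integral_cong) simp
      finally show ?thesis by (simp add: mult_left_mono)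
    qed
    have meas: "ennreal \<tau> * emeasure ?\<mu> \<Omega> \<le> ennreal C * (\<integral>\<^sup>+w. \<phi> w \<partial>?\<mu>)"
    proof (cases "P = {}")
      case True then show ?thesis by (simp add: \<Omega>_def)
    next
      case False
      let ?A = "\<lambda>m::nat. \<Union>(z, r)\<in>from_nat_into P ` {..<m}. kball z (2 * r)"
      have "(\<Union>m. ?A m) = \<Omega>"
      proof -
        have "(\<Union>m::nat. {..<m}) = UNIV" by auto
        then have "(\<Union>m. from_nat_into P ` {..<m}) = P"
          unfolding image_UN[symmetric] using range_from_nat_into[OF False cP] by simp
        moreover have "(\<Union>m. ?A m) = (\<Union>(z, r)\<in>(\<Union>m. from_nat_into P ` {..<m}). kball z (2 * r))"
          by (rule SUP_UNION[symmetric])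
        ultimately show ?thesis unfolding \<Omega>_def by simp
      qed
      moreover have "incseq ?A" by (intro incseq_SucI UN_mono image_mono) auto
      moreover have "range ?A \<subseteq> sets ?\<mu>" by (auto intro!: sets.finite_UN split: prod.split)
      ultimately have "emeasure ?\<mu> \<Omega> = (SUP m. emeasure ?\<mu> (?A m))"
        using SUP_emeasure_incseq[of ?A ?\<mu>] by simp
      then have "ennreal \<tau> * emeasure ?\<mu> \<Omega> = (SUP m. ennreal \<tau> * emeasure ?\<mu> (?A m))"
        by (simp add: SUP_mult_left_ennreal)
      also have "\<dots> \<le> ennreal C * (\<integral>\<^sup>+w. \<phi> w \<partial>?\<mu>)"
        using from_nat_into[OF False] by (intro SUP_least fin) auto
      finally show ?thesis .
    qed
    have good: "emeasure ?\<Phi> (kball z r) \<le> ennreal (4 powr ?N * \<tau> * r powr ?N)"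
      if z: "z \<in> ball 0 1 - \<Omega>" and r: "0 < r" for z r
    proof (rule ccontr)
      assume neg: "\<not> ?thesis"
      then have "kball z r \<noteq> {}" by auto
      then obtain w0 where "w0 \<in> ball 0 1" "kor z w0 < r" by (auto simp: kball_def)
      then have zr: "1 - norm z < r" using kor_ge[of z w0] z by simp
      have "z \<in> ball z r \<inter> ball 0 1" using z r by simp
      then have "open (ball z r \<inter> ball 0 1)" "ball z r \<inter> ball 0 1 \<noteq> {}" by (auto simp del: Int_iff)
      then obtain d where d: "d \<in> D" "d \<in> ball z r" "d \<in> ball 0 1" using D(2) by blast
      \<comment> \<open>The centre d is within r of z in norm, so radius 2 r around d covers the
        ball of radius r around z. Moreover \<open>kor d z\<close> < 3 r < 2 r', so the doubled ball
        catches z. The bound r' < 4 r is paid for by the factor 4^N.\<close>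
      obtain r' where r': "r' \<in> \<rat>" "2 * r < r'" "r' < 4 * r" using Rats_dense_in_real[of "2 * r" "4 * r"] r by auto
      have nd: "norm (d - z) < r" using d by (simp add: dist_norm norm_minus_commute)
      have sub: "kball z r \<subseteq> kball d r'"
      proof
        fix w assume w: "w \<in> kball z r"
        then have "kor d w \<le> kor z w + norm (d - z)"
          using kor_lipschitz[of w d z] by (simp add: kor_sym kball_def)
        then show "w \<in> kball d r'" using w nd r' by (simp add: kball_def)
      qed
      have "ennreal (\<tau> * r' powr ?N) \<le> ennreal (4 powr ?N * \<tau> * r powr ?N)"
      proof (rule ennreal_leI)
        have "r' powr ?N \<le> (4 * r) powr ?N" using r r' N by (intro powr_mono2) auto
        then show "\<tau> * r' powr ?N \<le> 4 powr ?N * \<tau> * r powr ?N" using \<tau> r by (simp add: powr_mult)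
      qed
      also have "\<dots> < emeasure ?\<Phi> (kball z r)" using neg by simp
      also have "\<dots> \<le> emeasure ?\<Phi> (kball d r')" using sub by (intro emeasure_mono) auto
      finally have "(d, r') \<in> P" using d r r' by (auto simp: P_def)
      moreover have "z \<in> kball d (2 * r')"
      proof -
        have "kor z z = 1 - (norm z)\<^sup>2"
        proof -
          have "(norm z)\<^sup>2 \<le> 1" using z by (simp add: power_le_one)
          moreover have "1 - herm z z = of_real (1 - (norm z)\<^sup>2)" by (simp add: herm_self)
          ultimately show ?thesis unfolding kor_def by (metis abs_of_nonneg diff_ge_0_iff_ge norm_of_real)
        qed
        then have "kor z z < 2 * r" using one_minus_norm_square(2)[of z] z zr by simp
        moreover have "kor d z \<le> kor z z + norm (d - z)"
          using kor_lipschitz[of z d z] z by (simp add: kor_sym)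
        ultimately show ?thesis using z nd r' by (simp add: kball_def)
      qed
      ultimately have "z \<in> \<Omega>" by (auto simp: \<Omega>_def)
      then show False using z by simp
    qed
    show ?thesis using \<Omega>s meas good by blast
  qed
  ultimately show thesis by (rule that)
qed

lemma ennreal_le_cancel:
  assumes "0 < m" "ennreal m * x \<le> ennreal (m * y)" "0 \<le> y"
  shows "x \<le> ennreal y"
  using assms ennreal_mult_le_mult_iff[of "ennreal m" x "ennreal y"] by (simp add: ennreal_mult)

text \<open>If all averages of \<open>\<phi>\<close> over balls centred in \<open>S\<close> are at most \<open>A\<close>, then \<open>\<phi>\<close> has little mass near
  \<open>S\<close>: averaging over balls of radius \<open>4 s\<close> compares it with \<open>A\<close> times the volume of a boundary
  layer of width \<open>4 s\<close>.\<close>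

lemma mass_near_good_set:
  assumes a: "a > -1"
  obtains C :: real where "0 < C"
    "\<And>(\<phi> :: complex ^ 'n \<Rightarrow> ennreal) A S \<delta> z r s. \<phi> \<in> borel_measurable (bmeas a) \<Longrightarrow> 0 < A \<Longrightarrow> S \<subseteq> ball 0 1 \<Longrightarrow>
      (\<And>z r. z \<in> S \<Longrightarrow> 0 < r \<Longrightarrow> emeasure (density (bmeas a) \<phi>) (kball z r) \<le> ennreal (A * r powr (real CARD('n) + 1 + a))) \<Longrightarrow>
      \<delta> \<in> borel_measurable (bmeas a) \<Longrightarrow> (\<And>w t. w \<in> ball 0 1 \<Longrightarrow> \<delta> w < t \<Longrightarrow> \<exists>z\<in>S. kor z w < t) \<Longrightarrow>
      z \<in> S \<Longrightarrow> 0 < s \<Longrightarrow> s \<le> r \<Longrightarrow> r \<le> 2 \<Longrightarrow>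
      emeasure (density (bmeas a) \<phi>) {w \<in> kball z r. \<delta> w \<le> s} \<le> ennreal (A * C * r ^ CARD('n) * s powr (1 + a))"
proof -
  let ?N = "real CARD('n) + 1 + a" and ?n = "CARD('n)"
  let ?\<mu> = "bmeas a :: (complex ^ 'n) measure"
  have N: "0 < ?N" using a by linarith
  obtain C1 where C1: "0 < C1"
    "\<And>(z :: complex ^ 'n) r s. z \<in> ball 0 1 \<Longrightarrow> 0 < s \<Longrightarrow> s \<le> r \<Longrightarrow>
       emeasure (bmeas a) {w \<in> ball 0 1. kor z w < r \<and> 1 - norm w \<le> s} \<le> ennreal (C1 * r ^ CARD('n) * s powr (1 + a))"
    by (rule emeasure_bmeas_layer[OF a, where ?'n = 'n]) blast
  obtain c where c: "0 < c"
    "\<And>(z :: complex ^ 'n) s. z \<in> ball 0 1 \<Longrightarrow> 2 * (1 - norm z) \<le> s \<Longrightarrow> s \<le> 8 \<Longrightarrow>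
       ennreal (c * s powr ?N) \<le> emeasure (bmeas a) {w \<in> ball 0 1. kor z w < s}"
    by (rule emeasure_bmeas_kor_ge[OF a, where ?'n = 'n]) blast
  \<comment> \<open>A ball of radius 4 s that meets the set lies within 37 s of a point of S, as (2
    + 2 + 2)^2 = 36, and its centre within 10 r of z, as (1 + 2)^2 = 9. The denominator comes from
    the lower bound c (4 s)^N for volumes.\<close>
  define C where "C = 37 powr ?N * C1 * 10 ^ ?n * 4 powr (1 + a) / (c * 4 powr ?N)"
  have C: "0 < C" using C1 c by (simp add: C_def)
  interpret fin: finite_measure ?\<mu> by (rule finite_measure_bmeas[OF a])
  interpret P: pair_sigma_finite ?\<mu> ?\<mu> ..
  have "emeasure (density ?\<mu> \<phi>) {w \<in> kball z r. \<delta> w \<le> s} \<le> ennreal (A * C * r ^ ?n * s powr (1 + a))"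
    if \<phi>[measurable]: "\<phi> \<in> borel_measurable ?\<mu>" and A: "0 < A" and S: "S \<subseteq> ball 0 1"
      and avg: "\<And>z r. z \<in> S \<Longrightarrow> 0 < r \<Longrightarrow> emeasure (density ?\<mu> \<phi>) (kball z r) \<le> ennreal (A * r powr ?N)"
      and \<delta>[measurable]: "\<delta> \<in> borel_measurable ?\<mu>"
      and near: "\<And>w t. w \<in> ball 0 1 \<Longrightarrow> \<delta> w < t \<Longrightarrow> \<exists>z\<in>S. kor z w < t"
      and zS: "z \<in> S" and s: "0 < s" and sr: "s \<le> r" and r2: "r \<le> 2"
    for \<phi> :: "complex ^ 'n \<Rightarrow> ennreal" and A S \<delta> z r s
  proof -
    let ?X = "{w \<in> kball z r. \<delta> w \<le> s}"
    have Xs[measurable]: "?X \<in> sets ?\<mu>"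
    proof -
      have "?X = {w \<in> space ?\<mu>. kor z w < r \<and> \<delta> w \<le> s}" by (auto simp: kball_def)
      also have "\<dots> \<in> sets ?\<mu>" by measurable
      finally show ?thesis .
    qed
    have zb: "z \<in> ball 0 1" using zS S by blast
    define m where "m = c * (4 * s) powr ?N"
    have m: "0 < m" using c s by (simp add: m_def)
    let ?k = "\<lambda>u w. indicator {x \<in> space (?\<mu> \<Otimes>\<^sub>M ?\<mu>). kor (fst x) (snd x) < 4 * s} (u, w) :: ennreal"
    have mk: "{x \<in> space (?\<mu> \<Otimes>\<^sub>M ?\<mu>). kor (fst x) (snd x) < 4 * s} \<in> sets (?\<mu> \<Otimes>\<^sub>M ?\<mu>)" by measurable
    have k: "?k u w = indicator (kball w (4 * s)) u" "?k u w = indicator (kball u (4 * s)) w"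
      if "u \<in> ball 0 1" "w \<in> ball 0 1" for u w
      using that by (auto simp: kball_def indicator_def space_pair_measure kor_sym)
    \<comment> \<open>Double counting over pairs (u, w) closer than 4 s: for fixed w in the set the
      u have volume at least m, for fixed u the w have mass at most that of a ball centred in
      S.\<close>
    have "ennreal m * emeasure (density ?\<mu> \<phi>) ?X = (\<integral>\<^sup>+w. ennreal m * (\<phi> w * indicator ?X w) \<partial>?\<mu>)"
      using Xs by (simp add: emeasure_density nn_integral_cmult)
    also have "\<dots> \<le> (\<integral>\<^sup>+w. (\<integral>\<^sup>+u. \<phi> w * indicator ?X w * ?k u w \<partial>?\<mu>) \<partial>?\<mu>)"
    proof (rule nn_integral_mono)
      fix w assume "w \<in> space ?\<mu>"
      then have w: "w \<in> ball 0 1" by simp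
      show "ennreal m * (\<phi> w * indicator ?X w) \<le> (\<integral>\<^sup>+u. \<phi> w * indicator ?X w * ?k u w \<partial>?\<mu>)"
      proof (cases "w \<in> ?X")
        case True
        obtain z' where z': "z' \<in> S" "kor z' w < 2 * s" using near[OF w, of "2 * s"] True s by auto
        then have "1 - norm w < 2 * s" using kor_ge[of w z'] w S by (force simp: kor_sym)
        then have "ennreal m \<le> emeasure ?\<mu> (kball w (4 * s))"
          unfolding m_def kball_def using w sr r2 by (intro c(2)) auto
        also have "\<dots> = (\<integral>\<^sup>+u. ?k u w \<partial>?\<mu>)"
        proof -
          have "(\<integral>\<^sup>+u. ?k u w \<partial>?\<mu>) = (\<integral>\<^sup>+u. indicator (kball w (4 * s)) u \<partial>?\<mu>)"
            by (rule nn_integral_cong, rule k(1)[OF _ w]) simp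
          then show ?thesis by simp
        qed
        finally have "ennreal m * (\<phi> w * indicator ?X w) \<le> (\<integral>\<^sup>+u. ?k u w \<partial>?\<mu>) * (\<phi> w * indicator ?X w)"
          by (rule mult_right_mono) simp
        also have "\<dots> = (\<integral>\<^sup>+u. \<phi> w * indicator ?X w * ?k u w \<partial>?\<mu>)"
        proof (subst nn_integral_cmult)
          show "(\<lambda>u. ?k u w) \<in> borel_measurable ?\<mu>"
            using measurable_Pair1'[OF \<open>w \<in> space ?\<mu>\<close>, of ?\<mu>] mk
            by (intro measurable_compose[OF measurable_Pair2'[OF \<open>w \<in> space ?\<mu>\<close>]] borel_measurable_indicator)
        qed (simp add: mult.commute)
        finally show ?thesis .
      qed simp
    qed
    also have "\<dots> = (\<integral>\<^sup>+u. (\<integral>\<^sup>+w. \<phi> w * indicator ?X w * ?k u w \<partial>?\<mu>) \<partial>?\<mu>)"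
    proof (rule P.Fubini')
      have 1: "(\<lambda>x. \<phi> (snd x) * indicator ?X (snd x)) \<in> borel_measurable (?\<mu> \<Otimes>\<^sub>M ?\<mu>)"
        by (rule measurable_compose[OF measurable_snd]) measurable
      have "(\<lambda>x. \<phi> (snd x) * indicator ?X (snd x) * indicator {x \<in> space (?\<mu> \<Otimes>\<^sub>M ?\<mu>). kor (fst x) (snd x) < 4 * s} x) \<in> borel_measurable (?\<mu> \<Otimes>\<^sub>M ?\<mu>)"
        using 1 mk by measurable
      then show "(\<lambda>(u, w). \<phi> w * indicator ?X w * ?k u w) \<in> borel_measurable (?\<mu> \<Otimes>\<^sub>M ?\<mu>)"
        by (simp add: case_prod_beta')
    qed
    also have "\<dots> \<le> (\<integral>\<^sup>+u. ennreal (A * (37 * s) powr ?N) * indicator {u \<in> ball 0 1. kor z u < 10 * r \<and> 1 - norm u \<le> 4 * s} u \<partial>?\<mu>)"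
    proof (rule nn_integral_mono)
      fix u assume "u \<in> space ?\<mu>"
      then have u: "u \<in> ball 0 1" by simp
      show "(\<integral>\<^sup>+w. \<phi> w * indicator ?X w * ?k u w \<partial>?\<mu>)
        \<le> ennreal (A * (37 * s) powr ?N) * indicator {u \<in> ball 0 1. kor z u < 10 * r \<and> 1 - norm u \<le> 4 * s} u"
      proof (cases "?X \<inter> kball u (4 * s) = {}")
        case True
        have "(\<integral>\<^sup>+w. \<phi> w * indicator ?X w * ?k u w \<partial>?\<mu>) = (\<integral>\<^sup>+w. 0 \<partial>?\<mu>)"
        proof (rule nn_integral_cong)
          fix w assume w: "w \<in> space ?\<mu>"
          then have "w \<in> ball 0 1" by simp
          then show "\<phi> w * indicator ?X w * ?k u w = 0" unfolding k(2)[OF u \<open>w \<in> ball 0 1\<close>]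
            using True by (auto simp: indicator_def)
        qed
        then show ?thesis by simp
      next
        case False
        then obtain w0 where w0: "w0 \<in> ball 0 1" "kor z w0 < r" "\<delta> w0 \<le> s" "kor u w0 < 4 * s" by (auto simp: kball_def)
        have "kor z u \<le> (1 + 2)\<^sup>2 * r"
          by (rule kball_chain[of _ w0]) (use zb u w0 s sr in \<open>auto simp: kor_sym[of w0]\<close>)
        then have zu: "kor z u < 10 * r" using s sr by simp
        have un: "1 - norm u \<le> 4 * s" using kor_ge[of u w0] u w0 by simp
        obtain z' where z': "z' \<in> S" "kor z' w0 < 2 * s" using near[OF w0(1), of "2 * s"] w0(3) s by auto
        have zb': "z' \<in> ball 0 1" using z' S by blast
        have "kor z' u \<le> (2 + 2)\<^sup>2 * s"
          by (rule kball_chain[of _ w0]) (use zb' u w0 z' s in \<open>auto simp: kor_sym[of w0]\<close>)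
        then have zu': "kor z' u \<le> 4\<^sup>2 * s" by simp
        have sub: "kball u (4 * s) \<subseteq> kball z' (37 * s)"
        proof
          fix w assume w: "w \<in> kball u (4 * s)"
          have "kor z' w \<le> (4 + 2)\<^sup>2 * s"
            by (rule kball_chain[OF _ _ _ zu']) (use zb' u w s in \<open>auto simp: kball_def\<close>)
          then show "w \<in> kball z' (37 * s)" using w s by (simp add: kball_def)
        qed
        have "(\<integral>\<^sup>+w. \<phi> w * indicator ?X w * ?k u w \<partial>?\<mu>) \<le> (\<integral>\<^sup>+w. \<phi> w * indicator (kball z' (37 * s)) w \<partial>?\<mu>)"
        proof (rule nn_integral_mono)
          fix w assume w: "w \<in> space ?\<mu>"
          then have "w \<in> ball 0 1" by simp
          then show "\<phi> w * indicator ?X w * ?k u w \<le> \<phi> w * indicator (kball z' (37 * s)) w"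
            unfolding k(2)[OF u \<open>w \<in> ball 0 1\<close>] using sub by (auto simp: indicator_def)
        qed
        also have "\<dots> = emeasure (density ?\<mu> \<phi>) (kball z' (37 * s))" by (simp add: emeasure_density)
        also have "\<dots> \<le> ennreal (A * (37 * s) powr ?N)" by (rule avg[OF z'(1)]) (use s in simp)
        finally show ?thesis using u zu un by simp
      qed
    qed
    also have "\<dots> = ennreal (A * (37 * s) powr ?N) * emeasure ?\<mu> {u \<in> ball 0 1. kor z u < 10 * r \<and> 1 - norm u \<le> 4 * s}"
    proof (rule nn_integral_cmult_indicator)
      have "{u \<in> ball 0 1. kor z u < 10 * r \<and> 1 - norm u \<le> 4 * s} = {u \<in> space ?\<mu>. kor z u < 10 * r \<and> 1 - norm u \<le> 4 * s}" by simp
      also have "\<dots> \<in> sets ?\<mu>" by measurable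
      finally show "{u \<in> ball 0 1. kor z u < 10 * r \<and> 1 - norm u \<le> 4 * s} \<in> sets ?\<mu>" .
    qed
    also have "\<dots> \<le> ennreal (A * (37 * s) powr ?N) * ennreal (C1 * (10 * r) ^ ?n * (4 * s) powr (1 + a))"
      by (intro mult_left_mono C1(2) zb) (use s sr in auto)
    also have "\<dots> = ennreal (m * (A * C * r ^ ?n * s powr (1 + a)))"
    proof (subst ennreal_mult[symmetric])
      have "m * C = c * 4 powr ?N * s powr ?N * C" using s by (simp add: m_def powr_mult)
      also have "\<dots> = 37 powr ?N * C1 * 10 ^ ?n * 4 powr (1 + a) * s powr ?N" using c(1) by (simp add: C_def)
      finally have mC: "m * C = 37 powr ?N * C1 * 10 ^ ?n * 4 powr (1 + a) * s powr ?N" .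
      have "m * (A * C * r ^ ?n * s powr (1 + a)) = (m * C) * (A * r ^ ?n * s powr (1 + a))" by (simp only: mult_ac)
      also have "\<dots> = A * (37 * s) powr ?N * (C1 * (10 * r) ^ ?n * (4 * s) powr (1 + a))"
        unfolding mC using s by (simp add: powr_mult power_mult_distrib mult_ac)
      finally show "ennreal (A * (37 * s) powr ?N * (C1 * (10 * r) ^ ?n * (4 * s) powr (1 + a))) = ennreal (m * (A * C * r ^ ?n * s powr (1 + a)))" by (simp only:)
    qed (use A C1(1) s sr in auto)
    finally show ?thesis by (rule ennreal_le_cancel[OF m]) (use A C s sr in auto)
  qed
  with C show thesis by (rule that)
qed

lemma nn_integral_bmeas_shift:
  assumes f: "\<And>a. f \<in> borel_measurable (bmeas a)"
  shows "(\<integral>\<^sup>+z. f z * ennreal ((1 - (norm z)\<^sup>2) powr b) \<partial>bmeas a) = (\<integral>\<^sup>+z. f z \<partial>bmeas (a + b))"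
proof -
  have m: "(\<lambda>z. ennreal ((1 - (norm z)\<^sup>2) powr b)) \<in> borel_measurable (bmeas a)"
    by (intro borel_measurable_bmeas_borel) measurable
  have "(\<lambda>z. f z * ennreal ((1 - (norm z)\<^sup>2) powr b)) \<in> borel_measurable (bmeas a)"
    using f m by (rule borel_measurable_times_ennreal)
  from nn_integral_bmeas[OF this] nn_integral_bmeas[OF f, of "a + b"] show ?thesis
    by (simp add: powr_add ennreal_mult mult_ac)
qed

text \<open>Off the exceptional set, the integral of (T z)^2 is bounded by a constant times \<tau>
  times the mass of \<phi>, and Chebyshev's inequality finishes. In the Cauchy--Schwarz product, the
  factor with \<delta>^(-e) is at most a constant times \<tau> (1 - |z|)^(-e), since \<phi> has
  little mass near S. The factor with \<delta>^e is integrated in z first, which produces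
  \<delta>^(-e) and cancels it.\<close>

lemma weak_type_kernel:
  assumes a: "a > -1"
  obtains C :: real where "0 < C"
    "\<And>(\<phi> :: complex ^ 'n \<Rightarrow> ennreal) (\<tau>::real). \<phi> \<in> borel_measurable (bmeas a) \<Longrightarrow> 0 < \<tau> \<Longrightarrow>
      ennreal \<tau> * emeasure (bmeas a) {z \<in> ball 0 1. ennreal \<tau> < (\<integral>\<^sup>+w. \<phi> w * ennreal (kor z w powr (- (real CARD('n) + 1 + a))) \<partial>bmeas a)}
        \<le> ennreal C * (\<integral>\<^sup>+w. \<phi> w \<partial>bmeas a)"
proof -
  let ?N = "real CARD('n) + 1 + a" and ?n = "CARD('n)"
  let ?\<mu> = "bmeas a :: (complex ^ 'n) measure"
  \<comment> \<open>Any exponent strictly between 0 and 1 + a would serve. Positivity makes the sums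
    over large shells converge; e < 1 + a makes \<delta>^(-e) integrable against \<phi> near S and
    keeps the exponent a - e above -1.\<close>
  define e where "e = (1 + a) / 2"
  have e: "0 < e" "e < 1 + a" "a - e > -1" using a by (simp_all add: e_def field_simps)
  have N: "0 < ?N" using a by linarith
  obtain C1 where C1: "0 < C1" and exc: "\<And>(\<phi> :: complex ^ 'n \<Rightarrow> ennreal) (\<tau>::real). \<phi> \<in> borel_measurable ?\<mu> \<Longrightarrow> 0 < \<tau> \<Longrightarrow>
      \<exists>\<Omega>\<in>sets ?\<mu>. ennreal \<tau> * emeasure ?\<mu> \<Omega> \<le> ennreal C1 * (\<integral>\<^sup>+w. \<phi> w \<partial>?\<mu>) \<and>
        (\<forall>z\<in>ball 0 1 - \<Omega>. \<forall>r>0. emeasure (density ?\<mu> \<phi>) (kball z r) \<le> ennreal (4 powr ?N * \<tau> * r powr ?N))"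
    by (rule maximal_exceptional_set[OF a, where ?'n = 'n]) blast
  obtain C2 where C2: "0 < C2" and mass: "\<And>(\<phi> :: complex ^ 'n \<Rightarrow> ennreal) A S \<delta> z r s. \<phi> \<in> borel_measurable ?\<mu> \<Longrightarrow> 0 < A \<Longrightarrow> S \<subseteq> ball 0 1 \<Longrightarrow>
      (\<And>z r. z \<in> S \<Longrightarrow> 0 < r \<Longrightarrow> emeasure (density ?\<mu> \<phi>) (kball z r) \<le> ennreal (A * r powr ?N)) \<Longrightarrow>
      \<delta> \<in> borel_measurable ?\<mu> \<Longrightarrow> (\<And>w t. w \<in> ball 0 1 \<Longrightarrow> \<delta> w < t \<Longrightarrow> \<exists>z\<in>S. kor z w < t) \<Longrightarrow>
      z \<in> S \<Longrightarrow> 0 < s \<Longrightarrow> s \<le> r \<Longrightarrow> r \<le> 2 \<Longrightarrow>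
      emeasure (density ?\<mu> \<phi>) {w \<in> kball z r. \<delta> w \<le> s} \<le> ennreal (A * C2 * r ^ ?n * s powr (1 + a))"
    by (rule mass_near_good_set[OF a, where ?'n = 'n]) blast
  obtain C3 where C3: "0 < C3"
    "\<And>(z :: complex ^ 'n) r. z \<in> ball 0 1 \<Longrightarrow> 0 < r \<Longrightarrow>
       emeasure (bmeas (a - e)) {w \<in> ball 0 1. kor z w < r} \<le> ennreal (C3 * r powr (real ?n + 1 + (a - e)))"
    by (rule emeasure_bmeas_kor[OF e(3), where ?'n = 'n]) blast
  define K1 where "K1 = C2 * (2 powr e / (1 - 2 powr (e - (1 + a))))"
  define q where "q = 2 powr (?N - e) / (1 - 2 powr (?N - e - ?N))"
  have q: "0 < q" unfolding q_def using e powr_less_one[of 2 "?N - e - ?N"] by simp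
  have K1: "0 < K1" unfolding K1_def using C2 e powr_less_one[of 2 "e - (1 + a)"] by simp
  define K2 where "K2 = K1 * q"
  have K2: "0 < K2" using K1 q by (simp add: K2_def)
  define K3 where "K3 = 2 powr e * (C3 * q)"
  have K3: "0 < K3" using C3 q by (simp add: K3_def)
  define C where "C = C1 + 4 powr ?N * K2 * K3"
  have C: "0 < C" using C1 K2 K3 by (simp add: C_def add_pos_pos)
  interpret fin: finite_measure ?\<mu> by (rule finite_measure_bmeas[OF a])
  interpret P: pair_sigma_finite ?\<mu> ?\<mu> ..
  have "ennreal \<tau> * emeasure ?\<mu> {z \<in> ball 0 1. ennreal \<tau> < (\<integral>\<^sup>+w. \<phi> w * ennreal (kor z w powr (- ?N)) \<partial>?\<mu>)}
        \<le> ennreal C * (\<integral>\<^sup>+w. \<phi> w \<partial>?\<mu>)"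
    if \<phi>[measurable]: "\<phi> \<in> borel_measurable ?\<mu>" and \<tau>: "0 < \<tau>" for \<phi> :: "complex ^ 'n \<Rightarrow> ennreal" and \<tau> :: real
  proof -
    let ?I = "\<integral>\<^sup>+w. \<phi> w \<partial>?\<mu>"
    define T where "T z = (\<integral>\<^sup>+w. \<phi> w * ennreal (kor z w powr (- ?N)) \<partial>?\<mu>)" for z
    have snd\<phi>: "(\<lambda>x. \<phi> (snd x)) \<in> borel_measurable (?\<mu> \<Otimes>\<^sub>M ?\<mu>)"
      by (rule measurable_compose[OF measurable_snd \<phi>])
    have mT[measurable]: "T \<in> borel_measurable ?\<mu>"
      unfolding T_def by (rule fin.borel_measurable_nn_integral) (use snd\<phi> in \<open>simp add: case_prod_beta'\<close>)
    obtain \<Omega> where \<Omega>[measurable]: "\<Omega> \<in> sets ?\<mu>" and \<Omega>m: "ennreal \<tau> * emeasure ?\<mu> \<Omega> \<le> ennreal C1 * ?I"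
      and \<Omega>a: "\<And>z r. z \<in> ball 0 1 - \<Omega> \<Longrightarrow> 0 < r \<Longrightarrow> emeasure (density ?\<mu> \<phi>) (kball z r) \<le> ennreal (4 powr ?N * \<tau> * r powr ?N)"
      using exc[OF \<phi> \<tau>] by blast
    define S where "S = ball 0 1 - \<Omega>"
    have Sm[measurable]: "S \<in> sets ?\<mu>"
    proof -
      have "S = space ?\<mu> - \<Omega>" by (simp add: S_def)
      then show ?thesis using sets.compl_sets[OF \<Omega>] by simp
    qed
    have Sb: "S \<subseteq> ball 0 1" by (auto simp: S_def)
    define A where "A = 4 powr ?N * \<tau>"
    have A: "0 < A" using \<tau> by (simp add: A_def)
    have SA: "emeasure (density ?\<mu> \<phi>) (kball z r) \<le> ennreal (A * r powr ?N)" if "z \<in> S" "0 < r" for z r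
      using \<Omega>a[of z r] that by (simp add: S_def A_def)
    have L2: "(\<integral>\<^sup>+z. indicator S z * (T z)\<^sup>2 \<partial>?\<mu>) \<le> ennreal (A * K2 * K3) * ?I"
    proof (cases "S = {}")
      case False
      define \<delta> where "\<delta> w = Inf ((\<lambda>z. kor z w) ` S)" for w
      have bdd: "bdd_below ((\<lambda>z. kor z w) ` S)" for w by (rule bdd_belowI[of _ 0]) (auto simp: kor_def)
      have near: "\<exists>z\<in>S. kor z w < t" if "\<delta> w < t" for w t
        using cInf_lessD[of "(\<lambda>z. kor z w) ` S" t] False that by (auto simp: \<delta>_def)
      have \<delta>le: "\<delta> w \<le> kor z w" if "z \<in> S" for z w
        unfolding \<delta>_def using that by (intro cInf_lower bdd) auto
      have \<delta>ge: "c \<le> \<delta> w" if "\<And>z. z \<in> S \<Longrightarrow> c \<le> kor z w" for c w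
        unfolding \<delta>_def using that False by (intro cInf_greatest) auto
      have \<delta>pos: "1 - norm w \<le> \<delta> w" if "w \<in> ball 0 1" for w
      proof (rule \<delta>ge)
        fix z assume "z \<in> S"
        then show "1 - norm w \<le> kor z w" using kor_ge[of w z] Sb that by (force simp: kor_sym)
      qed
      have \<delta>0: "0 < \<delta> w" if "w \<in> ball 0 1" for w using \<delta>pos[OF that] that by simp
      have lip: "\<delta> w \<le> \<delta> w' + norm (w - w')" for w w'
      proof -
        have "\<delta> w - norm (w - w') \<le> \<delta> w'"
        proof (rule \<delta>ge)
          fix z assume z: "z \<in> S"
          then have "norm z \<le> 1" using Sb by force
          from kor_lipschitz[OF this, of w w'] \<delta>le[OF z, of w] show "\<delta> w - norm (w - w') \<le> kor z w'" by linarith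
        qed
        then show ?thesis by linarith
      qed
      have "1-lipschitz_on UNIV \<delta>"
      proof (rule lipschitz_onI)
        show "dist (\<delta> x) (\<delta> y) \<le> 1 * dist x y" for x y
          using lip[of x y] lip[of y x] by (simp add: dist_norm norm_minus_commute abs_le_iff)
      qed simp
      then have m\<delta>: "\<delta> \<in> borel_measurable borel"
        by (intro borel_measurable_continuous_onI) (rule lipschitz_on_continuous_on)
      have m\<delta>'[measurable]: "\<delta> \<in> borel_measurable (bmeas b)" for b by (rule borel_measurable_bmeas_borel[OF m\<delta>])
      let ?M2 = "density ?\<mu> (\<lambda>w. \<phi> w * ennreal (\<delta> w powr (- e)))"
      \<comment> \<open>Inside the ball the part with \<delta> \<le> s has mass at most A C2 r^n
        s^(1+a). Summing \<delta>^(-e) over dyadic levels of \<delta> below r lowers the total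
        exponent from N to N - e, which is below the critical one.\<close>
      have small: "emeasure ?M2 (kball z r) \<le> ennreal (A * K1 * r powr (?N - e))" if z: "z \<in> S" and r: "0 < r" "r \<le> 2" for z r
      proof -
        let ?M1 = "restrict_space (density ?\<mu> \<phi>) (kball z r)"
        have sp: "space ?M1 = kball z r" by (auto simp: space_restrict_space kball_def)
        have kb: "kball z r \<subseteq> ball 0 1" by (auto simp: kball_def)
        have "emeasure ?M2 (kball z r) = (\<integral>\<^sup>+w. ennreal (\<delta> w powr (- e)) \<partial>?M1)"
        proof -
          have "kball z r \<inter> space (density ?\<mu> \<phi>) = kball z r" using kb by auto
          then have "(\<integral>\<^sup>+w. ennreal (\<delta> w powr (- e)) \<partial>?M1) = (\<integral>\<^sup>+w. ennreal (\<delta> w powr (- e)) * indicator (kball z r) w \<partial>density ?\<mu> \<phi>)"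
            by (subst nn_integral_restrict_space) auto
          also have "\<dots> = (\<integral>\<^sup>+w. \<phi> w * (ennreal (\<delta> w powr (- e)) * indicator (kball z r) w) \<partial>?\<mu>)"
            by (rule nn_integral_density) measurable
          finally show ?thesis by (simp add: emeasure_density mult.assoc)
        qed
        also have "\<dots> \<le> ennreal (A * C2 * r ^ ?n * (2 powr e / (1 - 2 powr (e - (1 + a)))) * r powr (1 + a - e))"
        proof (rule nn_integral_powr_small[OF _ _ _ r(1)])
          show "\<delta> \<in> borel_measurable ?M1" by (intro measurable_restrict_space1) simp
          show "0 < \<delta> w" if "w \<in> space ?M1" for w using \<delta>0 that kb unfolding sp by blast
          show "\<delta> w \<le> r" if "w \<in> space ?M1" for w using \<delta>le[OF z, of w] that unfolding sp by (simp add: kball_def)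
          show "0 \<le> A * C2 * r ^ ?n" using A C2 r by simp
          show "e < 1 + a" "0 \<le> e" using e by auto
          fix s assume s: "0 < s" "s \<le> r"
          have "emeasure ?M1 {x \<in> space ?M1. \<delta> x \<le> s} = emeasure (density ?\<mu> \<phi>) {w \<in> kball z r. \<delta> w \<le> s}"
            unfolding sp by (subst emeasure_restrict_space) (auto simp: Int_absorb2[OF kb])
          also have "\<dots> \<le> ennreal (A * C2 * r ^ ?n * s powr (1 + a))"
            by (rule mass[OF \<phi> A Sb SA m\<delta>' near z s r(2)])
          finally show "emeasure ?M1 {x \<in> space ?M1. \<delta> x \<le> s} \<le> ennreal (A * C2 * r ^ ?n * s powr (1 + a))" .
        qed
        also have "A * C2 * r ^ ?n * (2 powr e / (1 - 2 powr (e - (1 + a)))) * r powr (1 + a - e) = A * K1 * (r ^ ?n * r powr (1 + a - e))"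
          by (simp add: K1_def)
        also have "r ^ ?n * r powr (1 + a - e) = r powr (?N - e)"
          using r by (simp add: powr_realpow[symmetric] powr_add[symmetric] algebra_simps)
        finally show ?thesis .
      qed
      have all: "emeasure ?M2 (kball z r) \<le> ennreal (A * K1 * r powr (?N - e))" if z: "z \<in> S" and r: "0 < r" for z r
      proof (cases "r \<le> 2")
        case False
        have "kball z r \<subseteq> kball z 2" using kor_less_2[of z] z Sb by (auto simp: kball_def)
        then have "emeasure ?M2 (kball z r) \<le> emeasure ?M2 (kball z 2)" by (intro emeasure_mono) auto
        also have "\<dots> \<le> ennreal (A * K1 * 2 powr (?N - e))" by (rule small[OF z]) auto
        also have "\<dots> \<le> ennreal (A * K1 * r powr (?N - e))"
          using False A K1 e by (intro ennreal_leI mult_left_mono powr_mono2) auto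
        finally show ?thesis .
      qed (use small[OF z r] in auto)
      have i: "(\<integral>\<^sup>+w. \<phi> w * ennreal (\<delta> w powr (- e)) * ennreal (kor z w powr (- ?N)) \<partial>?\<mu>) \<le> ennreal (A * K2 * (1 - norm z) powr (- e))"
        if z: "z \<in> S" for z
      proof -
        have "(\<integral>\<^sup>+w. \<phi> w * ennreal (\<delta> w powr (- e)) * ennreal (kor z w powr (- ?N)) \<partial>?\<mu>) = (\<integral>\<^sup>+w. ennreal (kor z w powr (- ?N)) \<partial>?M2)"
          by (simp add: nn_integral_density)
        also have "\<dots> \<le> ennreal (A * K1 * (2 powr (?N - e) / (1 - 2 powr (?N - e - ?N))) * (1 - norm z) powr (?N - e - ?N))"
        proof (rule nn_integral_powr_large)
          show "(\<lambda>w. kor z w) \<in> borel_measurable ?M2" by measurable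
          show "0 < 1 - norm z" using z Sb by force
          show "1 - norm z \<le> kor z w" if "w \<in> space ?M2" for w using that z Sb by (intro kor_ge) (auto intro: less_imp_le)
          show "0 \<le> A * K1" using A K1 by simp
          have "{x \<in> space ?M2. kor z x < r} = kball z r" for r by (simp add: kball_def)
          then show "emeasure ?M2 {x \<in> space ?M2. kor z x < r} \<le> ennreal (A * K1 * r powr (?N - e))" if "0 < r" for r
            using all[OF z that] by simp
        qed (use e N in auto)
        finally show ?thesis by (simp add: K2_def q_def mult.assoc)
      qed
      have ii: "(\<integral>\<^sup>+z. indicator S z * (ennreal ((1 - norm z) powr (- e)) * ennreal (kor z w powr (- ?N))) \<partial>?\<mu>) \<le> ennreal (K3 * \<delta> w powr (- e))"
        if w: "w \<in> ball 0 1" for w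
      proof -
        let ?v = "\<lambda>z. max (kor w z) (\<delta> w)"
        have "(\<integral>\<^sup>+z. indicator S z * (ennreal ((1 - norm z) powr (- e)) * ennreal (kor z w powr (- ?N))) \<partial>?\<mu>)
          \<le> (\<integral>\<^sup>+z. ennreal (2 powr e) * (ennreal (?v z powr (- ?N)) * ennreal ((1 - (norm z)\<^sup>2) powr (- e))) \<partial>?\<mu>)"
        proof (rule nn_integral_mono)
          fix z assume "z \<in> space ?\<mu>"
          then have z: "norm z < 1" by simp
          show "indicator S z * (ennreal ((1 - norm z) powr (- e)) * ennreal (kor z w powr (- ?N)))
            \<le> ennreal (2 powr e) * (ennreal (?v z powr (- ?N)) * ennreal ((1 - (norm z)\<^sup>2) powr (- e)))"
          proof (cases "z \<in> S")
            case True
            then have v: "?v z = kor z w" using \<delta>le[OF True, of w] by (simp add: kor_sym max_def)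
            have "(1 - norm z) powr (- e) \<le> ((1 - (norm z)\<^sup>2) / 2) powr (- e)"
            proof (rule powr_mono2')
              have "(norm z)\<^sup>2 < 1" using z by (simp add: abs_square_less_1)
              then show "0 < (1 - (norm z)\<^sup>2) / 2" by simp
            qed (use one_minus_norm_square(2)[of z] z e in auto)
            also have "\<dots> = 2 powr e * (1 - (norm z)\<^sup>2) powr (- e)"
              using z by (simp add: powr_divide power_le_one powr_minus divide_simps)
            finally have "(1 - norm z) powr (- e) \<le> 2 powr e * (1 - (norm z)\<^sup>2) powr (- e)" .
            from mult_right_mono[OF this, of "kor z w powr (- ?N)"]
            have "(1 - norm z) powr (- e) * kor z w powr (- ?N) \<le> 2 powr e * (kor z w powr (- ?N) * (1 - (norm z)\<^sup>2) powr (- e))"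
              by (simp add: mult_ac)
            then show ?thesis unfolding v using True by (simp add: ennreal_mult[symmetric] ennreal_leI)
          qed simp
        qed
        also have "\<dots> = ennreal (2 powr e) * (\<integral>\<^sup>+z. ennreal (?v z powr (- ?N)) * ennreal ((1 - (norm z)\<^sup>2) powr (- e)) \<partial>?\<mu>)"
        proof (rule nn_integral_cmult, rule borel_measurable_times_ennreal)
          show "(\<lambda>z. ennreal (?v z powr (- ?N))) \<in> borel_measurable ?\<mu>" by measurable
          show "(\<lambda>z. ennreal ((1 - (norm z)\<^sup>2) powr (- e))) \<in> borel_measurable ?\<mu>"
            by (intro borel_measurable_bmeas_borel) measurable
        qed
        also have "(\<integral>\<^sup>+z. ennreal (?v z powr (- ?N)) * ennreal ((1 - (norm z)\<^sup>2) powr (- e)) \<partial>?\<mu>) = (\<integral>\<^sup>+z. ennreal (?v z powr (- ?N)) \<partial>bmeas (a - e))"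
          using nn_integral_bmeas_shift[of "\<lambda>z. ennreal (?v z powr (- ?N))" a "- e"] by simp
        finally have L: "(\<integral>\<^sup>+z. indicator S z * (ennreal ((1 - norm z) powr (- e)) * ennreal (kor z w powr (- ?N))) \<partial>?\<mu>)
          \<le> ennreal (2 powr e) * (\<integral>\<^sup>+z. ennreal (?v z powr (- ?N)) \<partial>bmeas (a - e))" .
        have "(\<integral>\<^sup>+z. ennreal (?v z powr (- ?N)) \<partial>bmeas (a - e))
          \<le> ennreal (C3 * (2 powr (?N - e) / (1 - 2 powr (?N - e - ?N))) * \<delta> w powr (?N - e - ?N))"
        proof (rule nn_integral_powr_large)
          show "0 < \<delta> w" by (rule \<delta>0[OF w])
          show "0 \<le> C3" using C3(1) by simp
          fix r :: real assume r: "0 < r"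
          have "emeasure (bmeas (a - e)) {x \<in> space (bmeas (a - e)). ?v x < r} \<le> emeasure (bmeas (a - e)) (kball w r)"
            by (rule emeasure_mono[OF _ sets_kball]) (auto simp: kball_def)
          also have "\<dots> \<le> ennreal (C3 * r powr (real ?n + 1 + (a - e)))"
            unfolding kball_def by (rule C3(2)[OF w r])
          finally show "emeasure (bmeas (a - e)) {x \<in> space (bmeas (a - e)). ?v x < r} \<le> ennreal (C3 * r powr (?N - e))"
            by (simp add: add_diff_eq)
        qed (use e N in auto)
        then have "(\<integral>\<^sup>+z. ennreal (?v z powr (- ?N)) \<partial>bmeas (a - e)) \<le> ennreal (C3 * q * \<delta> w powr (- e))"
          unfolding q_def[symmetric] by simp
        then have "ennreal (2 powr e) * (\<integral>\<^sup>+z. ennreal (?v z powr (- ?N)) \<partial>bmeas (a - e))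
          \<le> ennreal (2 powr e) * ennreal (C3 * q * \<delta> w powr (- e))" by (rule mult_left_mono) simp
        also have "\<dots> = ennreal (K3 * \<delta> w powr (- e))"
          using C3(1) q by (subst ennreal_mult[symmetric]) (simp_all add: K3_def mult.assoc)
        finally show ?thesis using L by (rule order_trans[rotated])
      qed
      let ?k = "\<lambda>z w. \<phi> w * ennreal (kor z w powr (- ?N))"
      \<comment> \<open>Cauchy--Schwarz with respect to the measure of density \<phi> times the
        kernel, for the product 1 = \<delta>^(-e/2) \<delta>^(e/2).\<close>
      have CS: "(T z)\<^sup>2 \<le> ennreal (A * K2 * (1 - norm z) powr (- e)) * (\<integral>\<^sup>+w. \<phi> w * ennreal (\<delta> w powr e) * ennreal (kor z w powr (- ?N)) \<partial>?\<mu>)"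
        if z: "z \<in> S" for z
      proof -
        let ?M = "density ?\<mu> (?k z)"
        let ?f = "\<lambda>w. ennreal (\<delta> w powr (- (e / 2)))" and ?g = "\<lambda>w. ennreal (\<delta> w powr (e / 2))"
        have fg: "?f w * ?g w = 1" "(?f w)\<^sup>2 = ennreal (\<delta> w powr (- e))" "(?g w)\<^sup>2 = ennreal (\<delta> w powr e)" if "w \<in> space ?\<mu>" for w
          using \<delta>0[of w] that by (auto simp: ennreal_mult[symmetric] power2_eq_square powr_add[symmetric])
        have "(\<integral>\<^sup>+w. ?f w * ?g w \<partial>?M)\<^sup>2 \<le> (\<integral>\<^sup>+w. (?f w)\<^sup>2 \<partial>?M) * (\<integral>\<^sup>+w. (?g w)\<^sup>2 \<partial>?M)"
          by (rule Cauchy_Schwarz_nn_integral) measurable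
        moreover have "(\<integral>\<^sup>+w. ?f w * ?g w \<partial>?M) = T z"
          unfolding T_def by (subst nn_integral_density) (auto intro!: nn_integral_cong simp: fg simp del: space_bmeas)
        moreover have "(\<integral>\<^sup>+w. (?f w)\<^sup>2 \<partial>?M) = (\<integral>\<^sup>+w. \<phi> w * ennreal (\<delta> w powr (- e)) * ennreal (kor z w powr (- ?N)) \<partial>?\<mu>)"
          by (subst nn_integral_density) (auto intro!: nn_integral_cong simp: fg mult_ac simp del: space_bmeas)
        moreover have "(\<integral>\<^sup>+w. (?g w)\<^sup>2 \<partial>?M) = (\<integral>\<^sup>+w. \<phi> w * ennreal (\<delta> w powr e) * ennreal (kor z w powr (- ?N)) \<partial>?\<mu>)"
          by (subst nn_integral_density) (auto intro!: nn_integral_cong simp: fg mult_ac simp del: space_bmeas)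
        ultimately have "(T z)\<^sup>2 \<le> (\<integral>\<^sup>+w. \<phi> w * ennreal (\<delta> w powr (- e)) * ennreal (kor z w powr (- ?N)) \<partial>?\<mu>)
            * (\<integral>\<^sup>+w. \<phi> w * ennreal (\<delta> w powr e) * ennreal (kor z w powr (- ?N)) \<partial>?\<mu>)"
          by (simp only:)
        also have "\<dots> \<le> ennreal (A * K2 * (1 - norm z) powr (- e))
            * (\<integral>\<^sup>+w. \<phi> w * ennreal (\<delta> w powr e) * ennreal (kor z w powr (- ?N)) \<partial>?\<mu>)"
          by (rule mult_right_mono[OF i[OF z]]) simp
        finally show ?thesis .
      qed
      define H where "H z w = \<phi> w * ennreal (\<delta> w powr e) * (indicator S z * (ennreal ((1 - norm z) powr (- e)) * ennreal (kor z w powr (- ?N))))" for z w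
      have mH: "(\<lambda>(z, w). H z w) \<in> borel_measurable (?\<mu> \<Otimes>\<^sub>M ?\<mu>)"
      proof -
        have 1: "(\<lambda>x. \<phi> (snd x) * ennreal (\<delta> (snd x) powr e)) \<in> borel_measurable (?\<mu> \<Otimes>\<^sub>M ?\<mu>)"
          by (rule measurable_compose[OF measurable_snd]) measurable
        have n: "(\<lambda>z. ennreal ((1 - norm z) powr (- e))) \<in> borel_measurable ?\<mu>"
          by (intro borel_measurable_bmeas_borel) measurable
        have "(\<lambda>z. indicator S z * ennreal ((1 - norm z) powr (- e))) \<in> borel_measurable ?\<mu>"
          using n by measurable
        from measurable_compose[OF measurable_fst this]
        have 2: "(\<lambda>x. indicator S (fst x) * ennreal ((1 - norm (fst x)) powr (- e))) \<in> borel_measurable (?\<mu> \<Otimes>\<^sub>M ?\<mu>)" .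
        have 3: "(\<lambda>x. ennreal (kor (fst x) (snd x) powr (- ?N))) \<in> borel_measurable (?\<mu> \<Otimes>\<^sub>M ?\<mu>)" by measurable
        show ?thesis
          using borel_measurable_times_ennreal[OF 1 borel_measurable_times_ennreal[OF 2 3]]
          by (simp add: H_def case_prod_beta' mult.assoc)
      qed
      have mk: "(\<lambda>w. ennreal (kor z w powr (- ?N))) \<in> borel_measurable ?\<mu>" for z by measurable
      have "(\<integral>\<^sup>+z. indicator S z * (T z)\<^sup>2 \<partial>?\<mu>) \<le> (\<integral>\<^sup>+z. ennreal (A * K2) * (\<integral>\<^sup>+w. H z w \<partial>?\<mu>) \<partial>?\<mu>)"
      proof (rule nn_integral_mono)
        fix z assume "z \<in> space ?\<mu>"
        show "indicator S z * (T z)\<^sup>2 \<le> ennreal (A * K2) * (\<integral>\<^sup>+w. H z w \<partial>?\<mu>)"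
        proof (cases "z \<in> S")
          case True
          have "(\<integral>\<^sup>+w. H z w \<partial>?\<mu>) = (\<integral>\<^sup>+w. ennreal ((1 - norm z) powr (- e)) * (\<phi> w * ennreal (\<delta> w powr e) * ennreal (kor z w powr (- ?N))) \<partial>?\<mu>)"
            unfolding H_def using True by (simp add: mult_ac)
          also have "\<dots> = ennreal ((1 - norm z) powr (- e)) * (\<integral>\<^sup>+w. \<phi> w * ennreal (\<delta> w powr e) * ennreal (kor z w powr (- ?N)) \<partial>?\<mu>)"
            by (rule nn_integral_cmult) measurable
          finally have "ennreal (A * K2) * (\<integral>\<^sup>+w. H z w \<partial>?\<mu>)
            = ennreal (A * K2 * (1 - norm z) powr (- e)) * (\<integral>\<^sup>+w. \<phi> w * ennreal (\<delta> w powr e) * ennreal (kor z w powr (- ?N)) \<partial>?\<mu>)"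
            using A K2 by (simp add: ennreal_mult mult.assoc)
          then show ?thesis using CS[OF True] True by simp
        qed simp
      qed
      also have "\<dots> = ennreal (A * K2) * (\<integral>\<^sup>+z. (\<integral>\<^sup>+w. H z w \<partial>?\<mu>) \<partial>?\<mu>)"
        by (rule nn_integral_cmult) (rule fin.borel_measurable_nn_integral[OF mH])
      also have "(\<integral>\<^sup>+z. (\<integral>\<^sup>+w. H z w \<partial>?\<mu>) \<partial>?\<mu>) = (\<integral>\<^sup>+w. (\<integral>\<^sup>+z. H z w \<partial>?\<mu>) \<partial>?\<mu>)"
        by (rule P.Fubini'[OF mH, symmetric])
      also have "\<dots> \<le> (\<integral>\<^sup>+w. ennreal K3 * \<phi> w \<partial>?\<mu>)"
      proof (rule nn_integral_mono)
        fix w assume "w \<in> space ?\<mu>"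
        then have w: "w \<in> ball 0 1" by simp
        have "(\<integral>\<^sup>+z. H z w \<partial>?\<mu>) = \<phi> w * ennreal (\<delta> w powr e) * (\<integral>\<^sup>+z. indicator S z * (ennreal ((1 - norm z) powr (- e)) * ennreal (kor z w powr (- ?N))) \<partial>?\<mu>)"
          unfolding H_def
        proof (rule nn_integral_cmult)
          have 1: "(\<lambda>z. ennreal ((1 - norm z) powr (- e))) \<in> borel_measurable ?\<mu>" by (intro borel_measurable_bmeas_borel) measurable
          have 2: "(\<lambda>z. ennreal (kor z w powr (- ?N))) \<in> borel_measurable ?\<mu>" using mk[of w] by (simp add: kor_sym)
          show "(\<lambda>z. indicator S z * (ennreal ((1 - norm z) powr (- e)) * ennreal (kor z w powr (- ?N)))) \<in> borel_measurable ?\<mu>"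
            using 1 2 by measurable
        qed
        also have "\<dots> \<le> \<phi> w * ennreal (\<delta> w powr e) * ennreal (K3 * \<delta> w powr (- e))"
          by (intro mult_left_mono ii[OF w]) simp
        also have "\<dots> = \<phi> w * ennreal (\<delta> w powr e * (K3 * \<delta> w powr (- e)))"
          using K3 by (simp add: ennreal_mult mult.assoc)
        also have "\<delta> w powr e * (K3 * \<delta> w powr (- e)) = K3"
          using \<delta>0[OF w] by (simp add: powr_minus field_simps)
        finally show "(\<integral>\<^sup>+z. H z w \<partial>?\<mu>) \<le> ennreal K3 * \<phi> w" by (simp add: mult.commute)
      qed
      also have "\<dots> = ennreal K3 * ?I" by (rule nn_integral_cmult) measurable
      finally show ?thesis
        using A K2 K3 by (simp add: ennreal_mult mult_left_mono mult.assoc)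
    qed simp
    let ?E = "{z \<in> ball 0 1. ennreal \<tau> < T z}"
    have mE: "?E \<in> sets ?\<mu>"
    proof -
      have "{z \<in> space ?\<mu>. ennreal \<tau> < T z} \<in> sets ?\<mu>" by measurable
      then show ?thesis by simp
    qed
    \<comment> \<open>Chebyshev's inequality for the square of T; one of the two factors \<tau>
      cancels the one contained in A.\<close>
    have "ennreal \<tau> * (ennreal \<tau> * emeasure ?\<mu> (?E \<inter> S)) = (\<integral>\<^sup>+z. (ennreal \<tau>)\<^sup>2 * indicator (?E \<inter> S) z \<partial>?\<mu>)"
      using mE Sm by (subst nn_integral_cmult_indicator) (auto simp: power2_eq_square mult.assoc)
    also have "\<dots> \<le> (\<integral>\<^sup>+z. indicator S z * (T z)\<^sup>2 \<partial>?\<mu>)"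
    proof (rule nn_integral_mono)
      fix z
      have "(ennreal \<tau>)\<^sup>2 \<le> (T z)\<^sup>2" if "ennreal \<tau> < T z" using that by (intro power_mono) auto
      then show "(ennreal \<tau>)\<^sup>2 * indicator (?E \<inter> S) z \<le> indicator S z * (T z)\<^sup>2" by (auto simp: indicator_def)
    qed
    also have "\<dots> \<le> ennreal (A * K2 * K3) * ?I" by (rule L2)
    also have "\<dots> = ennreal \<tau> * (ennreal (4 powr ?N * K2 * K3) * ?I)"
      using \<tau> K2 K3 by (simp add: A_def ennreal_mult mult_ac)
    finally have ES: "ennreal \<tau> * emeasure ?\<mu> (?E \<inter> S) \<le> ennreal (4 powr ?N * K2 * K3) * ?I"
      using ennreal_mult_le_mult_iff[of "ennreal \<tau>"] \<tau> by simp
    have "?E \<subseteq> \<Omega> \<union> (?E \<inter> S)" by (auto simp: S_def)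
    then have "emeasure ?\<mu> ?E \<le> emeasure ?\<mu> (\<Omega> \<union> (?E \<inter> S))" using mE by (intro emeasure_mono) auto
    also have "\<dots> \<le> emeasure ?\<mu> \<Omega> + emeasure ?\<mu> (?E \<inter> S)" using mE by (intro emeasure_subadditive) auto
    finally have "emeasure ?\<mu> ?E \<le> emeasure ?\<mu> \<Omega> + emeasure ?\<mu> (?E \<inter> S)" .
    then have "ennreal \<tau> * emeasure ?\<mu> ?E \<le> ennreal \<tau> * (emeasure ?\<mu> \<Omega> + emeasure ?\<mu> (?E \<inter> S))"
      by (rule mult_left_mono) simp
    also have "\<dots> = ennreal \<tau> * emeasure ?\<mu> \<Omega> + ennreal \<tau> * emeasure ?\<mu> (?E \<inter> S)" by (rule distrib_left)
    also have "\<dots> \<le> ennreal C1 * ?I + ennreal (4 powr ?N * K2 * K3) * ?I" by (rule add_mono[OF \<Omega>m ES])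
    also have "\<dots> = ennreal C * ?I" using C1 K2 K3 by (simp add: C_def distrib_right)
    finally show ?thesis unfolding T_def .
  qed
  with C show thesis by (rule that)
qed

section \<open>Vector-valued kernel integrals\<close>

lemma restrict_space_density:
  assumes f: "f \<in> borel_measurable M" and \<Omega>: "\<Omega> \<inter> space M \<in> sets M"
  shows "restrict_space (density M f) \<Omega> = density (restrict_space M \<Omega>) f"
proof (rule measure_eqI)
  show s: "sets (restrict_space (density M f) \<Omega>) = sets (density (restrict_space M \<Omega>) f)"
    by (simp add: sets_restrict_space)
  fix A assume "A \<in> sets (restrict_space (density M f) \<Omega>)"
  then have Ar: "A \<in> sets (restrict_space M \<Omega>)" using s by simp
  then have A: "A \<in> sets M" "A \<subseteq> \<Omega>" using sets_restrict_space_iff[OF \<Omega>] by auto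
  have "emeasure (restrict_space (density M f) \<Omega>) A = (\<integral>\<^sup>+x. f x * indicator A x \<partial>M)"
    using A \<Omega> f by (simp add: emeasure_restrict_space emeasure_density)
  also have "\<dots> = (\<integral>\<^sup>+x. (f x * indicator A x) * indicator \<Omega> x \<partial>M)"
    using A(2) by (intro nn_integral_cong) (auto simp: indicator_def)
  also have "\<dots> = (\<integral>\<^sup>+x. f x * indicator A x \<partial>restrict_space M \<Omega>)"
    by (rule nn_integral_restrict_space[OF \<Omega>, symmetric])
  also have "\<dots> = emeasure (density (restrict_space M \<Omega>) f) A"
    by (rule emeasure_density[OF measurable_restrict_space1[OF f] Ar, symmetric])
  finally show "emeasure (restrict_space (density M f) \<Omega>) A = emeasure (density (restrict_space M \<Omega>) f) A" .
qed

lemma ball_measure_bmeas: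
  assumes a: "a > -1"
  obtains c :: real where "0 < c" "(ball_measure a :: (complex ^ 'n) measure) = density (bmeas a) (\<lambda>_. ennreal c)"
proof -
  let ?B = "ball (0 :: complex ^ 'n) 1"
  define c where "c = weight_const CARD('n) a / measure lborel ?B"
  have mB: "0 < measure lborel ?B" using content_ball_pos[of 1 "0 :: complex ^ 'n"] by simp
  have eB: "emeasure lborel ?B = ennreal (measure lborel ?B)"
    using emeasure_lborel_ball_finite[of "0 :: complex ^ 'n" 1] by (intro emeasure_eq_ennreal_measure) auto
  have "c > 0 \<and> (ball_measure a :: (complex ^ 'n) measure) = density (bmeas a) (\<lambda>_. ennreal c)"
  proof
    have wc: "0 < weight_const CARD('n) a"
      unfolding weight_const_def using a by (intro divide_pos_pos mult_pos_pos Gamma_real_pos) auto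
    then show c: "0 < c" using mB by (simp add: c_def)
    have mw: "(\<lambda>z. ennreal (k * (1 - (norm z)\<^sup>2) powr a)) \<in> borel_measurable (restrict_space lborel ?B)" for k
    proof (rule measurable_restrict_space1)
      have "(\<lambda>z :: complex ^ 'n. ennreal (k * (1 - (norm z)\<^sup>2) powr a)) \<in> borel_measurable borel" by measurable
      then show "(\<lambda>z :: complex ^ 'n. ennreal (k * (1 - (norm z)\<^sup>2) powr a)) \<in> borel_measurable lborel" by simp
    qed
    have mi: "(\<lambda>z. indicator ?B z / emeasure lborel ?B :: ennreal) \<in> borel_measurable lborel"
      by (intro borel_measurable_divide_ennreal borel_measurable_indicator) auto
    have "(ball_measure a :: (complex ^ 'n) measure)
      = density (density (restrict_space lborel ?B) (\<lambda>z. indicator ?B z / emeasure lborel ?B))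
          (\<lambda>z. ennreal (weight_const CARD('n) a * (1 - (norm z)\<^sup>2) powr a))"
      unfolding ball_measure_def uniform_measure_def
      by (subst restrict_space_density) (use mi in auto)
    also have "\<dots> = density (restrict_space lborel ?B) (\<lambda>z. (indicator ?B z / emeasure lborel ?B) * ennreal (weight_const CARD('n) a * (1 - (norm z)\<^sup>2) powr a))"
      by (rule density_density_eq) (use mw measurable_restrict_space1[OF mi] in auto)
    also have "\<dots> = density (restrict_space lborel ?B) (\<lambda>z. ennreal ((1 - (norm z)\<^sup>2) powr a) * ennreal c)"
    proof (rule density_cong)
      show "(\<lambda>z. (indicator ?B z / emeasure lborel ?B) * ennreal (weight_const CARD('n) a * (1 - (norm z)\<^sup>2) powr a)) \<in> borel_measurable (restrict_space lborel ?B)"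
        using mw measurable_restrict_space1[OF mi] by (intro borel_measurable_times_ennreal) auto
      show "(\<lambda>z. ennreal ((1 - (norm z)\<^sup>2) powr a) * ennreal c) \<in> borel_measurable (restrict_space lborel ?B)"
        using mw[of 1] by (intro borel_measurable_times_ennreal) auto
      show "AE z in restrict_space lborel ?B. (indicator ?B z / emeasure lborel ?B) * ennreal (weight_const CARD('n) a * (1 - (norm z)\<^sup>2) powr a) = ennreal ((1 - (norm z)\<^sup>2) powr a) * ennreal c"
      proof (rule AE_I2)
        fix z assume "z \<in> space (restrict_space lborel ?B)"
        then have "z \<in> ?B" by (simp add: space_restrict_space)
        then show "(indicator ?B z / emeasure lborel ?B) * ennreal (weight_const CARD('n) a * (1 - (norm z)\<^sup>2) powr a) = ennreal ((1 - (norm z)\<^sup>2) powr a) * ennreal c"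
          unfolding eB c_def using mB wc
          by (simp add: divide_ennreal[of 1, unfolded ennreal_1] ennreal_mult[symmetric])
      qed
    qed
    also have "\<dots> = density (bmeas a) (\<lambda>_. ennreal c)"
      unfolding bmeas_def by (rule density_density_eq[symmetric]) (use mw[of 1] in auto)
    finally show "(ball_measure a :: (complex ^ 'n) measure) = density (bmeas a) (\<lambda>_. ennreal c)" .
  qed
  then show thesis using that by blast
qed

lemma bounded_bilinear_scaleC: "bounded_bilinear (scaleC :: complex \<Rightarrow> 'e::complex_normed_vector \<Rightarrow> 'e)"
proof
  show "\<exists>K. \<forall>a b. norm (a *\<^sub>C (b :: 'e)) \<le> norm a * norm b * K"
    by (intro exI[of _ 1]) (simp add: norm_scaleC)
  show "(r *\<^sub>R a) *\<^sub>C b = r *\<^sub>R a *\<^sub>C (b :: 'e)" for r a b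
    by (simp add: scaleR_conv_of_real scaleC_scaleC[symmetric] scaleC_of_real)
qed (simp_all add: scaleC_add_left scaleC_add_right scaleC_scaleR_commute)

lemmas continuous_on_scaleC [continuous_intros] = bounded_bilinear.continuous_on[OF bounded_bilinear_scaleC]
lemmas continuous_on_cblinfun_apply [continuous_intros] = bounded_bilinear.continuous_on[OF bounded_bilinear_cblinfun_apply]
lemmas continuous_on_conjugate [continuous_intros] = bounded_linear.continuous_on[OF bounded_linear_conjugate]

lemma scaleC_complex [simp]: "c *\<^sub>C (x::complex) = c * x"
  by (simp add: scaleC_complex_def)

section \<open>The kernels: branch, size and holomorphy\<close>

lemma cmod_herm_less: "z \<in> ball 0 1 \<Longrightarrow> norm w \<le> 1 \<Longrightarrow> cmod (herm z w) < 1"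
  using cmod_herm_le[of z w] mult_left_le[of "norm w" "norm z"] by simp

text \<open>Keeps 1 - <z,w> away from the branch cut of the principal power.\<close>

lemma one_minus_not_nonpos: "cmod x < 1 \<Longrightarrow> 1 - x \<notin> \<real>\<^sub>\<le>\<^sub>0"
proof
  assume x: "cmod x < 1" and "1 - x \<in> \<real>\<^sub>\<le>\<^sub>0"
  then have "Re (1 - x) \<le> 0" by (simp add: complex_nonpos_Reals_iff)
  then show False using x complex_Re_le_cmod[of x] by simp
qed

lemma one_minus_herm_not_nonpos [simp]:
  "z \<in> ball 0 1 \<Longrightarrow> norm w \<le> 1 \<Longrightarrow> 1 - herm z w \<notin> \<real>\<^sub>\<le>\<^sub>0"
  "norm z \<le> 1 \<Longrightarrow> w \<in> ball 0 1 \<Longrightarrow> 1 - herm z w \<notin> \<real>\<^sub>\<le>\<^sub>0"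
proof -
  show "z \<in> ball 0 1 \<Longrightarrow> norm w \<le> 1 \<Longrightarrow> 1 - herm z w \<notin> \<real>\<^sub>\<le>\<^sub>0" for z w
    using one_minus_not_nonpos[OF cmod_herm_less] by blast
  show "norm z \<le> 1 \<Longrightarrow> w \<in> ball 0 1 \<Longrightarrow> 1 - herm z w \<notin> \<real>\<^sub>\<le>\<^sub>0"
    using one_minus_not_nonpos[OF cmod_herm_less[of w z]] cnj_herm[of z w] one_minus_not_nonpos[of "herm z w"]
    by (metis cmod_herm_less complex_mod_cnj)
qed

lemma norm_kernel: "cmod ((1 - herm z w) powr (- of_real s)) = kor z w powr (- s)"
  unfolding kor_def using norm_powr_real_powr'[of "- of_real s" "1 - herm z w"] by simp

lemma cnj_kernel:
  assumes "z \<in> ball 0 1" "norm w \<le> 1"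
  shows "cnj ((1 - herm z w) powr (- of_real s)) = (1 - herm w z) powr (- of_real s)"
proof -
  have "Re (herm z w) \<le> 1" using cmod_herm_less[OF assms] complex_Re_le_cmod[of "herm z w"] by linarith
  then show ?thesis by (subst cnj_powr) (simp_all add: cnj_herm)
qed

lemma herm_linear_left: "((\<lambda>z. herm z w) has_derivative (\<lambda>v. herm v w)) (at z)"
proof -
  have "bounded_linear (\<lambda>z. herm z w)"
  proof (rule bounded_linear_intro[where K = "norm w"])
    show "herm (r *\<^sub>R z) w = r *\<^sub>R herm z w" for r z
      by (simp only: herm_scaleR_left scaleR_conv_of_real[where ?'a = complex])
  qed (simp_all add: herm_add_left cmod_herm_le)
  then show ?thesis by (rule bounded_linear_imp_has_derivative)
qed

lemma cholo_kernel:
  assumes w: "norm w \<le> 1"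
  shows "cholo (\<lambda>z. (1 - herm z w) powr s) (ball 0 1)"
  unfolding cholo_def
proof
  fix z :: "complex ^ 'a" assume z: "z \<in> ball 0 1"
  have "((\<lambda>x. (1 - x) powr s) has_field_derivative (- s * (1 - herm z w) powr (s - 1))) (at (herm z w))"
    using z w by (auto intro!: derivative_eq_intros)
  from diff_chain_at[OF herm_linear_left[of w z] this[unfolded has_field_derivative_def]]
  have "((\<lambda>z. (1 - herm z w) powr s) has_derivative (\<lambda>v. - s * (1 - herm z w) powr (s - 1) * herm v w)) (at z)"
    by (simp add: o_def)
  then show "\<exists>D. ((\<lambda>z. (1 - herm z w) powr s) has_derivative D) (at z) \<and> (\<forall>c v. D (c *s v) = c *\<^sub>C D v)"
    by (intro exI conjI) (auto simp: herm_smult_left)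
qed

lemma cholo_mult:
  fixes f g :: "complex ^ 'n \<Rightarrow> complex"
  assumes f: "cholo f S" and g: "cholo g S"
  shows "cholo (\<lambda>z. f z * g z) S"
  unfolding cholo_def
proof
  fix z assume z: "z \<in> S"
  have "((\<lambda>z. f z * g z) has_derivative (\<lambda>v. f z * fderiv g z v + fderiv f z v * g z)) (at z)"
    by (rule has_derivative_mult[OF cholo_fderiv(1)[OF f z] cholo_fderiv(1)[OF g z]])
  moreover have "f z * fderiv g z (c *s v) + fderiv f z (c *s v) * g z = c *\<^sub>C (f z * fderiv g z v + fderiv f z v * g z)" for c v
    by (simp add: cholo_fderiv(2)[OF f z] cholo_fderiv(2)[OF g z] algebra_simps)
  ultimately show "\<exists>D. ((\<lambda>z. f z * g z) has_derivative D) (at z) \<and> (\<forall>c v. D (c *s v) = c *\<^sub>C D v)" by blast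
qed

lemma cholo_scaleC_left:
  fixes x :: "'e::complex_normed_vector" and f :: "complex ^ 'n \<Rightarrow> complex"
  assumes f: "cholo f S"
  shows "cholo (\<lambda>z. f z *\<^sub>C x) S"
  by (rule cholo_compose_linear(1)[OF f bounded_bilinear.bounded_linear_left[OF bounded_bilinear_scaleC]])
    (simp add: scaleC_scaleC)

lemma cholo_sum:
  fixes f :: "'i \<Rightarrow> complex ^ 'n \<Rightarrow> 'e::complex_normed_vector"
  assumes f: "\<And>i. i \<in> I \<Longrightarrow> cholo (f i) S"
  shows "cholo (\<lambda>z. \<Sum>i\<in>I. c i *\<^sub>C f i z) S"
  unfolding cholo_def
proof
  fix z assume z: "z \<in> S"
  have d: "((\<lambda>z. c i *\<^sub>C f i z) has_derivative (\<lambda>v. c i *\<^sub>C fderiv (f i) z v)) (at z)" if "i \<in> I" for i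
    by (rule bounded_linear.has_derivative[OF bounded_linear_scaleC cholo_fderiv(1)[OF f[OF that] z]])
  have "((\<lambda>z. \<Sum>i\<in>I. c i *\<^sub>C f i z) has_derivative (\<lambda>v. \<Sum>i\<in>I. c i *\<^sub>C fderiv (f i) z v)) (at z)"
    by (rule has_derivative_sum[OF d])
  moreover have "(\<Sum>i\<in>I. c i *\<^sub>C fderiv (f i) z (d *s v)) = d *\<^sub>C (\<Sum>i\<in>I. c i *\<^sub>C fderiv (f i) z v)" for d v
    by (simp add: cholo_fderiv(2)[OF f z] linear_sum[OF bounded_linear.linear[OF bounded_linear_scaleC]] scaleC_scaleC mult.commute)
  ultimately show "\<exists>D. ((\<lambda>z. \<Sum>i\<in>I. c i *\<^sub>C f i z) has_derivative D) (at z) \<and> (\<forall>c v. D (c *s v) = c *\<^sub>C D v)" by blast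
qed

lemma coef_sum:
  fixes f :: "'i \<Rightarrow> complex ^ 'n \<Rightarrow> complex"
  assumes f: "\<And>i. i \<in> I \<Longrightarrow> cholo (f i) (ball 0 1)"
  shows "coef (\<lambda>z. \<Sum>i\<in>I. c i * f i z) w m = (\<Sum>i\<in>I. c i * coef (f i) w m)"
proof (rule coef_unique[of "1 / (norm w + 1)"])
  show "0 < 1 / (norm w + 1)" by (simp add: add_nonneg_pos)
  fix t assume "cmod t < 1 / (norm w + 1)"
  then have "cmod t * (norm w + 1) < 1" by (simp add: pos_less_divide_eq add_nonneg_pos)
  then have "cmod t * norm w < 1" by (simp add: algebra_simps) (smt (verit) norm_ge_zero)
  then have "(\<lambda>m. \<Sum>i\<in>I. c i * (coef (f i) w m * t ^ m)) sums (\<Sum>i\<in>I. c i * f i (t *s w))"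
    by (intro sums_sum sums_mult coef_sums f)
  then show "(\<lambda>m. (\<Sum>i\<in>I. c i * coef (f i) w m) * t ^ m) sums (\<Sum>i\<in>I. c i * f i (t *s w))"
    by (simp add: sum_distrib_right mult.assoc)
qed

text \<open>Supplies the countable set that existence of the vector-valued integral requires, in
  spaces that need not be separable.\<close>

lemma continuous_on_separable_range:
  fixes G :: "complex ^ 'n \<Rightarrow> 'b::metric_space"
  assumes G: "continuous_on (ball 0 1) G"
  obtains D where "countable D" "G ` ball 0 1 \<subseteq> closure D"
proof -
  obtain D0 :: "(complex ^ 'n) set" where D0: "countable D0" "\<And>X. open X \<Longrightarrow> X \<noteq> {} \<Longrightarrow> \<exists>d\<in>D0. d \<in> X"
    using countable_dense_exists by blast
  show thesis
  proof
    show "countable (G ` (D0 \<inter> ball 0 1))" using D0(1) by auto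
    show "G ` ball 0 1 \<subseteq> closure (G ` (D0 \<inter> ball 0 1))"
    proof clarify
      fix w :: "complex ^ 'n" assume w: "w \<in> ball 0 1"
      show "G w \<in> closure (G ` (D0 \<inter> ball 0 1))"
        unfolding closure_approachable
      proof (intro allI impI)
        fix e :: real assume e: "0 < e"
        obtain d where d: "0 < d" "\<And>x. x \<in> ball 0 1 \<Longrightarrow> dist x w < d \<Longrightarrow> dist (G x) (G w) < e"
          using G w e unfolding continuous_on_iff by blast
        have "w \<in> ball w d \<inter> ball 0 1" using w d(1) by simp
        then obtain x where "x \<in> D0" "x \<in> ball w d \<inter> ball 0 1" using D0(2)[of "ball w d \<inter> ball 0 1"] by blast
        then show "\<exists>y\<in>G ` (D0 \<inter> ball 0 1). dist y (G w) < e" using d(2)[of x] by (auto simp: dist_commute)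
      qed
    qed
  qed
qed

section \<open>Kernel integrals of vector-valued functions\<close>

lemma ball_measure_basics:
  assumes a: "a > -1"
  shows "space (ball_measure a :: (complex ^ 'n) measure) = ball 0 1"
    "continuous_on (ball 0 1) f \<Longrightarrow> f \<in> borel_measurable (ball_measure a :: (complex ^ 'n) measure)"
  by (rule ball_measure_bmeas[OF a, where ?'n='n], simp add: borel_measurable_bmeas)+

lemma has_banach_integral_continuous:
  fixes G :: "complex ^ 'n \<Rightarrow> 'b::cbanach"
  assumes a: "a > -1" and G: "continuous_on (ball 0 1) G" and fin: "(\<integral>\<^sup>+w. ennreal (norm (G w)) \<partial>ball_measure a) < \<infinity>"
  shows "has_banach_integral (ball_measure a) G (banach_integral (ball_measure a) G)"
proof -
  obtain D where "countable D" "G ` ball 0 1 \<subseteq> closure D" by (rule continuous_on_separable_range[OF G])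
  then obtain y where "has_banach_integral (ball_measure a) G y"
    using has_banach_integral_exists[OF ball_measure_basics(2)[OF a G] fin] ball_measure_basics(1)[OF a] by metis
  then show ?thesis using has_banach_integral_eq by metis
qed

lemma ball_measure_integral:
  assumes a: "a > -1"
  obtains c :: real where "0 < c"
    "\<And>f :: complex ^ 'n \<Rightarrow> ennreal. f \<in> borel_measurable (bmeas a) \<Longrightarrow> (\<integral>\<^sup>+z. f z \<partial>ball_measure a) = ennreal c * (\<integral>\<^sup>+z. f z \<partial>bmeas a)"
    "\<And>X :: (complex ^ 'n) set. X \<in> sets (bmeas a) \<Longrightarrow> emeasure (ball_measure a) X = ennreal c * emeasure (bmeas a) X"
    "\<And>f :: complex ^ 'n \<Rightarrow> complex. f \<in> borel_measurable (bmeas a) \<Longrightarrow> (\<integral>z. f z \<partial>ball_measure a) = of_real c * (\<integral>z. f z \<partial>bmeas a)"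
    "\<And>f :: complex ^ 'n \<Rightarrow> complex. f \<in> borel_measurable (bmeas a) \<Longrightarrow> integrable (ball_measure a) f \<longleftrightarrow> integrable (bmeas a) f"
proof -
  obtain c where c: "0 < c" "(ball_measure a :: (complex ^ 'n) measure) = density (bmeas a) (\<lambda>_. ennreal c)"
    by (rule ball_measure_bmeas[OF a, where ?'n = 'n])
  show thesis
  proof (rule that[OF c(1)])
    show "(\<integral>\<^sup>+z. f z \<partial>ball_measure a) = ennreal c * (\<integral>\<^sup>+z. f z \<partial>bmeas a)" if "f \<in> borel_measurable (bmeas a)" for f :: "complex ^ 'n \<Rightarrow> ennreal"
      unfolding c(2) using that by (simp add: nn_integral_density nn_integral_cmult)
    show "emeasure (ball_measure a) X = ennreal c * emeasure (bmeas a) X" if "X \<in> sets (bmeas a)" for X :: "(complex ^ 'n) set"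
      unfolding c(2) using that by (simp add: emeasure_density nn_integral_cmult_indicator)
    show "(\<integral>z. f z \<partial>ball_measure a) = of_real c * (\<integral>z. f z \<partial>bmeas a)" if "f \<in> borel_measurable (bmeas a)" for f :: "complex ^ 'n \<Rightarrow> complex"
      unfolding c(2) using that c(1) by (subst integral_density) (auto simp: scaleR_conv_of_real)
    show "integrable (ball_measure a) f \<longleftrightarrow> integrable (bmeas a) f" if "f \<in> borel_measurable (bmeas a)" for f :: "complex ^ 'n \<Rightarrow> complex"
    proof -
      have "integrable (ball_measure a) f \<longleftrightarrow> integrable (bmeas a) (\<lambda>x. of_real c * f x)"
        unfolding c(2) using that c(1) by (subst integrable_density) (auto simp: scaleR_conv_of_real)
      also have "\<dots> \<longleftrightarrow> integrable (bmeas a) f"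
      proof
        assume "integrable (bmeas a) (\<lambda>x. of_real c * f x)"
        from integrable_mult_right[OF this, of "inverse (of_real c)"] show "integrable (bmeas a) f"
          using c(1) by (simp add: mult.assoc[symmetric])
      qed simp
      finally show ?thesis .
    qed
  qed
qed

text \<open>The passage to scalar integrals: a bounded continuous kernel keeps the integrand
  absolutely integrable with separable range, so the vector-valued integral exists and functionals
  may be moved inside.\<close>

lemma banach_integral_kernel:
  fixes \<Phi> :: "complex ^ 'n \<Rightarrow> 'b::cbanach" and \<phi> :: "('b, complex) cblinfun"
  assumes a: "a > -1" and \<Phi>: "continuous_on (ball 0 1) \<Phi>" "(\<integral>\<^sup>+w. ennreal (norm (\<Phi> w)) \<partial>ball_measure a) < \<infinity>"
    and K: "continuous_on (ball 0 1) K" "\<And>w. w \<in> ball 0 1 \<Longrightarrow> cmod (K w) \<le> B"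
  shows "integrable (ball_measure a) (\<lambda>w. K w * cblinfun_apply \<phi> (\<Phi> w))"
    "cblinfun_apply \<phi> (banach_integral (ball_measure a) (\<lambda>w. K w *\<^sub>C \<Phi> w)) = (\<integral>w. K w * cblinfun_apply \<phi> (\<Phi> w) \<partial>ball_measure a)"
proof -
  have B: "0 \<le> B" using K(2)[of 0] by (metis centre_in_ball norm_ge_zero order_trans zero_less_one)
  have c: "continuous_on (ball 0 1) (\<lambda>w. K w *\<^sub>C \<Phi> w)" by (intro continuous_intros \<Phi> K)
  have m: "(\<lambda>w. ennreal (norm (\<Phi> w))) \<in> borel_measurable (ball_measure a)"
    using ball_measure_basics(2)[OF a continuous_on_norm[OF \<Phi>(1)]] by measurable
  have "(\<integral>\<^sup>+w. ennreal (norm (K w *\<^sub>C \<Phi> w)) \<partial>ball_measure a) \<le> (\<integral>\<^sup>+w. ennreal B * ennreal (norm (\<Phi> w)) \<partial>ball_measure a)"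
  proof (rule nn_integral_mono)
    fix w :: "complex ^ 'n" assume "w \<in> space (ball_measure a)"
    then have "w \<in> ball 0 1" by (simp only: ball_measure_basics(1)[OF a])
    then have "cmod (K w) * norm (\<Phi> w) \<le> B * norm (\<Phi> w)" using K(2)[of w] by (intro mult_right_mono) auto
    then show "ennreal (norm (K w *\<^sub>C \<Phi> w)) \<le> ennreal B * ennreal (norm (\<Phi> w))"
      using B by (simp add: norm_scaleC ennreal_mult[symmetric] ennreal_leI)
  qed
  also have "\<dots> = ennreal B * (\<integral>\<^sup>+w. ennreal (norm (\<Phi> w)) \<partial>ball_measure a)" by (rule nn_integral_cmult[OF m])
  also have "\<dots> < \<infinity>" using \<Phi>(2) by (simp add: ennreal_mult_less_top)
  finally have "has_banach_integral (ball_measure a) (\<lambda>w. K w *\<^sub>C \<Phi> w) (banach_integral (ball_measure a) (\<lambda>w. K w *\<^sub>C \<Phi> w))"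
    by (rule has_banach_integral_continuous[OF a c])
  from has_banach_integral_functional'[OF this, of \<phi>]
  show "integrable (ball_measure a) (\<lambda>w. K w * cblinfun_apply \<phi> (\<Phi> w))"
    "cblinfun_apply \<phi> (banach_integral (ball_measure a) (\<lambda>w. K w *\<^sub>C \<Phi> w)) = (\<integral>w. K w * cblinfun_apply \<phi> (\<Phi> w) \<partial>ball_measure a)"
    by (simp_all add: cblinfun_apply_scaleC)
qed

lemma continuous_on_kernel:
  assumes "norm z < 1"
  shows "continuous_on (ball 0 1) (\<lambda>w. (1 - herm z w) powr s)"
proof -
  have "continuous_on (ball 0 1) (\<lambda>w. herm z w)"
    unfolding herm_def by (intro continuous_intros)
  moreover have "0 < Re (1 - herm z w)" if "w \<in> ball 0 1" for w
    using cmod_herm_le[of z w] mult_left_le[of "norm w" "norm z"] assms that complex_Re_le_cmod[of "herm z w"] by simp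
  ultimately show ?thesis
    by (intro continuous_on_powr_complex continuous_on_diff continuous_on_const) (force simp: less_imp_le)+
qed

lemma kernel_le:
  assumes "norm z < 1" "0 \<le> s" "w \<in> ball 0 1"
  shows "kor z w powr (- s) \<le> (1 - norm z) powr (- s)"
  using assms kor_ge[of z w] by (intro powr_mono2') auto

text \<open>The Taylor bound for the power (1 - x)^(-s) at x = <z,w> with increment <v,w>. It is
  uniform in w, because on the disc of radius (1 - norm z) / 2 around x the base stays at least that
  far from 0.\<close>

lemma kernel_remainder:
  assumes z: "norm z < 1" and w: "norm w \<le> 1" and s: "0 \<le> s" and v: "norm v \<le> (1 - norm z) / 4"
  shows "cmod ((1 - herm (z + v) w) powr (- of_real s) - (1 - herm z w) powr (- of_real s)
     - of_real s * (1 - herm z w) powr (- of_real s - 1) * herm v w)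
    \<le> 18 * ((1 - norm z) / 2) powr (- s) / ((1 - norm z) / 2)\<^sup>2 * (norm v)\<^sup>2"
proof -
  define r where "r = (1 - norm z) / 2"
  have r: "0 < r" using z by (simp add: r_def)
  let ?x = "herm z w" and ?t = "herm v w"
  let ?h = "\<lambda>t. (1 - (?x + t)) powr (- of_real s)"
  have x: "cmod ?x \<le> norm z" using cmod_herm_le[of z w] mult_left_le[OF w, of "norm z"] by simp
  have t: "cmod ?t \<le> norm v" using cmod_herm_le[of v w] mult_left_le[OF w, of "norm v"] by simp
  have n: "1 - (?x + t) \<notin> \<real>\<^sub>\<le>\<^sub>0" "r \<le> cmod (1 - (?x + t))" if "t \<in> ball 0 r" for t :: complex
  proof -
    have "cmod (?x + t) < 1 - r" using norm_triangle_ineq[of ?x t] x that r_def by simp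
    then show "1 - (?x + t) \<notin> \<real>\<^sub>\<le>\<^sub>0" "r \<le> cmod (1 - (?x + t))"
      using one_minus_not_nonpos[of "?x + t"] r norm_triangle_ineq2[of 1 "?x + t"] by auto
  qed
  have d: "(?h has_field_derivative (of_real s * (1 - (?x + t)) powr (- of_real s - 1))) (at t)" if "t \<in> ball 0 r" for t :: complex
    using n(1)[OF that] by (auto intro!: derivative_eq_intros)
  have "cmod (?h ?t - ?h 0 - ?t * (of_real s * (1 - ?x) powr (- of_real s - 1))) \<le> 18 * r powr (- s) / r\<^sup>2 * (cmod ?t)\<^sup>2"
  proof (rule Taylor2_bound[OF _ r])
    show "?h holomorphic_on ball 0 r" unfolding holomorphic_on_open[OF open_ball] using d by blast
    show "cmod ?t \<le> r / 2" using t v by (simp add: r_def)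
    show "(?h has_field_derivative (of_real s * (1 - ?x) powr (- of_real s - 1))) (at 0)" using d[of 0] r by simp
    fix t :: complex assume "t \<in> ball 0 r"
    then have "cmod (?h t) = cmod (1 - (?x + t)) powr (- s)"
      using norm_powr_real_powr'[of "- of_real s" "1 - (?x + t)"] by simp
    also have "\<dots> \<le> r powr (- s)" using n(2)[OF \<open>t \<in> ball 0 r\<close>] r s by (intro powr_mono2') auto
    finally show "cmod (?h t) \<le> r powr (- s)" .
  qed
  also have "\<dots> \<le> 18 * r powr (- s) / r\<^sup>2 * (norm v)\<^sup>2"
    using t by (intro mult_left_mono power_mono) auto
  finally show ?thesis unfolding r_def[symmetric] by (simp add: herm_add_left mult_ac)
qed

text \<open>Differentiation under the integral sign. The derivative is guessed as the integral D of
  the differentiated kernel; identities and the quadratic remainder are checked on functionals of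
  norm at most 1, with bounds independent of the functional.\<close>

lemma cholo_kernel_integral:
  fixes \<Phi> :: "complex ^ 'n \<Rightarrow> 'b::cbanach"
  assumes a: "a > -1" and s: "0 \<le> s" and \<Phi>: "continuous_on (ball 0 1) \<Phi>" "(\<integral>\<^sup>+w. ennreal (norm (\<Phi> w)) \<partial>ball_measure a) < \<infinity>"
  shows "cholo (\<lambda>z. banach_integral (ball_measure a) (\<lambda>w. (1 - herm z w) powr (- of_real s) *\<^sub>C \<Phi> w)) (ball 0 1)"
  unfolding cholo_def
proof
  fix z :: "complex ^ 'n" assume "z \<in> ball 0 1"
  then have z: "norm z < 1" by simp
  let ?M = "ball_measure a :: (complex ^ 'n) measure"
  define h where "h z = banach_integral ?M (\<lambda>w. (1 - herm z w) powr (- of_real s) *\<^sub>C \<Phi> w)" for z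
  define k where "k v w = of_real s * (1 - herm z w) powr (- of_real s - 1) * herm v w" for v w
  define D where "D v = banach_integral ?M (\<lambda>w. k v w *\<^sub>C \<Phi> w)" for v
  have sp: "space ?M = ball 0 1" by (rule ball_measure_basics(1)[OF a])
  have m\<Phi>: "(\<lambda>w. norm (\<Phi> w)) \<in> borel_measurable ?M"
    by (rule ball_measure_basics(2)[OF a continuous_on_norm[OF \<Phi>(1)]])
  have i\<Phi>: "integrable ?M (\<lambda>w. norm (\<Phi> w))"
    by (rule integrableI_bounded[OF m\<Phi>]) (use \<Phi>(2) in simp)
  define J where "J = (\<integral>w. norm (\<Phi> w) \<partial>?M)"
  have J: "0 \<le> J" unfolding J_def by (rule integral_nonneg_AE) simp
  have hval: "integrable ?M (\<lambda>w. (1 - herm z' w) powr (- of_real s) * cblinfun_apply \<phi> (\<Phi> w))"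
    "cblinfun_apply \<phi> (h z') = (\<integral>w. (1 - herm z' w) powr (- of_real s) * cblinfun_apply \<phi> (\<Phi> w) \<partial>?M)"
    if "norm z' < 1" for z' and \<phi> :: "('b, complex) cblinfun"
    unfolding h_def
    using banach_integral_kernel[OF a \<Phi> continuous_on_kernel[OF that], of "- of_real s" "(1 - norm z') powr (- s)" \<phi>] kernel_le[OF that s]
    by (simp_all add: norm_kernel)
  have ks: "continuous_on (ball 0 1) (k v)" for v
    unfolding k_def[abs_def] by (intro continuous_intros continuous_on_kernel[OF z])
  have kb: "cmod (k v w) \<le> s * (1 - norm z) powr (- (s + 1)) * norm v" if "w \<in> ball 0 1" for v w
  proof -
    have "cmod ((1 - herm z w) powr (- of_real s - 1)) = kor z w powr (- (s + 1))"
      using norm_kernel[of z w "s + 1"] by simp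
    also have "\<dots> \<le> (1 - norm z) powr (- (s + 1))" using kernel_le[OF z _ that, of "s + 1"] s by simp
    finally have 1: "cmod ((1 - herm z w) powr (- of_real s - 1)) \<le> (1 - norm z) powr (- (s + 1))" .
    have 2: "cmod (herm v w) \<le> norm v" using cmod_herm_le[of v w] mult_left_le[of "norm w" "norm v"] that by simp
    show ?thesis unfolding k_def norm_mult using s 1 2 by (intro mult_mono) auto
  qed
  have Dval: "integrable ?M (\<lambda>w. k v w * cblinfun_apply \<phi> (\<Phi> w))"
    "cblinfun_apply \<phi> (D v) = (\<integral>w. k v w * cblinfun_apply \<phi> (\<Phi> w) \<partial>?M)" for v and \<phi> :: "('b, complex) cblinfun"
    unfolding D_def using banach_integral_kernel[OF a \<Phi> ks kb] by blast+
  have hom: "D (c *s v) = c *\<^sub>C D v" for c v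
  proof (rule eq_functionals)
    fix \<phi> :: "('b, complex) cblinfun"
    have "(\<integral>w. k (c *s v) w * cblinfun_apply \<phi> (\<Phi> w) \<partial>?M) = (\<integral>w. c * (k v w * cblinfun_apply \<phi> (\<Phi> w)) \<partial>?M)"
      by (simp add: k_def herm_smult_left mult_ac)
    then show "cblinfun_apply \<phi> (D (c *s v)) = cblinfun_apply \<phi> (c *\<^sub>C D v)"
      by (simp add: Dval(2) cblinfun_apply_scaleC)
  qed
  have add: "D (v + v') = D v + D v'" for v v'
  proof (rule eq_functionals)
    fix \<phi> :: "('b, complex) cblinfun"
    have "(\<integral>w. k (v + v') w * cblinfun_apply \<phi> (\<Phi> w) \<partial>?M) = (\<integral>w. k v w * cblinfun_apply \<phi> (\<Phi> w) + k v' w * cblinfun_apply \<phi> (\<Phi> w) \<partial>?M)"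
      by (simp add: k_def herm_add_left algebra_simps)
    then show "cblinfun_apply \<phi> (D (v + v')) = cblinfun_apply \<phi> (D v + D v')"
      by (simp add: Dval linear_add[OF bounded_linear.linear[OF bounded_linear_cblinfun_apply]])
  qed
  have "linear D"
    by (rule linearI) (simp_all add: add hom[of "of_real _", unfolded of_real_smult scaleC_of_real])
  then have blD: "bounded_linear D" by (simp add: linear_conv_bounded_linear)
  define c where "c = 18 * ((1 - norm z) / 2) powr (- s) / ((1 - norm z) / 2)\<^sup>2"
  have rem: "norm (h (z + v) - h z - D v) \<le> c * (norm v)\<^sup>2 * J" if v: "norm v \<le> (1 - norm z) / 4" for v
  proof (rule norm_le_functionals)
    fix \<phi> :: "('b, complex) cblinfun" assume \<phi>: "norm \<phi> \<le> 1"
    interpret l: bounded_linear "cblinfun_apply \<phi>" by (rule bounded_linear_cblinfun_apply)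
    have zv: "norm (z + v) < 1" using norm_triangle_ineq[of z v] v z by simp
    let ?r = "\<lambda>w. (1 - herm (z + v) w) powr (- of_real s) - (1 - herm z w) powr (- of_real s) - k v w"
    have "cblinfun_apply \<phi> (h (z + v) - h z - D v) = (\<integral>w. (1 - herm (z + v) w) powr (- of_real s) * cblinfun_apply \<phi> (\<Phi> w)
       - (1 - herm z w) powr (- of_real s) * cblinfun_apply \<phi> (\<Phi> w) - k v w * cblinfun_apply \<phi> (\<Phi> w) \<partial>?M)"
      by (simp add: l.diff hval z zv Dval)
    then have e: "cblinfun_apply \<phi> (h (z + v) - h z - D v) = (\<integral>w. ?r w * cblinfun_apply \<phi> (\<Phi> w) \<partial>?M)"
      by (simp add: left_diff_distrib)
    have "norm (\<integral>w. ?r w * cblinfun_apply \<phi> (\<Phi> w) \<partial>?M) \<le> (\<integral>w. c * (norm v)\<^sup>2 * norm (\<Phi> w) \<partial>?M)"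
    proof (rule Bochner_Integration.integral_norm_bound_integral)
      show "integrable ?M (\<lambda>w. ?r w * cblinfun_apply \<phi> (\<Phi> w))"
        using hval(1)[OF z, of \<phi>] hval(1)[OF zv, of \<phi>] Dval(1)[of v \<phi>] by (simp add: left_diff_distrib)
      show "integrable ?M (\<lambda>w. c * (norm v)\<^sup>2 * norm (\<Phi> w))" using i\<Phi> by simp
      fix w assume "w \<in> space ?M"
      then have w: "norm w < 1" using sp by simp
      have "cmod (?r w) \<le> c * (norm v)\<^sup>2" unfolding c_def k_def by (rule kernel_remainder) (use z w s v in auto)
      moreover have "cmod (cblinfun_apply \<phi> (\<Phi> w)) \<le> norm (\<Phi> w)"
        using norm_cblinfun_apply[of \<phi> "\<Phi> w"] mult_right_mono[OF \<phi>, of "norm (\<Phi> w)"] by simp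
      ultimately show "norm (?r w * cblinfun_apply \<phi> (\<Phi> w)) \<le> c * (norm v)\<^sup>2 * norm (\<Phi> w)"
        unfolding norm_mult by (intro mult_mono) (auto simp: c_def)
    qed
    also have "\<dots> = c * (norm v)\<^sup>2 * J" by (simp add: J_def)
    finally show "cmod (cblinfun_apply \<phi> (h (z + v) - h z - D v)) \<le> c * (norm v)\<^sup>2 * J" using e by simp
  qed
  have "(h has_derivative D) (at z)"
    unfolding has_derivative_at
  proof (intro conjI blD)
    show "((\<lambda>v. norm (h (z + v) - h z - D v) / norm v) \<longlongrightarrow> 0) (at 0)"
    proof (rule tendsto_sandwich[OF _ _ tendsto_const])
      have "((\<lambda>v :: complex ^ 'n. c * J * norm v) \<longlongrightarrow> c * J * norm (0 :: complex ^ 'n)) (at 0)"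
        by (intro tendsto_mult tendsto_const tendsto_norm[OF tendsto_ident_at])
      then show "((\<lambda>v :: complex ^ 'n. c * J * norm v) \<longlongrightarrow> 0) (at 0)" by simp
      have "\<forall>\<^sub>F v in at 0. v \<in> ball (0 :: complex ^ 'n) ((1 - norm z) / 4) - {0}"
        using z by (intro eventually_at_in_open) auto
      then show "\<forall>\<^sub>F v in at 0. norm (h (z + v) - h z - D v) / norm v \<le> c * J * norm v"
      proof eventually_elim
        case (elim v)
        then have "norm (h (z + v) - h z - D v) \<le> c * (norm v)\<^sup>2 * J" by (intro rem) auto
        then show ?case using elim by (simp add: field_simps power2_eq_square)
      qed
    qed simp
  qed
  then show "\<exists>D. ((\<lambda>z. banach_integral ?M (\<lambda>w. (1 - herm z w) powr (- of_real s) *\<^sub>C \<Phi> w)) has_derivative D) (at z) \<and> (\<forall>c v. D (c *s v) = c *\<^sub>C D v)"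
    unfolding h_def using hom by blast
qed

text \<open>A substitute for subharmonicity. Let M be the supremum of F u = (1 - |u|^2)^t |g u|.
  Reproducing g by the kernel of exponent t and estimating |g|^(1-p) through M gives M \<le> K
  M^(1-p) I, with I the integral of |g|^p. The bound B makes M finite, so that M^(1-p) can be
  cancelled.\<close>

lemma scalar_point_estimate:
  assumes a: "a > -1" and p: "0 < p" "p \<le> 1"
  obtains K :: real where "0 < K"
    "\<And>(g :: complex ^ 'n \<Rightarrow> complex) B w. cholo g (ball 0 1) \<Longrightarrow> (\<And>u. u \<in> ball 0 1 \<Longrightarrow> cmod (g u) \<le> B) \<Longrightarrow> w \<in> ball 0 1 \<Longrightarrow>
      ennreal ((1 - (norm w)\<^sup>2) powr (real CARD('n) + 1 + a) * cmod (g w) powr p) \<le> ennreal K * (\<integral>\<^sup>+u. ennreal (cmod (g u) powr p) \<partial>bmeas a)"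
proof -
  let ?N = "real CARD('n) + 1 + a"
  have N: "0 < ?N" using a by linarith
  \<comment> \<open>With this b the exponent t = N / p reproduces for the weight a + b, and b = t (1
    - p) is the power of 1 - |u|^2 that F^(1-p) provides.\<close>
  define b where "b = ?N * (1 / p - 1)"
  define t where "t = ?N / p"
  have t: "0 < t" "t = real CARD('n) + 1 + (a + b)" "t * (1 - p) = b" "t * p = ?N"
    using p N by (simp_all add: t_def b_def field_simps)
  have b: "0 \<le> b" unfolding b_def using N p by (intro mult_nonneg_nonneg) auto
  have ab: "a + b > -1" using a b by linarith
  obtain C where C: "0 < C" and ker: "\<And>s (g :: complex ^ 'n \<Rightarrow> complex) w. s > 0 \<Longrightarrow> cholo g (ball 0 1) \<Longrightarrow> integrable (bmeas (a + b)) g \<Longrightarrow> w \<in> ball 0 1 \<Longrightarrow>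
      (\<lambda>m. of_real (C * (pochhammer s m / pochhammer (real CARD('n) + 1 + (a + b)) m)) * coef g w m) sums
        (\<integral>u. (1 - herm w u) powr (- of_real s) * g u \<partial>bmeas (a + b))"
    by (rule kernel_integral[OF ab, where ?'n = 'n]) blast
  define K where "K = 2 powr t / C"
  have K: "0 < K" using C by (simp add: K_def)
  have "ennreal ((1 - (norm w)\<^sup>2) powr ?N * cmod (g w) powr p) \<le> ennreal K * (\<integral>\<^sup>+u. ennreal (cmod (g u) powr p) \<partial>bmeas a)"
    if g: "cholo g (ball 0 1)" and B: "\<And>u. u \<in> ball 0 1 \<Longrightarrow> cmod (g u) \<le> B" and w: "w \<in> ball 0 1" for g :: "complex ^ 'n \<Rightarrow> complex" and B w
  proof -
    have cg: "continuous_on (ball 0 1) g" by (rule cholo_continuous[OF g])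
    have B0: "0 \<le> B" using B[of 0] by (metis centre_in_ball norm_ge_zero order_trans zero_less_one)
    have mg: "(\<lambda>u. cmod (g u)) \<in> borel_measurable (bmeas a')" for a' by (intro borel_measurable_bmeas continuous_intros cg)
    interpret f1: finite_measure "bmeas a :: (complex ^ 'n) measure" by (rule finite_measure_bmeas[OF a])
    interpret f2: finite_measure "bmeas (a + b) :: (complex ^ 'n) measure" by (rule finite_measure_bmeas[OF ab])
    have ig: "integrable (bmeas (a + b)) g"
      by (rule f2.integrable_const_bound[where B=B]) (use B borel_measurable_bmeas[OF cg] in auto)
    let ?I = "\<integral>\<^sup>+u. ennreal (cmod (g u) powr p) \<partial>bmeas a"
    have "?I \<le> (\<integral>\<^sup>+u. ennreal (B powr p) \<partial>(bmeas a :: (complex ^ 'n) measure))"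
      by (intro nn_integral_mono ennreal_leI powr_mono2) (use B p in auto)
    also have "\<dots> < \<infinity>" by (simp add: ennreal_mult_eq_top_iff f1.emeasure_finite less_top[symmetric])
    finally have Ifin: "?I < \<infinity>" .
    define I where "I = enn2real ?I"
    have I: "?I = ennreal I" "0 \<le> I" using Ifin by (simp_all add: I_def)
    have rep: "(\<integral>u. (1 - herm x u) powr (- of_real t) * g u \<partial>bmeas (a + b)) = of_real C * g x" if x: "x \<in> ball 0 1" for x
    proof -
      have "pochhammer t m \<noteq> 0" for m using t(1) pochhammer_pos[of t m] by simp
      then have "(\<lambda>m. of_real C * coef g x m) sums (\<integral>u. (1 - herm x u) powr (- of_real t) * g u \<partial>bmeas (a + b))"
        using ker[OF t(1) g ig x] unfolding t(2)[symmetric] by simp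
      moreover have "(\<lambda>m. of_real C * coef g x m) sums (of_real C * g x)"
        by (intro sums_mult coef_sums1 g x)
      ultimately show ?thesis by (rule sums_unique2)
    qed
    define F where "F u = (1 - (norm u)\<^sup>2) powr t * cmod (g u)" for u
    have w1: "0 < 1 - (norm u)\<^sup>2" "1 - (norm u)\<^sup>2 \<le> 1" if "u \<in> ball 0 1" for u :: "complex ^ 'n"
      using that by (auto simp: abs_square_less_1)
    have FB: "F u \<le> B" if "u \<in> ball 0 1" for u
    proof -
      have "(1 - (norm u)\<^sup>2) powr t \<le> 1" using w1[OF that] t by (intro powr_le1) auto
      then show ?thesis unfolding F_def using B[OF that] mult_mono[of "(1 - (norm u)\<^sup>2) powr t" 1 "cmod (g u)" B] by simp
    qed
    define M where "M = Sup (F ` ball 0 1)"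
    have bdd: "bdd_above (F ` ball 0 1)" using FB by (intro bdd_aboveI[of _ B]) auto
    have FM: "F u \<le> M" if "u \<in> ball 0 1" for u unfolding M_def using that by (intro cSup_upper bdd) auto
    have M0: "0 \<le> M" using FM[of 0] by (simp add: F_def) (metis norm_ge_zero order_trans)
    have pt: "cmod (g u) * (1 - (norm u)\<^sup>2) powr b \<le> M powr (1 - p) * cmod (g u) powr p" if u: "u \<in> ball 0 1" for u
    proof (cases "g u = 0")
      case False
      have "cmod (g u) * (1 - (norm u)\<^sup>2) powr b = cmod (g u) powr p * (cmod (g u) powr (1 - p) * ((1 - (norm u)\<^sup>2) powr t) powr (1 - p))"
        unfolding t(3)[symmetric] using False by (simp add: powr_powr powr_add[symmetric] mult.assoc[symmetric])
      also have "cmod (g u) powr (1 - p) * ((1 - (norm u)\<^sup>2) powr t) powr (1 - p) = F u powr (1 - p)"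
        unfolding F_def by (simp add: powr_mult mult.commute)
      also have "cmod (g u) powr p * F u powr (1 - p) \<le> cmod (g u) powr p * M powr (1 - p)"
        using FM[OF u] p by (intro mult_left_mono powr_mono2) (auto simp: F_def)
      finally show ?thesis by (simp add: mult.commute)
    qed (use p in simp)
    have est: "F x \<le> K * (M powr (1 - p) * I)" if x: "x \<in> ball 0 1" for x
    proof -
      have x1: "norm x < 1" using x by simp
      have ii: "integrable (bmeas (a + b)) (\<lambda>u. (1 - herm x u) powr (- of_real t) * g u)"
      proof (rule f2.integrable_const_bound[where B="(1 - norm x) powr (- t) * B"])
        show "AE u in bmeas (a + b). norm ((1 - herm x u) powr (- of_real t) * g u) \<le> (1 - norm x) powr (- t) * B"
          unfolding norm_mult norm_kernel using kernel_le[OF x1 less_imp_le[OF t(1)]] B B0 by (intro AE_I2 mult_mono) auto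
        show "(\<lambda>u. (1 - herm x u) powr (- of_real t) * g u) \<in> borel_measurable (bmeas (a + b))"
          by (intro borel_measurable_bmeas continuous_on_mult continuous_on_kernel x1 cg)
      qed
      have "ennreal (cmod (of_real C * g x)) \<le> (\<integral>\<^sup>+u. ennreal (cmod ((1 - herm x u) powr (- of_real t) * g u)) \<partial>bmeas (a + b))"
        unfolding rep[OF x, symmetric] using integral_norm_bound_ennreal[OF ii] .
      also have "\<dots> = (\<integral>\<^sup>+u. ennreal (kor x u powr (- t) * cmod (g u)) * ennreal ((1 - (norm u)\<^sup>2) powr b) \<partial>bmeas a)"
      proof (subst nn_integral_bmeas_shift)
        show "(\<lambda>z. ennreal (kor x z powr (- t) * cmod (g z))) \<in> borel_measurable (bmeas a')" for a'
          using mg[of a'] by measurable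
      qed (simp add: norm_mult norm_kernel)
      also have "\<dots> \<le> (\<integral>\<^sup>+u. ennreal ((1 - norm x) powr (- t) * M powr (1 - p)) * ennreal (cmod (g u) powr p) \<partial>bmeas a)"
      proof (rule nn_integral_mono)
        fix u :: "complex ^ 'n" assume "u \<in> space (bmeas a)"
        then have u: "u \<in> ball 0 1" by simp
        have "kor x u powr (- t) * (cmod (g u) * (1 - (norm u)\<^sup>2) powr b) \<le> (1 - norm x) powr (- t) * (M powr (1 - p) * cmod (g u) powr p)"
          by (rule mult_mono[OF kernel_le[OF x1 less_imp_le[OF t(1)] u] pt[OF u]]) auto
        then show "ennreal (kor x u powr (- t) * cmod (g u)) * ennreal ((1 - (norm u)\<^sup>2) powr b)
          \<le> ennreal ((1 - norm x) powr (- t) * M powr (1 - p)) * ennreal (cmod (g u) powr p)"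
          by (simp add: ennreal_mult[symmetric] mult_ac ennreal_leI)
      qed
      also have "\<dots> = ennreal ((1 - norm x) powr (- t) * M powr (1 - p)) * ?I"
        by (rule nn_integral_cmult) (use mg[of a] in measurable)
      also have "\<dots> = ennreal ((1 - norm x) powr (- t) * M powr (1 - p) * I)"
        using I by (simp add: ennreal_mult[symmetric])
      finally have "C * cmod (g x) \<le> (1 - norm x) powr (- t) * M powr (1 - p) * I"
        using C I(2) by (simp add: norm_mult)
      moreover have "(1 - (norm x)\<^sup>2) powr t \<le> (2 * (1 - norm x)) powr t"
        using one_minus_norm_square(2)[of x] w1[OF x] x1 t by (intro powr_mono2) auto
      ultimately have "(1 - (norm x)\<^sup>2) powr t * (C * cmod (g x)) \<le> (2 * (1 - norm x)) powr t * ((1 - norm x) powr (- t) * M powr (1 - p) * I)"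
        using C by - (rule mult_mono, auto)
      also have "\<dots> = (2 powr t * ((1 - norm x) powr t * (1 - norm x) powr (- t))) * (M powr (1 - p) * I)"
        using x1 powr_mult[of 2 "1 - norm x" t] by (simp only: mult_ac)
      also have "(1 - norm x) powr t * (1 - norm x) powr (- t) = 1"
        using x1 by (simp add: powr_add[symmetric])
      finally have "C * F x \<le> 2 powr t * (M powr (1 - p) * I)" by (simp add: F_def mult_ac)
      then show ?thesis unfolding K_def using C by (simp add: pos_le_divide_eq mult.commute)
    qed
    have "F w powr p \<le> K * I"
    proof (cases "M = 0")
      case True
      moreover have "0 \<le> F w" unfolding F_def by simp
      ultimately have "F w = 0" using FM[OF w] by simp
      then show ?thesis using K I by simp
    next
      case False
      then have Mp: "0 < M" using M0 by simp
      have "M \<le> K * (M powr (1 - p) * I)" unfolding M_def by (rule cSup_least) (use est M_def in auto)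
      then have "M powr p * M powr (1 - p) \<le> (K * I) * M powr (1 - p)"
        using Mp by (simp add: powr_add[symmetric] mult_ac)
      then have "M powr p \<le> K * I" using Mp by simp
      moreover have "F w powr p \<le> M powr p" using FM[OF w] p by (intro powr_mono2) (auto simp: F_def)
      ultimately show ?thesis by linarith
    qed
    moreover have "F w powr p = (1 - (norm w)\<^sup>2) powr ?N * cmod (g w) powr p"
      unfolding F_def t(4)[symmetric] by (simp add: powr_mult powr_powr)
    ultimately show ?thesis using K I by (simp add: ennreal_mult[symmetric] ennreal_leI)
  qed
  with K show thesis by (rule that)
qed

section \<open>Pointwise estimates\<close>

text \<open>A functional that norms the single value f w suffices, since on the right-hand side
  functionals of norm at most 1 only decrease norms.\<close>

lemma point_estimate:
  assumes a: "a > -1" and p: "0 < p" "p \<le> 1"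
  obtains K :: real where "0 < K"
    "\<And>(f :: complex ^ 'n \<Rightarrow> 'e::complex_normed_vector) B w. cholo f (ball 0 1) \<Longrightarrow> (\<And>u. u \<in> ball 0 1 \<Longrightarrow> norm (f u) \<le> B) \<Longrightarrow> w \<in> ball 0 1 \<Longrightarrow>
      ennreal ((1 - (norm w)\<^sup>2) powr (real CARD('n) + 1 + a) * norm (f w) powr p) \<le> ennreal K * (\<integral>\<^sup>+u. ennreal (norm (f u) powr p) \<partial>bmeas a)"
proof -
  obtain K where K: "0 < K" "\<And>(g :: complex ^ 'n \<Rightarrow> complex) B w. cholo g (ball 0 1) \<Longrightarrow> (\<And>u. u \<in> ball 0 1 \<Longrightarrow> cmod (g u) \<le> B) \<Longrightarrow> w \<in> ball 0 1 \<Longrightarrow>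
      ennreal ((1 - (norm w)\<^sup>2) powr (real CARD('n) + 1 + a) * cmod (g w) powr p) \<le> ennreal K * (\<integral>\<^sup>+u. ennreal (cmod (g u) powr p) \<partial>bmeas a)"
    by (rule scalar_point_estimate[OF a p, where ?'n = 'n]) blast
  show thesis
  proof (rule that[OF K(1)])
    fix f :: "complex ^ 'n \<Rightarrow> 'e" and B and w :: "complex ^ 'n"
    assume f: "cholo f (ball 0 1)" and B: "\<And>u. u \<in> ball 0 1 \<Longrightarrow> norm (f u) \<le> B" and w: "w \<in> ball 0 1"
    obtain \<phi> :: "('e, complex) cblinfun" where \<phi>: "norm \<phi> \<le> 1" "cblinfun_apply \<phi> (f w) = norm (f w)"
      by (rule norming_functional)
    have le: "cmod (cblinfun_apply \<phi> x) \<le> norm x" for x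
      using norm_cblinfun_apply[of \<phi> x] mult_right_mono[OF \<phi>(1), of "norm x"] by simp
    have "ennreal ((1 - (norm w)\<^sup>2) powr (real CARD('n) + 1 + a) * cmod (cblinfun_apply \<phi> (f w)) powr p)
      \<le> ennreal K * (\<integral>\<^sup>+u. ennreal (cmod (cblinfun_apply \<phi> (f u)) powr p) \<partial>bmeas a)"
      by (rule K(2)[OF cholo_functional(1)[OF f] _ w]) (use order_trans[OF le B] in blast)
    also have "\<dots> \<le> ennreal K * (\<integral>\<^sup>+u. ennreal (norm (f u) powr p) \<partial>bmeas a)"
      using p by (intro mult_left_mono nn_integral_mono ennreal_leI powr_mono2 le) auto
    finally show "ennreal ((1 - (norm w)\<^sup>2) powr (real CARD('n) + 1 + a) * norm (f w) powr p)
      \<le> ennreal K * (\<integral>\<^sup>+u. ennreal (norm (f u) powr p) \<partial>bmeas a)"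
      by (simp add: \<phi>(2))
  qed
qed

text \<open>Here f need not be bounded, as h_b f is only known to lie in a Bergman space. The
  estimate for weight 1 is applied to z \<mapsto> f (z / 2), which is bounded, and on the ball of
  radius 1/2 all weights are comparable.\<close>

lemma point_estimate_zero:
  assumes q: "0 < q" "q \<le> 1"
  obtains K :: real where "0 < K"
    "\<And>f :: complex ^ 'n \<Rightarrow> 'e::complex_normed_vector. cholo f (ball 0 1) \<Longrightarrow>
      ennreal (norm (f 0) powr q) \<le> ennreal K * (\<integral>\<^sup>+u. ennreal (norm (f u) powr q) \<partial>bmeas a)"
proof -
  obtain K where K: "0 < K" "\<And>(f :: complex ^ 'n \<Rightarrow> 'e) B w. cholo f (ball 0 1) \<Longrightarrow> (\<And>u. u \<in> ball 0 1 \<Longrightarrow> norm (f u) \<le> B) \<Longrightarrow> w \<in> ball 0 1 \<Longrightarrow>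
      ennreal ((1 - (norm w)\<^sup>2) powr (real CARD('n) + 1 + 0) * norm (f w) powr q) \<le> ennreal K * (\<integral>\<^sup>+u. ennreal (norm (f u) powr q) \<partial>bmeas 0)"
    by (rule point_estimate[OF _ q, where ?'n = 'n and ?'e = 'e and a = 0]) auto
  \<comment> \<open>For |z| < 1/2 the number 1 - |z|^2 lies between 3/4 and 1, so its a-th power is
    at least (3/4)^|a| for either sign of a.\<close>
  define M where "M = 1 / (3 / 4) powr \<bar>a\<bar>"
  have M: "0 < M" by (simp add: M_def)
  define d where "d = (1 / 2 :: real) ^ DIM(complex ^ 'n)"
  have d: "0 < d" by (simp add: d_def)
  show thesis
  proof (rule that)
    show "0 < K * (M / d)" using K M d by simp
    fix f :: "complex ^ 'n \<Rightarrow> 'e" assume f: "cholo f (ball 0 1)"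
    have cf: "continuous_on (ball 0 1) f" by (rule cholo_continuous[OF f])
    define F where "F z = ennreal (indicator (ball 0 (1/2)) z *\<^sub>R (norm (f z) powr q))" for z
    have "(\<lambda>z. indicator (ball 0 (1/2)) z *\<^sub>R (norm (f z) powr q)) \<in> borel_measurable borel"
      by (intro borel_measurable_continuous_on_indicator continuous_on_powr' continuous_intros continuous_on_subset[OF cf])
        (use q in auto)
    then have mF: "F \<in> borel_measurable borel" unfolding F_def by measurable
    have half: "cholo (\<lambda>z. f (0 + (1/2) *\<^sub>R z)) (ball 0 1)"
      by (rule cholo_compose_affine(1)[OF f bounded_linear_scaleR_right]) (simp_all add: vec_eq_iff)
    have "bounded (f ` cball 0 (1/2))"
      by (intro compact_imp_bounded compact_continuous_image continuous_on_subset[OF cf]) auto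
    then obtain B where B: "\<And>z. z \<in> cball 0 (1/2) \<Longrightarrow> norm (f z) \<le> B" unfolding bounded_iff by blast
    have mh: "(\<lambda>z. ennreal (norm (f (0 + (1/2) *\<^sub>R z)) powr q)) \<in> borel_measurable (bmeas 0)"
    proof -
      have "(\<lambda>z. norm (f (0 + (1/2) *\<^sub>R z))) \<in> borel_measurable (bmeas 0)"
        by (intro borel_measurable_bmeas continuous_on_norm cholo_continuous[OF half])
      then show ?thesis by measurable
    qed
    have mf: "(\<lambda>z. ennreal (norm (f z) powr q)) \<in> borel_measurable (bmeas a)"
    proof -
      have "(\<lambda>z. norm (f z)) \<in> borel_measurable (bmeas a)" by (intro borel_measurable_bmeas continuous_on_norm cf)
      then show ?thesis by measurable
    qed
    have "ennreal (norm (f 0) powr q) \<le> ennreal K * (\<integral>\<^sup>+u. ennreal (norm (f (0 + (1/2) *\<^sub>R u)) powr q) \<partial>bmeas 0)"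
      using K(2)[OF half, of B 0] B by simp
    also have "(\<integral>\<^sup>+u. ennreal (norm (f (0 + (1/2) *\<^sub>R u)) powr q) \<partial>bmeas 0) = (\<integral>\<^sup>+z. F (0 + (1/2) *\<^sub>R z) \<partial>lborel)"
      unfolding nn_integral_bmeas[OF mh] by (intro nn_integral_cong) (auto simp: F_def indicator_def abs_square_eq_1)
    also have "\<dots> = ennreal (1 / d) * (\<integral>\<^sup>+z. F z \<partial>lborel)"
    proof -
      have "(\<integral>\<^sup>+z. F z \<partial>lborel) = ennreal d * (\<integral>\<^sup>+z. F (0 + (1/2) *\<^sub>R z) \<partial>lborel)"
        unfolding d_def by (rule nn_integral_affine[OF mF]) simp
      then show ?thesis using d by (simp add: mult.assoc[symmetric] ennreal_mult[symmetric])
    qed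
    also have "(\<integral>\<^sup>+z. F z \<partial>lborel) \<le> (\<integral>\<^sup>+z. ennreal M * (indicator (ball 0 1) z * (ennreal ((1 - (norm z)\<^sup>2) powr a) * ennreal (norm (f z) powr q))) \<partial>lborel)"
    proof (rule nn_integral_mono)
      fix z :: "complex ^ 'n"
      show "F z \<le> ennreal M * (indicator (ball 0 1) z * (ennreal ((1 - (norm z)\<^sup>2) powr a) * ennreal (norm (f z) powr q)))"
      proof (cases "norm z < 1/2")
        case True
        have "(norm z)\<^sup>2 \<le> (1/2)\<^sup>2" using True by (intro power_mono) auto
        then have x: "3 / 4 \<le> 1 - (norm z)\<^sup>2" "1 - (norm z)\<^sup>2 \<le> 1" by (simp_all add: power2_eq_square)
        have "(3/4) powr \<bar>a\<bar> \<le> (1 - (norm z)\<^sup>2) powr \<bar>a\<bar>" using x by (intro powr_mono2) auto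
        also have "\<dots> \<le> (1 - (norm z)\<^sup>2) powr a" using x by (intro powr_mono') auto
        finally have "1 \<le> M * (1 - (norm z)\<^sup>2) powr a" by (simp add: M_def)
        then have "norm (f z) powr q \<le> M * (1 - (norm z)\<^sup>2) powr a * (norm (f z) powr q)"
          using mult_right_mono[of 1 _ "norm (f z) powr q"] by fastforce
        then show ?thesis using True M by (simp add: F_def ennreal_mult[symmetric] mult_ac ennreal_leI)
      qed (simp add: F_def)
    qed
    also have "\<dots> = ennreal M * (\<integral>\<^sup>+z. ennreal (norm (f z) powr q) \<partial>bmeas a)"
      unfolding nn_integral_bmeas[OF mf]
    proof (rule nn_integral_cmult)
      have "(\<lambda>z. indicator (ball 0 1) z *\<^sub>R ((1 - (norm z)\<^sup>2) powr a * norm (f z) powr q)) \<in> borel_measurable borel"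
        by (intro borel_measurable_continuous_on_indicator continuous_on_mult continuous_on_powr' continuous_intros cf)
          (use q in \<open>auto simp: abs_square_less_1 abs_square_eq_1\<close>)
      then have "(\<lambda>z. ennreal (indicator (ball 0 1) z *\<^sub>R ((1 - (norm z)\<^sup>2) powr a * norm (f z) powr q))) \<in> borel_measurable borel"
        by measurable
      also have "(\<lambda>z. ennreal (indicator (ball 0 1) z *\<^sub>R ((1 - (norm z)\<^sup>2) powr a * norm (f z) powr q)))
         = (\<lambda>z. indicator (ball 0 1) z * (ennreal ((1 - (norm z)\<^sup>2) powr a) * ennreal (norm (f z) powr q)))"
        by (auto simp: indicator_def ennreal_mult)
      finally show "(\<lambda>z. indicator (ball 0 1) z * (ennreal ((1 - (norm z)\<^sup>2) powr a) * ennreal (norm (f z) powr q))) \<in> borel_measurable lborel"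
        by simp
    qed
    finally have "ennreal (norm (f 0) powr q) \<le> ennreal K * (ennreal (1 / d) * (ennreal M * (\<integral>\<^sup>+z. ennreal (norm (f z) powr q) \<partial>bmeas a)))"
      by (simp add: mult_left_mono)
    then show "ennreal (norm (f 0) powr q) \<le> ennreal (K * (M / d)) * (\<integral>\<^sup>+u. ennreal (norm (f u) powr q) \<partial>bmeas a)"
      using K(1) M d by (simp add: mult.assoc[symmetric] ennreal_mult[symmetric])
  qed
qed

text \<open>Yields the combination g of radial derivatives of the symbol: at y = m the left-hand
  side is the multiplier to be produced, and m^j is the multiplier of the j-th radial
  derivative.\<close>

lemma pochhammer_eq_powers:
  fixes x :: real
  obtains d :: "nat \<Rightarrow> real" where "\<And>y. pochhammer (x + y) k = (\<Sum>j\<le>k. d j * y ^ j)"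
proof -
  have "\<exists>p :: real poly. degree p \<le> k \<and> (\<forall>y. poly p y = pochhammer (x + y) k)"
  proof (induction k)
    case 0
    show ?case by (intro exI[of _ 1]) simp
  next
    case (Suc k)
    then obtain p where p: "degree p \<le> k" "\<And>y. poly p y = pochhammer (x + y) k" by blast
    show ?case
    proof (intro exI[of _ "p * [:x + real k, 1:]"] conjI allI)
      show "degree (p * [:x + real k, 1:]) \<le> Suc k"
        using degree_mult_le[of p "[:x + real k, 1:]"] p(1) by simp
    qed (simp add: p(2) pochhammer_Suc algebra_simps)
  qed
  then obtain p :: "real poly" where p: "degree p \<le> k" "\<And>y. poly p y = pochhammer (x + y) k" by blast
  have "pochhammer (x + y) k = (\<Sum>j\<le>k. coeff p j * y ^ j)" for y
    unfolding p(2)[symmetric] poly_altdef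
    using p(1) by (intro sum.mono_neutral_left) (auto simp: coeff_eq_0)
  then show thesis by (rule that)
qed

text \<open>The reverse change of basis yields the test functions: m^k belongs to the k-th radial
  derivative, and (N + m)_j belongs, up to a constant, to the kernel of exponent N + j.\<close>

lemma power_eq_pochhammers:
  fixes x :: real
  obtains A :: "nat \<Rightarrow> real" where "\<And>y. y ^ k = (\<Sum>j\<le>k. A j * pochhammer (x + y) j)"
proof -
  have "\<exists>A. \<forall>y. y ^ k = (\<Sum>j\<le>k. A j * pochhammer (x + y) j)"
  proof (induction k)
    case 0
    show ?case by (intro exI[of _ "\<lambda>_. 1"]) simp
  next
    case (Suc k)
    then obtain A where A: "\<And>y. y ^ k = (\<Sum>j\<le>k. A j * pochhammer (x + y) j)" by blast
    \<comment> \<open>The coefficients follow from y (x + y)_j = (x + y)_(j+1) - (x + j) (x +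
      y)_j.\<close>
    define A' where "A' j = (if j = 0 then 0 else A (j - 1)) - (if j \<le> k then A j * (x + real j) else 0)" for j
    have "y ^ Suc k = (\<Sum>j\<le>Suc k. A' j * pochhammer (x + y) j)" for y
    proof -
      have "y ^ Suc k = (\<Sum>j\<le>k. A j * (y * pochhammer (x + y) j))"
        by (simp add: A sum_distrib_left mult_ac)
      also have "\<dots> = (\<Sum>j\<le>k. A j * pochhammer (x + y) (Suc j)) - (\<Sum>j\<le>k. A j * (x + real j) * pochhammer (x + y) j)"
        unfolding sum_subtractf[symmetric] by (intro sum.cong refl) (simp add: pochhammer_Suc algebra_simps)
      also have "(\<Sum>j\<le>k. A j * pochhammer (x + y) (Suc j)) = (\<Sum>j\<le>Suc k. (if j = 0 then 0 else A (j - 1)) * pochhammer (x + y) j)"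
        by (subst sum.atMost_Suc_shift) simp
      also have "(\<Sum>j\<le>k. A j * (x + real j) * pochhammer (x + y) j) = (\<Sum>j\<le>Suc k. (if j \<le> k then A j * (x + real j) else 0) * pochhammer (x + y) j)"
        by simp
      finally show ?thesis by (simp only: A'_def left_diff_distrib sum_subtractf)
    qed
    then show ?case by blast
  qed
  then show thesis using that by blast
qed

text \<open>Both sides are the Pochhammer symbol of x of length m + j. It converts quotients of
  symbols of length m into polynomials in m of degree j or their reciprocals.\<close>

lemma pochhammer_swap:
  fixes x :: real
  shows "pochhammer x m * pochhammer (x + real m) j = pochhammer x j * pochhammer (x + real j) m"
  using pochhammer_product'[of x m j] pochhammer_product'[of x j m] by (simp add: add.commute)

section \<open>Little Hankel operators\<close>

lemma cblinfun_apply_conjugate_linear: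
  fixes x :: "'a::complex_normed_vector" and \<phi> :: "('b::cbanach, complex) cblinfun"
  shows "bounded_linear (\<lambda>T :: ('a cconj, 'b) cblinfun. cblinfun_apply \<phi> (cblinfun_apply T (conjugate x)))"
    "cblinfun_apply \<phi> (cblinfun_apply (c *\<^sub>C T) (conjugate x)) = c *\<^sub>C cblinfun_apply \<phi> (cblinfun_apply T (conjugate x))"
proof -
  show "bounded_linear (\<lambda>T :: ('a cconj, 'b) cblinfun. cblinfun_apply \<phi> (cblinfun_apply T (conjugate x)))"
    using bounded_linear_compose[OF bounded_linear_cblinfun_apply
        bounded_bilinear.bounded_linear_left[OF bounded_bilinear_cblinfun_apply]] .
qed (simp add: apply_scaleC_cblinfun cblinfun_apply_scaleC)

lemma norm_cblinfun_bound_conjugate: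
  "0 \<le> C \<Longrightarrow> (\<And>x. norm (cblinfun_apply T (conjugate x)) \<le> C * norm x) \<Longrightarrow> norm T \<le> C"
  by (rule norm_cblinfun_bound) (metis conjugate_cases norm_conjugate)+

text \<open>h_b conjugates its argument, so the conjugate of F a has to be the desired combination
  of the kernels (1 - <a,w>)^(-(N+j)), and F a itself is holomorphic in w. The operator is evaluated
  at 0, where its own kernel is 1.\<close>

lemma hankel_test_functions:
  fixes b :: "complex ^ 'n \<Rightarrow> ('a::cbanach cconj, 'b::cbanach) cblinfun"
  assumes \<alpha>: "\<alpha> > -1" and b: "cholo b (ball 0 1)" and fin: "(\<integral>\<^sup>+w. ennreal (norm (b w)) \<partial>ball_measure \<alpha>) < \<infinity>"
  obtains F :: "complex ^ 'n \<Rightarrow> complex ^ 'n \<Rightarrow> complex" and B c :: real where "0 < c" "0 \<le> B"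
    "\<And>a. a \<in> ball 0 1 \<Longrightarrow> cholo (F a) (ball 0 1)"
    "\<And>a w. a \<in> ball 0 1 \<Longrightarrow> w \<in> ball 0 1 \<Longrightarrow> cmod (F a w) \<le> B * kor a w powr (- (real CARD('n) + 1 + \<alpha> + real k))"
    "\<And>a x. a \<in> ball 0 1 \<Longrightarrow> little_hankel \<alpha> b (\<lambda>w. F a w *\<^sub>C x) 0 = of_real c *\<^sub>C cblinfun_apply ((radial_deriv ^^ k) b a) (conjugate x)"
proof -
  let ?N = "real CARD('n) + 1 + \<alpha>"
  have N: "0 < ?N" using \<alpha> by linarith
  have pN: "0 < pochhammer ?N j" for j using N by (rule pochhammer_pos)
  obtain C where C: "0 < C" and ker: "\<And>s (g :: complex ^ 'n \<Rightarrow> complex) w. s > 0 \<Longrightarrow> cholo g (ball 0 1) \<Longrightarrow> integrable (bmeas \<alpha>) g \<Longrightarrow> w \<in> ball 0 1 \<Longrightarrow>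
      (\<lambda>m. of_real (C * (pochhammer s m / pochhammer (real CARD('n) + 1 + \<alpha>) m)) * coef g w m) sums
        (\<integral>u. (1 - herm w u) powr (- of_real s) * g u \<partial>bmeas \<alpha>)"
    by (rule kernel_integral[OF \<alpha>, where ?'n = 'n]) blast
  obtain c where c: "0 < c" and cI: "\<And>f :: complex ^ 'n \<Rightarrow> complex. f \<in> borel_measurable (bmeas \<alpha>) \<Longrightarrow> (\<integral>z. f z \<partial>ball_measure \<alpha>) = of_real c * (\<integral>z. f z \<partial>bmeas \<alpha>)"
    and cint: "\<And>f :: complex ^ 'n \<Rightarrow> complex. f \<in> borel_measurable (bmeas \<alpha>) \<Longrightarrow> integrable (ball_measure \<alpha>) f \<longleftrightarrow> integrable (bmeas \<alpha>) f"
    by (rule ball_measure_integral[OF \<alpha>, where ?'n = 'n]) blast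
  obtain A where A: "\<And>y. y ^ k = (\<Sum>j\<le>k. A j * pochhammer (?N + y) j)"
    using power_eq_pochhammers[of k ?N] by blast
  \<comment> \<open>The factor (N)_j compensates for (N + j)_m / (N)_m = (N + m)_j / (N)_j.\<close>
  define \<beta> where "\<beta> j = A j * pochhammer ?N j" for j
  define F where "F a w = (\<Sum>j\<le>k. of_real (\<beta> j) *\<^sub>C (1 - herm w a) powr (- of_real (?N + real j)))" for a w :: "complex ^ 'n"
  \<comment> \<open>The factor 2^k bounds the powers of \<open>kor\<close> up to k that bring all
    kernels to the exponent N + k, since \<open>kor\<close> < 2.\<close>
  define B where "B = (\<Sum>j\<le>k. \<bar>\<beta> j\<bar>) * 2 ^ k"
  show thesis
  proof (rule that)
    show "0 < c * C" using c C by simp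
    show B0: "0 \<le> B" unfolding B_def by (intro mult_nonneg_nonneg sum_nonneg) auto
    fix a :: "complex ^ 'n" assume a: "a \<in> ball 0 1"
    then have a1: "norm a < 1" by simp
    show hF: "cholo (F a) (ball 0 1)" unfolding F_def by (intro cholo_sum cholo_kernel) (use a1 in auto)
    show Fb: "cmod (F a w) \<le> B * kor a w powr (- (?N + real k))" if w: "w \<in> ball 0 1" for w
    proof -
      have "cmod (F a w) \<le> (\<Sum>j\<le>k. \<bar>\<beta> j\<bar> * kor a w powr (- (?N + real j)))"
        unfolding F_def using norm_sum[of "\<lambda>j. of_real (\<beta> j) *\<^sub>C (1 - herm w a) powr (- of_real (?N + real j))" "{..k}"]
        by (simp only: scaleC_complex norm_mult norm_kernel norm_of_real kor_sym[of w a])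
      also have "\<dots> \<le> (\<Sum>j\<le>k. \<bar>\<beta> j\<bar> * (2 ^ k * kor a w powr (- (?N + real k))))"
      proof (intro sum_mono mult_left_mono)
        fix j assume "j \<in> {..k}"
        then have j: "j \<le> k" by simp
        have kp: "0 < kor a w" "kor a w \<le> 2" using kor_pos[OF a w] kor_less_2[OF a w] by auto
        have "kor a w powr (- (?N + real j)) = kor a w powr (real (k - j)) * kor a w powr (- (?N + real k))"
          unfolding powr_add[symmetric] using j by (intro arg_cong[where f = "\<lambda>t. kor a w powr t"]) (simp add: of_nat_diff)
        also have "kor a w powr (real (k - j)) = kor a w ^ (k - j)" using kp by (simp add: powr_realpow)
        also have "kor a w ^ (k - j) \<le> 2 ^ (k - j)" using kp by (intro power_mono) auto
        also have "(2::real) ^ (k - j) \<le> 2 ^ k" by (intro power_increasing) auto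
        finally show "kor a w powr (- (?N + real j)) \<le> 2 ^ k * kor a w powr (- (?N + real k))"
          by (simp add: mult_right_mono)
      qed auto
      also have "\<dots> = B * kor a w powr (- (?N + real k))"
        by (simp add: B_def sum_distrib_right mult.assoc)
      finally show ?thesis .
    qed
    fix x :: 'a
    show "little_hankel \<alpha> b (\<lambda>w. F a w *\<^sub>C x) 0 = of_real (c * C) *\<^sub>C cblinfun_apply ((radial_deriv ^^ k) b a) (conjugate x)"
    proof (rule eq_functionals)
      fix \<phi> :: "('b, complex) cblinfun"
      let ?\<Phi> = "\<lambda>w. cblinfun_apply (b w) (conjugate x)"
      define g where "g w = cblinfun_apply \<phi> (?\<Phi> w)" for w
      have cb: "continuous_on (ball 0 1) b" by (rule cholo_continuous[OF b])
      have c\<Phi>: "continuous_on (ball 0 1) ?\<Phi>" by (intro continuous_intros cb)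
      have "(\<integral>\<^sup>+w. ennreal (norm (?\<Phi> w)) \<partial>ball_measure \<alpha>) \<le> (\<integral>\<^sup>+w. ennreal (norm x) * ennreal (norm (b w)) \<partial>ball_measure \<alpha>)"
        using norm_cblinfun_apply[of _ "conjugate x"]
        by (intro nn_integral_mono) (simp add: ennreal_mult[symmetric] ennreal_leI norm_conjugate mult.commute)
      also have "\<dots> = ennreal (norm x) * (\<integral>\<^sup>+w. ennreal (norm (b w)) \<partial>ball_measure \<alpha>)"
      proof (rule nn_integral_cmult)
        have "(\<lambda>w. norm (b w)) \<in> borel_measurable (ball_measure \<alpha>)"
          by (rule ball_measure_basics(2)[OF \<alpha> continuous_on_norm[OF cb]])
        then show "(\<lambda>w. ennreal (norm (b w))) \<in> borel_measurable (ball_measure \<alpha>)" by measurable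
      qed
      also have "\<dots> < \<infinity>" using fin by (simp add: ennreal_mult_less_top)
      finally have f\<Phi>: "(\<integral>\<^sup>+w. ennreal (norm (?\<Phi> w)) \<partial>ball_measure \<alpha>) < \<infinity>" .
      have hg: "cholo g (ball 0 1)"
        unfolding g_def[abs_def] by (rule cholo_compose_linear(1)[OF b cblinfun_apply_conjugate_linear])
      have cg: "continuous_on (ball 0 1) g" by (rule cholo_continuous[OF hg])
      have "integrable (ball_measure \<alpha>) (\<lambda>w. 1 * cblinfun_apply \<phi> (?\<Phi> w))"
        by (rule banach_integral_kernel(1)[OF \<alpha> c\<Phi> f\<Phi>, of _ 1]) auto
      then have ig: "integrable (bmeas \<alpha>) g"
        unfolding g_def[abs_def] using cint[OF borel_measurable_bmeas[OF cg]] by (simp add: g_def[abs_def])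
      have cF: "cnj (F a w) = (\<Sum>j\<le>k. of_real (\<beta> j) * (1 - herm a w) powr (- of_real (?N + real j)))" if "w \<in> ball 0 1" for w
      proof -
        have "cnj ((1 - herm w a) powr (- of_real (?N + real j))) = (1 - herm a w) powr (- of_real (?N + real j))" for j
          by (rule cnj_kernel) (use that a1 in auto)
        then show ?thesis unfolding F_def cnj_sum scaleC_complex complex_cnj_mult complex_cnj_complex_of_real by (simp only:)
      qed
      have bF: "cmod (cnj (F a w)) \<le> B * (1 - norm a) powr (- (?N + real k))" if "w \<in> ball 0 1" for w
        using order_trans[OF Fb[OF that] mult_left_mono[OF kernel_le[OF a1 _ that] B0]] N by simp
      have ccF: "continuous_on (ball 0 1) (\<lambda>w. cnj (F a w))" by (intro continuous_on_cnj cholo_continuous[OF hF])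
      have lh: "little_hankel \<alpha> b (\<lambda>w. F a w *\<^sub>C x) 0 = banach_integral (ball_measure \<alpha>) (\<lambda>w. cnj (F a w) *\<^sub>C ?\<Phi> w)"
        unfolding little_hankel_def by (simp add: herm_def conjugate_scaleC cblinfun_apply_scaleC)
      have ik: "integrable (bmeas \<alpha>) (\<lambda>w. (1 - herm a w) powr (- of_real (?N + real j)) * g w)" for j
      proof (rule Bochner_Integration.integrable_bound)
        show "integrable (bmeas \<alpha>) (\<lambda>w. of_real ((1 - norm a) powr (- (?N + real j))) * g w)" using ig by simp
        show "(\<lambda>w. (1 - herm a w) powr (- of_real (?N + real j)) * g w) \<in> borel_measurable (bmeas \<alpha>)"
          by (intro borel_measurable_bmeas continuous_on_mult continuous_on_kernel a1 cg)
        show "AE w in bmeas \<alpha>. norm ((1 - herm a w) powr (- of_real (?N + real j)) * g w) \<le> norm (of_real ((1 - norm a) powr (- (?N + real j))) * g w)"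
          unfolding norm_mult norm_kernel using kernel_le[OF a1, of "?N + real j"] N by (intro AE_I2 mult_right_mono) auto
      qed
      have "(\<lambda>m. \<Sum>j\<le>k. of_real (\<beta> j) * (of_real (C * (pochhammer (?N + real j) m / pochhammer ?N m)) * coef g a m)) sums
          (\<Sum>j\<le>k. of_real (\<beta> j) * (\<integral>w. (1 - herm a w) powr (- of_real (?N + real j)) * g w \<partial>bmeas \<alpha>))"
        by (intro sums_sum sums_mult ker hg ig a) (use N in linarith)
      also have "(\<lambda>m. \<Sum>j\<le>k. of_real (\<beta> j) * (of_real (C * (pochhammer (?N + real j) m / pochhammer ?N m)) * coef g a m))
          = (\<lambda>m. of_real C * coef ((radial_deriv ^^ k) g) a m)"
      proof
        fix m
        have "\<beta> j * (C * (pochhammer (?N + real j) m / pochhammer ?N m)) = C * (A j * pochhammer (?N + real m) j)" for j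
          using pochhammer_swap[of ?N m j] pN[of m] unfolding \<beta>_def by (simp add: field_simps)
        then have "(\<Sum>j\<le>k. of_real (\<beta> j) * (of_real (C * (pochhammer (?N + real j) m / pochhammer ?N m)) * coef g a m))
            = (\<Sum>j\<le>k. of_real (C * (A j * pochhammer (?N + real m) j)) * coef g a m)"
          unfolding mult.assoc[symmetric] of_real_mult[symmetric] by (simp only: mult.assoc)
        also have "\<dots> = of_real C * (of_real (real m ^ k) * coef g a m)"
          unfolding A by (simp add: sum_distrib_left sum_distrib_right mult.assoc)
        finally show "(\<Sum>j\<le>k. of_real (\<beta> j) * (of_real (C * (pochhammer (?N + real j) m / pochhammer ?N m)) * coef g a m))
            = of_real C * coef ((radial_deriv ^^ k) g) a m"
          by (simp add: coef_radial_deriv_iterate[OF hg])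
      qed
      finally have "(\<Sum>j\<le>k. of_real (\<beta> j) * (\<integral>w. (1 - herm a w) powr (- of_real (?N + real j)) * g w \<partial>bmeas \<alpha>)) = of_real C * (radial_deriv ^^ k) g a"
        using sums_mult[OF coef_sums1[OF cholo_radial_deriv_iterate[OF hg] a]] by (rule sums_unique2)
      moreover have "(\<integral>w. cnj (F a w) * g w \<partial>bmeas \<alpha>) = (\<Sum>j\<le>k. of_real (\<beta> j) * (\<integral>w. (1 - herm a w) powr (- of_real (?N + real j)) * g w \<partial>bmeas \<alpha>))"
      proof -
        have "(\<integral>w. cnj (F a w) * g w \<partial>bmeas \<alpha>) = (\<integral>w. (\<Sum>j\<le>k. of_real (\<beta> j) * ((1 - herm a w) powr (- of_real (?N + real j)) * g w)) \<partial>bmeas \<alpha>)"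
          by (intro Bochner_Integration.integral_cong refl) (simp only: cF space_bmeas sum_distrib_right mult.assoc)
        also have "\<dots> = (\<Sum>j\<le>k. \<integral>w. of_real (\<beta> j) * ((1 - herm a w) powr (- of_real (?N + real j)) * g w) \<partial>bmeas \<alpha>)"
          by (rule Bochner_Integration.integral_sum) (intro integrable_mult_right ik)
        finally show ?thesis by simp
      qed
      moreover have "(radial_deriv ^^ k) g a = cblinfun_apply \<phi> (cblinfun_apply ((radial_deriv ^^ k) b a) (conjugate x))"
        unfolding g_def[abs_def] by (rule radial_deriv_iterate_functional[OF b cblinfun_apply_conjugate_linear a])
      ultimately have "(\<integral>w. cnj (F a w) * g w \<partial>ball_measure \<alpha>) = of_real (c * C) * cblinfun_apply \<phi> (cblinfun_apply ((radial_deriv ^^ k) b a) (conjugate x))"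
        using cI[OF borel_measurable_bmeas[OF continuous_on_mult[OF ccF cg]]] by simp
      then show "cblinfun_apply \<phi> (little_hankel \<alpha> b (\<lambda>w. F a w *\<^sub>C x) 0) = cblinfun_apply \<phi> (of_real (c * C) *\<^sub>C cblinfun_apply ((radial_deriv ^^ k) b a) (conjugate x))"
        using banach_integral_kernel(2)[OF \<alpha> c\<Phi> f\<Phi> ccF bF, of \<phi>] by (simp add: lh g_def cblinfun_apply_scaleC)
    qed
  qed
qed

lemma symbol_in_Gamma_space:
  fixes b :: "complex ^ 'n \<Rightarrow> ('a::cbanach cconj, 'b::cbanach) cblinfun"
  assumes p: "0 < p" "p \<le> 1" and \<alpha>: "\<alpha> > -1" and b: "cholo b (ball 0 1)"
    and fin: "(\<integral>\<^sup>+w. ennreal (norm (b w)) \<partial>ball_measure \<alpha>) < \<infinity>" and q: "0 < q" "q \<le> 1"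
    and bdd: "bounded_on_Hinf (bergman_norm p \<alpha>) (bergman q \<alpha>) (bergman_norm q \<alpha>) (little_hankel \<alpha> b)"
  shows "b \<in> Gamma_space ((real CARD('n) + 1 + \<alpha>) * (1 / p - 1))"
proof -
  let ?N = "real CARD('n) + 1 + \<alpha>"
  have N: "0 < ?N" using \<alpha> by linarith
  define \<gamma> where "\<gamma> = ?N * (1 / p - 1)"
  have \<gamma>: "0 \<le> \<gamma>" unfolding \<gamma>_def using N p by (intro mult_nonneg_nonneg) auto
  define k where "k = Suc (nat \<lfloor>\<gamma>\<rfloor>)"
  have k: "\<gamma> < real k" unfolding k_def using \<gamma> by linarith
  have pN: "p * (\<gamma> + ?N) = ?N" unfolding \<gamma>_def using p by (simp add: field_simps)
  \<comment> \<open>The condition of Forelli--Rudin for the p-th power of the test function; it is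
    equivalent to k > \<gamma>, as p (\<gamma> + N) = N.\<close>
  have pk: "?N < p * (?N + real k)"
    using mult_strict_left_mono[of "\<gamma> + ?N" "?N + real k" p] pN k p by simp
  obtain F B c1 where c1: "0 < c1" and B: "0 \<le> B"
    and hF: "\<And>a. a \<in> ball 0 1 \<Longrightarrow> cholo (F a) (ball 0 1)"
    and Fb: "\<And>a w :: complex ^ 'n. a \<in> ball 0 1 \<Longrightarrow> w \<in> ball 0 1 \<Longrightarrow> cmod (F a w) \<le> B * kor a w powr (- (?N + real k))"
    and test: "\<And>a x. a \<in> ball 0 1 \<Longrightarrow> little_hankel \<alpha> b (\<lambda>w. F a w *\<^sub>C x) 0 = of_real c1 *\<^sub>C cblinfun_apply ((radial_deriv ^^ k) b a) (conjugate x)"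
    by (rule hankel_test_functions[OF \<alpha> b fin, of k]) blast
  obtain C0 where C0: "\<And>f. f \<in> Hinf \<Longrightarrow> little_hankel \<alpha> b f \<in> bergman q \<alpha>"
    "\<And>f. f \<in> Hinf \<Longrightarrow> bergman_norm q \<alpha> (little_hankel \<alpha> b f) \<le> C0 * bergman_norm p \<alpha> f"
    using bdd unfolding bounded_on_Hinf_def by blast
  obtain c where c: "0 < c" and cN: "\<And>f :: complex ^ 'n \<Rightarrow> ennreal. f \<in> borel_measurable (bmeas \<alpha>) \<Longrightarrow> (\<integral>\<^sup>+z. f z \<partial>ball_measure \<alpha>) = ennreal c * (\<integral>\<^sup>+z. f z \<partial>bmeas \<alpha>)"
    by (rule ball_measure_integral[OF \<alpha>, where ?'n = 'n]) blast
  obtain Cf where Cf: "0 < Cf" "\<And>z :: complex ^ 'n. z \<in> ball 0 1 \<Longrightarrow>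
       (\<integral>\<^sup>+w. ennreal (kor z w powr (- (p * (?N + real k)))) \<partial>bmeas \<alpha>) \<le> ennreal (Cf * (1 - norm z) powr (?N - p * (?N + real k)))"
    by (rule forelli_rudin[OF \<alpha>, of "p * (?N + real k)"]) (use pk in auto)
  obtain K where K: "0 < K" "\<And>f :: complex ^ 'n \<Rightarrow> 'b. cholo f (ball 0 1) \<Longrightarrow>
      ennreal (norm (f 0) powr q) \<le> ennreal K * (\<integral>\<^sup>+u. ennreal (norm (f u) powr q) \<partial>bmeas \<alpha>)"
    by (rule point_estimate_zero[OF q, where ?'n = 'n and ?'e = 'b and a = \<alpha>]) blast
  have mn: "(\<lambda>z. ennreal (norm (f z) powr r)) \<in> borel_measurable (bmeas \<alpha>)" if "cholo f (ball 0 1)" for f :: "complex ^ 'n \<Rightarrow> 'd::complex_normed_vector" and r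
  proof -
    have "(\<lambda>z. norm (f z)) \<in> borel_measurable (bmeas \<alpha>)" by (intro borel_measurable_bmeas continuous_on_norm cholo_continuous that)
    then show ?thesis by measurable
  qed
  \<comment> \<open>The factors come from the bound of h_b, the norm of the test function,
    evaluation at 0 and the normalization c1. None depends on the point a or the vector x, so the
    bound passes to operator norms. The constant C0 need not be nonnegative, hence its absolute
    value.\<close>
  define D where "D = \<bar>C0\<bar> * (c * B powr p * Cf) powr (1 / p) * (K / c) powr (1 / q) / c1"
  have D: "0 \<le> D" unfolding D_def using c1 by (intro divide_nonneg_pos mult_nonneg_nonneg) auto
  have key: "norm ((radial_deriv ^^ k) b a) \<le> D * (1 - norm a) powr (\<gamma> - real k)" if a: "a \<in> ball 0 1" for a
  proof (rule norm_cblinfun_bound_conjugate)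
    have a1: "norm a < 1" using a by simp
    show "0 \<le> D * (1 - norm a) powr (\<gamma> - real k)" using D by simp
    fix x :: 'a
    define f where "f w = F a w *\<^sub>C x" for w
    have hf: "cholo f (ball 0 1)" unfolding f_def[abs_def] by (rule cholo_scaleC_left[OF hF[OF a]])
    have fb: "norm (f w) \<le> B * norm x * kor a w powr (- (?N + real k))" if w: "w \<in> ball 0 1" for w
      using mult_right_mono[OF Fb[OF a w], of "norm x"] by (simp add: f_def norm_scaleC mult_ac)
    have fH: "f \<in> Hinf"
      unfolding Hinf_def mem_Collect_eq ball_holomorphic_iff
    proof (intro conjI hf boundedI)
      fix y assume "y \<in> f ` ball 0 1"
      then obtain w where w: "w \<in> ball 0 1" "y = f w" by blast
      have "B * norm x * kor a w powr (- (?N + real k)) \<le> B * norm x * (1 - norm a) powr (- (?N + real k))"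
        using kernel_le[OF a1 _ w(1), of "?N + real k"] N B by (intro mult_left_mono) auto
      then show "norm y \<le> B * norm x * (1 - norm a) powr (- (?N + real k))" using fb[OF w(1)] w(2) by simp
    qed
    have "bergman_integral p \<alpha> f = ennreal c * (\<integral>\<^sup>+w. ennreal (norm (f w) powr p) \<partial>bmeas \<alpha>)"
      unfolding bergman_integral_def by (rule cN[OF mn[OF hf]])
    also have "(\<integral>\<^sup>+w. ennreal (norm (f w) powr p) \<partial>bmeas \<alpha>) \<le> (\<integral>\<^sup>+w. ennreal ((B * norm x) powr p) * ennreal (kor a w powr (- (p * (?N + real k)))) \<partial>bmeas \<alpha>)"
    proof (rule nn_integral_mono)
      fix w :: "complex ^ 'n" assume "w \<in> space (bmeas \<alpha>)"
      then have w: "w \<in> ball 0 1" by simp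
      have "norm (f w) powr p \<le> (B * norm x * kor a w powr (- (?N + real k))) powr p"
        using fb[OF w] p by (intro powr_mono2) auto
      also have "\<dots> = (B * norm x) powr p * kor a w powr (- (p * (?N + real k)))"
        by (simp only: powr_mult powr_powr mult.commute[of p] mult_minus_left)
      finally show "ennreal (norm (f w) powr p) \<le> ennreal ((B * norm x) powr p) * ennreal (kor a w powr (- (p * (?N + real k))))"
        by (simp add: ennreal_mult[symmetric] ennreal_leI)
    qed
    also have "\<dots> = ennreal ((B * norm x) powr p) * (\<integral>\<^sup>+w. ennreal (kor a w powr (- (p * (?N + real k)))) \<partial>bmeas \<alpha>)"
      by (rule nn_integral_cmult) measurable
    also have "\<dots> \<le> ennreal ((B * norm x) powr p) * ennreal (Cf * (1 - norm a) powr (?N - p * (?N + real k)))"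
      by (intro mult_left_mono Cf(2)[OF a]) auto
    finally have "bergman_integral p \<alpha> f \<le> ennreal c * (ennreal ((B * norm x) powr p) * ennreal (Cf * (1 - norm a) powr (?N - p * (?N + real k))))"
      by (simp add: mult_left_mono)
    also have "\<dots> = ennreal (c * B powr p * Cf * (norm x powr p * (1 - norm a) powr (?N - p * (?N + real k))))"
      using c Cf(1) B by (simp add: ennreal_mult[symmetric] powr_mult mult_ac)
    finally have "enn2real (bergman_integral p \<alpha> f) \<le> c * B powr p * Cf * (norm x powr p * (1 - norm a) powr (?N - p * (?N + real k)))"
      using c Cf(1) by (intro enn2real_leI) auto
    then have "bergman_norm p \<alpha> f \<le> (c * B powr p * Cf * (norm x powr p * (1 - norm a) powr (?N - p * (?N + real k)))) powr (1 / p)"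
      unfolding bergman_norm_def using p by (intro powr_mono2) auto
    also have "\<dots> = (c * B powr p * Cf) powr (1 / p) * (norm x * (1 - norm a) powr (\<gamma> - real k))"
    proof -
      have "(?N - p * (?N + real k)) * (1 / p) = \<gamma> - real k" unfolding \<gamma>_def using p by (simp add: field_simps)
      then show ?thesis using p c Cf(1) by (simp add: powr_mult powr_powr)
    qed
    finally have nf: "bergman_norm p \<alpha> f \<le> (c * B powr p * Cf) powr (1 / p) * (norm x * (1 - norm a) powr (\<gamma> - real k))" .
    define h where "h = little_hankel \<alpha> b f"
    have hb: "h \<in> bergman q \<alpha>" unfolding h_def by (rule C0(1)[OF fH])
    then have hh: "cholo h (ball 0 1)" and hfin: "bergman_integral q \<alpha> h < \<infinity>"
      by (simp_all add: bergman_def ball_holomorphic_iff)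
    define I where "I = enn2real (bergman_integral q \<alpha> h)"
    have I: "bergman_integral q \<alpha> h = ennreal I" "0 \<le> I" using hfin by (simp_all add: I_def)
    have "ennreal (K / c) * bergman_integral q \<alpha> h = ennreal (K / c) * (ennreal c * (\<integral>\<^sup>+u. ennreal (norm (h u) powr q) \<partial>bmeas \<alpha>))"
      unfolding bergman_integral_def cN[OF mn[OF hh]] ..
    also have "\<dots> = ennreal K * (\<integral>\<^sup>+u. ennreal (norm (h u) powr q) \<partial>bmeas \<alpha>)"
      using K(1) c by (simp add: mult.assoc[symmetric] ennreal_mult[symmetric])
    finally have "ennreal (norm (h 0) powr q) \<le> ennreal (K / c) * ennreal I" using K(2)[OF hh] I(1) by simp
    then have "norm (h 0) powr q \<le> K / c * I" using K(1) c I(2) by (simp add: ennreal_mult[symmetric])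
    then have "(norm (h 0) powr q) powr (1 / q) \<le> (K / c * I) powr (1 / q)" using q by (intro powr_mono2) auto
    then have "norm (h 0) \<le> (K / c) powr (1 / q) * bergman_norm q \<alpha> h"
      using q unfolding powr_mult[of "K / c"] by (simp add: powr_powr bergman_norm_def I_def)
    also have "\<dots> \<le> (K / c) powr (1 / q) * (\<bar>C0\<bar> * bergman_norm p \<alpha> f)"
    proof (rule mult_left_mono)
      have "bergman_norm q \<alpha> h \<le> C0 * bergman_norm p \<alpha> f" unfolding h_def by (rule C0(2)[OF fH])
      also have "\<dots> \<le> \<bar>C0\<bar> * bergman_norm p \<alpha> f" by (intro mult_right_mono) (auto simp: bergman_norm_def)
      finally show "bergman_norm q \<alpha> h \<le> \<bar>C0\<bar> * bergman_norm p \<alpha> f" .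
    qed auto
    also have "\<dots> \<le> (K / c) powr (1 / q) * (\<bar>C0\<bar> * ((c * B powr p * Cf) powr (1 / p) * (norm x * (1 - norm a) powr (\<gamma> - real k))))"
      by (intro mult_left_mono nf) auto
    also have "\<dots> = c1 * (D * (1 - norm a) powr (\<gamma> - real k) * norm x)" using c1 by (simp add: D_def)
    finally have "norm (h 0) \<le> c1 * (D * (1 - norm a) powr (\<gamma> - real k) * norm x)" .
    moreover have "norm (h 0) = c1 * norm (cblinfun_apply ((radial_deriv ^^ k) b a) (conjugate x))"
      unfolding h_def f_def[abs_def] test[OF a] using c1 by (simp add: norm_scaleC)
    ultimately show "norm (cblinfun_apply ((radial_deriv ^^ k) b a) (conjugate x)) \<le> D * (1 - norm a) powr (\<gamma> - real k) * norm x"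
      using c1 by simp
  qed
  have "(SUP z\<in>ball 0 1. ennreal ((1 - (norm z)\<^sup>2) powr (real k - \<gamma>) * norm ((radial_deriv ^^ k) b z))) \<le> ennreal (2 powr (real k - \<gamma>) * D)"
  proof (intro SUP_least ennreal_leI)
    fix z :: "complex ^ 'n" assume z: "z \<in> ball 0 1"
    then have z1: "norm z < 1" by simp
    have "(1 - (norm z)\<^sup>2) powr (real k - \<gamma>) \<le> (2 * (1 - norm z)) powr (real k - \<gamma>)"
      using one_minus_norm_square(2)[of z] z1 k by (intro powr_mono2) (auto simp: abs_square_le_1)
    then have "(1 - (norm z)\<^sup>2) powr (real k - \<gamma>) * norm ((radial_deriv ^^ k) b z)
       \<le> (2 * (1 - norm z)) powr (real k - \<gamma>) * (D * (1 - norm z) powr (\<gamma> - real k))"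
      using key[OF z] by - (rule mult_mono, auto)
    also have "\<dots> = 2 powr (real k - \<gamma>) * D * ((1 - norm z) powr (real k - \<gamma>) * (1 - norm z) powr (\<gamma> - real k))"
      using z1 powr_mult[of 2 "1 - norm z" "real k - \<gamma>"] by (simp only: mult_ac)
    also have "(1 - norm z) powr (real k - \<gamma>) * (1 - norm z) powr (\<gamma> - real k) = 1"
      using z1 by (simp add: powr_add[symmetric])
    finally show "(1 - (norm z)\<^sup>2) powr (real k - \<gamma>) * norm ((radial_deriv ^^ k) b z) \<le> 2 powr (real k - \<gamma>) * D" by simp
  qed
  then have "ennreal (norm (b 0)) + (SUP z\<in>ball 0 1. ennreal ((1 - (norm z)\<^sup>2) powr (real k - \<gamma>) * norm ((radial_deriv ^^ k) b z))) < \<infinity>"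
    by (simp add: order_le_less_trans)
  then show ?thesis
    unfolding Gamma_space_def \<gamma>_def[symmetric] using b k by (auto simp: ball_holomorphic_iff)
qed

section \<open>Sufficiency of the growth condition\<close>

lemma radial_growth:
  fixes G :: "complex ^ 'n \<Rightarrow> 'e::complex_normed_vector"
  assumes G: "cholo G (ball 0 1)" and \<delta>: "0 \<le> \<delta>"
    and M: "\<And>z. z \<in> ball 0 1 \<Longrightarrow> norm (radial_deriv G z) \<le> M * (1 - (norm z)\<^sup>2) powr (- \<delta>)"
  obtains M' where "\<And>z. z \<in> ball 0 1 \<Longrightarrow> norm (G z) \<le> M' * (1 - (norm z)\<^sup>2) powr (- \<delta>)"
proof -
  have M0: "0 \<le> M" using order_trans[OF norm_ge_zero M[of 0]] by simp
  have "bounded (G ` cball 0 (1/2))"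
    by (intro compact_imp_bounded compact_continuous_image continuous_on_subset[OF cholo_continuous[OF G]]) auto
  then obtain B where B: "\<And>z. z \<in> cball 0 (1/2) \<Longrightarrow> norm (G z) \<le> B" unfolding bounded_iff by blast
  have B0: "0 \<le> B" using order_trans[OF norm_ge_zero B[of 0]] by simp
  show thesis
  proof (rule that)
    fix z :: "complex ^ 'n" assume z: "z \<in> ball 0 1"
    let ?P = "(1 - (norm z)\<^sup>2) powr (- \<delta>)"
    have z2: "0 < 1 - (norm z)\<^sup>2" using z by (simp add: abs_square_less_1)
    have tz: "norm (t *\<^sub>R z) \<le> norm z" if "t \<in> {1/2..1}" for t
      using that mult_left_le_one_le[of "norm z" t] by simp
    then have zt: "t *\<^sub>R z \<in> ball 0 1" if "t \<in> {1/2..1}" for t using z tz[OF that] by simp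
    have lin: "fderiv G (t *\<^sub>R z) (s *\<^sub>R z) = s *\<^sub>R fderiv G (t *\<^sub>R z) z" if "t \<in> {1/2..1}" for t s
      using has_derivative_linear[OF cholo_fderiv(1)[OF G zt[OF that]]] by (simp add: linear_scale)
    have d: "((\<lambda>t. G (t *\<^sub>R z)) has_derivative (\<lambda>s. s *\<^sub>R fderiv G (t *\<^sub>R z) z)) (at t within {1/2..1})" if t: "t \<in> {1/2..1}" for t
    proof -
      have "((\<lambda>t. t *\<^sub>R z) has_derivative (\<lambda>s. s *\<^sub>R z)) (at t)" by (auto intro!: derivative_eq_intros)
      from diff_chain_at[OF this cholo_fderiv(1)[OF G zt[OF t]]]
      have "((\<lambda>t. G (t *\<^sub>R z)) has_derivative (\<lambda>s. s *\<^sub>R fderiv G (t *\<^sub>R z) z)) (at t)" by (simp add: o_def lin[OF t])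
      then show ?thesis by (rule has_derivative_at_withinI)
    qed
    have b: "onorm (\<lambda>s. s *\<^sub>R fderiv G (t *\<^sub>R z) z) \<le> 2 * M * ?P" if t: "t \<in> {1/2..1}" for t
    proof (rule onorm_le)
      fix s :: real
      have "radial_deriv G (t *\<^sub>R z) = t *\<^sub>R fderiv G (t *\<^sub>R z) z"
        using radial_deriv_cholo[OF G zt[OF t]] lin[OF t] by simp
      then have "t * norm (fderiv G (t *\<^sub>R z) z) \<le> M * (1 - (norm (t *\<^sub>R z))\<^sup>2) powr (- \<delta>)"
        using M[OF zt[OF t]] t by simp
      also have "\<dots> \<le> M * ?P"
        using M0 \<delta> z2 power_mono[OF tz[OF t], of 2] by (intro mult_left_mono powr_mono2') auto
      finally have "t * norm (fderiv G (t *\<^sub>R z) z) \<le> M * ?P" .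
      moreover have "1 / 2 * norm (fderiv G (t *\<^sub>R z) z) \<le> t * norm (fderiv G (t *\<^sub>R z) z)"
        using t by (intro mult_right_mono) auto
      ultimately have "norm (fderiv G (t *\<^sub>R z) z) \<le> 2 * M * ?P" by simp
      from mult_right_mono[OF this, of "norm s"]
      show "norm (s *\<^sub>R fderiv G (t *\<^sub>R z) z) \<le> 2 * M * ?P * norm s" by (simp add: mult.commute)
    qed
    \<comment> \<open>Mean value inequality on the segment from z / 2 to z. The derivative of t
      \<mapsto> G (t z) is the radial derivative at t z divided by t; starting at t = 1/2 keeps that
      divisor harmless, and along the segment the weight is largest at z.\<close>
    have "norm (G (1 *\<^sub>R z) - G ((1/2) *\<^sub>R z)) \<le> 2 * M * ?P * norm (1 - 1/2 :: real)"
      by (rule differentiable_bound[OF _ d b]) auto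
    then have "norm (G z - G ((1/2) *\<^sub>R z)) \<le> M * ?P" by simp
    moreover have "norm (G ((1/2) *\<^sub>R z)) \<le> B" by (rule B) (use z in simp)
    moreover have "B \<le> B * ?P"
    proof -
      have "1 powr (- \<delta>) \<le> ?P" using \<delta> z2 by (intro powr_mono2') auto
      then show ?thesis using B0 mult_left_mono[of 1 ?P B] by simp
    qed
    ultimately show "norm (G z) \<le> (B + M) * ?P"
      using norm_triangle_ineq[of "G z - G ((1/2) *\<^sub>R z)" "G ((1/2) *\<^sub>R z)"] by (simp add: distrib_right)
  qed
qed

text \<open>The combination g also contains the lower derivatives, so the bound for the k-th one is
  passed down by descending induction without changing the exponent.\<close>

lemma radial_deriv_iterate_growth:
  fixes b :: "complex ^ 'n \<Rightarrow> 'e::cbanach"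
  assumes b: "cholo b (ball 0 1)" and \<delta>: "0 \<le> \<delta>"
    and M: "\<And>z. z \<in> ball 0 1 \<Longrightarrow> norm ((radial_deriv ^^ k) b z) \<le> M * (1 - (norm z)\<^sup>2) powr (- \<delta>)"
  obtains M' where "\<And>i z. i \<le> k \<Longrightarrow> z \<in> ball 0 1 \<Longrightarrow> norm ((radial_deriv ^^ i) b z) \<le> M' i * (1 - (norm z)\<^sup>2) powr (- \<delta>)"
proof -
  have "\<exists>M. \<forall>z\<in>ball 0 1. norm ((radial_deriv ^^ i) b z) \<le> M * (1 - (norm z)\<^sup>2) powr (- \<delta>)" if "i \<le> k" for i
    using that
  proof (induction i rule: inc_induct)
    case base
    show ?case using M by blast
  next
    case (step i)
    then have "\<exists>M. \<forall>z\<in>ball 0 1. norm (radial_deriv ((radial_deriv ^^ i) b) z) \<le> M * (1 - (norm z)\<^sup>2) powr (- \<delta>)" by simp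
    then obtain M1 where "\<And>z. z \<in> ball 0 1 \<Longrightarrow> norm (radial_deriv ((radial_deriv ^^ i) b) z) \<le> M1 * (1 - (norm z)\<^sup>2) powr (- \<delta>)" by blast
    from radial_growth[OF cholo_radial_deriv_iterate[OF b] \<delta> this] show ?case by metis
  qed
  then show thesis using that by metis
qed

lemma nn_integral_norm_bmeas:
  fixes g :: "complex ^ 'n \<Rightarrow> 'e::real_normed_vector"
  assumes g: "continuous_on (ball 0 1) g"
    and le: "\<And>u. u \<in> ball 0 1 \<Longrightarrow> norm (g u) * (1 - (norm u)\<^sup>2) powr c \<le> M * (1 - (norm u)\<^sup>2) powr \<gamma>"
    and f: "\<And>a. f \<in> borel_measurable (bmeas a)"
  shows "(\<integral>\<^sup>+u. ennreal (norm (g u)) * f u \<partial>bmeas (a + c)) \<le> (\<integral>\<^sup>+u. ennreal (M * (1 - (norm u)\<^sup>2) powr \<gamma>) * f u \<partial>bmeas a)"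
proof -
  have "(\<lambda>u. norm (g u)) \<in> borel_measurable (bmeas a)" for a
    by (intro borel_measurable_bmeas continuous_on_norm g)
  then have "(\<lambda>u. ennreal (norm (g u)) * f u) \<in> borel_measurable (bmeas a)" for a using f by measurable
  from nn_integral_bmeas_shift[OF this, of a c]
  have "(\<integral>\<^sup>+u. ennreal (norm (g u)) * f u \<partial>bmeas (a + c)) = (\<integral>\<^sup>+u. ennreal (norm (g u)) * f u * ennreal ((1 - (norm u)\<^sup>2) powr c) \<partial>bmeas a)"
    by simp
  also have "\<dots> \<le> (\<integral>\<^sup>+u. ennreal (M * (1 - (norm u)\<^sup>2) powr \<gamma>) * f u \<partial>bmeas a)"
  proof (rule nn_integral_mono)
    fix u :: "complex ^ 'n" assume "u \<in> space (bmeas a)"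
    then have "ennreal (norm (g u) * (1 - (norm u)\<^sup>2) powr c) \<le> ennreal (M * (1 - (norm u)\<^sup>2) powr \<gamma>)"
      by (intro ennreal_leI le) simp
    then have "ennreal (norm (g u) * (1 - (norm u)\<^sup>2) powr c) * f u \<le> ennreal (M * (1 - (norm u)\<^sup>2) powr \<gamma>) * f u"
      by (intro mult_right_mono) auto
    then show "ennreal (norm (g u)) * f u * ennreal ((1 - (norm u)\<^sup>2) powr c) \<le> ennreal (M * (1 - (norm u)\<^sup>2) powr \<gamma>) * f u"
      by (simp add: ennreal_mult mult_ac)
  qed
  finally show ?thesis .
qed

text \<open>In degree m the kernel of exponent N acts on the weight \<alpha> + k as multiplication
  by C (N)_m / (N + k)_m = C (N)_k / (N + m)_k. The combination g carries the factor (N + m)_k, so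
  only the constant C (N)_k remains.\<close>

lemma symbol_reproduction:
  fixes b :: "complex ^ 'n \<Rightarrow> ('a::cbanach cconj, 'b::cbanach) cblinfun"
  assumes \<alpha>: "\<alpha> > -1" and b: "cholo b (ball 0 1)" and \<gamma>: "0 \<le> \<gamma>" "\<gamma> < real k"
    and M: "\<And>z. z \<in> ball 0 1 \<Longrightarrow> (1 - (norm z)\<^sup>2) powr (real k - \<gamma>) * norm ((radial_deriv ^^ k) b z) \<le> M"
  obtains g :: "complex ^ 'n \<Rightarrow> ('a cconj, 'b) cblinfun" and \<kappa> M' :: real where "0 < \<kappa>" "0 \<le> M'" "continuous_on (ball 0 1) g"
    "\<And>u. u \<in> ball 0 1 \<Longrightarrow> norm (g u) * (1 - (norm u)\<^sup>2) powr real k \<le> M' * (1 - (norm u)\<^sup>2) powr \<gamma>"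
    "\<And>\<phi> x w. w \<in> ball 0 1 \<Longrightarrow> cblinfun_apply \<phi> (cblinfun_apply (b w) (conjugate x))
      = of_real \<kappa> * (\<integral>u. (1 - herm w u) powr (- of_real (real CARD('n) + 1 + \<alpha>)) * cblinfun_apply \<phi> (cblinfun_apply (g u) (conjugate x)) \<partial>bmeas (\<alpha> + real k))"
proof -
  let ?N = "real CARD('n) + 1 + \<alpha>"
  have N: "0 < ?N" using \<alpha> by linarith
  have w1: "0 < 1 - (norm u)\<^sup>2" "1 - (norm u)\<^sup>2 \<le> 1" if "u \<in> ball 0 1" for u :: "complex ^ 'n"
    using that by (auto simp: abs_square_less_1)
  have "norm ((radial_deriv ^^ k) b z) \<le> M * (1 - (norm z)\<^sup>2) powr (- (real k - \<gamma>))" if z: "z \<in> ball 0 1" for z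
  proof -
    have "norm ((radial_deriv ^^ k) b z) = ((1 - (norm z)\<^sup>2) powr (real k - \<gamma>) * norm ((radial_deriv ^^ k) b z)) * (1 - (norm z)\<^sup>2) powr (- (real k - \<gamma>))"
      using w1[OF z] powr_add[of "1 - (norm z)\<^sup>2" "real k - \<gamma>" "- (real k - \<gamma>)"] by simp
    also have "\<dots> \<le> M * (1 - (norm z)\<^sup>2) powr (- (real k - \<gamma>))" by (intro mult_right_mono M z) auto
    finally show ?thesis .
  qed
  then obtain M1 where M1: "\<And>i z. i \<le> k \<Longrightarrow> z \<in> ball 0 1 \<Longrightarrow> norm ((radial_deriv ^^ i) b z) \<le> M1 i * (1 - (norm z)\<^sup>2) powr (- (real k - \<gamma>))"
    using radial_deriv_iterate_growth[OF b, of "real k - \<gamma>" k M] \<gamma> by auto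
  have M1p: "0 \<le> M1 i" if "i \<le> k" for i using order_trans[OF norm_ge_zero M1[OF that, of 0]] by simp
  obtain d where d: "\<And>y. pochhammer (?N + y) k = (\<Sum>j\<le>k. d j * y ^ j)" using pochhammer_eq_powers[of ?N k] by blast
  define g where "g u = (\<Sum>j\<le>k. of_real (d j) *\<^sub>C (radial_deriv ^^ j) b u)" for u
  have hg: "cholo g (ball 0 1)" unfolding g_def[abs_def] by (intro cholo_sum cholo_radial_deriv_iterate b)
  have cg: "continuous_on (ball 0 1) g" by (rule cholo_continuous[OF hg])
  define M' where "M' = (\<Sum>j\<le>k. \<bar>d j\<bar> * M1 j)"
  have M': "0 \<le> M'" unfolding M'_def using M1p by (intro sum_nonneg mult_nonneg_nonneg) auto
  have gb: "norm (g u) * (1 - (norm u)\<^sup>2) powr real k \<le> M' * (1 - (norm u)\<^sup>2) powr \<gamma>" if u: "u \<in> ball 0 1" for u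
  proof -
    have "norm (g u) \<le> (\<Sum>j\<le>k. norm (of_real (d j) *\<^sub>C (radial_deriv ^^ j) b u))" unfolding g_def by (rule norm_sum)
    also have "\<dots> \<le> (\<Sum>j\<le>k. \<bar>d j\<bar> * (M1 j * (1 - (norm u)\<^sup>2) powr (- (real k - \<gamma>))))"
      unfolding norm_scaleC norm_of_real using M1[OF _ u] by (intro sum_mono mult_left_mono) auto
    also have "\<dots> = M' * (1 - (norm u)\<^sup>2) powr (- (real k - \<gamma>))" by (simp add: M'_def sum_distrib_right mult.assoc)
    finally have "norm (g u) * (1 - (norm u)\<^sup>2) powr real k \<le> M' * (1 - (norm u)\<^sup>2) powr (- (real k - \<gamma>)) * (1 - (norm u)\<^sup>2) powr real k"
      by (intro mult_right_mono) auto
    also have "\<dots> = M' * (1 - (norm u)\<^sup>2) powr \<gamma>" by (simp add: mult.assoc powr_add[symmetric])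
    finally show ?thesis .
  qed
  have \<alpha>k: "\<alpha> + real k > -1" using \<alpha> by simp
  interpret f1: finite_measure "bmeas \<alpha> :: (complex ^ 'n) measure" by (rule finite_measure_bmeas[OF \<alpha>])
  have "(\<integral>\<^sup>+u. ennreal (norm (g u)) * 1 \<partial>bmeas (\<alpha> + real k)) \<le> (\<integral>\<^sup>+u. ennreal (M' * (1 - (norm u)\<^sup>2) powr \<gamma>) * 1 \<partial>(bmeas \<alpha> :: (complex ^ 'n) measure))"
    by (rule nn_integral_norm_bmeas[OF cg gb]) auto
  also have "\<dots> \<le> (\<integral>\<^sup>+u. ennreal M' \<partial>(bmeas \<alpha> :: (complex ^ 'n) measure))"
  proof (rule nn_integral_mono)
    fix u :: "complex ^ 'n" assume "u \<in> space (bmeas \<alpha>)"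
    then have "(1 - (norm u)\<^sup>2) powr \<gamma> \<le> 1" using w1[of u] \<gamma> by (intro powr_le1) auto
    then show "ennreal (M' * (1 - (norm u)\<^sup>2) powr \<gamma>) * 1 \<le> ennreal M'"
      using M' mult_left_mono[of _ 1 M'] by (simp add: ennreal_leI)
  qed
  also have "\<dots> < \<infinity>" by (simp add: ennreal_mult_eq_top_iff f1.emeasure_finite less_top[symmetric])
  finally have gfin: "(\<integral>\<^sup>+u. ennreal (norm (g u)) \<partial>bmeas (\<alpha> + real k)) < \<infinity>" by simp
  obtain C where C: "0 < C" and ker: "\<And>s (g :: complex ^ 'n \<Rightarrow> complex) w. s > 0 \<Longrightarrow> cholo g (ball 0 1) \<Longrightarrow> integrable (bmeas (\<alpha> + real k)) g \<Longrightarrow> w \<in> ball 0 1 \<Longrightarrow>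
      (\<lambda>m. of_real (C * (pochhammer s m / pochhammer (real CARD('n) + 1 + (\<alpha> + real k)) m)) * coef g w m) sums
        (\<integral>u. (1 - herm w u) powr (- of_real s) * g u \<partial>bmeas (\<alpha> + real k))"
    by (rule kernel_integral[OF \<alpha>k, where ?'n = 'n]) blast
  have Nk: "real CARD('n) + 1 + (\<alpha> + real k) = ?N + real k" by simp
  have pN: "0 < pochhammer ?N k" using N by (rule pochhammer_pos)
  show thesis
  proof (rule that[OF _ M' cg gb])
    show "0 < 1 / (C * pochhammer ?N k)" using C pN by simp
    fix \<phi> :: "('b, complex) cblinfun" and x :: 'a and w :: "complex ^ 'n" assume w: "w \<in> ball 0 1"
    define \<psi> where "\<psi> T = cblinfun_apply \<phi> (cblinfun_apply T (conjugate x))" for T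
    have \<psi>: "bounded_linear \<psi>" "\<And>c T. \<psi> (c *\<^sub>C T) = c *\<^sub>C \<psi> T"
      unfolding \<psi>_def[abs_def] by (rule cblinfun_apply_conjugate_linear)+
    define \<beta> where "\<beta> z = \<psi> (b z)" for z
    have h\<beta>: "cholo \<beta> (ball 0 1)" unfolding \<beta>_def[abs_def] by (rule cholo_compose_linear(1)[OF b \<psi>])
    define G where "G u = (\<Sum>j\<le>k. of_real (d j) *\<^sub>C (radial_deriv ^^ j) \<beta> u)" for u
    have hG: "cholo G (ball 0 1)" unfolding G_def[abs_def] by (intro cholo_sum cholo_radial_deriv_iterate h\<beta>)
    have Gg: "G u = \<psi> (g u)" if u: "u \<in> ball 0 1" for u
      unfolding G_def g_def linear_sum[OF bounded_linear.linear[OF \<psi>(1)]] \<psi>(2) \<beta>_def[abs_def]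
      using radial_deriv_iterate_functional[OF b \<psi> u] by simp
    have iG: "integrable (bmeas (\<alpha> + real k)) G"
    proof (rule integrableI_bounded)
      show "G \<in> borel_measurable (bmeas (\<alpha> + real k))" by (rule borel_measurable_bmeas[OF cholo_continuous[OF hG]])
      have "(\<integral>\<^sup>+u. ennreal (norm (G u)) \<partial>bmeas (\<alpha> + real k)) \<le> (\<integral>\<^sup>+u. ennreal (norm \<phi> * norm x) * ennreal (norm (g u)) \<partial>bmeas (\<alpha> + real k))"
      proof (rule nn_integral_mono)
        fix u :: "complex ^ 'n" assume "u \<in> space (bmeas (\<alpha> + real k))"
        then have u: "u \<in> ball 0 1" by simp
        have "norm (G u) \<le> norm \<phi> * norm (cblinfun_apply (g u) (conjugate x))" unfolding Gg[OF u] \<psi>_def by (rule norm_cblinfun_apply)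
        also have "\<dots> \<le> norm \<phi> * (norm (g u) * norm x)"
          using norm_cblinfun_apply[of "g u" "conjugate x"] by (intro mult_left_mono) (auto simp: norm_conjugate)
        finally show "ennreal (norm (G u)) \<le> ennreal (norm \<phi> * norm x) * ennreal (norm (g u))"
          by (simp add: ennreal_mult[symmetric] ennreal_leI mult_ac)
      qed
      also have "\<dots> = ennreal (norm \<phi> * norm x) * (\<integral>\<^sup>+u. ennreal (norm (g u)) \<partial>bmeas (\<alpha> + real k))"
      proof (rule nn_integral_cmult)
        have "(\<lambda>u. norm (g u)) \<in> borel_measurable (bmeas (\<alpha> + real k))" by (intro borel_measurable_bmeas continuous_on_norm cg)
        then show "(\<lambda>u. ennreal (norm (g u))) \<in> borel_measurable (bmeas (\<alpha> + real k))" by measurable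
      qed
      also have "\<dots> < \<infinity>" using gfin by (simp add: ennreal_mult_less_top)
      finally show "(\<integral>\<^sup>+u. ennreal (norm (G u)) \<partial>bmeas (\<alpha> + real k)) < \<infinity>" .
    qed
    have "C * (pochhammer ?N m / pochhammer (?N + real k) m) * pochhammer (?N + real m) k = C * pochhammer ?N k" for m
    proof -
      have "0 < pochhammer (?N + real k) m" using N by (intro pochhammer_pos) simp
      then show ?thesis using pochhammer_swap[of ?N m k] by (simp add: field_simps)
    qed
    moreover have "coef G w m = of_real (pochhammer (?N + real m) k) * coef \<beta> w m" for m
      unfolding G_def[abs_def] scaleC_complex
      by (subst coef_sum) (simp_all add: cholo_radial_deriv_iterate h\<beta> coef_radial_deriv_iterate d sum_distrib_right mult.assoc)
    ultimately have eq: "of_real (C * (pochhammer ?N m / pochhammer (?N + real k) m)) * coef G w m = of_real (C * pochhammer ?N k) * coef \<beta> w m" for m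
      by (simp only: mult.assoc[symmetric] of_real_mult[symmetric])
    have "(\<lambda>m. of_real (C * pochhammer ?N k) * coef \<beta> w m) sums (\<integral>u. (1 - herm w u) powr (- of_real ?N) * G u \<partial>bmeas (\<alpha> + real k))"
      using ker[OF N hG iG w] unfolding Nk eq .
    then have "(\<integral>u. (1 - herm w u) powr (- of_real ?N) * G u \<partial>bmeas (\<alpha> + real k)) = of_real (C * pochhammer ?N k) * \<beta> w"
      using sums_mult[OF coef_sums1[OF h\<beta> w]] by (rule sums_unique2)
    moreover have "(\<integral>u. (1 - herm w u) powr (- of_real ?N) * G u \<partial>bmeas (\<alpha> + real k)) = (\<integral>u. (1 - herm w u) powr (- of_real ?N) * \<psi> (g u) \<partial>bmeas (\<alpha> + real k))"
      by (intro Bochner_Integration.integral_cong refl) (simp add: Gg)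
    ultimately have "(\<integral>u. (1 - herm w u) powr (- of_real ?N) * \<psi> (g u) \<partial>bmeas (\<alpha> + real k)) = of_real (C * pochhammer ?N k) * \<beta> w"
      by (simp only:)
    moreover have "of_real (1 / (C * pochhammer ?N k)) * (of_real (C * pochhammer ?N k) * \<beta> w) = \<beta> w"
      unfolding mult.assoc[symmetric] of_real_mult[symmetric] using C pN by simp
    ultimately show "cblinfun_apply \<phi> (cblinfun_apply (b w) (conjugate x))
      = of_real (1 / (C * pochhammer ?N k)) * (\<integral>u. (1 - herm w u) powr (- of_real ?N) * cblinfun_apply \<phi> (cblinfun_apply (g u) (conjugate x)) \<partial>bmeas (\<alpha> + real k))"
      unfolding \<psi>_def \<beta>_def by (simp only:)
  qed
qed

lemma borel_measurable_pair_bmeas: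
  fixes F :: "complex ^ 'n \<Rightarrow> complex ^ 'm \<Rightarrow> complex"
  assumes F: "continuous_on (ball 0 1 \<times> ball 0 1) (\<lambda>(w, u). F w u)"
  shows "(\<lambda>(w, u). F w u) \<in> borel_measurable (bmeas a \<Otimes>\<^sub>M bmeas b)"
proof -
  let ?X = "ball (0 :: complex ^ 'n) 1 \<times> ball (0 :: complex ^ 'm) 1"
  have "(\<lambda>x. indicator ?X x *\<^sub>R (case x of (w, u) \<Rightarrow> F w u)) \<in> borel_measurable borel"
    by (rule borel_measurable_continuous_on_indicator[OF _ F]) (intro borel_open open_Times open_ball)
  moreover have "(\<lambda>x. (fst x, snd x)) \<in> measurable (bmeas a \<Otimes>\<^sub>M bmeas b) (borel :: ((complex ^ 'n) \<times> (complex ^ 'm)) measure)"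
    by (rule borel_measurable_Pair) (rule measurable_bmeas_coordinates)+
  ultimately have "(\<lambda>x. indicator ?X (fst x, snd x) *\<^sub>R (case (fst x, snd x) of (w, u) \<Rightarrow> F w u)) \<in> borel_measurable (bmeas a \<Otimes>\<^sub>M bmeas b)"
    by (rule measurable_compose[rotated])
  then show ?thesis
    by (rule measurable_cong[THEN iffD1, rotated]) (auto simp: space_pair_measure)
qed

lemma continuous_on_kernel_pair:
  "continuous_on (ball 0 1 \<times> ball 0 1) (\<lambda>x. (1 - herm (fst x) (snd x)) powr s)"
proof -
  have "continuous_on (ball 0 1 \<times> ball 0 1) (\<lambda>x. herm (fst x :: complex ^ 'n) (snd x))"
    unfolding herm_def by (intro continuous_intros)
  moreover have "0 < Re (1 - herm (fst x) (snd x))" if "x \<in> ball 0 1 \<times> ball 0 1" for x :: "(complex ^ 'n) \<times> (complex ^ 'n)"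
    using cmod_herm_less[of "fst x" "snd x"] that complex_Re_le_cmod[of "herm (fst x) (snd x)"] by auto
  ultimately show ?thesis
    by (intro continuous_on_powr_complex continuous_on_diff continuous_on_const) (force simp: less_imp_le)+
qed

text \<open>The absolute convergence needed for Fubini. At the critical exponent a little is given
  away: as \<open>kor\<close> < 2, the exponent may be raised to N + \<epsilon>, and Forelli--Rudin
  then costs (1 - |u|^2)^(-\<epsilon>), which is integrable for \<epsilon> = (1 + \<alpha>) /
  2.\<close>

lemma kernel_double_integral:
  fixes g :: "complex ^ 'n \<Rightarrow> 'e::real_normed_vector"
  assumes \<alpha>: "\<alpha> > -1" and g: "continuous_on (ball 0 1) g" and \<gamma>: "0 \<le> \<gamma>" and M: "0 \<le> M"
    and le: "\<And>u. u \<in> ball 0 1 \<Longrightarrow> norm (g u) * (1 - (norm u)\<^sup>2) powr c \<le> M * (1 - (norm u)\<^sup>2) powr \<gamma>"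
  shows "(\<integral>\<^sup>+u. ennreal (norm (g u)) * (\<integral>\<^sup>+w. ennreal (kor w u powr (- (real CARD('n) + 1 + \<alpha>))) \<partial>(bmeas \<alpha> :: (complex ^ 'n) measure)) \<partial>bmeas (\<alpha> + c)) < \<infinity>"
proof -
  let ?N = "real CARD('n) + 1 + \<alpha>"
  define \<epsilon> where "\<epsilon> = (1 + \<alpha>) / 2"
  have \<epsilon>: "0 < \<epsilon>" "\<alpha> + - \<epsilon> > -1" using \<alpha> by (simp_all add: \<epsilon>_def field_simps)
  obtain Cf where Cf: "0 < Cf" "\<And>z :: complex ^ 'n. z \<in> ball 0 1 \<Longrightarrow>
       (\<integral>\<^sup>+w. ennreal (kor z w powr (- (?N + \<epsilon>))) \<partial>bmeas \<alpha>) \<le> ennreal (Cf * (1 - norm z) powr (?N - (?N + \<epsilon>)))"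
  proof -
    have "?N + \<epsilon> > ?N" using \<epsilon> by simp
    from forelli_rudin[OF \<alpha> this] show thesis using that by blast
  qed
  define A where "A = 2 powr \<epsilon> * Cf * 2 powr \<epsilon>"
  have A: "0 \<le> A" using Cf(1) by (simp add: A_def)
  have inner: "(\<integral>\<^sup>+w. ennreal (kor w u powr (- ?N)) \<partial>bmeas \<alpha>) \<le> ennreal (A * (1 - (norm u)\<^sup>2) powr (- \<epsilon>))" if u: "u \<in> ball 0 1" for u :: "complex ^ 'n"
  proof -
    have u1: "norm u < 1" using u by simp
    have "(\<integral>\<^sup>+w. ennreal (kor w u powr (- ?N)) \<partial>bmeas \<alpha>) \<le> (\<integral>\<^sup>+w. ennreal (2 powr \<epsilon>) * ennreal (kor u w powr (- (?N + \<epsilon>))) \<partial>bmeas \<alpha>)"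
    proof (rule nn_integral_mono)
      fix w :: "complex ^ 'n" assume "w \<in> space (bmeas \<alpha>)"
      then have w: "w \<in> ball 0 1" by simp
      have "kor w u powr (- ?N) = kor u w powr (\<epsilon> + - (?N + \<epsilon>))"
        unfolding kor_sym[of w u] by (rule arg_cong[where f = "\<lambda>t. kor u w powr t"]) simp
      also have "\<dots> = kor u w powr \<epsilon> * kor u w powr (- (?N + \<epsilon>))" by (rule powr_add)
      also have "\<dots> \<le> 2 powr \<epsilon> * kor u w powr (- (?N + \<epsilon>))"
        using kor_pos[OF u w] kor_less_2[OF u w] \<epsilon>(1) by (intro mult_right_mono powr_mono2) auto
      finally show "ennreal (kor w u powr (- ?N)) \<le> ennreal (2 powr \<epsilon>) * ennreal (kor u w powr (- (?N + \<epsilon>)))"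
        by (simp add: ennreal_mult[symmetric] ennreal_leI)
    qed
    also have "\<dots> = ennreal (2 powr \<epsilon>) * (\<integral>\<^sup>+w. ennreal (kor u w powr (- (?N + \<epsilon>))) \<partial>bmeas \<alpha>)"
      by (rule nn_integral_cmult) measurable
    also have "\<dots> \<le> ennreal (2 powr \<epsilon>) * ennreal (Cf * (1 - norm u) powr (?N - (?N + \<epsilon>)))"
      by (intro mult_left_mono Cf(2)[OF u]) auto
    also have "\<dots> = ennreal (2 powr \<epsilon> * Cf * (1 - norm u) powr (- \<epsilon>))"
      using Cf(1) by (simp add: ennreal_mult[symmetric] mult.assoc)
    also have "\<dots> \<le> ennreal (A * (1 - (norm u)\<^sup>2) powr (- \<epsilon>))"
    proof (rule ennreal_leI)
      have "(2 * (1 - norm u)) powr (- \<epsilon>) \<le> (1 - (norm u)\<^sup>2) powr (- \<epsilon>)"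
        using one_minus_norm_square[of u] u1 \<epsilon>(1) by (intro powr_mono2') auto
      then have "2 powr (- \<epsilon>) * (1 - norm u) powr (- \<epsilon>) \<le> (1 - (norm u)\<^sup>2) powr (- \<epsilon>)"
        by (simp only: powr_mult)
      from mult_left_mono[OF this, of "2 powr \<epsilon>"]
      have "(1 - norm u) powr (- \<epsilon>) \<le> 2 powr \<epsilon> * (1 - (norm u)\<^sup>2) powr (- \<epsilon>)"
        by (simp add: mult.assoc[symmetric] powr_add[symmetric])
      then show "2 powr \<epsilon> * Cf * (1 - norm u) powr (- \<epsilon>) \<le> A * (1 - (norm u)\<^sup>2) powr (- \<epsilon>)"
        unfolding A_def mult.assoc[of "2 powr \<epsilon> * Cf"] using Cf(1) by (intro mult_left_mono) auto
    qed
    finally show ?thesis .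
  qed
  have mp: "(\<lambda>u. ennreal (x * (1 - (norm u)\<^sup>2) powr y)) \<in> borel_measurable (bmeas a)" for x y a
    by (intro borel_measurable_bmeas_borel) measurable
  interpret f: finite_measure "bmeas (\<alpha> + - \<epsilon>) :: (complex ^ 'n) measure" by (rule finite_measure_bmeas[OF \<epsilon>(2)])
  have "(\<integral>\<^sup>+u. ennreal (norm (g u)) * (\<integral>\<^sup>+w. ennreal (kor w u powr (- ?N)) \<partial>bmeas \<alpha>) \<partial>bmeas (\<alpha> + c))
      \<le> (\<integral>\<^sup>+u. ennreal (norm (g u)) * ennreal (A * (1 - (norm u)\<^sup>2) powr (- \<epsilon>)) \<partial>bmeas (\<alpha> + c))"
    by (intro nn_integral_mono mult_left_mono inner) auto
  also have "\<dots> \<le> (\<integral>\<^sup>+u. ennreal (M * (1 - (norm u)\<^sup>2) powr \<gamma>) * ennreal (A * (1 - (norm u)\<^sup>2) powr (- \<epsilon>)) \<partial>(bmeas \<alpha> :: (complex ^ 'n) measure))"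
    by (rule nn_integral_norm_bmeas[OF g le mp])
  also have "\<dots> \<le> (\<integral>\<^sup>+u. ennreal (M * A) * ennreal ((1 - (norm u)\<^sup>2) powr (- \<epsilon>)) \<partial>(bmeas \<alpha> :: (complex ^ 'n) measure))"
  proof (rule nn_integral_mono)
    fix u :: "complex ^ 'n" assume "u \<in> space (bmeas \<alpha>)"
    then have "(1 - (norm u)\<^sup>2) powr \<gamma> \<le> 1" using \<gamma> by (intro powr_le1) (auto simp: abs_square_le_1)
    then have "M * (1 - (norm u)\<^sup>2) powr \<gamma> * (A * (1 - (norm u)\<^sup>2) powr (- \<epsilon>)) \<le> M * (A * (1 - (norm u)\<^sup>2) powr (- \<epsilon>))"
      using M A mult_left_mono[of _ 1 M] by (intro mult_right_mono) auto
    then show "ennreal (M * (1 - (norm u)\<^sup>2) powr \<gamma>) * ennreal (A * (1 - (norm u)\<^sup>2) powr (- \<epsilon>)) \<le> ennreal (M * A) * ennreal ((1 - (norm u)\<^sup>2) powr (- \<epsilon>))"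
      using M A by (simp add: ennreal_mult[symmetric] mult.assoc ennreal_leI)
  qed
  also have "\<dots> = ennreal (M * A) * (\<integral>\<^sup>+u. ennreal ((1 - (norm u)\<^sup>2) powr (- \<epsilon>)) \<partial>(bmeas \<alpha> :: (complex ^ 'n) measure))"
    by (rule nn_integral_cmult) (use mp[of 1] in simp)
  also have "(\<integral>\<^sup>+u. ennreal ((1 - (norm u)\<^sup>2) powr (- \<epsilon>)) \<partial>(bmeas \<alpha> :: (complex ^ 'n) measure)) = emeasure (bmeas (\<alpha> + - \<epsilon>) :: (complex ^ 'n) measure) (ball 0 1)"
    using nn_integral_bmeas_shift[of "\<lambda>_. 1" \<alpha> "- \<epsilon>"] by simp
  also have "ennreal (M * A) * \<dots> < \<infinity>"
    using f.emeasure_finite[of "ball 0 1"] by (simp add: ennreal_mult_eq_top_iff less_top[symmetric])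
  finally show ?thesis .
qed

lemma nn_integral_hankel_integrand:
  fixes b :: "complex ^ 'n \<Rightarrow> ('a::cbanach cconj, 'b::cbanach) cblinfun"
  assumes \<alpha>: "\<alpha> > -1" and b: "continuous_on (ball 0 1) b" and fin: "(\<integral>\<^sup>+w. ennreal (norm (b w)) \<partial>ball_measure \<alpha>) < \<infinity>"
    and f: "continuous_on (ball 0 1) f" "\<And>u. u \<in> ball 0 1 \<Longrightarrow> norm (f u) \<le> B"
  shows "continuous_on (ball 0 1) (\<lambda>w. cblinfun_apply (b w) (conjugate (f w)))"
    "(\<integral>\<^sup>+w. ennreal (norm (cblinfun_apply (b w) (conjugate (f w)))) \<partial>ball_measure \<alpha>) < \<infinity>"
proof -
  show "continuous_on (ball 0 1) (\<lambda>w. cblinfun_apply (b w) (conjugate (f w)))" by (intro continuous_intros b f)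
  have B: "0 \<le> B" using order_trans[OF norm_ge_zero f(2)[of 0]] by simp
  have "(\<integral>\<^sup>+w. ennreal (norm (cblinfun_apply (b w) (conjugate (f w)))) \<partial>ball_measure \<alpha>) \<le> (\<integral>\<^sup>+w. ennreal B * ennreal (norm (b w)) \<partial>ball_measure \<alpha>)"
  proof (rule nn_integral_mono)
    fix w :: "complex ^ 'n" assume "w \<in> space (ball_measure \<alpha>)"
    then have w: "w \<in> ball 0 1" by (simp only: ball_measure_basics(1)[OF \<alpha>])
    have "norm (cblinfun_apply (b w) (conjugate (f w))) \<le> norm (b w) * norm (f w)"
      using norm_cblinfun_apply[of "b w" "conjugate (f w)"] by (simp add: norm_conjugate)
    also have "\<dots> \<le> norm (b w) * B" by (intro mult_left_mono f(2) w) auto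
    finally show "ennreal (norm (cblinfun_apply (b w) (conjugate (f w)))) \<le> ennreal B * ennreal (norm (b w))"
      using B by (simp add: ennreal_mult[symmetric] ennreal_leI mult.commute)
  qed
  also have "\<dots> = ennreal B * (\<integral>\<^sup>+w. ennreal (norm (b w)) \<partial>ball_measure \<alpha>)"
  proof (rule nn_integral_cmult)
    have "(\<lambda>w. norm (b w)) \<in> borel_measurable (ball_measure \<alpha>)"
      by (rule ball_measure_basics(2)[OF \<alpha> continuous_on_norm[OF b]])
    then show "(\<lambda>w. ennreal (norm (b w))) \<in> borel_measurable (ball_measure \<alpha>)" by measurable
  qed
  also have "\<dots> < \<infinity>" using fin by (simp add: ennreal_mult_less_top)
  finally show "(\<integral>\<^sup>+w. ennreal (norm (cblinfun_apply (b w) (conjugate (f w)))) \<partial>ball_measure \<alpha>) < \<infinity>" .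
qed

lemma little_hankel_kernel:
  fixes b :: "complex ^ 'n \<Rightarrow> ('a::cbanach cconj, 'b::cbanach) cblinfun"
  shows "little_hankel \<alpha> b f z = banach_integral (ball_measure \<alpha>)
    (\<lambda>w. (1 - herm z w) powr (- of_real (real CARD('n) + 1 + \<alpha>)) *\<^sub>C cblinfun_apply (b w) (conjugate (f w)))"
  unfolding little_hankel_def powr_minus ..

text \<open>After inserting the representation of b and exchanging integrals, the inner integral in
  w is the conjugate of a reproducing integral, which evaluates the rest of the integrand at w = u.
  In this way f w becomes f u.\<close>

lemma little_hankel_functional:
  fixes b g :: "complex ^ 'n \<Rightarrow> ('a::cbanach cconj, 'b::cbanach) cblinfun"
  assumes \<alpha>: "\<alpha> > -1" and b: "continuous_on (ball 0 1) b" and fin: "(\<integral>\<^sup>+w. ennreal (norm (b w)) \<partial>ball_measure \<alpha>) < \<infinity>"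
    and \<kappa>: "0 < \<kappa>" and M: "0 \<le> M" and \<gamma>: "0 \<le> \<gamma>" and g: "continuous_on (ball 0 1) g"
    and gb: "\<And>u. u \<in> ball 0 1 \<Longrightarrow> norm (g u) * (1 - (norm u)\<^sup>2) powr c \<le> M * (1 - (norm u)\<^sup>2) powr \<gamma>"
    and rep: "\<And>\<phi> x w. w \<in> ball 0 1 \<Longrightarrow> cblinfun_apply \<phi> (cblinfun_apply (b w) (conjugate x))
      = of_real \<kappa> * (\<integral>u. (1 - herm w u) powr (- of_real (real CARD('n) + 1 + \<alpha>)) * cblinfun_apply \<phi> (cblinfun_apply (g u) (conjugate x)) \<partial>bmeas (\<alpha> + c))"
    and c: "0 \<le> c"
  obtains C :: real where "0 < C"
    "\<And>f B z \<phi>. cholo f (ball 0 1) \<Longrightarrow> (\<And>u. u \<in> ball 0 1 \<Longrightarrow> norm (f u) \<le> B) \<Longrightarrow> z \<in> ball 0 1 \<Longrightarrow>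
      cblinfun_apply \<phi> (little_hankel \<alpha> b f z) = of_real C *
        (\<integral>u. (1 - herm z u) powr (- of_real (real CARD('n) + 1 + \<alpha>)) * cblinfun_apply \<phi> (cblinfun_apply (g u) (conjugate (f u))) \<partial>bmeas (\<alpha> + c))"
proof -
  let ?N = "real CARD('n) + 1 + \<alpha>"
  have N: "0 < ?N" using \<alpha> by linarith
  have \<alpha>c: "\<alpha> + c > -1" using \<alpha> c by simp
  interpret f1: finite_measure "bmeas \<alpha> :: (complex ^ 'n) measure" by (rule finite_measure_bmeas[OF \<alpha>])
  interpret f2: finite_measure "bmeas (\<alpha> + c) :: (complex ^ 'n) measure" by (rule finite_measure_bmeas[OF \<alpha>c])
  interpret P: pair_sigma_finite "bmeas \<alpha> :: (complex ^ 'n) measure" "bmeas (\<alpha> + c) :: (complex ^ 'n) measure" ..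
  obtain C where C: "0 < C" and ker: "\<And>s (g :: complex ^ 'n \<Rightarrow> complex) w. s > 0 \<Longrightarrow> cholo g (ball 0 1) \<Longrightarrow> integrable (bmeas \<alpha>) g \<Longrightarrow> w \<in> ball 0 1 \<Longrightarrow>
      (\<lambda>m. of_real (C * (pochhammer s m / pochhammer (real CARD('n) + 1 + \<alpha>) m)) * coef g w m) sums
        (\<integral>u. (1 - herm w u) powr (- of_real s) * g u \<partial>bmeas \<alpha>)"
    by (rule kernel_integral[OF \<alpha>, where ?'n = 'n]) blast
  obtain c0 where c0: "0 < c0" and cI: "\<And>f :: complex ^ 'n \<Rightarrow> complex. f \<in> borel_measurable (bmeas \<alpha>) \<Longrightarrow> (\<integral>z. f z \<partial>ball_measure \<alpha>) = of_real c0 * (\<integral>z. f z \<partial>bmeas \<alpha>)"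
    by (rule ball_measure_integral[OF \<alpha>, where ?'n = 'n]) blast
  have reproduce: "(\<integral>w. (1 - herm u w) powr (- of_real ?N) * H w \<partial>bmeas \<alpha>) = of_real C * H u"
    if H: "cholo H (ball 0 1)" "integrable (bmeas \<alpha>) H" and u: "u \<in> ball 0 1" for H :: "complex ^ 'n \<Rightarrow> complex" and u
  proof -
    have "pochhammer ?N m \<noteq> 0" for m using pochhammer_pos[OF N, of m] by simp
    then have "(\<lambda>m. of_real C * coef H u m) sums (\<integral>w. (1 - herm u w) powr (- of_real ?N) * H w \<partial>bmeas \<alpha>)"
      using ker[OF N H u] by simp
    then show ?thesis using sums_mult[OF coef_sums1[OF H(1) u]] by (rule sums_unique2)
  qed
  show thesis
  proof (rule that)
    show "0 < c0 * \<kappa> * C" using c0 \<kappa> C by simp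
    fix f :: "complex ^ 'n \<Rightarrow> 'a" and B and z :: "complex ^ 'n" and \<phi> :: "('b, complex) cblinfun"
    assume f: "cholo f (ball 0 1)" and B: "\<And>u. u \<in> ball 0 1 \<Longrightarrow> norm (f u) \<le> B" and z: "z \<in> ball 0 1"
    have z1: "norm z < 1" using z by simp
    have B0: "0 \<le> B" using order_trans[OF norm_ge_zero B[of 0]] by simp
    have cf: "continuous_on (ball 0 1) f" by (rule cholo_continuous[OF f])
    let ?\<Phi> = "\<lambda>w. cblinfun_apply (b w) (conjugate (f w))"
    let ?q = "\<lambda>w u. cblinfun_apply \<phi> (cblinfun_apply (g u) (conjugate (f w)))"
    define I where "I w u = (1 - herm z w) powr (- of_real ?N) * ((1 - herm w u) powr (- of_real ?N) * ?q w u)" for w u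
    note c\<Phi> = nn_integral_hankel_integrand[OF \<alpha> b fin cf B]
    have qb: "cmod (?q w u) \<le> norm \<phi> * B * norm (g u)" if "w \<in> ball 0 1" for w u
    proof -
      have "cmod (?q w u) \<le> norm \<phi> * norm (cblinfun_apply (g u) (conjugate (f w)))" by (rule norm_cblinfun_apply)
      also have "\<dots> \<le> norm \<phi> * (norm (g u) * norm (f w))"
        using norm_cblinfun_apply[of "g u" "conjugate (f w)"] by (intro mult_left_mono) (auto simp: norm_conjugate)
      also have "\<dots> \<le> norm \<phi> * (norm (g u) * B)" by (intro mult_left_mono B that) auto
      finally show ?thesis by (simp add: mult_ac)
    qed
    define A where "A = (1 - norm z) powr (- ?N) * (norm \<phi> * B)"
    have A: "0 \<le> A" using B0 by (simp add: A_def)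
    have Ib: "cmod (I w u) \<le> A * (norm (g u) * kor w u powr (- ?N))" if w: "w \<in> ball 0 1" for w u
    proof -
      have "cmod (I w u) = kor z w powr (- ?N) * (kor w u powr (- ?N) * cmod (?q w u))"
        unfolding I_def norm_mult norm_kernel ..
      also have "\<dots> \<le> (1 - norm z) powr (- ?N) * (kor w u powr (- ?N) * (norm \<phi> * B * norm (g u)))"
        using kernel_le[OF z1 less_imp_le[OF N] w] qb[OF w] by (intro mult_mono mult_left_mono) auto
      finally show ?thesis by (simp add: A_def mult_ac)
    qed
    have mI: "(\<lambda>(w, u). I w u) \<in> borel_measurable (bmeas \<alpha> \<Otimes>\<^sub>M bmeas (\<alpha> + c))"
    proof (rule borel_measurable_pair_bmeas)
      have 1: "continuous_on (ball 0 1 \<times> ball 0 1) (\<lambda>x. (1 - herm z (fst x)) powr (- of_real ?N))"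
        by (rule continuous_on_compose2[OF continuous_on_kernel[OF z1]]) (auto intro!: continuous_intros)
      have 2: "continuous_on (ball 0 1 \<times> ball 0 1) (\<lambda>x. g (snd x))" "continuous_on (ball 0 1 \<times> ball 0 1) (\<lambda>x. f (fst x))"
        by (rule continuous_on_compose2[OF g], auto intro!: continuous_intros)
          (rule continuous_on_compose2[OF cf], auto intro!: continuous_intros)
      show "continuous_on (ball 0 1 \<times> ball 0 1) (\<lambda>(w, u). I w u)"
        unfolding I_def case_prod_beta'
        by (intro continuous_on_mult 1 continuous_on_kernel_pair continuous_on_cblinfun_apply continuous_on_conjugate 2 continuous_on_const)
    qed
    have "integrable (bmeas \<alpha> \<Otimes>\<^sub>M bmeas (\<alpha> + c)) (\<lambda>(w, u). I w u)"
    proof (rule integrableI_bounded[OF mI])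
      have "(\<integral>\<^sup>+x. ennreal (norm (case x of (w, u) \<Rightarrow> I w u)) \<partial>(bmeas \<alpha> \<Otimes>\<^sub>M bmeas (\<alpha> + c))) = (\<integral>\<^sup>+u. (\<integral>\<^sup>+w. ennreal (cmod (I w u)) \<partial>bmeas \<alpha>) \<partial>bmeas (\<alpha> + c))"
      proof -
        have "(\<lambda>x. ennreal (norm (case x of (w, u) \<Rightarrow> I w u))) \<in> borel_measurable (bmeas \<alpha> \<Otimes>\<^sub>M bmeas (\<alpha> + c))"
          using mI by measurable
        from P.nn_integral_snd[OF this] show ?thesis by simp
      qed
      also have "\<dots> \<le> (\<integral>\<^sup>+u. ennreal A * (ennreal (norm (g u)) * (\<integral>\<^sup>+w. ennreal (kor w u powr (- ?N)) \<partial>(bmeas \<alpha> :: (complex ^ 'n) measure))) \<partial>bmeas (\<alpha> + c))"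
      proof (rule nn_integral_mono)
        fix u :: "complex ^ 'n"
        have "(\<integral>\<^sup>+w. ennreal (cmod (I w u)) \<partial>bmeas \<alpha>) \<le> (\<integral>\<^sup>+w. ennreal (A * norm (g u)) * ennreal (kor w u powr (- ?N)) \<partial>bmeas \<alpha>)"
        proof (rule nn_integral_mono)
          fix w :: "complex ^ 'n" assume "w \<in> space (bmeas \<alpha>)"
          then show "ennreal (cmod (I w u)) \<le> ennreal (A * norm (g u)) * ennreal (kor w u powr (- ?N))"
            using Ib[of w u] A by (simp add: ennreal_mult[symmetric] mult.assoc ennreal_leI)
        qed
        also have "\<dots> = ennreal (A * norm (g u)) * (\<integral>\<^sup>+w. ennreal (kor w u powr (- ?N)) \<partial>bmeas \<alpha>)"
          by (rule nn_integral_cmult) measurable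
        finally show "(\<integral>\<^sup>+w. ennreal (cmod (I w u)) \<partial>bmeas \<alpha>) \<le> ennreal A * (ennreal (norm (g u)) * (\<integral>\<^sup>+w. ennreal (kor w u powr (- ?N)) \<partial>bmeas \<alpha>))"
          using A by (simp add: ennreal_mult mult.assoc)
      qed
      also have "\<dots> = ennreal A * (\<integral>\<^sup>+u. ennreal (norm (g u)) * (\<integral>\<^sup>+w. ennreal (kor w u powr (- ?N)) \<partial>(bmeas \<alpha> :: (complex ^ 'n) measure)) \<partial>bmeas (\<alpha> + c))"
      proof (rule nn_integral_cmult)
        have "(\<lambda>u. norm (g u)) \<in> borel_measurable (bmeas (\<alpha> + c))" by (intro borel_measurable_bmeas continuous_on_norm g)
        moreover have "(\<lambda>u. \<integral>\<^sup>+w. ennreal (kor w u powr (- ?N)) \<partial>(bmeas \<alpha> :: (complex ^ 'n) measure)) \<in> borel_measurable (bmeas (\<alpha> + c))"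
          by (rule f1.borel_measurable_nn_integral) (simp add: case_prod_beta')
        ultimately show "(\<lambda>u. ennreal (norm (g u)) * (\<integral>\<^sup>+w. ennreal (kor w u powr (- ?N)) \<partial>(bmeas \<alpha> :: (complex ^ 'n) measure))) \<in> borel_measurable (bmeas (\<alpha> + c))"
          by measurable
      qed
      also have "\<dots> < \<infinity>" using kernel_double_integral[OF \<alpha> g \<gamma> M gb] by (simp add: ennreal_mult_less_top)
      finally show "(\<integral>\<^sup>+x. ennreal (norm (case x of (w, u) \<Rightarrow> I w u)) \<partial>(bmeas \<alpha> \<Otimes>\<^sub>M bmeas (\<alpha> + c))) < \<infinity>" .
    qed
    then have fub: "(\<integral>u. (\<integral>w. I w u \<partial>bmeas \<alpha>) \<partial>bmeas (\<alpha> + c)) = (\<integral>w. (\<integral>u. I w u \<partial>bmeas (\<alpha> + c)) \<partial>bmeas \<alpha>)"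
      by (rule P.Fubini_integral)
    have inner: "(\<integral>w. I w u \<partial>bmeas \<alpha>) = of_real C * ((1 - herm z u) powr (- of_real ?N) * ?q u u)" if u: "u \<in> ball 0 1" for u
    proof -
      \<comment> \<open>\<open>conjugate (f w)\<close> depends antiholomorphically on w; the complex
        conjugate of the scalar factor is holomorphic and may be reproduced.\<close>
      define \<beta> where "\<beta> w = cnj (?q w u)" for w
      have h\<beta>: "cholo \<beta> (ball 0 1)" unfolding \<beta>_def[abs_def]
      proof (rule cholo_compose_linear(1)[OF f, of "\<lambda>x. cnj (cblinfun_apply \<phi> (cblinfun_apply (g u) (conjugate x)))"])
        show "bounded_linear (\<lambda>x. cnj (cblinfun_apply \<phi> (cblinfun_apply (g u) (conjugate x))))"
          using bounded_linear_compose[OF bounded_linear_cnj bounded_linear_compose[OF bounded_linear_cblinfun_apply[of \<phi>]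
            bounded_linear_compose[OF bounded_linear_cblinfun_apply[of "g u"] bounded_linear_conjugate]]] .
      qed (simp add: conjugate_scaleC cblinfun_apply_scaleC)
      define H where "H w = (1 - herm w z) powr (- of_real ?N) * \<beta> w" for w
      have hH: "cholo H (ball 0 1)"
        unfolding H_def[abs_def] by (intro cholo_mult cholo_kernel h\<beta>) (use z1 in simp)
      have "integrable (bmeas \<alpha>) H"
      proof (rule f1.integrable_const_bound[where B = "(1 - norm z) powr (- ?N) * (norm \<phi> * B * norm (g u))"])
        show "H \<in> borel_measurable (bmeas \<alpha>)" by (rule borel_measurable_bmeas[OF cholo_continuous[OF hH]])
        show "AE w in bmeas \<alpha>. norm (H w) \<le> (1 - norm z) powr (- ?N) * (norm \<phi> * B * norm (g u))"
        proof (rule AE_I2)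
          fix w :: "complex ^ 'n" assume "w \<in> space (bmeas \<alpha>)"
          then have w: "w \<in> ball 0 1" by simp
          have "norm (H w) = kor z w powr (- ?N) * cmod (?q w u)"
            unfolding H_def norm_mult norm_kernel \<beta>_def by (simp add: kor_sym[of w z])
          also have "\<dots> \<le> (1 - norm z) powr (- ?N) * (norm \<phi> * B * norm (g u))"
            by (rule mult_mono[OF kernel_le[OF z1 less_imp_le[OF N] w] qb[OF w]]) auto
          finally show "norm (H w) \<le> (1 - norm z) powr (- ?N) * (norm \<phi> * B * norm (g u))" .
        qed
      qed
      from reproduce[OF hH this u] have "(\<integral>w. (1 - herm u w) powr (- of_real ?N) * H w \<partial>bmeas \<alpha>) = of_real C * H u" .
      then have "(\<integral>w. cnj ((1 - herm u w) powr (- of_real ?N) * H w) \<partial>bmeas \<alpha>) = of_real C * cnj (H u)"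
        by (simp only: Bochner_Integration.integral_cnj complex_cnj_mult[of "of_real C"] complex_cnj_complex_of_real)
      moreover have "I w u = cnj ((1 - herm u w) powr (- of_real ?N) * H w)" if "w \<in> ball 0 1" for w
        unfolding H_def \<beta>_def I_def complex_cnj_mult using that u z1
        by (subst cnj_kernel, simp, simp, subst cnj_kernel, simp, simp, simp add: mult_ac)
      then have "(\<integral>w. I w u \<partial>bmeas \<alpha>) = (\<integral>w. cnj ((1 - herm u w) powr (- of_real ?N) * H w) \<partial>bmeas \<alpha>)"
        by (intro Bochner_Integration.integral_cong refl) simp
      moreover have "cnj (H u) = (1 - herm z u) powr (- of_real ?N) * ?q u u"
        unfolding H_def \<beta>_def complex_cnj_mult using u z1 by (subst cnj_kernel) auto
      ultimately show ?thesis by (simp only:)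
    qed
    have kb: "cmod ((1 - herm z w) powr (- of_real ?N)) \<le> (1 - norm z) powr (- ?N)" if "w \<in> ball 0 1" for w
      unfolding norm_kernel by (rule kernel_le[OF z1 less_imp_le[OF N] that])
    have "cblinfun_apply \<phi> (little_hankel \<alpha> b f z) = (\<integral>w. (1 - herm z w) powr (- of_real ?N) * cblinfun_apply \<phi> (?\<Phi> w) \<partial>ball_measure \<alpha>)"
      unfolding little_hankel_kernel by (rule banach_integral_kernel(2)[OF \<alpha> c\<Phi> continuous_on_kernel[OF z1] kb])
    also have "\<dots> = of_real c0 * (\<integral>w. (1 - herm z w) powr (- of_real ?N) * cblinfun_apply \<phi> (?\<Phi> w) \<partial>bmeas \<alpha>)"
      by (intro cI borel_measurable_bmeas continuous_on_mult continuous_on_kernel z1 continuous_on_cblinfun_apply c\<Phi>(1) continuous_on_const)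
    also have "(\<integral>w. (1 - herm z w) powr (- of_real ?N) * cblinfun_apply \<phi> (?\<Phi> w) \<partial>bmeas \<alpha>) = (\<integral>w. of_real \<kappa> * (\<integral>u. I w u \<partial>bmeas (\<alpha> + c)) \<partial>bmeas \<alpha>)"
    proof (intro Bochner_Integration.integral_cong refl)
      fix w :: "complex ^ 'n" assume "w \<in> space (bmeas \<alpha>)"
      then have w: "w \<in> ball 0 1" by simp
      show "(1 - herm z w) powr (- of_real ?N) * cblinfun_apply \<phi> (?\<Phi> w) = of_real \<kappa> * (\<integral>u. I w u \<partial>bmeas (\<alpha> + c))"
        unfolding rep[OF w] I_def integral_mult_right_zero by (rule mult.left_commute)
    qed
    also have "\<dots> = of_real \<kappa> * (\<integral>u. (\<integral>w. I w u \<partial>bmeas \<alpha>) \<partial>bmeas (\<alpha> + c))"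
      unfolding fub by simp
    also have "(\<integral>u. (\<integral>w. I w u \<partial>bmeas \<alpha>) \<partial>bmeas (\<alpha> + c)) = (\<integral>u. of_real C * ((1 - herm z u) powr (- of_real ?N) * ?q u u) \<partial>bmeas (\<alpha> + c))"
      by (intro Bochner_Integration.integral_cong refl inner) simp
    finally show "cblinfun_apply \<phi> (little_hankel \<alpha> b f z) = of_real (c0 * \<kappa> * C) *
        (\<integral>u. (1 - herm z u) powr (- of_real ?N) * ?q u u \<partial>bmeas (\<alpha> + c))"
      by (simp only: integral_mult_right_zero of_real_mult mult.assoc)
  qed
qed

text \<open>With s = 1 / p - 1 write |f| = (|f|^p)^s |f|^p. The weight together with the first
  factor is bounded by the point estimate, and the second is integrated.\<close>

lemma weighted_norm_integral:
  assumes \<alpha>: "\<alpha> > -1" and p: "0 < p" "p \<le> 1"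
  obtains K :: real where "0 < K"
    "\<And>(f :: complex ^ 'n \<Rightarrow> 'e::complex_normed_vector) B I. cholo f (ball 0 1) \<Longrightarrow> (\<And>u. u \<in> ball 0 1 \<Longrightarrow> norm (f u) \<le> B) \<Longrightarrow>
      0 \<le> I \<Longrightarrow> (\<integral>\<^sup>+u. ennreal (norm (f u) powr p) \<partial>bmeas \<alpha>) = ennreal I \<Longrightarrow>
      (\<integral>\<^sup>+u. ennreal ((1 - (norm u)\<^sup>2) powr ((real CARD('n) + 1 + \<alpha>) * (1 / p - 1)) * norm (f u)) \<partial>bmeas \<alpha>) \<le> ennreal (K * I powr (1 / p))"
proof -
  let ?N = "real CARD('n) + 1 + \<alpha>"
  obtain K where K: "0 < K" "\<And>(f :: complex ^ 'n \<Rightarrow> 'e) B w. cholo f (ball 0 1) \<Longrightarrow> (\<And>u. u \<in> ball 0 1 \<Longrightarrow> norm (f u) \<le> B) \<Longrightarrow> w \<in> ball 0 1 \<Longrightarrow>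
      ennreal ((1 - (norm w)\<^sup>2) powr ?N * norm (f w) powr p) \<le> ennreal K * (\<integral>\<^sup>+u. ennreal (norm (f u) powr p) \<partial>bmeas \<alpha>)"
    by (rule point_estimate[OF \<alpha> p, where ?'n = 'n and ?'e = 'e]) blast
  define s where "s = 1 / p - 1"
  have s: "0 \<le> s" "p + p * s = 1" "1 + s = 1 / p" using p by (simp_all add: s_def field_simps)
  show thesis
  proof (rule that)
    show "0 < K powr s" using K(1) by simp
    fix f :: "complex ^ 'n \<Rightarrow> 'e" and B I
    assume f: "cholo f (ball 0 1)" and B: "\<And>u. u \<in> ball 0 1 \<Longrightarrow> norm (f u) \<le> B" and I: "0 \<le> I"
      and fI: "(\<integral>\<^sup>+u. ennreal (norm (f u) powr p) \<partial>bmeas \<alpha>) = ennreal I"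
    have "(\<integral>\<^sup>+u. ennreal ((1 - (norm u)\<^sup>2) powr (?N * s) * norm (f u)) \<partial>bmeas \<alpha>) \<le> (\<integral>\<^sup>+u. ennreal ((K * I) powr s) * ennreal (norm (f u) powr p) \<partial>bmeas \<alpha>)"
    proof (rule nn_integral_mono)
      fix u :: "complex ^ 'n" assume "u \<in> space (bmeas \<alpha>)"
      then have u: "u \<in> ball 0 1" by simp
      have "(1 - (norm u)\<^sup>2) powr ?N * norm (f u) powr p \<le> K * I"
        using K(2)[OF f B u] K(1) I unfolding fI by (simp add: ennreal_mult[symmetric])
      then have le: "((1 - (norm u)\<^sup>2) powr ?N * norm (f u) powr p) powr s \<le> (K * I) powr s"
        using s by (intro powr_mono2) auto
      have "(1 - (norm u)\<^sup>2) powr (?N * s) * norm (f u) = (1 - (norm u)\<^sup>2) powr (?N * s) * (norm (f u) powr p * norm (f u) powr (p * s))"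
        unfolding powr_add[symmetric] s(2) by simp
      also have "\<dots> = ((1 - (norm u)\<^sup>2) powr ?N * norm (f u) powr p) powr s * norm (f u) powr p"
        unfolding powr_mult powr_powr by (simp only: mult_ac)
      also have "\<dots> \<le> (K * I) powr s * norm (f u) powr p" by (intro mult_right_mono le) auto
      finally show "ennreal ((1 - (norm u)\<^sup>2) powr (?N * s) * norm (f u)) \<le> ennreal ((K * I) powr s) * ennreal (norm (f u) powr p)"
        by (simp add: ennreal_mult[symmetric] ennreal_leI)
    qed
    also have "\<dots> = ennreal ((K * I) powr s) * (\<integral>\<^sup>+u. ennreal (norm (f u) powr p) \<partial>bmeas \<alpha>)"
    proof (rule nn_integral_cmult)
      have "(\<lambda>u. norm (f u)) \<in> borel_measurable (bmeas \<alpha>)" by (intro borel_measurable_bmeas continuous_on_norm cholo_continuous f)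
      then show "(\<lambda>u. ennreal (norm (f u) powr p)) \<in> borel_measurable (bmeas \<alpha>)" by measurable
    qed
    also have "\<dots> = ennreal ((K * I) powr s * I)" unfolding fI using I by (simp add: ennreal_mult)
    also have "(K * I) powr s * I = K powr s * I powr (1 / p)"
      unfolding powr_mult s(3)[symmetric] powr_add using I by simp
    finally show "(\<integral>\<^sup>+u. ennreal ((1 - (norm u)\<^sup>2) powr (?N * (1 / p - 1)) * norm (f u)) \<partial>bmeas \<alpha>) \<le> ennreal (K powr s * I powr (1 / p))"
      unfolding s_def .
  qed
qed

text \<open>Pointwise, norm (h_b f) is at most C times the positive operator of kernel \<rho>^(-N)
  applied to a scalar function whose integral is at most a constant times the norm of f. The
  weak-type estimate for that operator is then rescaled from t to t / C.\<close>

lemma little_hankel_weak_type: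
  fixes b :: "complex ^ 'n \<Rightarrow> ('a::cbanach cconj, 'b::cbanach) cblinfun"
  assumes p: "0 < p" "p \<le> 1" and \<alpha>: "\<alpha> > -1" and \<gamma>: "\<gamma> = (real CARD('n) + 1 + \<alpha>) * (1 / p - 1)"
    and fin: "(\<integral>\<^sup>+w. ennreal (norm (b w)) \<partial>ball_measure \<alpha>) < \<infinity>" and bG: "b \<in> Gamma_space \<gamma>"
  shows "bounded_on_Hinf (bergman_norm p \<alpha>) (weak_bergman 1 \<alpha>) (weak_bergman_norm 1 \<alpha>) (little_hankel \<alpha> b)"
proof -
  let ?N = "real CARD('n) + 1 + \<alpha>"
  let ?\<mu> = "bmeas \<alpha> :: (complex ^ 'n) measure"
  have N: "0 < ?N" using \<alpha> by linarith
  have \<gamma>0: "0 \<le> \<gamma>" unfolding \<gamma> using N p by (intro mult_nonneg_nonneg) auto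
  interpret f1: finite_measure ?\<mu> by (rule finite_measure_bmeas[OF \<alpha>])
  have b: "cholo b (ball 0 1)" using bG by (simp add: Gamma_space_def ball_holomorphic_iff)
  have cb: "continuous_on (ball 0 1) b" by (rule cholo_continuous[OF b])
  obtain k where k: "\<gamma> < real k" and kfin: "ennreal (norm (b 0)) + (SUP z\<in>ball 0 1. ennreal ((1 - (norm z)\<^sup>2) powr (real k - \<gamma>) * norm ((radial_deriv ^^ k) b z))) < \<infinity>"
    using bG unfolding Gamma_space_def by auto
  define S where "S = (SUP z\<in>ball 0 1. ennreal ((1 - (norm z)\<^sup>2) powr (real k - \<gamma>) * norm ((radial_deriv ^^ k) b z)))"
  have S: "S < \<infinity>" using kfin unfolding S_def[symmetric] by (simp add: less_top)
  have bk: "(1 - (norm z)\<^sup>2) powr (real k - \<gamma>) * norm ((radial_deriv ^^ k) b z) \<le> enn2real S" if "z \<in> ball 0 1" for z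
  proof -
    have "ennreal ((1 - (norm z)\<^sup>2) powr (real k - \<gamma>) * norm ((radial_deriv ^^ k) b z)) \<le> S"
      unfolding S_def by (rule SUP_upper[OF that])
    then have "ennreal ((1 - (norm z)\<^sup>2) powr (real k - \<gamma>) * norm ((radial_deriv ^^ k) b z)) \<le> ennreal (enn2real S)"
      using S by simp
    then show ?thesis by (simp only: ennreal_le_iff[OF enn2real_nonneg])
  qed
  obtain g \<kappa> M where \<kappa>: "0 < \<kappa>" and M: "0 \<le> M" and g: "continuous_on (ball 0 1) g"
    and gb: "\<And>u. u \<in> ball 0 1 \<Longrightarrow> norm (g u) * (1 - (norm u)\<^sup>2) powr real k \<le> M * (1 - (norm u)\<^sup>2) powr \<gamma>"
    and rep: "\<And>\<phi> x w. w \<in> ball 0 1 \<Longrightarrow> cblinfun_apply \<phi> (cblinfun_apply (b w) (conjugate x))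
      = of_real \<kappa> * (\<integral>u. (1 - herm w u) powr (- of_real ?N) * cblinfun_apply \<phi> (cblinfun_apply (g u) (conjugate x)) \<partial>bmeas (\<alpha> + real k))"
    by (rule symbol_reproduction[OF \<alpha> b \<gamma>0 k bk]) (assumption, rule that)
  obtain C where C: "0 < C" and hf: "\<And>f B z \<phi>. cholo f (ball 0 1) \<Longrightarrow> (\<And>u. u \<in> ball 0 1 \<Longrightarrow> norm (f u) \<le> B) \<Longrightarrow> z \<in> ball 0 1 \<Longrightarrow>
      cblinfun_apply \<phi> (little_hankel \<alpha> b f z) = of_real C *
        (\<integral>u. (1 - herm z u) powr (- of_real ?N) * cblinfun_apply \<phi> (cblinfun_apply (g u) (conjugate (f u))) \<partial>bmeas (\<alpha> + real k))"
    by (rule little_hankel_functional[OF \<alpha> cb fin \<kappa> M \<gamma>0 g gb rep]) auto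
  obtain W where W: "0 < W" and weak: "\<And>(\<phi> :: complex ^ 'n \<Rightarrow> ennreal) (\<tau>::real). \<phi> \<in> borel_measurable (bmeas \<alpha>) \<Longrightarrow> 0 < \<tau> \<Longrightarrow>
      ennreal \<tau> * emeasure (bmeas \<alpha>) {z \<in> ball 0 1. ennreal \<tau> < (\<integral>\<^sup>+w. \<phi> w * ennreal (kor z w powr (- ?N)) \<partial>bmeas \<alpha>)}
        \<le> ennreal W * (\<integral>\<^sup>+w. \<phi> w \<partial>bmeas \<alpha>)"
    by (rule weak_type_kernel[OF \<alpha>, where ?'n = 'n]) blast
  obtain K where K: "0 < K" and wni: "\<And>(f :: complex ^ 'n \<Rightarrow> 'a) B I. cholo f (ball 0 1) \<Longrightarrow> (\<And>u. u \<in> ball 0 1 \<Longrightarrow> norm (f u) \<le> B) \<Longrightarrow>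
      0 \<le> I \<Longrightarrow> (\<integral>\<^sup>+u. ennreal (norm (f u) powr p) \<partial>bmeas \<alpha>) = ennreal I \<Longrightarrow>
      (\<integral>\<^sup>+u. ennreal ((1 - (norm u)\<^sup>2) powr \<gamma> * norm (f u)) \<partial>bmeas \<alpha>) \<le> ennreal (K * I powr (1 / p))"
    unfolding \<gamma> by (rule weighted_norm_integral[OF \<alpha> p, where ?'n = 'n and ?'e = 'a]) blast
  obtain c where c: "0 < c" and cN: "\<And>f :: complex ^ 'n \<Rightarrow> ennreal. f \<in> borel_measurable (bmeas \<alpha>) \<Longrightarrow> (\<integral>\<^sup>+z. f z \<partial>ball_measure \<alpha>) = ennreal c * (\<integral>\<^sup>+z. f z \<partial>bmeas \<alpha>)"
    and ce: "\<And>X :: (complex ^ 'n) set. X \<in> sets (bmeas \<alpha>) \<Longrightarrow> emeasure (ball_measure \<alpha>) X = ennreal c * emeasure (bmeas \<alpha>) X"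
    by (rule ball_measure_integral[OF \<alpha>, where ?'n = 'n]) blast
  define D where "D = c * C * W * (M * K) * (1 / c) powr (1 / p)"
  have D: "0 \<le> D" unfolding D_def using c C W M K by (intro mult_nonneg_nonneg) auto
  have "little_hankel \<alpha> b f \<in> weak_bergman 1 \<alpha> \<and> weak_bergman_norm 1 \<alpha> (little_hankel \<alpha> b f) \<le> D * bergman_norm p \<alpha> f" if fH: "f \<in> Hinf" for f
  proof -
    have f: "cholo f (ball 0 1)" using fH by (simp add: Hinf_def ball_holomorphic_iff)
    have cf: "continuous_on (ball 0 1) f" by (rule cholo_continuous[OF f])
    obtain B where B: "\<And>u. u \<in> ball 0 1 \<Longrightarrow> norm (f u) \<le> B"
      using fH unfolding Hinf_def bounded_iff by blast
    have mf: "(\<lambda>u. norm (f u)) \<in> borel_measurable (bmeas a)" for a by (intro borel_measurable_bmeas continuous_on_norm cf)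
    have mfp: "(\<lambda>u. ennreal (norm (f u) powr p)) \<in> borel_measurable ?\<mu>" using mf[of \<alpha>] by measurable
    have "(\<integral>\<^sup>+u. ennreal (norm (f u) powr p) \<partial>bmeas \<alpha>) \<le> (\<integral>\<^sup>+u. ennreal (B powr p) \<partial>?\<mu>)"
      by (intro nn_integral_mono ennreal_leI powr_mono2) (use B p in auto)
    also have "\<dots> < \<infinity>" by (simp add: ennreal_mult_eq_top_iff f1.emeasure_finite less_top[symmetric])
    finally have Ifin: "(\<integral>\<^sup>+u. ennreal (norm (f u) powr p) \<partial>bmeas \<alpha>) < \<infinity>" .
    define I where "I = enn2real (\<integral>\<^sup>+u. ennreal (norm (f u) powr p) \<partial>bmeas \<alpha>)"
    have I: "(\<integral>\<^sup>+u. ennreal (norm (f u) powr p) \<partial>bmeas \<alpha>) = ennreal I" "0 \<le> I" using Ifin by (simp_all add: I_def)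
    have "bergman_integral p \<alpha> f = ennreal (c * I)"
      unfolding bergman_integral_def cN[OF mfp] I(1) using c I(2) by (simp add: ennreal_mult)
    then have bn: "bergman_norm p \<alpha> f = (c * I) powr (1 / p)" using c I(2) by (simp add: bergman_norm_def)
    have Ip: "I powr (1 / p) = (1 / c) powr (1 / p) * bergman_norm p \<alpha> f"
      unfolding bn powr_mult[symmetric] using c by simp
    let ?h = "little_hankel \<alpha> b f"
    note \<Phi> = nn_integral_hankel_integrand[OF \<alpha> cb fin cf B]
    have hh: "cholo ?h (ball 0 1)"
      unfolding little_hankel_kernel[abs_def] by (rule cholo_kernel_integral[OF \<alpha> less_imp_le[OF N] \<Phi>])
    \<comment> \<open>Against the weight \<alpha> this dominates |g| |f| against the weight \<alpha>
      + k.\<close>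
    define \<psi> where "\<psi> u = ennreal (M * ((1 - (norm u)\<^sup>2) powr \<gamma> * norm (f u)))" for u
    have mw: "(\<lambda>u :: complex ^ 'n. (1 - (norm u)\<^sup>2) powr \<gamma>) \<in> borel_measurable ?\<mu>" by (intro borel_measurable_bmeas_borel) measurable
    then have m\<psi>: "\<psi> \<in> borel_measurable ?\<mu>" unfolding \<psi>_def[abs_def] using mf[of \<alpha>] by measurable
    have I\<psi>: "(\<integral>\<^sup>+u. \<psi> u \<partial>?\<mu>) \<le> ennreal (M * (K * I powr (1 / p)))"
    proof -
      have "(\<integral>\<^sup>+u. \<psi> u \<partial>?\<mu>) = (\<integral>\<^sup>+u. ennreal M * ennreal ((1 - (norm u)\<^sup>2) powr \<gamma> * norm (f u)) \<partial>?\<mu>)"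
        unfolding \<psi>_def using M by (simp add: ennreal_mult)
      also have "\<dots> = ennreal M * (\<integral>\<^sup>+u. ennreal ((1 - (norm u)\<^sup>2) powr \<gamma> * norm (f u)) \<partial>?\<mu>)"
        by (rule nn_integral_cmult) (use mw mf[of \<alpha>] in measurable)
      also have "\<dots> \<le> ennreal M * ennreal (K * I powr (1 / p))"
        by (intro mult_left_mono wni[OF f B I(2,1)]) auto
      finally show ?thesis using M K by (simp add: ennreal_mult)
    qed
    define T where "T z = (\<integral>\<^sup>+u. \<psi> u * ennreal (kor z u powr (- ?N)) \<partial>?\<mu>)" for z
    have "(\<lambda>x. \<psi> (snd x)) \<in> borel_measurable (?\<mu> \<Otimes>\<^sub>M ?\<mu>)" by (rule measurable_compose[OF measurable_snd m\<psi>])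
    then have mT: "T \<in> borel_measurable ?\<mu>"
      unfolding T_def by (intro f1.borel_measurable_nn_integral) (simp add: case_prod_beta')
    have hT: "ennreal (norm (?h z)) \<le> ennreal C * T z" if z: "z \<in> ball 0 1" for z
    proof -
      obtain \<phi> :: "('b, complex) cblinfun" where \<phi>: "norm \<phi> \<le> 1" "cblinfun_apply \<phi> (?h z) = norm (?h z)"
        by (rule norming_functional)
      have \<phi>le: "cmod (cblinfun_apply \<phi> y) \<le> norm y" for y
        using norm_cblinfun_apply[of \<phi> y] mult_right_mono[OF \<phi>(1), of "norm y"] by simp
      let ?q = "\<lambda>u. (1 - herm z u) powr (- of_real ?N) * cblinfun_apply \<phi> (cblinfun_apply (g u) (conjugate (f u)))"
      have "norm (?h z) = cmod (of_real C * (\<integral>u. ?q u \<partial>bmeas (\<alpha> + real k)))"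
        using arg_cong[OF hf[OF f B z, of \<phi>], of cmod] \<phi>(2) by simp
      then have "ennreal (norm (?h z)) = ennreal C * ennreal (cmod (\<integral>u. ?q u \<partial>bmeas (\<alpha> + real k)))"
        using C by (simp add: norm_mult ennreal_mult)
      \<comment> \<open>If the integrand is not integrable, its integral is 0 by convention and the
        inequality holds trivially.\<close>
      also have "ennreal (cmod (\<integral>u. ?q u \<partial>bmeas (\<alpha> + real k))) \<le> (\<integral>\<^sup>+u. ennreal (cmod (?q u)) \<partial>bmeas (\<alpha> + real k))"
        by (cases "integrable (bmeas (\<alpha> + real k)) ?q")
          (use integral_norm_bound_ennreal in blast, simp add: not_integrable_integral_eq)
      also have "\<dots> \<le> (\<integral>\<^sup>+u. ennreal (norm (g u)) * (ennreal (norm (f u)) * ennreal (kor z u powr (- ?N))) \<partial>bmeas (\<alpha> + real k))"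
      proof (rule nn_integral_mono)
        fix u :: "complex ^ 'n"
        have "cmod (?q u) \<le> kor z u powr (- ?N) * (norm (g u) * norm (f u))"
          unfolding norm_mult norm_kernel
          using \<phi>le[of "cblinfun_apply (g u) (conjugate (f u))"] norm_cblinfun_apply[of "g u" "conjugate (f u)"]
          by (intro mult_left_mono) (auto simp: norm_conjugate)
        then show "ennreal (cmod (?q u)) \<le> ennreal (norm (g u)) * (ennreal (norm (f u)) * ennreal (kor z u powr (- ?N)))"
          by (simp add: ennreal_mult[symmetric] ennreal_leI mult_ac)
      qed
      also have "\<dots> \<le> (\<integral>\<^sup>+u. ennreal (M * (1 - (norm u)\<^sup>2) powr \<gamma>) * (ennreal (norm (f u)) * ennreal (kor z u powr (- ?N))) \<partial>?\<mu>)"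
      proof (rule nn_integral_norm_bmeas[OF g gb])
        show "(\<lambda>u. ennreal (norm (f u)) * ennreal (kor z u powr (- ?N))) \<in> borel_measurable (bmeas a)" for a
          using mf[of a] by measurable
      qed
      also have "\<dots> = T z"
        unfolding T_def \<psi>_def using M by (intro nn_integral_cong) (simp add: ennreal_mult mult.assoc)
      finally show ?thesis by (simp add: mult_left_mono)
    qed
    have wb: "weak_bergman_sup 1 \<alpha> ?h \<le> ennreal (D * bergman_norm p \<alpha> f)"
      unfolding weak_bergman_sup_def
    proof (rule SUP_least)
      fix t :: real assume "t \<in> {0<..}"
      then have t: "0 < t" by simp
      have X: "{z \<in> ball 0 1. t < norm (?h z)} \<in> sets ?\<mu>"
      proof -
        have "(\<lambda>z. norm (?h z)) \<in> borel_measurable ?\<mu>" by (intro borel_measurable_bmeas continuous_on_norm cholo_continuous hh)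
        from borel_measurable_less[OF measurable_const[of t] this] show ?thesis by simp
      qed
      have Y: "{z \<in> ball 0 1. ennreal (t / C) < T z} \<in> sets ?\<mu>"
        using borel_measurable_less[OF measurable_const[of "ennreal (t / C)"] mT] by simp
      have "{z \<in> ball 0 1. t < norm (?h z)} \<subseteq> {z \<in> ball 0 1. ennreal (t / C) < T z}"
      proof clarify
        fix z :: "complex ^ 'n" assume z: "z \<in> ball 0 1" "t < norm (?h z)"
        show "ennreal (t / C) < T z"
        proof (rule ccontr)
          assume "\<not> ennreal (t / C) < T z"
          then have "ennreal C * T z \<le> ennreal C * ennreal (t / C)" by (intro mult_left_mono) auto
          also have "\<dots> = ennreal t" using C t by (simp add: ennreal_mult[symmetric])
          finally have "ennreal (norm (?h z)) \<le> ennreal t" using hT[OF z(1)] by (rule order_trans[rotated])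
          then show False using z(2) t by simp
        qed
      qed
      then have le: "emeasure ?\<mu> {z \<in> ball 0 1. t < norm (?h z)} \<le> emeasure ?\<mu> {z \<in> ball 0 1. ennreal (t / C) < T z}"
        by (rule emeasure_mono[OF _ Y])
      have "ennreal (t powr 1) * emeasure (ball_measure \<alpha>) {z \<in> ball 0 1. t < norm (?h z)}
         = ennreal t * (ennreal c * emeasure ?\<mu> {z \<in> ball 0 1. t < norm (?h z)})"
        unfolding ce[OF X] using t by simp
      also have "\<dots> \<le> ennreal t * (ennreal c * emeasure ?\<mu> {z \<in> ball 0 1. ennreal (t / C) < T z})"
        by (intro mult_left_mono le) auto
      also have "\<dots> = ennreal (c * C) * (ennreal (t / C) * emeasure ?\<mu> {z \<in> ball 0 1. ennreal (t / C) < T z})"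
      proof -
        have "ennreal t * ennreal c = ennreal (c * C) * ennreal (t / C)"
          using c C t by (simp add: ennreal_mult[symmetric])
        then show ?thesis by (simp only: mult.assoc[symmetric])
      qed
      also have "\<dots> \<le> ennreal (c * C) * (ennreal W * (\<integral>\<^sup>+u. \<psi> u \<partial>?\<mu>))"
        unfolding T_def using C t by (intro mult_left_mono weak m\<psi>) auto
      also have "\<dots> \<le> ennreal (c * C) * (ennreal W * ennreal (M * (K * I powr (1 / p))))"
        by (intro mult_left_mono I\<psi>) auto
      also have "\<dots> = ennreal (c * C * (W * (M * (K * I powr (1 / p)))))"
        using c C W M K by (simp add: ennreal_mult)
      also have "c * C * (W * (M * (K * I powr (1 / p)))) = D * bergman_norm p \<alpha> f"
        unfolding Ip D_def by (simp only: mult_ac)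
      finally show "ennreal (t powr 1) * emeasure (ball_measure \<alpha>) {z \<in> ball 0 1. t < norm (?h z)} \<le> ennreal (D * bergman_norm p \<alpha> f)" .
    qed
    have "weak_bergman_norm 1 \<alpha> ?h \<le> D * bergman_norm p \<alpha> f"
    proof -
      have "0 \<le> D * bergman_norm p \<alpha> f" using D by (simp add: bergman_norm_def)
      with wb have "enn2real (weak_bergman_sup 1 \<alpha> ?h) \<le> D * bergman_norm p \<alpha> f" by (intro enn2real_leI)
      then show ?thesis by (simp add: weak_bergman_norm_def)
    qed
    moreover have "weak_bergman_sup 1 \<alpha> ?h < \<infinity>" using order_le_less_trans[OF wb] by simp
    ultimately show ?thesis using hh by (simp add: weak_bergman_def ball_holomorphic_iff)
  qed
  then show ?thesis unfolding bounded_on_Hinf_def by blast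
qed

theorem theorem4:
  fixes b :: "complex ^ 'n \<Rightarrow> ('a::cbanach cconj, 'b::cbanach) cblinfun"
    and p \<alpha> \<gamma> :: real
  assumes "0 < p" "p \<le> 1" "\<alpha> > -1"
    and "\<gamma> = (real CARD('n) + 1 + \<alpha>) * (1 / p - 1)"
    and "b \<in> ball_holomorphic"
    and "\<forall>z\<in>ball 0 1. (\<integral>\<^sup>+w. ennreal (norm (b w) / cmod (1 - herm z w) powr (real CARD('n) + 1 + \<alpha>))
            \<partial>ball_measure \<alpha>) < \<infinity>"
    and "(\<integral>\<^sup>+z. ennreal (norm (b z) * ln (1 / (1 - (norm z)\<^sup>2))) \<partial>ball_measure \<alpha>) < \<infinity>"
  shows "(\<forall>q. 0 < q \<and> q < 1 \<and>
            bounded_on_Hinf (bergman_norm p \<alpha>) (bergman q \<alpha>) (bergman_norm q \<alpha>) (little_hankel \<alpha> b)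
            \<longrightarrow> b \<in> Gamma_space \<gamma>)
       \<and> (b \<in> Gamma_space \<gamma> \<longrightarrow>
            bounded_on_Hinf (bergman_norm p \<alpha>) (weak_bergman 1 \<alpha>) (weak_bergman_norm 1 \<alpha>)
              (little_hankel \<alpha> b))"
proof -
  \<comment> \<open>At z = 0 the kernel is 1, so the first integrability condition becomes
    integrability of the norm of b.\<close>
  have fin: "(\<integral>\<^sup>+w. ennreal (norm (b w)) \<partial>ball_measure \<alpha>) < \<infinity>"
    using bspec[OF assms(6), of 0] by (simp add: herm_def)
  show ?thesis
  proof (intro conjI allI impI)
    show "b \<in> Gamma_space \<gamma>" if "0 < q \<and> q < 1 \<and> bounded_on_Hinf (bergman_norm p \<alpha>) (bergman q \<alpha>) (bergman_norm q \<alpha>) (little_hankel \<alpha> b)" for q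
      unfolding assms(4)
      using that assms(5) symbol_in_Gamma_space[OF assms(1,2,3) _ fin, of q] by (simp add: ball_holomorphic_iff)
  qed (rule little_hankel_weak_type[OF assms(1-4) fin])
qed

end
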